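(* Let $\nu$ be a probability measure on $\mathbb R^d$ such that assumption (A) or assumption (B) of the context is satisfied. If the FCLT holds under $\mathbb P_\mu$ with a normalization $v(\varepsilon)$ such that $v(\varepsilon)\to0$ as $\varepsilon\to0$ but $v(\varepsilon)\gg\varepsilon$ (i.e. $v(\varepsilon)/\varepsilon\to\infty$), then it also holds under $\mathbb P_\nu$, provided one of the following additional assumptions is satisfied: (i) $\nu$ is absolutely continuous with respect to $\mu$; (ii) $\nu=\delta_x$, for $\mu$ almost all $x$; (iii) $f$ is bounded.
   Context: $(X_t)_{t\ge0}$ is a diffusion process on $\mathbb R^d$ with generator $L=\frac12\sum_{i,j}A_{ij}(x)\partial^2_{i,j}+\sum_iB_i(x)\partial_i$, where $A$ is a smooth field of symmetric positive semidefinite matrices and $B$ a smooth vector field; it is strong Markov, non explosive, irreducible, positive recurrent, with unique invariant probability measure $\mu$. $\mathbb P_\nu$ is the law of the process with $X_0\sim\nu$; $P_t$ is its semigroup; $\Gamma(g,g)=L(g^2)-2gLg$. $f\in L^2(\mu)$, $f\ne0$, $\int f\,d\mu=0$, and $S_t=\int_0^tf(X_s)\,ds$. The FCLT holds under $\mathbb P_\nu$ with normalization $v(\varepsilon)>0$ (deterministic; $v(\varepsilon)=1/s_{1/\varepsilon}$) if for every $0<t_1\le\cdots\le t_n<\infty$ the vector $(v(\varepsilon)S_{t_1/\varepsilon},\ldots,v(\varepsilon)S_{t_n/\varepsilon})$ converges in law under $\mathbb P_\nu$, as $\varepsilon\to0$, to $(B_{t_1},\ldots,B_{t_n})$, $(B_t)$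 being a standard Brownian motion on $\mathbb R$. Assumption (A) (Lyapunov): there exist a smooth increasing concave function $\varphi:[1,\infty)\to(0,\infty)$, with either $\lim_{u\to\infty}\varphi'(u)=0$ or $\varphi$ linear, and a $\varphi$-Lyapunov function $V$ in the domain of $L$, i.e. $V\ge1$ and $LV\le-\varphi(V)+\kappa\mathbf 1_C$ for a constant $\kappa$ and a compact petite set $C$, with $\int V\,d\mu<\infty$; and $V\in L^1(\nu)$. (A set $C$ is petite if there are a probability measure $p(dt)$ on $\mathbb R_+$ and a non trivial positive measure $m$ such that $\int_0^\infty P_t(x,\cdot)\,p(dt)\ge m$ for all $x\in C$.) Assumption (B): the diffusion matrix $A$ is uniformly elliptic and bounded; $\mu(dx)=e^{-W(x)}dx$ is reversible; there is $c<\infty$ such that $2\Gamma(W,W)(x)-LW(x)\ge-c$ for all $x$; the diffusion is uniformly ergodic, i.e. $\sup\{\|P_tg\|_{L^2(\mu)}:\|g\|_{L^\infty(\mu)}=1,\int g\,d\mu=0\}\to0$ as $t\to\infty$; and $e^W\in L^1(\nu)$. *)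

theory Defs
  imports "HOL-Probability.Probability"
begin

section \<open>The differential operator\<close>

definition partial_deriv :: "'d \<Rightarrow> (real^'d \<Rightarrow> real) \<Rightarrow> real^'d \<Rightarrow> real" where
  "partial_deriv i g x = frechet_derivative g (at x) (axis i 1)"

primrec C_k :: "nat \<Rightarrow> (real^'d \<Rightarrow> real) \<Rightarrow> bool" where
  "C_k 0 g \<longleftrightarrow> continuous_on UNIV g"
| "C_k (Suc k) g \<longleftrightarrow> g differentiable_on UNIV \<and> (\<forall>i. C_k k (partial_deriv i g))"

definition smooth :: "(real^'d \<Rightarrow> real) \<Rightarrow> bool" where
  "smooth g \<longleftrightarrow> (\<forall>k. C_k k g)"

definition diff_op ::
  "(real^'d \<Rightarrow> real^'d^'d) \<Rightarrow> (real^'d \<Rightarrow> real^'d) \<Rightarrow> (real^'d \<Rightarrow> real) \<Rightarrow> real^'d \<Rightarrow> real" where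
  "diff_op A b g x =
     1/2 * (\<Sum>i\<in>UNIV. \<Sum>j\<in>UNIV. A x $ i $ j * partial_deriv i (partial_deriv j g) x)
     + (\<Sum>i\<in>UNIV. b x $ i * partial_deriv i g x)"

definition carre_du_champ ::
  "(real^'d \<Rightarrow> real^'d^'d) \<Rightarrow> (real^'d \<Rightarrow> real^'d) \<Rightarrow> (real^'d \<Rightarrow> real) \<Rightarrow> real^'d \<Rightarrow> real" where
  "carre_du_champ A b g x = diff_op A b (\<lambda>y. (g y)\<^sup>2) x - 2 * g x * diff_op A b g x"


section \<open>Markov families\<close>

text \<open>
  A process is given by a measurable space \<open>\<Omega>\<close> (the measure it carries is irrelevant),
  laws \<open>P x\<close> on it, and a coordinate map \<open>X t\<close>, used only for \<open>t \<ge> 0\<close>;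
  \<open>P x\<close> is the law of the process started at \<open>x\<close>.
  The law started from \<open>\<nu>\<close> is then the mixture \<open>\<nu> \<bind> P\<close>.
\<close>

definition natural_filtration ::
  "'w measure \<Rightarrow> (real \<Rightarrow> 'w \<Rightarrow> 'a::topological_space) \<Rightarrow> real \<Rightarrow> 'w measure" where
  "natural_filtration \<Omega> X t =
     sigma (space \<Omega>) {X s -` D \<inter> space \<Omega> | s D. 0 \<le> s \<and> s \<le> t \<and> D \<in> sets borel}"

definition trans_kernel ::
  "('a::topological_space \<Rightarrow> 'w measure) \<Rightarrow> (real \<Rightarrow> 'w \<Rightarrow> 'a) \<Rightarrow> real \<Rightarrow> 'a \<Rightarrow> 'a measure" where
  "trans_kernel P X t x = distr (P x) borel (X t)"

definition semigroup_op ::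
  "('a::topological_space \<Rightarrow> 'w measure) \<Rightarrow> (real \<Rightarrow> 'w \<Rightarrow> 'a) \<Rightarrow> real \<Rightarrow> ('a \<Rightarrow> real) \<Rightarrow> 'a \<Rightarrow> real" where
  "semigroup_op P X t g x = (LINT y|trans_kernel P X t x. g y)"

definition strong_markov ::
  "'w measure \<Rightarrow> ('a::topological_space \<Rightarrow> 'w measure) \<Rightarrow> (real \<Rightarrow> 'w \<Rightarrow> 'a) \<Rightarrow> bool" where
  "strong_markov \<Omega> P X \<longleftrightarrow>
     (\<forall>x \<tau> t g.
        stopping_time (natural_filtration \<Omega> X) \<tau> \<and> (\<forall>\<omega>\<in>space \<Omega>. 0 \<le> \<tau> \<omega>) \<and>
        0 \<le> t \<and> g \<in> borel_measurable borel \<and> bounded (range g) \<longrightarrow>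
        (AE \<omega> in P x.
           real_cond_exp (P x) (filtration.pre_sigma (space \<Omega>) (natural_filtration \<Omega> X) \<tau>)
             (\<lambda>\<omega>. g (X (\<tau> \<omega> + t) \<omega>)) \<omega>
           = semigroup_op P X t g (X (\<tau> \<omega>) \<omega>)))"

definition invariant_prob ::
  "('a::topological_space \<Rightarrow> 'w measure) \<Rightarrow> (real \<Rightarrow> 'w \<Rightarrow> 'a) \<Rightarrow> 'a measure \<Rightarrow> bool" where
  "invariant_prob P X \<mu> \<longleftrightarrow>
     prob_space \<mu> \<and> sets \<mu> = sets borel \<and> (\<forall>t\<ge>0. \<mu> \<bind> trans_kernel P X t = \<mu>)"

text \<open>The expected total time spent in \<open>D\<close> by the process started at \<open>x\<close>.\<close>

definition occupation ::
  "('a::topological_space \<Rightarrow> 'w measure) \<Rightarrow> (real \<Rightarrow> 'w \<Rightarrow> 'a) \<Rightarrow> 'a \<Rightarrow> 'a set \<Rightarrow> ennreal" where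
  "occupation P X x D = (\<integral>\<^sup>+t\<in>{0..}. emeasure (trans_kernel P X t x) D \<partial>lborel)"

text \<open>Irreducibility and positive recurrence are meant in the sense of Meyn and Tweedie.\<close>

definition irreducible_process ::
  "('a::topological_space \<Rightarrow> 'w measure) \<Rightarrow> (real \<Rightarrow> 'w \<Rightarrow> 'a) \<Rightarrow> 'a measure \<Rightarrow> bool" where
  "irreducible_process P X \<psi> \<longleftrightarrow>
     sigma_finite_measure \<psi> \<and> sets \<psi> = sets borel \<and> emeasure \<psi> UNIV \<noteq> 0 \<and>
     (\<forall>x. \<forall>D\<in>sets borel. emeasure \<psi> D > 0 \<longrightarrow> occupation P X x D > 0)"

definition positive_recurrent ::
  "('a::topological_space \<Rightarrow> 'w measure) \<Rightarrow> (real \<Rightarrow> 'w \<Rightarrow> 'a) \<Rightarrow> 'a measure \<Rightarrow> bool" where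
  "positive_recurrent P X \<psi> \<longleftrightarrow>
     (\<forall>x. \<forall>D\<in>sets borel. emeasure \<psi> D > 0 \<longrightarrow> occupation P X x D = \<infinity>) \<and>
     (\<exists>\<mu>. invariant_prob P X \<mu>)"

definition petite ::
  "('a::topological_space \<Rightarrow> 'w measure) \<Rightarrow> (real \<Rightarrow> 'w \<Rightarrow> 'a) \<Rightarrow> 'a set \<Rightarrow> bool" where
  "petite P X C \<longleftrightarrow>
     (\<exists>p m. prob_space p \<and> sets p = sets (borel :: real measure) \<and> emeasure p {0..} = 1 \<and>
        sets m = sets borel \<and> emeasure m UNIV \<noteq> 0 \<and>
        (\<forall>x\<in>C. \<forall>D\<in>sets borel.
           (\<integral>\<^sup>+t\<in>{0..}. emeasure (trans_kernel P X t x) D \<partial>p) \<ge> emeasure m D))"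


section \<open>Martingales and the generator\<close>

definition is_martingale :: "'w measure \<Rightarrow> (real \<Rightarrow> 'w measure) \<Rightarrow> (real \<Rightarrow> 'w \<Rightarrow> real) \<Rightarrow> bool" where
  "is_martingale Q F M \<longleftrightarrow>
     (\<forall>t\<ge>0. M t \<in> borel_measurable (F t) \<and> integrable Q (M t)) \<and>
     (\<forall>s t. 0 \<le> s \<and> s \<le> t \<longrightarrow> (AE \<omega> in Q. real_cond_exp Q (F s) (M t) \<omega> = M s \<omega>))"

definition is_local_martingale ::
  "'w measure \<Rightarrow> (real \<Rightarrow> 'w measure) \<Rightarrow> (real \<Rightarrow> 'w \<Rightarrow> real) \<Rightarrow> bool" where
  "is_local_martingale Q F M \<longleftrightarrow>
     (\<exists>\<tau> :: nat \<Rightarrow> 'w \<Rightarrow> real.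
        (\<forall>n. stopping_time F (\<tau> n) \<and> (\<forall>\<omega>\<in>space Q. 0 \<le> \<tau> n \<omega>)) \<and>
        (AE \<omega> in Q. incseq (\<lambda>n. \<tau> n \<omega>) \<and> filterlim (\<lambda>n. \<tau> n \<omega>) at_top sequentially) \<and>
        (\<forall>n. is_martingale Q F (\<lambda>t \<omega>. M (min t (\<tau> n \<omega>)) \<omega>)))"

definition dynkin_process ::
  "(real \<Rightarrow> 'w \<Rightarrow> 'a) \<Rightarrow> ('a \<Rightarrow> real) \<Rightarrow> ('a \<Rightarrow> real) \<Rightarrow> real \<Rightarrow> 'w \<Rightarrow> real" where
  "dynkin_process X g h t \<omega> = g (X t \<omega>) - g (X 0 \<omega>) - (LINT s:{0..t}|lborel. h (X s \<omega>))"

text \<open>\<open>g\<close> is in the extended domain of the generator, and the generator maps it to \<open>h\<close>.\<close>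

definition extended_generator ::
  "'w measure \<Rightarrow> ('a::topological_space \<Rightarrow> 'w measure) \<Rightarrow> (real \<Rightarrow> 'w \<Rightarrow> 'a) \<Rightarrow>
   ('a \<Rightarrow> real) \<Rightarrow> ('a \<Rightarrow> real) \<Rightarrow> bool" where
  "extended_generator \<Omega> P X g h \<longleftrightarrow>
     g \<in> borel_measurable borel \<and> h \<in> borel_measurable borel \<and>
     (\<forall>x. (AE \<omega> in P x. \<forall>t\<ge>0. set_integrable lborel {0..t} (\<lambda>s. h (X s \<omega>))) \<and>
          is_local_martingale (P x) (natural_filtration \<Omega> X) (dynkin_process X g h))"

text \<open>
  Non-explosion is part of the formulation, since \<open>X t\<close> takes values in \<open>real^'d\<close> for all
  \<open>t \<ge> 0\<close>. That the process has generator \<open>diff_op A b\<close> is expressed by the martingale problem.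
\<close>

locale ergodic_diffusion =
  fixes A :: "real^'d \<Rightarrow> real^'d^'d" and b :: "real^'d \<Rightarrow> real^'d"
    and \<Omega> :: "'w measure" and P :: "real^'d \<Rightarrow> 'w measure" and X :: "real \<Rightarrow> 'w \<Rightarrow> real^'d"
    and \<mu> :: "(real^'d) measure"
  assumes A_smooth: "\<And>i j. smooth (\<lambda>x. A x $ i $ j)"
    and A_symmetric: "\<And>x. transpose (A x) = A x"
    and A_psd: "\<And>x \<xi>. 0 \<le> \<xi> \<bullet> (A x *v \<xi>)"
    and b_smooth: "\<And>i. smooth (\<lambda>x. b x $ i)"
    and P_kernel: "P \<in> borel \<rightarrow>\<^sub>M prob_algebra \<Omega>"
    and X_measurable: "\<And>t. 0 \<le> t \<Longrightarrow> X t \<in> \<Omega> \<rightarrow>\<^sub>M borel"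
    and X_continuous: "\<And>\<omega>. \<omega> \<in> space \<Omega> \<Longrightarrow> continuous_on {0..} (\<lambda>t. X t \<omega>)"
    and X_start: "\<And>x. AE \<omega> in P x. X 0 \<omega> = x"
    and X_strong_markov: "strong_markov \<Omega> P X"
    and X_generator: "\<And>g x. smooth g \<Longrightarrow> compact (closure {y. g y \<noteq> 0}) \<Longrightarrow>
       is_martingale (P x) (natural_filtration \<Omega> X) (dynkin_process X g (diff_op A b g))"
    and X_recurrent: "\<exists>\<psi>. irreducible_process P X \<psi> \<and> positive_recurrent P X \<psi>"
    and \<mu>_invariant: "invariant_prob P X \<mu>"
    and \<mu>_unique: "\<And>\<mu>'. invariant_prob P X \<mu>' \<Longrightarrow> \<mu>' = \<mu>"


section \<open>Lyapunov and reversibility assumptions\<close>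

definition smooth_from_one :: "(real \<Rightarrow> real) \<Rightarrow> bool" where
  "smooth_from_one \<phi> \<longleftrightarrow>
     (\<exists>D :: nat \<Rightarrow> real \<Rightarrow> real. (\<forall>u\<ge>1. D 0 u = \<phi> u) \<and>
        (\<forall>k. \<forall>u\<ge>1. (D k has_real_derivative D (Suc k) u) (at u within {1..})))"

definition assumption_A ::
  "'w measure \<Rightarrow> (real^'d \<Rightarrow> 'w measure) \<Rightarrow> (real \<Rightarrow> 'w \<Rightarrow> real^'d) \<Rightarrow>
   (real^'d) measure \<Rightarrow> (real^'d) measure \<Rightarrow> bool" where
  "assumption_A \<Omega> P X \<mu> \<nu> \<longleftrightarrow>
     (\<exists>\<phi> V LV \<kappa> C.
        smooth_from_one \<phi> \<and> mono_on {1..} \<phi> \<and> concave_on {1..} \<phi> \<and> (\<forall>u\<ge>1. 0 < \<phi> u) \<and>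
        ((deriv \<phi> \<longlongrightarrow> 0) at_top \<or> (\<exists>a. \<forall>u\<ge>1. \<phi> u = a * u)) \<and>
        extended_generator \<Omega> P X V LV \<and> (\<forall>x. 1 \<le> V x) \<and>
        compact C \<and> petite P X C \<and>
        (\<forall>x. LV x \<le> - \<phi> (V x) + \<kappa> * indicator C x) \<and>
        integrable \<mu> V \<and> integrable \<nu> V)"

definition uniformly_elliptic :: "(real^'d \<Rightarrow> real^'d^'d) \<Rightarrow> bool" where
  "uniformly_elliptic A \<longleftrightarrow> (\<exists>l>0. \<forall>x \<xi>. l * (\<xi> \<bullet> \<xi>) \<le> \<xi> \<bullet> (A x *v \<xi>))"

definition reversible ::
  "('a::topological_space \<Rightarrow> 'w measure) \<Rightarrow> (real \<Rightarrow> 'w \<Rightarrow> 'a) \<Rightarrow> 'a measure \<Rightarrow> bool" where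
  "reversible P X \<mu> \<longleftrightarrow>
     (\<forall>t\<ge>0. \<forall>g h. g \<in> borel_measurable borel \<and> bounded (range g) \<and>
        h \<in> borel_measurable borel \<and> bounded (range h) \<longrightarrow>
        (LINT x|\<mu>. g x * semigroup_op P X t h x) = (LINT x|\<mu>. semigroup_op P X t g x * h x))"

definition uniformly_ergodic ::
  "('a::topological_space \<Rightarrow> 'w measure) \<Rightarrow> (real \<Rightarrow> 'w \<Rightarrow> 'a) \<Rightarrow> 'a measure \<Rightarrow> bool" where
  "uniformly_ergodic P X \<mu> \<longleftrightarrow>
     ((\<lambda>t. SUP g \<in> {g \<in> borel_measurable borel.
                     esssup \<mu> (\<lambda>x. ennreal \<bar>g x\<bar>) = 1 \<and> (LINT x|\<mu>. g x) = 0}.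
            ennreal (sqrt (LINT x|\<mu>. (semigroup_op P X t g x)\<^sup>2))) \<longlongrightarrow> 0) at_top"

definition assumption_B ::
  "(real^'d \<Rightarrow> real^'d^'d) \<Rightarrow> (real^'d \<Rightarrow> real^'d) \<Rightarrow>
   (real^'d \<Rightarrow> 'w measure) \<Rightarrow> (real \<Rightarrow> 'w \<Rightarrow> real^'d) \<Rightarrow>
   (real^'d) measure \<Rightarrow> (real^'d) measure \<Rightarrow> bool" where
  "assumption_B A b P X \<mu> \<nu> \<longleftrightarrow>
     uniformly_elliptic A \<and> bounded (range A) \<and>
     (\<exists>W c. C_k 2 W \<and> \<mu> = density lborel (\<lambda>x. ennreal (exp (- W x))) \<and>
        reversible P X \<mu> \<and>
        (\<forall>x. 2 * carre_du_champ A b W x - diff_op A b W x \<ge> - c) \<and>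
        uniformly_ergodic P X \<mu> \<and>
        integrable \<nu> (\<lambda>x. exp (W x)))"


section \<open>The functional central limit theorem\<close>

definition standard_brownian_motion :: "'v measure \<Rightarrow> (real \<Rightarrow> 'v \<Rightarrow> real) \<Rightarrow> bool" where
  "standard_brownian_motion Q B \<longleftrightarrow>
     prob_space Q \<and> (\<forall>t\<ge>0. B t \<in> borel_measurable Q) \<and>
     (AE \<omega> in Q. B 0 \<omega> = 0 \<and> continuous_on {0..} (\<lambda>t. B t \<omega>)) \<and>
     (\<forall>(t :: nat \<Rightarrow> real) n. 0 \<le> t 0 \<and> mono t \<longrightarrow>
        prob_space.indep_vars Q (\<lambda>_. borel) (\<lambda>i \<omega>. B (t (Suc i)) \<omega> - B (t i) \<omega>) {..<n}) \<and>
     (\<forall>s t. 0 \<le> s \<and> s < t \<longrightarrow>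
        distributed Q lborel (\<lambda>\<omega>. B t \<omega> - B s \<omega>)
          (\<lambda>x. ennreal (normal_density 0 (sqrt (t - s)) x)))"

definition converges_in_law :: "('i \<Rightarrow> 'b::topological_space measure) \<Rightarrow> 'b measure \<Rightarrow> 'i filter \<Rightarrow> bool" where
  "converges_in_law N N' F \<longleftrightarrow>
     (\<forall>h :: 'b \<Rightarrow> real. continuous_on UNIV h \<and> bounded (range h) \<longrightarrow>
        ((\<lambda>i. LINT y|N i. h y) \<longlongrightarrow> (LINT y|N'. h y)) F)"

text \<open>
  The space of n-dimensional vectors is identified with the set of sequences vanishing from
  index n on, with the product topology. Every bounded continuous function of n variables is the
  restriction of one on all sequences, so convergence in law is not affected by the embedding.
\<close>

definition vector_law :: "'w measure \<Rightarrow> nat \<Rightarrow> (nat \<Rightarrow> 'w \<Rightarrow> real) \<Rightarrow> (nat \<Rightarrow> real) measure" where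
  "vector_law Q n Y = distr Q borel (\<lambda>\<omega> i. if i < n then Y i \<omega> else 0)"

definition additive_functional ::
  "(real \<Rightarrow> 'w \<Rightarrow> 'a) \<Rightarrow> ('a \<Rightarrow> real) \<Rightarrow> real \<Rightarrow> 'w \<Rightarrow> real" where
  "additive_functional X f t \<omega> = (LINT s:{0..t}|lborel. f (X s \<omega>))"

text \<open>
  The Brownian motion may live on any measure on \<open>real \<Rightarrow> real\<close>, with an arbitrary
  \<open>\<sigma>\<close>-algebra; as only its law matters, the choice of this type is immaterial.
\<close>

definition FCLT ::
  "('a::topological_space \<Rightarrow> 'w measure) \<Rightarrow> (real \<Rightarrow> 'w \<Rightarrow> 'a) \<Rightarrow> ('a \<Rightarrow> real) \<Rightarrow> (real \<Rightarrow> real) \<Rightarrow>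
   'a measure \<Rightarrow> bool" where
  "FCLT P X f v \<nu> \<longleftrightarrow>
     (\<exists>(Q :: (real \<Rightarrow> real) measure) B. standard_brownian_motion Q B \<and>
        (\<forall>n (t :: nat \<Rightarrow> real).
           (\<forall>i<n. 0 < t i) \<and> (\<forall>i j. i \<le> j \<and> j < n \<longrightarrow> t i \<le> t j) \<longrightarrow>
           converges_in_law
             (\<lambda>\<epsilon>. vector_law (\<nu> \<bind> P) n (\<lambda>i \<omega>. v \<epsilon> * additive_functional X f (t i / \<epsilon>) \<omega>))
             (vector_law Q n (\<lambda>i. B (t i)))
             (at_right 0)))"

end

theory Submission
  imports Defs
begin

text \<open>
  Why the limit theorem does not depend on the starting point. Let
  \<open>\<epsilon> k\<close> tend to \<open>0\<close>, and let \<open>F k y\<close> be the expectation under \<open>P y\<close> of a bounded Lipschitz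
  function of the numbers
  \<open>v (\<epsilon> k) * additive_functional X f (t i / \<epsilon> k)\<close>. The limit theorem
  under \<open>\<mu>\<close> says that the integrals of \<open>F k\<close> with respect to
  \<open>\<mu>\<close> converge to the Gaussian value \<open>c\<close>. It has to be shown that
  \<open>F k x\<close> itself converges to \<open>c\<close>, for almost every \<open>x\<close> with
  respect to the new initial law; dominated convergence and an approximation of continuous functions
  by Lipschitz ones (\<open>lipschitz_portmanteau\<close>) then give the theorem
  (\<open>FCLT_transfer\<close>).

  Starting the functional at time \<open>s\<close> instead of \<open>0\<close> changes the additive
  functional by two integrals of \<open>f\<close> over time intervals of length \<open>s\<close>,
  which the normalisation sends to \<open>0\<close>. Under the stationary law this means that
  \<open>F k\<close> is asymptotically invariant: \<open>F k\<close> minus its image under the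
  semigroup tends to \<open>0\<close> in the mean
  (\<open>expected_functional_asymptotically_invariant\<close>). A weak limit point of such a
  sequence is an invariant function, and invariant functions are constant because the invariant
  probability is unique. Hence the integral of \<open>F k\<close> against any finite measure that is
  absolutely continuous with respect to \<open>\<mu>\<close> converges to \<open>c\<close> times the
  total mass (\<open>weak_limit\<close>).

  Under \<open>P x\<close> the same shift, averaged over \<open>s\<close> in \<open>{0..m}\<close>,
  compares \<open>F k x\<close> with the integral of \<open>F k\<close> with respect to the mean
  occupation measure \<open>cesaro m x\<close>, the average of the laws of \<open>X s\<close>. The
  error has a term from the start of the path, which vanishes as \<open>k\<close> grows, and a term
  from its end, which is again asymptotically invariant
  (\<open>expected_functional_cesaro_diff\<close>). On the absolutely continuous part of
  \<open>cesaro m x\<close> both integrals are covered by \<open>weak_limit\<close>; its singular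
  part is carried by a \<open>\<mu>\<close>-null set \<open>N\<close>. So everything reduces to one
  property of the process (\<open>expected_functional_tendsto\<close>): the mass that
  \<open>cesaro m x\<close> gives to a \<open>\<mu>\<close>-null set tends to \<open>0\<close> as
  \<open>m\<close> grows.

  Under the Lyapunov assumption (\<open>cesaro_null_of_drift\<close>) one may enlarge
  \<open>N\<close> so that it is not visited from outside. The upper limiting fraction
  \<open>sojourn N x\<close> of time spent in \<open>N\<close> is then a subinvariant function that
  vanishes off \<open>N\<close>. By irreducibility it is nowhere equal to \<open>1\<close>, by
  petiteness it stays away from \<open>1\<close> on the petite set, and by the drift condition,
  which forces the process to spend a fixed fraction of its time there, it is bounded by some
  \<open>\<rho> < 1\<close>. Then \<open>sojourn N \<le> \<rho> * indicator N\<close>; averaging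
  this along the process gives \<open>sojourn N \<le> \<rho> * sojourn N\<close>, so
  \<open>sojourn N\<close> vanishes.

  Under uniform ellipticity the measure \<open>cesaro T x\<close> does not charge Lebesgue null sets
  at all. By the martingale problem its integrals of \<open>diff_op A b \<phi>\<close> are
  controlled by \<open>\<phi>\<close> alone (\<open>dynkin_cesaro\<close>). Testing with bumps
  adapted to the operator frozen at a point \<open>z\<close>, as in the parametrix method of Levi,
  bounds the density of the measure near \<open>z\<close> by a locally integrable function
  (\<open>lborel_null_imp_null\<close>).

  The additive functional makes sense under \<open>P x\<close> only if \<open>f\<close> is
  integrable along the path; this holds for \<open>\<mu>\<close>-almost every \<open>x\<close>
  because \<open>f\<close> is \<open>\<mu>\<close>-integrable, and for every \<open>x\<close> if
  \<open>f\<close> is bounded. This is where the three alternatives on the initial law are used.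
\<close>

section \<open>The Markov property on path space\<close>

lemma space_natural_filtration [simp]: "space (natural_filtration \<Omega> X t) = space \<Omega>"
  unfolding natural_filtration_def by (subst space_measure_of) auto

lemma sets_natural_filtration:
  "sets (natural_filtration \<Omega> X t) = sigma_sets (space \<Omega>)
     {X s -` D \<inter> space \<Omega> | s D. 0 \<le> s \<and> s \<le> t \<and> D \<in> sets borel}"
  unfolding natural_filtration_def by (subst sets_measure_of) auto

lemma filtration_natural_filtration: "filtration (space \<Omega>) (natural_filtration \<Omega> X)"
proof
  fix i j :: real assume "i \<le> j"
  then show "sets (natural_filtration \<Omega> X i) \<subseteq> sets (natural_filtration \<Omega> X j)"
    unfolding sets_natural_filtration by (intro sigma_sets_mono') force
qed simp

lemma vimage_in_natural_filtration:
  assumes "0 \<le> s" "s \<le> t" "D \<in> sets borel"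
  shows "X s -` D \<inter> space \<Omega> \<in> sets (natural_filtration \<Omega> X t)"
  unfolding sets_natural_filtration using assms by (intro sigma_sets.Basic) auto

text \<open>
  The generator enters the proof at two separate points only. All arguments based on the Markov
  property are kept independent of it, and of the state space being \<open>real^'d\<close>.
\<close>

locale markov_family =
  fixes \<Omega> :: "'w measure" and P :: "'a::euclidean_space \<Rightarrow> 'w measure" and X :: "real \<Rightarrow> 'w \<Rightarrow> 'a"
  assumes P_kernel: "P \<in> borel \<rightarrow>\<^sub>M prob_algebra \<Omega>"
    and X_measurable: "\<And>t. 0 \<le> t \<Longrightarrow> X t \<in> \<Omega> \<rightarrow>\<^sub>M borel"
    and X_continuous: "\<And>\<omega>. \<omega> \<in> space \<Omega> \<Longrightarrow> continuous_on {0..} (\<lambda>t. X t \<omega>)"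
    and X_start: "\<And>x. AE \<omega> in P x. X 0 \<omega> = x"
    and X_strong_markov: "strong_markov \<Omega> P X"
begin

abbreviation "tk \<equiv> trans_kernel P X"
abbreviation "paths \<equiv> Pi\<^sub>M {0::real..} (\<lambda>_. borel :: 'a measure)"

text \<open>
  The function is restricted to nonnegative times so that it is a point of the product space
  \<open>paths\<close>.
\<close>

definition shift_path :: "real \<Rightarrow> 'w \<Rightarrow> real \<Rightarrow> 'a" where
  "shift_path s \<omega> = (\<lambda>t\<in>{0..}. X (s + t) \<omega>)"

lemma P_subprob [measurable]: "P \<in> borel \<rightarrow>\<^sub>M subprob_algebra \<Omega>"
  by (rule measurable_prob_algebraD[OF P_kernel])

lemma prob_space_P: "prob_space (P x)"
  using measurable_space[OF P_kernel, of x] by (simp add: space_prob_algebra)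

lemma sets_P [simp, measurable_cong]: "sets (P x) = sets \<Omega>"
  using measurable_space[OF P_kernel, of x] by (simp add: space_prob_algebra)

lemma space_P [simp]: "space (P x) = space \<Omega>"
  by (rule sets_eq_imp_space_eq) simp

lemma X_meas_P [measurable]: "0 \<le> t \<Longrightarrow> X t \<in> P x \<rightarrow>\<^sub>M borel"
  using X_measurable[of t] by (simp add: measurable_cong_sets[OF sets_P refl])

lemma sets_tk [simp, measurable_cong]: "sets (tk t x) = sets borel"
  by (simp add: trans_kernel_def)

lemma space_tk [simp]: "space (tk t x) = UNIV"
  by (simp add: trans_kernel_def)

lemma prob_space_tk: "0 \<le> t \<Longrightarrow> prob_space (tk t x)"
  unfolding trans_kernel_def by (intro prob_space.prob_space_distr prob_space_P X_meas_P)

lemma natural_filtration_subset: "sets (natural_filtration \<Omega> X t) \<subseteq> sets \<Omega>"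
  unfolding sets_natural_filtration
proof (rule sets.sigma_sets_subset, safe)
  fix s :: real and D assume "0 \<le> s" "D \<in> sets (borel :: 'a measure)"
  then show "X s -` D \<inter> space \<Omega> \<in> sets \<Omega>"
    using X_measurable[of s] measurable_sets by blast
qed

lemma natural_filtration_mono: "s \<le> t \<Longrightarrow> sets (natural_filtration \<Omega> X s) \<subseteq> sets (natural_filtration \<Omega> X t)"
  by (rule filtration.sets_F_mono[OF filtration_natural_filtration])

text \<open>
  Constant times are stopping times, and the \<open>\<sigma>\<close>-algebra of the past of the
  constant time \<open>s\<close> contains the natural filtration at \<open>s\<close>.
\<close>

lemma markov_set:
  assumes s: "0 \<le> s" and t: "0 \<le> t" and A: "A \<in> sets (natural_filtration \<Omega> X s)"
    and D: "D \<in> sets borel"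
  shows "emeasure (P x) (A \<inter> (X (s + t) -` D \<inter> space \<Omega>)) =
    (\<integral>\<^sup>+\<omega>. indicator A \<omega> * emeasure (tk t (X s \<omega>)) D \<partial>P x)"
proof -
  interpret prob_space "P x" by (rule prob_space_P)
  interpret F: filtration "space \<Omega>" "natural_filtration \<Omega> X" by (rule filtration_natural_filtration)
  let ?G = "F.pre_sigma (\<lambda>_. s)"
  have st: "stopping_time (natural_filtration \<Omega> X) (\<lambda>_. s)" by (rule stopping_time_const)
  have sub: "subalgebra (P x) ?G"
    unfolding subalgebra_def
  proof safe
    fix B assume "B \<in> sets ?G"
    from F.sets_pre_sigmaD[OF st this, of s] show "B \<in> sets (P x)"
      using natural_filtration_subset by auto
  qed (simp_all add: F.space_pre_sigma)
  interpret finite_measure_subalgebra "P x" ?G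
    by (unfold_locales) (use sub in auto)
  have A': "A \<in> sets ?G"
  proof (rule F.sets_pre_sigmaI[OF st])
    show "{\<omega> \<in> A. s \<le> t} \<in> sets (natural_filtration \<Omega> X t)" for t
      using A natural_filtration_mono[of s t] by (cases "s \<le> t") auto
  qed
  have A\<Omega>[measurable]: "A \<in> sets \<Omega>" using A natural_filtration_subset by auto
  note D[measurable]
  define g :: "'a \<Rightarrow> real" where "g = indicator D"
  have g[measurable]: "g \<in> borel_measurable borel" by (simp add: g_def)
  have bg: "bounded (range g)" by (rule boundedI[of _ 1]) (auto simp: g_def indicator_def)
  have Xst[measurable]: "X (s+t) \<in> \<Omega> \<rightarrow>\<^sub>M borel" "X s \<in> \<Omega> \<rightarrow>\<^sub>M borel" using s t X_measurable by auto
  have int: "integrable (P x) (\<lambda>\<omega>. g (X (s + t) \<omega>))"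
    by (rule integrable_const_bound[where B=1]) (auto simp: g_def indicator_def)
  have mk: "AE \<omega> in P x. real_cond_exp (P x) ?G (\<lambda>\<omega>. g (X (s + t) \<omega>)) \<omega> = semigroup_op P X t g (X s \<omega>)"
    using X_strong_markov st s t g bg unfolding strong_markov_def by blast
  have sg: "semigroup_op P X t g y = measure (tk t y) D" for y
    unfolding semigroup_op_def g_def by simp
  have meas: "(\<lambda>y. emeasure (tk t y) D) \<in> borel_measurable borel"
    unfolding trans_kernel_def using t X_measurable[of t]
    by (intro measurable_emeasure_kernel[OF measurable_compose[OF P_subprob measurable_distr]] D) auto
  have "(\<integral>\<omega>\<in>A. g (X (s + t) \<omega>) \<partial>P x) = (\<integral>\<omega>\<in>A. real_cond_exp (P x) ?G (\<lambda>\<omega>. g (X (s + t) \<omega>)) \<omega> \<partial>P x)"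
    by (rule real_cond_exp_intA[OF int A'])
  also have "\<dots> = (\<integral>\<omega>. indicator A \<omega> * measure (tk t (X s \<omega>)) D \<partial>P x)"
    unfolding set_lebesgue_integral_def
    using meas mk
    by (intro integral_cong_AE) (auto simp: sg measure_def)
  finally have e1: "(\<integral>\<omega>\<in>A. g (X (s + t) \<omega>) \<partial>P x) = (\<integral>\<omega>. indicator A \<omega> * measure (tk t (X s \<omega>)) D \<partial>P x)" .
  have m1: "measure (tk t y) D \<le> 1" "measure (tk t y) D \<ge> 0" for y
    using prob_space.prob_le_1[OF prob_space_tk[OF t]] by auto
  have "ennreal (\<integral>\<omega>\<in>A. g (X (s + t) \<omega>) \<partial>P x) = emeasure (P x) (A \<inter> (X (s + t) -` D \<inter> space \<Omega>))"
  proof -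
    have "(\<integral>\<omega>\<in>A. g (X (s + t) \<omega>) \<partial>P x) = (\<integral>\<omega>. indicator (A \<inter> (X (s + t) -` D \<inter> space \<Omega>)) \<omega> \<partial>P x)"
      unfolding set_lebesgue_integral_def g_def
      by (intro Bochner_Integration.integral_cong) (auto simp: indicator_def)
    also have "\<dots> = measure (P x) (A \<inter> (X (s + t) -` D \<inter> space \<Omega>))"
      by (subst Bochner_Integration.integral_indicator) (auto intro!: arg_cong[where f="measure _"])
    finally show ?thesis by (simp add: emeasure_eq_measure)
  qed
  moreover have "ennreal (\<integral>\<omega>. indicator A \<omega> * measure (tk t (X s \<omega>)) D \<partial>P x) =
     (\<integral>\<^sup>+\<omega>. ennreal (indicator A \<omega> * measure (tk t (X s \<omega>)) D) \<partial>P x)"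
    using meas m1
    by (intro nn_integral_eq_integral[symmetric] integrable_const_bound[where B=1])
       (auto simp: measure_def indicator_def)
  moreover have "\<dots> = (\<integral>\<^sup>+\<omega>. indicator A \<omega> * emeasure (tk t (X s \<omega>)) D \<partial>P x)"
    by (intro nn_integral_cong)
       (auto simp: indicator_def finite_measure.emeasure_eq_measure[OF prob_space.finite_measure[OF prob_space_tk[OF t]]])
  ultimately show ?thesis using e1 by simp
qed

lemma tk_kernel [measurable]: "0 \<le> t \<Longrightarrow> tk t \<in> borel \<rightarrow>\<^sub>M subprob_algebra borel"
  unfolding trans_kernel_def using X_measurable[of t]
  by (intro measurable_compose[OF P_subprob measurable_distr]) auto

lemma markov_nn:
  assumes s: "0 \<le> s" and t: "0 \<le> t" and A: "A \<in> sets (natural_filtration \<Omega> X s)"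
    and g: "g \<in> borel_measurable borel"
  shows "(\<integral>\<^sup>+\<omega>. indicator A \<omega> * g (X (s + t) \<omega>) \<partial>P x) =
    (\<integral>\<^sup>+\<omega>. indicator A \<omega> * (\<integral>\<^sup>+y. g y \<partial>tk t (X s \<omega>)) \<partial>P x)"
proof -
  have A\<Omega>[measurable]: "A \<in> sets \<Omega>" using A natural_filtration_subset by auto
  have Xst[measurable]: "X (s+t) \<in> \<Omega> \<rightarrow>\<^sub>M borel" "X s \<in> \<Omega> \<rightarrow>\<^sub>M borel" using s t X_measurable by auto
  have [measurable]: "tk t \<in> borel \<rightarrow>\<^sub>M subprob_algebra borel" using t by (rule tk_kernel)
  let ?M = "distr (density (P x) (indicator A)) borel (X (s + t))"
  let ?N = "density (P x) (indicator A) \<bind> (\<lambda>\<omega>. tk t (X s \<omega>))"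
  have ne: "space (P x) \<noteq> {}" using prob_space.not_empty[OF prob_space_P] .
  have K: "(\<lambda>\<omega>. tk t (X s \<omega>)) \<in> density (P x) (indicator A) \<rightarrow>\<^sub>M subprob_algebra borel" by measurable
  have "?M = ?N"
  proof (rule measure_eqI)
    show "sets ?M = sets ?N" by (subst sets_bind[where N=borel]) (use ne in auto)
    fix D assume "D \<in> sets ?M" then have D[measurable]: "D \<in> sets borel" by simp
    have "emeasure ?M D = emeasure (P x) (A \<inter> (X (s + t) -` D \<inter> space \<Omega>))"
      by (subst emeasure_distr; simp add: emeasure_density)
         (auto intro!: arg_cong[where f="emeasure _"] simp: indicator_inter_arith[symmetric] nn_integral_indicator)
    also have "\<dots> = emeasure ?N D"
      unfolding markov_set[OF s t A D] using ne
      by (subst emeasure_bind[OF _ K D]) (auto simp: nn_integral_density)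
    finally show "emeasure ?M D = emeasure ?N D" .
  qed
  then have "(\<integral>\<^sup>+y. g y \<partial>?M) = (\<integral>\<^sup>+y. g y \<partial>?N)" by simp
  then show ?thesis using g
    by (subst (asm) nn_integral_distr, simp, simp, subst (asm) nn_integral_bind[OF _ K], simp)
       (simp add: nn_integral_density)
qed

text \<open>
  The probability that the process, being at \<open>y\<close> at time \<open>c\<close>, lies in
  \<open>B t\<close> at each of the later times \<open>t\<close> in the list.
\<close>

fun visit_prob :: "(real \<Rightarrow> 'a set) \<Rightarrow> real \<Rightarrow> real list \<Rightarrow> 'a \<Rightarrow> ennreal" where
  "visit_prob B c [] y = 1"
| "visit_prob B c (t # ts) y = (\<integral>\<^sup>+z. indicator (B t) z * visit_prob B t ts z \<partial>tk (t - c) y)"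

lemma visit_prob_measurable:
  assumes "sorted (c # ts)" "\<And>t. t \<in> set ts \<Longrightarrow> B t \<in> sets borel"
  shows "visit_prob B c ts \<in> borel_measurable borel"
  using assms
proof (induction ts arbitrary: c)
  case (Cons t ts)
  have [measurable]: "visit_prob B t ts \<in> borel_measurable borel" "B t \<in> sets borel"
    using Cons.prems by (auto intro!: Cons.IH)
  have [measurable]: "tk (t - c) \<in> borel \<rightarrow>\<^sub>M subprob_algebra borel"
    using Cons.prems by (intro tk_kernel) auto
  show ?case by simp
qed (simp add: visit_prob.simps(1)[abs_def])

text \<open>
  Induction on the list of times: the event at the earliest time is joined to the past event
  \<open>A\<close>, and the Markov property is used for the step to that time.
\<close>

lemma markov_cylinder:
  assumes "0 \<le> s" "0 \<le> c" "sorted (c # ts)" "\<And>t. t \<in> set ts \<Longrightarrow> B t \<in> sets borel"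
    "A \<in> sets (natural_filtration \<Omega> X (s + c))"
  shows "emeasure (P x) {\<omega> \<in> A. \<forall>t\<in>set ts. X (s + t) \<omega> \<in> B t} =
    (\<integral>\<^sup>+\<omega>. indicator A \<omega> * visit_prob B c ts (X (s + c) \<omega>) \<partial>P x)"
  using assms
proof (induction ts arbitrary: c A)
  case Nil
  then have "A \<in> sets \<Omega>" using natural_filtration_subset by auto
  then show ?case by simp
next
  case (Cons t ts)
  have t: "c \<le> t" "0 \<le> t" "0 \<le> t - c" and st: "sorted (t # ts)" using Cons.prems by auto
  have A: "A \<in> sets \<Omega>" using natural_filtration_subset Cons.prems(5) by auto
  then have A0: "A \<subseteq> space \<Omega>" by (rule sets.sets_into_space)
  have [measurable]: "visit_prob B t ts \<in> borel_measurable borel" "B t \<in> sets borel"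
    using Cons.prems st by (auto intro!: visit_prob_measurable)
  let ?A = "A \<inter> (X (s + t) -` B t \<inter> space \<Omega>)"
  have A': "?A \<in> sets (natural_filtration \<Omega> X (s + t))"
    using Cons.prems t natural_filtration_mono[of "s + c" "s + t"]
    by (intro sets.Int vimage_in_natural_filtration) auto
  have "{\<omega> \<in> A. \<forall>t\<in>set (t # ts). X (s + t) \<omega> \<in> B t} = {\<omega> \<in> ?A. \<forall>t\<in>set ts. X (s + t) \<omega> \<in> B t}"
    using A0 by auto
  then have "emeasure (P x) {\<omega> \<in> A. \<forall>t\<in>set (t # ts). X (s + t) \<omega> \<in> B t} =
      (\<integral>\<^sup>+\<omega>. indicator ?A \<omega> * visit_prob B t ts (X (s + t) \<omega>) \<partial>P x)"
    using Cons.IH[OF Cons.prems(1) t(2) st _ A'] Cons.prems(4) by simp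
  also have "\<dots> = (\<integral>\<^sup>+\<omega>. indicator A \<omega> * (indicator (B t) (X ((s + c) + (t - c)) \<omega>) * visit_prob B t ts (X ((s + c) + (t - c)) \<omega>)) \<partial>P x)"
    by (intro nn_integral_cong) (auto simp: indicator_def)
  also have "\<dots> = (\<integral>\<^sup>+\<omega>. indicator A \<omega> * visit_prob B c (t # ts) (X (s + c) \<omega>) \<partial>P x)"
    using Cons.prems t by (subst markov_nn[where g="\<lambda>z. indicator (B t) z * visit_prob B t ts z"]) auto
  finally show ?case .
qed

lemma shift_path_measurable [measurable]:
  assumes "0 \<le> s" shows "shift_path s \<in> \<Omega> \<rightarrow>\<^sub>M paths"
  unfolding shift_path_def using assms by (intro measurable_restrict X_measurable) auto

text \<open>
  By \<open>markov_cylinder\<close> the two laws agree on the cylinder sets, which generate the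
  product \<open>\<sigma>\<close>-algebra.
\<close>

lemma shift_path_law:
  assumes s: "0 \<le> s"
  shows "distr (P x) paths (shift_path s) = distr (tk s x \<bind> P) paths (shift_path 0)"
proof (rule measure_eqI_PiM_infinite)
  have ne: "space (tk s x) \<noteq> {}" by simp
  have K: "P \<in> tk s x \<rightarrow>\<^sub>M subprob_algebra \<Omega>" by (simp add: P_subprob)
  have sb: "sets (tk s x \<bind> P) = sets \<Omega>" using ne K by (subst sets_bind[where N=\<Omega>]) auto
  then have spb: "space (tk s x \<bind> P) = space \<Omega>" by (rule sets_eq_imp_space_eq)
  have Xs[measurable]: "X s \<in> \<Omega> \<rightarrow>\<^sub>M borel" "X 0 \<in> \<Omega> \<rightarrow>\<^sub>M borel" using X_measurable s by auto
  show "finite_measure (distr (P x) paths (shift_path s))"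
    using s by (intro prob_space.finite_measure prob_space.prob_space_distr prob_space_P) simp
  fix A :: "real \<Rightarrow> 'a set" and J :: "real set"
  assume J: "finite J" "J \<subseteq> {0..}" and A: "\<And>i. i \<in> J \<Longrightarrow> A i \<in> sets borel"
  define ts where "ts = sorted_list_of_set J"
  have ts: "set ts = J" "sorted (0 # ts)" using J by (auto simp: ts_def)
  have Am: "prod_emb {0..} (\<lambda>_. borel) J (Pi\<^sub>E J A) \<in> sets paths"
    using J A by (intro sets_PiM_I) auto
  have sF: "space \<Omega> \<in> sets (natural_filtration \<Omega> X t)" for t
    using sets.top[of "natural_filtration \<Omega> X t"] by simp
  have pre: "shift_path r -` prod_emb {0..} (\<lambda>_. borel) J (Pi\<^sub>E J A) \<inter> space \<Omega> =
      {\<omega> \<in> space \<Omega>. \<forall>t\<in>set ts. X (r + t) \<omega> \<in> A t}" for r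
    using J by (auto simp: prod_emb_def shift_path_def ts restrict_def PiE_def Pi_def extensional_def space_PiM split: if_splits)
  have cyl: "emeasure (P y) {\<omega> \<in> space \<Omega>. \<forall>t\<in>set ts. X (r + t) \<omega> \<in> A t} = (\<integral>\<^sup>+\<omega>. visit_prob A 0 ts (X r \<omega>) \<partial>P y)"
    if "0 \<le> r" for r y
  proof -
    have "emeasure (P y) {\<omega> \<in> space \<Omega>. \<forall>t\<in>set ts. X (r + t) \<omega> \<in> A t} =
        (\<integral>\<^sup>+\<omega>. indicator (space \<Omega>) \<omega> * visit_prob A 0 ts (X r \<omega>) \<partial>P y)"
      using markov_cylinder[OF that _ ts(2) _ sF, of A y] A ts by simp
    also have "\<dots> = (\<integral>\<^sup>+\<omega>. visit_prob A 0 ts (X r \<omega>) \<partial>P y)" by (intro nn_integral_cong) auto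
    finally show ?thesis .
  qed
  have Pm[measurable]: "visit_prob A 0 ts \<in> borel_measurable borel" using ts A by (intro visit_prob_measurable) auto
  have "emeasure (distr (P x) paths (shift_path s)) (prod_emb {0..} (\<lambda>_. borel) J (Pi\<^sub>E J A)) = (\<integral>\<^sup>+\<omega>. visit_prob A 0 ts (X s \<omega>) \<partial>P x)"
    using s by (subst emeasure_distr[OF _ Am]) (auto simp: pre cyl)
  also have "\<dots> = (\<integral>\<^sup>+y. visit_prob A 0 ts y \<partial>tk s x)"
    unfolding trans_kernel_def by (subst nn_integral_distr) auto
  also have "\<dots> = (\<integral>\<^sup>+y. (\<integral>\<^sup>+\<omega>. visit_prob A 0 ts (X 0 \<omega>) \<partial>P y) \<partial>tk s x)"
  proof (rule nn_integral_cong)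
    fix y
    have "(\<integral>\<^sup>+\<omega>. visit_prob A 0 ts (X 0 \<omega>) \<partial>P y) = (\<integral>\<^sup>+\<omega>. visit_prob A 0 ts y \<partial>P y)"
      using X_start[of y] by (intro nn_integral_cong_AE) auto
    then show "visit_prob A 0 ts y = (\<integral>\<^sup>+\<omega>. visit_prob A 0 ts (X 0 \<omega>) \<partial>P y)"
      using prob_space.emeasure_space_1[OF prob_space_P, of y] by simp
  qed
  also have "\<dots> = emeasure (distr (tk s x \<bind> P) paths (shift_path 0)) (prod_emb {0..} (\<lambda>_. borel) J (Pi\<^sub>E J A))"
  proof -
    have p0: "shift_path 0 \<in> (tk s x \<bind> P) \<rightarrow>\<^sub>M paths"
      using shift_path_measurable[of 0] by (simp add: measurable_cong_sets[OF sb refl])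
    have m: "shift_path 0 -` prod_emb {0..} (\<lambda>_. borel) J (Pi\<^sub>E J A) \<inter> space \<Omega> \<in> sets \<Omega>"
      using shift_path_measurable[of 0] Am by auto
    show ?thesis
      using m by (subst emeasure_distr[OF p0 Am])
        (auto simp: spb emeasure_bind[OF ne K] pre[of 0] cyl[of 0, simplified])
  qed
  finally show "emeasure (distr (P x) paths (shift_path s)) (prod_emb {0..} (\<lambda>_. borel) J (Pi\<^sub>E J A)) =
     emeasure (distr (tk s x \<bind> P) paths (shift_path 0)) (prod_emb {0..} (\<lambda>_. borel) J (Pi\<^sub>E J A))" .
qed simp_all

lemma markov_path:
  assumes s: "0 \<le> s" and G: "G \<in> borel_measurable paths"
  shows "(\<integral>\<^sup>+\<omega>. G (shift_path s \<omega>) \<partial>P x) = (\<integral>\<^sup>+y. (\<integral>\<^sup>+\<omega>. G (shift_path 0 \<omega>) \<partial>P y) \<partial>tk s x)"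
proof -
  have ne: "space (tk s x) \<noteq> {}" by simp
  have K: "P \<in> tk s x \<rightarrow>\<^sub>M subprob_algebra \<Omega>" by (simp add: P_subprob)
  have sb: "sets (tk s x \<bind> P) = sets \<Omega>" using ne K by (subst sets_bind[where N=\<Omega>]) auto
  have p0: "shift_path 0 \<in> (tk s x \<bind> P) \<rightarrow>\<^sub>M paths"
    using shift_path_measurable[of 0] by (simp add: measurable_cong_sets[OF sb refl])
  have ps: "shift_path s \<in> P x \<rightarrow>\<^sub>M paths" using s by simp
  have Gm: "(\<lambda>\<omega>. G (shift_path 0 \<omega>)) \<in> borel_measurable \<Omega>"
    using G shift_path_measurable[of 0] by (rule measurable_compose[rotated]) simp
  have "(\<integral>\<^sup>+\<omega>. G (shift_path s \<omega>) \<partial>P x) = (\<integral>\<^sup>+p. G p \<partial>distr (P x) paths (shift_path s))"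
    using G by (subst nn_integral_distr[OF ps]) auto
  also have "\<dots> = (\<integral>\<^sup>+\<omega>. G (shift_path 0 \<omega>) \<partial>(tk s x \<bind> P))"
    unfolding shift_path_law[OF s] using G by (subst nn_integral_distr[OF p0]) auto
  also have "\<dots> = (\<integral>\<^sup>+y. (\<integral>\<^sup>+\<omega>. G (shift_path 0 \<omega>) \<partial>P y) \<partial>tk s x)"
    by (rule nn_integral_bind[OF Gm K])
  finally show ?thesis .
qed

text \<open>
  Evaluation at a time is not jointly measurable on the whole product space. For a continuous path
  the value at \<open>u\<close> is the limit of the values at the first grid point of mesh
  \<open>1 / (n + 1)\<close> above \<open>u\<close>, and this limit is jointly measurable. The
  conversion to natural numbers makes negative times behave like time \<open>0\<close>.
\<close>

definition path_at :: "(real \<Rightarrow> 'a) \<Rightarrow> real \<Rightarrow> 'a" where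
  "path_at p u = lim (\<lambda>n. p ((real (nat \<lfloor>real (Suc n) * u\<rfloor>) + 1) / real (Suc n)))"

lemma path_at_measurable: "(\<lambda>q. path_at (fst q) (snd q)) \<in> borel_measurable (paths \<Otimes>\<^sub>M borel)"
  unfolding path_at_def
proof (rule borel_measurable_lim_metric)
  fix n
  let ?N = "real (Suc n)"
  show "(\<lambda>q. fst q ((real (nat \<lfloor>?N * snd q\<rfloor>) + 1) / ?N)) \<in> borel_measurable (paths \<Otimes>\<^sub>M borel)"
  proof (rule measurable_compose_countable[where g="\<lambda>q. nat \<lfloor>?N * snd q\<rfloor>" and f="\<lambda>k q. fst q ((real k + 1) / ?N)"])
    fix k
    have "(\<lambda>p. p ((real k + 1) / ?N)) \<in> borel_measurable paths"
      by (rule measurable_component_singleton) simp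
    then show "(\<lambda>q. fst q ((real k + 1) / ?N)) \<in> borel_measurable (paths \<Otimes>\<^sub>M borel)"
      by (rule measurable_compose[OF measurable_fst])
  qed measurable
qed

lemma path_at_shift_path:
  assumes s: "0 \<le> s" and \<omega>: "\<omega> \<in> space \<Omega>"
  shows "path_at (shift_path s \<omega>) u = X (s + max 0 u) \<omega>"
proof -
  let ?m = "max 0 u"
  let ?t = "\<lambda>n. (real (nat \<lfloor>real (Suc n) * u\<rfloor>) + 1) / real (Suc n)"
  have eq: "real (nat \<lfloor>real (Suc n) * u\<rfloor>) = real_of_int \<lfloor>real (Suc n) * ?m\<rfloor>" for n
  proof (cases "u \<ge> 0")
    case False
    then have "real (Suc n) * u \<le> 0" by (intro mult_nonneg_nonpos) auto
    then show ?thesis using False by (simp add: max_def)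
  next
    case True then show ?thesis by (simp add: max_def)
  qed
  have t0: "?t n \<ge> 0" for n by simp
  have b: "\<bar>?t n - ?m\<bar> \<le> 1 / real (Suc n)" for n
  proof -
    define N w z where "N = real (Suc n)" and "w = ?m" and "z = real_of_int \<lfloor>N * w\<rfloor>"
    have N: "0 < N" by (simp add: N_def)
    have "N * w \<le> z + 1" "z \<le> N * w" unfolding z_def by linarith+
    with N have "w \<le> (z + 1) / N" "(z + 1) / N \<le> w + 1 / N"
      by (simp_all add: pos_le_divide_eq pos_divide_le_eq distrib_left mult.commute)
    moreover have "?t n = (z + 1) / N" unfolding eq z_def N_def w_def ..
    ultimately have "?t n \<ge> ?m" "?t n \<le> ?m + 1 / real (Suc n)"
      unfolding w_def[symmetric] N_def[symmetric] by auto
    then show ?thesis by linarith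
  qed
  have "(\<lambda>n. ?t n - ?m) \<longlonglongrightarrow> 0"
    by (rule Lim_null_comparison[OF _ LIMSEQ_inverse_real_of_nat])
       (use b in \<open>auto simp: divide_inverse\<close>)
  then have "?t \<longlonglongrightarrow> ?m" by (rule LIM_zero_cancel)
  then have lim: "(\<lambda>n. s + ?t n) \<longlonglongrightarrow> s + ?m" by (intro tendsto_intros)
  have "(\<lambda>n. X (s + ?t n) \<omega>) \<longlonglongrightarrow> X (s + ?m) \<omega>"
    by (rule continuous_on_tendsto_compose[OF X_continuous[OF \<omega>] lim]) (use s t0 in \<open>auto intro!: always_eventually\<close>)
  then have "(\<lambda>n. shift_path s \<omega> (?t n)) \<longlonglongrightarrow> X (s + ?m) \<omega>"
    using t0 by (simp add: shift_path_def)
  then show ?thesis unfolding path_at_def by (rule limI)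
qed

lemma X_joint_measurable: "(\<lambda>q. X (max 0 (snd q)) (fst q)) \<in> borel_measurable (\<Omega> \<Otimes>\<^sub>M borel)"
proof -
  have "(\<lambda>q. (shift_path 0 (fst q), snd q)) \<in> \<Omega> \<Otimes>\<^sub>M borel \<rightarrow>\<^sub>M paths \<Otimes>\<^sub>M borel"
    using shift_path_measurable[of 0] by measurable
  from measurable_compose[OF this path_at_measurable]
  show ?thesis by (rule measurable_cong[THEN iffD1, rotated]) (auto simp: space_pair_measure path_at_shift_path)
qed

text \<open>
  Freezing the process before time \<open>0\<close> makes the kernels measurable in time over the
  whole line, so that they can be integrated with respect to Lebesgue measure.
\<close>

lemma tk_joint_kernel: "(\<lambda>q. tk (max 0 (fst q)) (snd q)) \<in> borel \<Otimes>\<^sub>M borel \<rightarrow>\<^sub>M subprob_algebra borel"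
  unfolding trans_kernel_def
proof (rule measurable_distr2)
  have "(\<lambda>r. (snd r, fst (fst r))) \<in> (borel \<Otimes>\<^sub>M borel) \<Otimes>\<^sub>M \<Omega> \<rightarrow>\<^sub>M \<Omega> \<Otimes>\<^sub>M borel" by measurable
  from measurable_compose[OF this X_joint_measurable]
  show "case_prod (\<lambda>x. X (max 0 (fst x))) \<in> borel_measurable ((borel \<Otimes>\<^sub>M borel) \<Otimes>\<^sub>M \<Omega>)"
    by (simp add: case_prod_beta')
qed simp

lemma tk_chapman:
  assumes "0 \<le> s" "0 \<le> t" and g: "g \<in> borel_measurable borel"
  shows "(\<integral>\<^sup>+y. g y \<partial>tk (s + t) x) = (\<integral>\<^sup>+y. (\<integral>\<^sup>+z. g z \<partial>tk t y) \<partial>tk s x)"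
proof -
  have [measurable]: "X (s + t) \<in> \<Omega> \<rightarrow>\<^sub>M borel" "X t \<in> \<Omega> \<rightarrow>\<^sub>M borel" "g \<in> borel_measurable borel"
    using assms X_measurable by auto
  have c: "(\<lambda>p. p t) \<in> borel_measurable paths" using assms by (intro measurable_component_singleton) auto
  have "(\<lambda>p. g (p t)) \<in> borel_measurable paths" by (rule measurable_compose[OF c g])
  from markov_path[OF assms(1) this, of x] assms show ?thesis
    unfolding trans_kernel_def shift_path_def by (simp add: nn_integral_distr)
qed

end

section \<open>Convex averages of bounded sequences\<close>

text \<open>
  A substitute for the convex hull of the tail of a sequence: the parallelogram identity asks for
  closure under midpoints only, and properties pass from the sequence to the hull by induction.
\<close>

inductive_set midpoint_hull :: "(nat \<Rightarrow> 'b \<Rightarrow> real) \<Rightarrow> nat \<Rightarrow> ('b \<Rightarrow> real) set"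
  for F :: "nat \<Rightarrow> 'b \<Rightarrow> real" and j :: nat where
  base: "j \<le> k \<Longrightarrow> F k \<in> midpoint_hull F j"
| mid: "a \<in> midpoint_hull F j \<Longrightarrow> b \<in> midpoint_hull F j \<Longrightarrow> (\<lambda>x. (a x + b x) / 2) \<in> midpoint_hull F j"

lemma midpoint_hull_antimono:
  assumes "i \<le> j" shows "midpoint_hull F j \<subseteq> midpoint_hull F i"
proof
  fix a assume "a \<in> midpoint_hull F j"
  then show "a \<in> midpoint_hull F i"
    by induction (use assms in \<open>auto intro: midpoint_hull.intros\<close>)
qed

lemma midpoint_hull_bounded:
  assumes "a \<in> midpoint_hull F j" and "\<And>k x. \<bar>F k x\<bar> \<le> K"
  shows "\<bar>a x\<bar> \<le> K"
  using assms(1)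
proof induction
  case (mid a b) then show ?case by (simp add: abs_if field_simps split: if_splits)
qed (rule assms(2))

lemma midpoint_hull_measurable:
  assumes "a \<in> midpoint_hull F j" and "\<And>k. F k \<in> borel_measurable M"
  shows "a \<in> borel_measurable M"
  using assms(1) by induction (use assms(2) in auto)

text \<open>
  Functions in the hulls of later and later tails that nearly minimise the norm of
  \<open>L\<^sup>2\<close> form a Cauchy sequence by the parallelogram identity, since their
  midpoints cannot do better than the minimum. Near-minimisers up to \<open>(1/4)^n\<close> have
  increments summable in the mean, hence converge almost everywhere.
\<close>

lemma mazur_AE:
  fixes F :: "nat \<Rightarrow> 'b \<Rightarrow> real"
  assumes "prob_space M" and F: "\<And>k. F k \<in> borel_measurable M" and K: "\<And>k x. \<bar>F k x\<bar> \<le> K"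
  obtains G g where "\<And>n. G n \<in> midpoint_hull F n" "g \<in> borel_measurable M" "\<And>x. \<bar>g x\<bar> \<le> K"
    "AE x in M. (\<lambda>n. G n x) \<longlonglongrightarrow> g x"
proof -
  interpret prob_space M by fact
  have hm: "a \<in> borel_measurable M" if "a \<in> midpoint_hull F j" for a j
    using midpoint_hull_measurable[OF that F] .
  have hb: "\<bar>a x\<bar> \<le> K" if "a \<in> midpoint_hull F j" for a j x
    using midpoint_hull_bounded[OF that K] .
  have K0: "0 \<le> K" using K[of 0 undefined] by linarith
  have sqb: "(a x)\<^sup>2 \<le> K\<^sup>2" if "\<bar>a x\<bar> \<le> K" for a :: "'b \<Rightarrow> real" and x
    using that abs_le_square_iff[of "a x" K] K0 by simp
  have int2: "integrable M (\<lambda>x. (a x)\<^sup>2)" if "a \<in> midpoint_hull F j" for a j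
    using hm[OF that] by (intro integrable_const_bound[where B="K\<^sup>2"]) (auto intro!: AE_I2 sqb hb[OF that])
  define q where "q a = (\<integral>x. (a x)\<^sup>2 \<partial>M)" for a :: "'b \<Rightarrow> real"
  define m where "m j = (INF a\<in>midpoint_hull F j. q a)" for j
  have ne: "midpoint_hull F j \<noteq> {}" for j using midpoint_hull.base[of j j F] by auto
  have q0: "0 \<le> q a" for a unfolding q_def by simp
  have bdd: "bdd_below (q ` midpoint_hull F j)" for j using q0 by (intro bdd_belowI2[of _ 0]) auto
  have m_le: "m j \<le> q a" if "a \<in> midpoint_hull F j" for a j
    unfolding m_def by (rule cINF_lower[OF bdd that])
  have m_mono: "m i \<le> m j" if "i \<le> j" for i j
    unfolding m_def by (intro cINF_superset_mono[OF ne bdd midpoint_hull_antimono[OF that]]) auto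
  have m_up: "m j \<le> K\<^sup>2" for j
  proof -
    have "q (F j) \<le> (\<integral>x. K\<^sup>2 \<partial>M)" unfolding q_def
      using int2[OF midpoint_hull.base[of j j F]] sqb[OF K] by (intro integral_mono) auto
    then have "q (F j) \<le> K\<^sup>2" by (simp add: prob_space)
    then show ?thesis using m_le[OF midpoint_hull.base[of j j F]] by simp
  qed
  have conv: "m \<longlonglongrightarrow> (SUP j. m j)"
    using m_mono m_up by (intro LIMSEQ_incseq_SUP) (auto simp: incseq_def intro!: bdd_aboveI2[of _ _ "K\<^sup>2"])
  define L where "L = (SUP j. m j)"
  have mL: "m j \<le> L" for j
    unfolding L_def using m_up by (intro cSUP_upper) (auto intro!: bdd_aboveI2[of _ _ "K\<^sup>2"])
  \<comment> \<open>The tolerance decays like the square of \<open>(1/2)^n\<close>, so that the increments have norm of order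
  \<open>(1/2)^n\<close> in \<open>L\<^sup>2\<close>.\<close>
  define e where "e n = (1/4::real)^n" for n
  have e0: "0 < e n" for n by (simp add: e_def)
  have "\<exists>N. \<forall>j\<ge>N. L - e n \<le> m j" for n
  proof -
    have "\<forall>\<^sub>F j in sequentially. L - e n < m j"
      using conv e0[of n] unfolding L_def by (intro order_tendstoD) auto
    then show ?thesis unfolding eventually_sequentially by (meson less_imp_le)
  qed
  then obtain N where N: "\<And>n j. N n \<le> j \<Longrightarrow> L - e n \<le> m j" by metis
  have "\<exists>a\<in>midpoint_hull F (max n (N n)). q a < L + e n" for n
  proof -
    have "m (max n (N n)) < L + e n" using mL[of "max n (N n)"] e0[of n] by linarith
    then show ?thesis unfolding m_def using cINF_less_iff[OF ne bdd] by auto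
  qed
  then obtain G where G: "\<And>n. G n \<in> midpoint_hull F (max n (N n))" "\<And>n. q (G n) < L + e n" by metis
  have G': "G n \<in> midpoint_hull F n" for n
    using G(1)[of n] midpoint_hull_antimono[of n "max n (N n)" F] by auto
  have Gm[measurable]: "G n \<in> borel_measurable M" for n by (rule hm[OF G'])
  have diff: "q (\<lambda>x. G n x - G (Suc n) x) \<le> 8 * e n" for n
  proof -
    let ?i = "min (max n (N n)) (max (Suc n) (N (Suc n)))"
    have mh: "(\<lambda>x. (G n x + G (Suc n) x) / 2) \<in> midpoint_hull F ?i"
      using G(1)[of n] G(1)[of "Suc n"] midpoint_hull_antimono[of ?i _ F]
      by (intro midpoint_hull.mid) (meson min.cobounded1 min.cobounded2 subsetD)+
    have es: "e (Suc n) \<le> e n" by (simp add: e_def)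
    have "L - e n \<le> m ?i"
    proof (cases "max n (N n) \<le> max (Suc n) (N (Suc n))")
      case True then show ?thesis using N[of n "max n (N n)"] by (simp add: min_def)
    next
      case False
      then show ?thesis using N[of "Suc n" "max (Suc n) (N (Suc n))"] es by (simp add: min_def)
    qed
    with m_le[OF mh] have lo: "L - e n \<le> q (\<lambda>x. (G n x + G (Suc n) x) / 2)" by linarith
    have "q (\<lambda>x. G n x - G (Suc n) x) =
        (\<integral>x. 2 * (G n x)\<^sup>2 + 2 * (G (Suc n) x)\<^sup>2 - 4 * ((G n x + G (Suc n) x) / 2)\<^sup>2 \<partial>M)"
      unfolding q_def by (intro Bochner_Integration.integral_cong) (auto simp: field_simps power2_eq_square)
    also have "\<dots> = 2 * q (G n) + 2 * q (G (Suc n)) - 4 * q (\<lambda>x. (G n x + G (Suc n) x) / 2)"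
      unfolding q_def using int2[OF G'] int2[OF mh]
      by (subst Bochner_Integration.integral_diff) auto
    also have "\<dots> \<le> 8 * e n" using lo G(2)[of n] G(2)[of "Suc n"] es by linarith
    finally show ?thesis .
  qed
  have int_d: "integrable M (\<lambda>x. (G n x - G (Suc n) x)\<^sup>2)" for n
  proof (rule integrable_const_bound[where B="(2*K)\<^sup>2"])
    show "AE x in M. norm ((G n x - G (Suc n) x)\<^sup>2) \<le> (2 * K)\<^sup>2"
    proof (rule AE_I2)
      fix x
      have "\<bar>G n x - G (Suc n) x\<bar> \<le> \<bar>2 * K\<bar>" using hb[OF G', of n x] hb[OF G', of "Suc n" x] by linarith
      then have "(G n x - G (Suc n) x)\<^sup>2 \<le> (2 * K)\<^sup>2" by (simp only: abs_le_square_iff)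
      then show "norm ((G n x - G (Suc n) x)\<^sup>2) \<le> (2 * K)\<^sup>2" by (simp only: real_norm_def abs_power2)
    qed
  qed simp
  have nnd: "(\<integral>\<^sup>+x. ennreal \<bar>G n x - G (Suc n) x\<bar> \<partial>M) \<le> ennreal (5 * (1/2)^n)" for n
  proof -
    \<comment> \<open>Arithmetic-geometric mean, in place of the Cauchy-Schwarz inequality.\<close>
    have pt: "\<bar>y\<bar> \<le> (2^n * y\<^sup>2 + (1/2)^n) / 2" for y :: real
    proof -
      have "0 \<le> 2^n * (\<bar>y\<bar> - (1/2)^n)\<^sup>2" by simp
      also have "\<dots> = 2^n * y\<^sup>2 - 2 * \<bar>y\<bar> + (1/2)^n"
        by (simp add: power2_diff algebra_simps power_divide power2_eq_square)
      finally show ?thesis by simp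
    qed
    have "(\<integral>\<^sup>+x. ennreal \<bar>G n x - G (Suc n) x\<bar> \<partial>M) \<le> (\<integral>\<^sup>+x. ennreal ((2^n * (G n x - G (Suc n) x)\<^sup>2 + (1/2)^n) / 2) \<partial>M)"
      using pt by (intro nn_integral_mono ennreal_leI) auto
    also have "\<dots> = ennreal (\<integral>x. (2^n * (G n x - G (Suc n) x)\<^sup>2 + (1/2)^n) / 2 \<partial>M)"
      using int_d by (intro nn_integral_eq_integral) auto
    also have "(\<integral>x. (2^n * (G n x - G (Suc n) x)\<^sup>2 + (1/2)^n) / 2 \<partial>M) = (2^n * q (\<lambda>x. G n x - G (Suc n) x) + (1/2)^n) / 2"
      unfolding q_def using int_d by (simp add: prob_space)
    also have "\<dots> \<le> (2^n * (8 * e n) + (1/2)^n) / 2"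
      using diff[of n] by (intro divide_right_mono add_mono mult_left_mono) auto
    also have "\<dots> \<le> 5 * (1/2)^n"
      by (simp add: e_def power_divide power_mult_distrib[symmetric] field_simps)
    finally show ?thesis by (simp add: ennreal_leI)
  qed
  have "(\<integral>\<^sup>+x. (\<Sum>n. ennreal \<bar>G n x - G (Suc n) x\<bar>) \<partial>M) = (\<Sum>n. \<integral>\<^sup>+x. ennreal \<bar>G n x - G (Suc n) x\<bar> \<partial>M)"
    by (rule nn_integral_suminf) simp
  also have "\<dots> \<le> (\<Sum>n. ennreal (5 * (1/2)^n))" by (intro suminf_le nnd) auto
  also have "\<dots> < \<infinity>"
    by (subst suminf_ennreal2) (auto intro!: summable_mult summable_geometric)
  finally have "AE x in M. (\<Sum>n. ennreal \<bar>G n x - G (Suc n) x\<bar>) \<noteq> \<infinity>"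
    by (intro nn_integral_noteq_infinite) auto
  then have AEc: "AE x in M. convergent (\<lambda>n. G n x)"
  proof eventually_elim
    case (elim x)
    then have "summable (\<lambda>n. \<bar>G n x - G (Suc n) x\<bar>)"
      by (intro summable_suminf_not_top) (auto simp: top_unique)
    then have "summable (\<lambda>n. G n x - G (Suc n) x)" by (rule summable_rabs_cancel)
    then have s: "summable (\<lambda>n. G (Suc n) x - G n x)" using summable_minus by fastforce
    have "(\<lambda>n. (\<Sum>i<n. G (Suc i) x - G i x) + G 0 x) \<longlonglongrightarrow> suminf (\<lambda>n. G (Suc n) x - G n x) + G 0 x"
      by (intro tendsto_add summable_LIMSEQ[OF s] tendsto_const)
    then show ?case using sum_lessThan_telescope[of "\<lambda>n. G n x"] by (auto simp: convergent_def)
  qed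
  \<comment> \<open>The truncation fixes the bound on the null set where the limit does not exist.\<close>
  define g where "g x = max (- K) (min K (lim (\<lambda>n. G n x)))" for x
  show ?thesis
  proof (rule that[OF G'])
    show "g \<in> borel_measurable M" unfolding g_def by measurable
    show "\<bar>g x\<bar> \<le> K" for x using K0 by (auto simp: g_def)
    show "AE x in M. (\<lambda>n. G n x) \<longlonglongrightarrow> g x"
      using AEc
    proof eventually_elim
      case (elim x)
      then have l: "(\<lambda>n. G n x) \<longlonglongrightarrow> lim (\<lambda>n. G n x)" by (simp add: convergent_LIMSEQ_iff)
      have b: "- K \<le> G n x" "G n x \<le> K" for n using hb[OF G', of n x] by auto
      have "lim (\<lambda>n. G n x) \<le> K" using l b by (intro LIMSEQ_le_const2) auto
      moreover have "- K \<le> lim (\<lambda>n. G n x)" using l b by (intro LIMSEQ_le_const) auto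
      ultimately have "g x = lim (\<lambda>n. G n x)" by (simp add: g_def)
      then show ?case using l by simp
    qed
  qed
qed

section \<open>Asymptotically invariant functions under the stationary law\<close>

locale ergodic_markov = markov_family \<Omega> P X for \<Omega> :: "'w measure" and P :: "'a::euclidean_space \<Rightarrow> 'w measure" and X +
  fixes \<mu> :: "'a measure"
  assumes \<mu>_invariant: "invariant_prob P X \<mu>"
    and \<mu>_unique: "\<And>\<mu>'. invariant_prob P X \<mu>' \<Longrightarrow> \<mu>' = \<mu>"
begin

lemma prob_space_\<mu>: "prob_space \<mu>" and sets_\<mu> [simp, measurable_cong]: "sets \<mu> = sets borel"
  using \<mu>_invariant by (auto simp: invariant_prob_def)

lemma space_\<mu> [simp]: "space \<mu> = UNIV"
  using sets_eq_imp_space_eq[OF sets_\<mu>] by simp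

sublocale mu: prob_space \<mu> by (rule prob_space_\<mu>)

lemma measure_\<mu>_UNIV [simp]: "measure \<mu> UNIV = 1" and emeasure_\<mu>_UNIV [simp]: "emeasure \<mu> UNIV = 1"
  using mu.prob_space mu.emeasure_space_1 by auto

lemma measure_tk_UNIV [simp]: "0 \<le> t \<Longrightarrow> measure (tk t y) UNIV = 1"
  using prob_space.prob_space[OF prob_space_tk[of t y]] by simp

lemma invariant_nn:
  assumes "0 \<le> t" "g \<in> borel_measurable borel"
  shows "(\<integral>\<^sup>+y. (\<integral>\<^sup>+z. g z \<partial>tk t y) \<partial>\<mu>) = (\<integral>\<^sup>+y. g y \<partial>\<mu>)"
proof -
  have "(\<integral>\<^sup>+y. g y \<partial>(\<mu> \<bind> tk t)) = (\<integral>\<^sup>+y. (\<integral>\<^sup>+z. g z \<partial>tk t y) \<partial>\<mu>)"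
    using assms tk_kernel[OF assms(1)] by (intro nn_integral_bind) auto
  then show ?thesis using \<mu>_invariant assms(1) by (simp add: invariant_prob_def)
qed

lemma invariant_AE:
  assumes "0 \<le> t" "AE y in \<mu>. Q y"
  shows "AE y in \<mu>. AE z in tk t y. Q z"
proof -
  from assms(2) obtain N where N: "{y. \<not> Q y} \<subseteq> N" "N \<in> null_sets \<mu>"
    unfolding eventually_ae_filter by auto
  then have [measurable]: "N \<in> sets borel" by auto
  have [measurable]: "tk t \<in> borel \<rightarrow>\<^sub>M subprob_algebra borel" using assms tk_kernel by auto
  have "(\<integral>\<^sup>+y. (\<integral>\<^sup>+z. indicator N z \<partial>tk t y) \<partial>\<mu>) = (\<integral>\<^sup>+y. indicator N y \<partial>\<mu>)"
    using assms(1) by (intro invariant_nn) auto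
  also have "\<dots> = 0" using null_setsD1[OF N(2)] by simp
  finally have "AE y in \<mu>. (\<integral>\<^sup>+z. indicator N z \<partial>tk t y) = 0"
    by (subst (asm) nn_integral_0_iff_AE) auto
  then show ?thesis
  proof eventually_elim
    case (elim y)
    then have "N \<in> null_sets (tk t y)" by (auto simp: null_sets_def)
    then have "AE z in tk t y. z \<notin> N" by (rule AE_not_in)
    then show ?case by eventually_elim (use N in auto)
  qed
qed

abbreviation "Pt \<equiv> semigroup_op P X"

lemma Pt_measurable [measurable]:
  assumes "0 \<le> t" "g \<in> borel_measurable borel"
  shows "Pt t g \<in> borel_measurable borel"
  unfolding semigroup_op_def
  by (rule measurable_compose[OF tk_kernel[OF assms(1)] integral_measurable_subprob_algebra[OF assms(2)]])

lemma integrable_tk: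
  fixes g :: "'a \<Rightarrow> real"
  assumes "0 \<le> t" "g \<in> borel_measurable borel" "\<And>x. \<bar>g x\<bar> \<le> K"
  shows "integrable (tk t y) g"
proof -
  interpret prob_space "tk t y" by (rule prob_space_tk[OF assms(1)])
  show ?thesis using assms by (intro integrable_const_bound[where B=K]) auto
qed

lemma integrable_\<mu>:
  fixes g :: "'a \<Rightarrow> real"
  assumes "g \<in> borel_measurable borel" "\<And>x. \<bar>g x\<bar> \<le> K"
  shows "integrable \<mu> g"
  using assms by (intro mu.integrable_const_bound[where B=K]) auto

lemma Pt_bounded:
  assumes "0 \<le> t" "g \<in> borel_measurable borel" "\<And>x. \<bar>g x\<bar> \<le> K"
  shows "\<bar>Pt t g y\<bar> \<le> K"
proof -
  interpret prob_space "tk t y" by (rule prob_space_tk[OF assms(1)])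
  have "\<bar>Pt t g y\<bar> \<le> (\<integral>z. \<bar>g z\<bar> \<partial>tk t y)" unfolding semigroup_op_def
    using integral_norm_bound[of "tk t y" g] by simp
  also have "\<dots> \<le> (\<integral>z. K \<partial>tk t y)"
    using integrable_tk[OF assms] assms(3) by (intro integral_mono) auto
  finally show ?thesis using assms(1) by simp
qed

lemma invariant_integral:
  fixes g :: "'a \<Rightarrow> real"
  assumes "0 \<le> t" "g \<in> borel_measurable borel" "\<And>x. \<bar>g x\<bar> \<le> K"
  shows "(\<integral>y. Pt t g y \<partial>\<mu>) = (\<integral>y. g y \<partial>\<mu>)"
proof -
  have K: "0 \<le> K" using assms(3)[of undefined] by linarith
  have nn: "(\<integral>y. Pt t h y \<partial>\<mu>) = (\<integral>y. h y \<partial>\<mu>)"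
    if h: "h \<in> borel_measurable borel" "\<And>x. \<bar>h x\<bar> \<le> C" "\<And>x. 0 \<le> h x" for h :: "'a \<Rightarrow> real" and C
  proof -
    have p0: "0 \<le> Pt t h y" for y unfolding semigroup_op_def using h by (intro integral_nonneg_AE) auto
    have "ennreal (\<integral>y. Pt t h y \<partial>\<mu>) = (\<integral>\<^sup>+y. ennreal (Pt t h y) \<partial>\<mu>)"
      using p0 Pt_bounded[OF assms(1) h(1,2)] Pt_measurable[OF assms(1) h(1)]
      by (intro nn_integral_eq_integral[symmetric] integrable_\<mu>) auto
    also have "\<dots> = (\<integral>\<^sup>+y. (\<integral>\<^sup>+z. ennreal (h z) \<partial>tk t y) \<partial>\<mu>)"
      unfolding semigroup_op_def
      using integrable_tk[OF assms(1) h(1,2)] h(3) by (intro nn_integral_cong nn_integral_eq_integral[symmetric]) auto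
    also have "\<dots> = (\<integral>\<^sup>+y. ennreal (h y) \<partial>\<mu>)" using assms h by (intro invariant_nn) auto
    also have "\<dots> = ennreal (\<integral>y. h y \<partial>\<mu>)"
      using h by (intro nn_integral_eq_integral integrable_\<mu>) auto
    finally show ?thesis using p0 h by (simp add: ennreal_inj integral_nonneg_AE)
  qed
  have P1: "Pt t (\<lambda>x. g x + K) y = Pt t g y + K" for y
  proof -
    interpret prob_space "tk t y" by (rule prob_space_tk[OF assms(1)])
    show ?thesis unfolding semigroup_op_def using integrable_tk[OF assms] assms(1) by simp
  qed
  have "(\<integral>y. Pt t (\<lambda>x. g x + K) y \<partial>\<mu>) = (\<integral>y. g y + K \<partial>\<mu>)"
  proof (rule nn[of "\<lambda>x. g x + K" "2*K"])
    fix x show "\<bar>g x + K\<bar> \<le> 2 * K" "0 \<le> g x + K" using assms(3)[of x] by (auto simp: abs_le_iff)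
  qed (use assms in auto)
  moreover have "integrable \<mu> (Pt t g)" "integrable \<mu> g"
    using Pt_bounded[OF assms] Pt_measurable[OF assms(1,2)] assms by (auto intro!: integrable_\<mu>)
  ultimately show ?thesis by (simp add: P1 mu.prob_space)
qed

text \<open>
  The expected squared jump of \<open>F\<close> in one step is
  \<open>Pt s (F\<^sup>2) - F\<^sup>2\<close> when \<open>F\<close> is invariant, and this has
  integral \<open>0\<close> because \<open>\<mu>\<close> is invariant.
\<close>

lemma invariant_function_jump:
  fixes F :: "'a \<Rightarrow> real"
  assumes F: "F \<in> borel_measurable borel" and K: "\<And>x. \<bar>F x\<bar> \<le> K" and s: "0 \<le> s"
    and inv: "AE y in \<mu>. F y = Pt s F y"
  shows "AE y in \<mu>. AE z in tk s y. F z = F y"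
proof -
  note F[measurable]
  have [measurable]: "tk s \<in> borel \<rightarrow>\<^sub>M subprob_algebra borel" using s by (rule tk_kernel)
  have K0: "0 \<le> K" using K[of undefined] by linarith
  have sq: "\<bar>(F x)\<^sup>2\<bar> \<le> K\<^sup>2" for x using K[of x] abs_le_square_iff[of "F x" K] K0 by simp
  have sqm: "(\<lambda>x. (F x)\<^sup>2) \<in> borel_measurable borel" by measurable
  have key: "AE y in \<mu>. (\<integral>\<^sup>+z. ennreal ((F z - F y)\<^sup>2) \<partial>tk s y) = ennreal (Pt s (\<lambda>x. (F x)\<^sup>2) y - (F y)\<^sup>2)
       \<and> Pt s (\<lambda>x. (F x)\<^sup>2) y - (F y)\<^sup>2 \<ge> 0"
    using inv
  proof eventually_elim
    case (elim y)
    interpret prob_space "tk s y" by (rule prob_space_tk[OF s])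
    have i: "integrable (tk s y) F" "integrable (tk s y) (\<lambda>x. (F x)\<^sup>2)"
      using integrable_tk[OF s F K] integrable_tk[OF s sqm sq] by auto
    have eq: "(F z - F y)\<^sup>2 = (F z)\<^sup>2 - 2 * F y * F z + (F y)\<^sup>2" for z
      by (simp add: power2_diff)
    have i2: "integrable (tk s y) (\<lambda>z. (F z - F y)\<^sup>2)" unfolding eq using i by simp
    have "(\<integral>z. (F z - F y)\<^sup>2 \<partial>tk s y) = Pt s (\<lambda>x. (F x)\<^sup>2) y - 2 * F y * Pt s F y + (F y)\<^sup>2"
      unfolding eq semigroup_op_def using i s by simp
    also have "\<dots> = Pt s (\<lambda>x. (F x)\<^sup>2) y - (F y)\<^sup>2" using elim by (simp add: power2_eq_square)
    finally have e: "(\<integral>z. (F z - F y)\<^sup>2 \<partial>tk s y) = Pt s (\<lambda>x. (F x)\<^sup>2) y - (F y)\<^sup>2" .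
    have "0 \<le> (\<integral>z. (F z - F y)\<^sup>2 \<partial>tk s y)" by simp
    then show ?case using nn_integral_eq_integral[OF i2] e by simp
  qed
  have m2: "(\<lambda>y. \<integral>\<^sup>+z. ennreal ((F z - F y)\<^sup>2) \<partial>tk s y) \<in> borel_measurable borel"
    by (rule nn_integral_measurable_subprob_algebra2[where N=borel]) measurable
  have Pm: "Pt s (\<lambda>x. (F x)\<^sup>2) \<in> borel_measurable borel" by (rule Pt_measurable[OF s sqm])
  have iP: "integrable \<mu> (Pt s (\<lambda>x. (F x)\<^sup>2))" by (rule integrable_\<mu>[OF Pm Pt_bounded[OF s sqm sq]])
  have iF: "integrable \<mu> (\<lambda>x. (F x)\<^sup>2)" by (rule integrable_\<mu>[OF sqm sq])
  have "(\<integral>\<^sup>+y. (\<integral>\<^sup>+z. ennreal ((F z - F y)\<^sup>2) \<partial>tk s y) \<partial>\<mu>) = (\<integral>\<^sup>+y. ennreal (Pt s (\<lambda>x. (F x)\<^sup>2) y - (F y)\<^sup>2) \<partial>\<mu>)"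
    using key by (intro nn_integral_cong_AE) auto
  also have "\<dots> = ennreal (\<integral>y. Pt s (\<lambda>x. (F x)\<^sup>2) y - (F y)\<^sup>2 \<partial>\<mu>)"
    using key iP iF by (intro nn_integral_eq_integral) auto
  also have "\<dots> = 0" using iP iF invariant_integral[OF s sqm sq] by simp
  finally have "AE y in \<mu>. (\<integral>\<^sup>+z. ennreal ((F z - F y)\<^sup>2) \<partial>tk s y) = 0"
    using m2 by (subst (asm) nn_integral_0_iff_AE) auto
  then show ?thesis
  proof eventually_elim
    case (elim y)
    then have "AE z in tk s y. ennreal ((F z - F y)\<^sup>2) = 0"
      by (subst (asm) nn_integral_0_iff_AE) auto
    then show ?case by eventually_elim (auto simp: ennreal_eq_0_iff)
  qed
qed

text \<open>
  Conditioning \<open>\<mu>\<close> on a charged invariant set gives an invariant probability, which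
  must be \<open>\<mu>\<close>.
\<close>

lemma invariant_set_trivial:
  assumes D: "D \<in> sets borel" and inv: "\<And>s. 0 \<le> s \<Longrightarrow> AE y in \<mu>. AE z in tk s y. z \<in> D \<longleftrightarrow> y \<in> D"
    and pos: "emeasure \<mu> D \<noteq> 0"
  shows "emeasure \<mu> D = 1"
proof -
  note D[measurable]
  let ?\<nu> = "uniform_measure \<mu> D"
  have fin: "emeasure \<mu> D \<noteq> \<infinity>" by simp
  have "invariant_prob P X ?\<nu>"
    unfolding invariant_prob_def
  proof (intro conjI allI impI)
    show "prob_space ?\<nu>" by (rule prob_space_uniform_measure[OF pos fin])
    fix t :: real assume t: "0 \<le> t"
    have [measurable]: "tk t \<in> borel \<rightarrow>\<^sub>M subprob_algebra borel" using t by (rule tk_kernel)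
    have K: "tk t \<in> ?\<nu> \<rightarrow>\<^sub>M subprob_algebra borel" by measurable
    show "?\<nu> \<bind> tk t = ?\<nu>"
    proof (rule measure_eqI)
      show "sets (?\<nu> \<bind> tk t) = sets ?\<nu>" by (subst sets_bind[where N=borel]) auto
      fix B assume "B \<in> sets (?\<nu> \<bind> tk t)"
      then have B[measurable]: "B \<in> sets borel" by (subst (asm) sets_bind[where N=borel]) auto
      have "emeasure (?\<nu> \<bind> tk t) B = (\<integral>\<^sup>+y. emeasure (tk t y) B \<partial>?\<nu>)"
        by (rule emeasure_bind[OF _ K B]) simp
      also have "\<dots> = (\<integral>\<^sup>+y. emeasure (tk t y) B * indicator D y \<partial>\<mu>) / emeasure \<mu> D"
        by (rule nn_integral_uniform_measure) auto
      also have "(\<integral>\<^sup>+y. emeasure (tk t y) B * indicator D y \<partial>\<mu>) = (\<integral>\<^sup>+y. (\<integral>\<^sup>+z. indicator (D \<inter> B) z \<partial>tk t y) \<partial>\<mu>)"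
        using inv[OF t]
      proof (intro nn_integral_cong_AE, eventually_elim)
        case (elim y)
        have "emeasure (tk t y) B * indicator D y = (\<integral>\<^sup>+z. indicator B z * indicator D y \<partial>tk t y)"
          by (subst nn_integral_multc) auto
        also have "\<dots> = (\<integral>\<^sup>+z. indicator (D \<inter> B) z \<partial>tk t y)"
          using elim by (intro nn_integral_cong_AE) (auto simp: indicator_def)
        finally show ?case .
      qed
      also have "\<dots> = (\<integral>\<^sup>+y. indicator (D \<inter> B) y \<partial>\<mu>)" by (rule invariant_nn[OF t]) auto
      finally show "emeasure (?\<nu> \<bind> tk t) B = emeasure ?\<nu> B" by simp
    qed
  qed simp
  then have "?\<nu> = \<mu>" by (rule \<mu>_unique)
  then have "emeasure \<mu> D = emeasure ?\<nu> D" by simp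
  also have "\<dots> = 1" using pos by (simp add: mu.emeasure_eq_measure ennreal_divide_self del: mu.emeasure_eq_measure[symmetric])
  finally show ?thesis .
qed

text \<open>
  If \<open>F\<close> exceeded its mean on a charged set, it would do so almost everywhere, since
  this set is invariant.
\<close>

lemma invariant_function_const:
  fixes F :: "'a \<Rightarrow> real"
  assumes F: "F \<in> borel_measurable borel" and K: "\<And>x. \<bar>F x\<bar> \<le> K"
    and inv: "\<And>s. 0 \<le> s \<Longrightarrow> AE y in \<mu>. F y = Pt s F y"
  shows "AE y in \<mu>. F y = (\<integral>y. F y \<partial>\<mu>)"
proof -
  note F[measurable]
  let ?m = "\<integral>y. F y \<partial>\<mu>"
  let ?D = "{y. ?m < F y}"
  have iF: "integrable \<mu> F" by (rule integrable_\<mu>[OF F K])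
  have D: "?D \<in> sets borel" by measurable
  have iD: "AE y in \<mu>. AE z in tk s y. z \<in> ?D \<longleftrightarrow> y \<in> ?D" if "0 \<le> s" for s
    using invariant_function_jump[OF F K that inv[OF that]] by eventually_elim auto
  have "emeasure \<mu> ?D = 0"
  proof (rule ccontr)
    assume "emeasure \<mu> ?D \<noteq> 0"
    from invariant_set_trivial[OF D iD this] have "AE y in \<mu>. y \<in> ?D"
      by (intro mu.AE_prob_1) (simp add: mu.emeasure_eq_measure)
    then have lt: "AE y in \<mu>. ?m < F y" by simp
    have "(\<integral>y. ?m \<partial>\<mu>) < (\<integral>y. F y \<partial>\<mu>)"
      using lt iF by (intro mu.integral_less_AE_space) simp_all
    then show False by (simp add: mu.prob_space)
  qed
  then have le: "AE y in \<mu>. F y \<le> ?m"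
    using D by (subst AE_iff_measurable[of ?D]) (auto simp: not_le)
  have "(\<integral>y. ?m - F y \<partial>\<mu>) = 0" using iF by (simp add: mu.prob_space)
  then have "AE y in \<mu>. ?m - F y = 0"
    using le iF by (subst (asm) integral_nonneg_eq_0_iff_AE) auto
  then show ?thesis by eventually_elim auto
qed

text \<open>
  Along a subsequence violating the bound, the averages of \<open>mazur_AE\<close> converge almost
  everywhere to a function that inherits the mean \<open>c\<close> and, in the limit, invariance; so
  it is the constant \<open>c\<close>, also almost everywhere for \<open>\<nu>\<close>. But the
  averages keep the excess \<open>\<delta>\<close> of their integrals over \<open>\<nu>\<close>.
\<close>

lemma weak_limit_upper:
  fixes F :: "nat \<Rightarrow> 'a \<Rightarrow> real"
  assumes F: "\<And>k. F k \<in> borel_measurable borel" and K: "\<And>k x. \<bar>F k x\<bar> \<le> K"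
    and inv: "\<And>s. 0 \<le> s \<Longrightarrow> (\<lambda>k. \<integral>y. \<bar>F k y - Pt s (F k) y\<bar> \<partial>\<mu>) \<longlonglongrightarrow> 0"
    and c: "(\<lambda>k. \<integral>y. F k y \<partial>\<mu>) \<longlonglongrightarrow> c"
    and fin: "finite_measure \<nu>" and sets: "sets \<nu> = sets borel" and ac: "absolutely_continuous \<mu> \<nu>"
    and \<delta>: "0 < \<delta>"
  shows "\<forall>\<^sub>F k in sequentially. (\<integral>y. F k y \<partial>\<nu>) < c * measure \<nu> UNIV + \<delta>"
proof (rule ccontr)
  interpret \<nu>: finite_measure \<nu> by fact
  have spn: "space \<nu> = UNIV" using sets_eq_imp_space_eq[OF sets] by simp
  note [measurable_cong] = sets
  assume "\<not> ?thesis"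
  from not_eventually_sequentiallyD[OF this] obtain r :: "nat \<Rightarrow> nat"
    where r: "strict_mono r" and big: "\<And>k. c * measure \<nu> UNIV + \<delta> \<le> (\<integral>y. F (r k) y \<partial>\<nu>)"
    by (auto simp: not_less)
  define E where "E k = F (r k)" for k
  have E: "E k \<in> borel_measurable borel" for k by (simp add: E_def F)
  have EK: "\<bar>E k x\<bar> \<le> K" for k x by (simp add: E_def K)
  have Einv: "(\<lambda>k. \<integral>y. \<bar>E k y - Pt s (E k) y\<bar> \<partial>\<mu>) \<longlonglongrightarrow> 0" if "0 \<le> s" for s
    using LIMSEQ_subseq_LIMSEQ[OF inv[OF that] r] by (simp add: E_def o_def)
  have Ec: "(\<lambda>k. \<integral>y. E k y \<partial>\<mu>) \<longlonglongrightarrow> c"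
    using LIMSEQ_subseq_LIMSEQ[OF c r] by (simp add: E_def o_def)
  obtain G g where G: "\<And>n. G n \<in> midpoint_hull E n" and g: "g \<in> borel_measurable \<mu>"
    and gK: "\<And>x. \<bar>g x\<bar> \<le> K" and lim: "AE x in \<mu>. (\<lambda>n. G n x) \<longlonglongrightarrow> g x"
    using mazur_AE[OF prob_space_\<mu>, of E K] E EK by (auto simp: measurable_cong_sets[OF sets_\<mu> refl])
  have g[measurable]: "g \<in> borel_measurable borel" using g by (simp add: measurable_cong_sets[OF sets_\<mu> refl])
  have hm: "a \<in> borel_measurable borel" if "a \<in> midpoint_hull E j" for a j
    using midpoint_hull_measurable[OF that E] .
  have hb: "\<bar>a x\<bar> \<le> K" if "a \<in> midpoint_hull E j" for a j x
    using midpoint_hull_bounded[OF that EK] .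
  have Gm[measurable]: "G n \<in> borel_measurable borel" for n by (rule hm[OF G])
  have i\<mu>: "integrable \<mu> a" if "a \<in> midpoint_hull E j" for a j
    by (rule integrable_\<mu>[OF hm[OF that] hb[OF that]])
  have i\<nu>: "integrable \<nu> a" if "a \<in> midpoint_hull E j" for a j
    using hm[OF that] hb[OF that] by (intro \<nu>.integrable_const_bound[where B=K]) (auto simp: measurable_cong_sets[OF sets refl])
  have low: "c * measure \<nu> UNIV + \<delta> \<le> (\<integral>y. a y \<partial>\<nu>)" if "a \<in> midpoint_hull E j" for a j
    using that
  proof induction
    case (mid a b)
    then show ?case using i\<nu>[OF mid.hyps(1)] i\<nu>[OF mid.hyps(2)] by simp
  qed (simp add: E_def big)
  have near: "\<bar>(\<integral>y. a y \<partial>\<mu>) - c\<bar> \<le> \<eta>" if "a \<in> midpoint_hull E j" "\<And>k. j \<le> k \<Longrightarrow> \<bar>(\<integral>y. E k y \<partial>\<mu>) - c\<bar> \<le> \<eta>" for a j \<eta>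
    using that(1)
  proof induction
    case (mid a b)
    then show ?case using i\<mu>[OF mid.hyps(1)] i\<mu>[OF mid.hyps(2)] by (simp add: abs_le_iff field_simps)
  qed (use that(2) in auto)
  have ninv: "(\<integral>y. \<bar>a y - Pt s a y\<bar> \<partial>\<mu>) \<le> \<eta>"
    if "a \<in> midpoint_hull E j" "0 \<le> s" "\<And>k. j \<le> k \<Longrightarrow> (\<integral>y. \<bar>E k y - Pt s (E k) y\<bar> \<partial>\<mu>) \<le> \<eta>" for a j s \<eta>
    using that(1)
  proof induction
    case (mid a b)
    have Pi: "Pt s (\<lambda>x. (a x + b x) / 2) y = (Pt s a y + Pt s b y) / 2" for y
      unfolding semigroup_op_def
      using integrable_tk[OF that(2) hm[OF mid.hyps(1)] hb[OF mid.hyps(1)]] integrable_tk[OF that(2) hm[OF mid.hyps(2)] hb[OF mid.hyps(2)]]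
      by simp
    have ia: "integrable \<mu> (\<lambda>y. \<bar>u y - Pt s u y\<bar>)" if u: "u \<in> midpoint_hull E j" for u
      using i\<mu>[OF u] integrable_\<mu>[OF Pt_measurable[OF \<open>0 \<le> s\<close> hm[OF u]] Pt_bounded[OF \<open>0 \<le> s\<close> hm[OF u] hb[OF u]]]
      by auto
    have "(\<integral>y. \<bar>(a y + b y) / 2 - Pt s (\<lambda>x. (a x + b x) / 2) y\<bar> \<partial>\<mu>) \<le>
        (\<integral>y. (\<bar>a y - Pt s a y\<bar> + \<bar>b y - Pt s b y\<bar>) / 2 \<partial>\<mu>)"
    proof (rule integral_mono[OF ia[OF midpoint_hull.mid[OF mid.hyps(1,2)]]])
      have "\<bar>(x + y) / 2 - (u + w) / 2\<bar> \<le> (\<bar>x - u\<bar> + \<bar>y - w\<bar>) / 2" for x y u w :: real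
      proof -
        have "(x + y) / 2 - (u + w) / 2 = ((x - u) + (y - w)) / 2" by (simp add: field_simps)
        then have "\<bar>(x + y) / 2 - (u + w) / 2\<bar> = \<bar>(x - u) + (y - w)\<bar> / 2" by (simp only: abs_divide)
        then show ?thesis by (simp only: divide_right_mono[OF abs_triangle_ineq])
      qed
      then show "\<bar>(a y + b y) / 2 - Pt s (\<lambda>x. (a x + b x) / 2) y\<bar> \<le> (\<bar>a y - Pt s a y\<bar> + \<bar>b y - Pt s b y\<bar>) / 2" for y
        unfolding Pi .
    qed (use ia[OF mid.hyps(1)] ia[OF mid.hyps(2)] in auto)
    also have "\<dots> = ((\<integral>y. \<bar>a y - Pt s a y\<bar> \<partial>\<mu>) + (\<integral>y. \<bar>b y - Pt s b y\<bar> \<partial>\<mu>)) / 2"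
      using ia[OF mid.hyps(1)] ia[OF mid.hyps(2)] by simp
    finally show ?case using mid.IH by simp
  qed (use that(3) in auto)
  have dc: "(\<lambda>n. \<integral>y. G n y \<partial>N) \<longlonglongrightarrow> (\<integral>y. g y \<partial>N)"
    if "finite_measure N" "sets N = sets borel" "AE x in N. (\<lambda>n. G n x) \<longlonglongrightarrow> g x" for N
  proof -
    interpret N: finite_measure N by fact
    show ?thesis
      using that(3) g Gm hb[OF G] that(2)
      by (intro integral_dominated_convergence[where w="\<lambda>_. K"])
         (auto simp: measurable_cong_sets[OF that(2) refl] intro!: AE_I2)
  qed
  have gc: "(\<integral>y. g y \<partial>\<mu>) = c"
  proof (rule LIMSEQ_unique[OF dc])
    show "(\<lambda>n. \<integral>y. G n y \<partial>\<mu>) \<longlonglongrightarrow> c"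
    proof (rule LIMSEQ_I)
      fix \<eta> :: real assume "0 < \<eta>"
      then obtain k0 where k0: "\<And>k. k0 \<le> k \<Longrightarrow> \<bar>(\<integral>y. E k y \<partial>\<mu>) - c\<bar> < \<eta> / 2"
        using LIMSEQ_D[OF Ec, of "\<eta> / 2"] by auto
      have "norm ((\<integral>y. G n y \<partial>\<mu>) - c) < \<eta>" if "n \<ge> k0" for n
        using near[OF G[of n], of "\<eta> / 2"] k0 that \<open>0 < \<eta>\<close> by (force intro: less_imp_le)
      then show "\<exists>no. \<forall>n\<ge>no. norm ((\<integral>y. G n y \<partial>\<mu>) - c) < \<eta>" by blast
    qed
  qed (use lim mu.finite_measure_axioms in auto)
  have ginv: "AE y in \<mu>. g y = Pt s g y" if s: "0 \<le> s" for s
  proof -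
    have "AE y in \<mu>. (\<lambda>n. Pt s (G n) y) \<longlonglongrightarrow> Pt s g y"
      using invariant_AE[OF s lim]
    proof eventually_elim
      case (elim y)
      then show ?case unfolding semigroup_op_def
        using prob_space.finite_measure[OF prob_space_tk[OF s, of y]] by (intro dc) auto
    qed
    with lim have l2: "AE y in \<mu>. (\<lambda>n. \<bar>G n y - Pt s (G n) y\<bar>) \<longlonglongrightarrow> \<bar>g y - Pt s g y\<bar>"
      by eventually_elim (intro tendsto_intros)
    have mm[measurable]: "Pt s g \<in> borel_measurable borel" "\<And>n. Pt s (G n) \<in> borel_measurable borel"
      using s by (auto intro!: Pt_measurable)
    have bb: "\<bar>G n y - Pt s (G n) y\<bar> \<le> 2 * K" for n y
      using hb[OF G, of n y] Pt_bounded[OF s Gm hb[OF G], of n y] by linarith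
    have "(\<lambda>n. \<integral>y. \<bar>G n y - Pt s (G n) y\<bar> \<partial>\<mu>) \<longlonglongrightarrow> (\<integral>y. \<bar>g y - Pt s g y\<bar> \<partial>\<mu>)"
      using l2 bb by (intro integral_dominated_convergence[where w="\<lambda>_. 2 * K"]) (auto intro!: AE_I2)
    moreover have "(\<lambda>n. \<integral>y. \<bar>G n y - Pt s (G n) y\<bar> \<partial>\<mu>) \<longlonglongrightarrow> 0"
    proof (rule LIMSEQ_I)
      fix \<eta> :: real assume "0 < \<eta>"
      then obtain k0 where k0: "\<And>k. k0 \<le> k \<Longrightarrow> (\<integral>y. \<bar>E k y - Pt s (E k) y\<bar> \<partial>\<mu>) < \<eta> / 2"
        using LIMSEQ_D[OF Einv[OF s], of "\<eta> / 2"] by auto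
      have "norm ((\<integral>y. \<bar>G n y - Pt s (G n) y\<bar> \<partial>\<mu>) - 0) < \<eta>" if "n \<ge> k0" for n
        using ninv[OF G[of n] s, of "\<eta> / 2"] k0 that \<open>0 < \<eta>\<close> by (force intro: less_imp_le)
      then show "\<exists>no. \<forall>n\<ge>no. norm ((\<integral>y. \<bar>G n y - Pt s (G n) y\<bar> \<partial>\<mu>) - 0) < \<eta>" by blast
    qed
    ultimately have z: "(\<integral>y. \<bar>g y - Pt s g y\<bar> \<partial>\<mu>) = 0" by (rule LIMSEQ_unique)
    have "integrable \<mu> (\<lambda>y. \<bar>g y - Pt s g y\<bar>)"
      using integrable_\<mu>[OF g gK] integrable_\<mu>[OF mm(1) Pt_bounded[OF s g gK]] by auto
    then have "AE y in \<mu>. \<bar>g y - Pt s g y\<bar> = 0" using z by (subst (asm) integral_nonneg_eq_0_iff_AE) auto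
    then show ?thesis by eventually_elim auto
  qed
  have const: "AE y in \<mu>. g y = c" using invariant_function_const[OF g gK ginv] gc by simp
  have limn: "AE x in \<nu>. (\<lambda>n. G n x) \<longlonglongrightarrow> g x" and constn: "AE x in \<nu>. g x = c"
    using absolutely_continuous_AE[OF _ ac] lim const sets by auto
  have "c * measure \<nu> UNIV + \<delta> \<le> (\<integral>y. g y \<partial>\<nu>)"
    using dc[OF fin sets limn] low[OF G] by (intro LIMSEQ_le_const) auto
  also have "(\<integral>y. g y \<partial>\<nu>) = (\<integral>y. c \<partial>\<nu>)" using constn by (intro integral_cong_AE) auto
  also have "\<dots> = c * measure \<nu> UNIV" by (simp add: spn mult.commute)
  finally show False using \<delta> by simp
qed

theorem weak_limit:
  fixes F :: "nat \<Rightarrow> 'a \<Rightarrow> real"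
  assumes F: "\<And>k. F k \<in> borel_measurable borel" and K: "\<And>k x. \<bar>F k x\<bar> \<le> K"
    and inv: "\<And>s. 0 \<le> s \<Longrightarrow> (\<lambda>k. \<integral>y. \<bar>F k y - Pt s (F k) y\<bar> \<partial>\<mu>) \<longlonglongrightarrow> 0"
    and c: "(\<lambda>k. \<integral>y. F k y \<partial>\<mu>) \<longlonglongrightarrow> c"
    and fin: "finite_measure \<nu>" and sets: "sets \<nu> = sets borel" and ac: "absolutely_continuous \<mu> \<nu>"
  shows "(\<lambda>k. \<integral>y. F k y \<partial>\<nu>) \<longlonglongrightarrow> c * measure \<nu> UNIV"
proof (rule LIMSEQ_I)
  fix \<delta> :: real assume \<delta>: "0 < \<delta>"
  have Pm: "Pt s (\<lambda>y. - F k y) y = - Pt s (F k) y" for s k y by (simp add: semigroup_op_def)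
  have "(\<lambda>k. \<integral>y. \<bar>- F k y - Pt s (\<lambda>y. - F k y) y\<bar> \<partial>\<mu>) \<longlonglongrightarrow> 0" if "0 \<le> s" for s
  proof -
    have "\<bar>- F k y - Pt s (\<lambda>y. - F k y) y\<bar> = \<bar>F k y - Pt s (F k) y\<bar>" for k y by (simp add: Pm abs_minus_commute)
    then show ?thesis using inv[OF that] by simp
  qed
  then have 1: "\<forall>\<^sub>F k in sequentially. (\<integral>y. - F k y \<partial>\<nu>) < (- c) * measure \<nu> UNIV + \<delta>"
    using F K c by (intro weak_limit_upper[OF _ _ _ _ fin sets ac \<delta>, of "\<lambda>k y. - F k y" K]) (auto intro: tendsto_minus)
  have 2: "\<forall>\<^sub>F k in sequentially. (\<integral>y. F k y \<partial>\<nu>) < c * measure \<nu> UNIV + \<delta>"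
    by (rule weak_limit_upper[OF F K inv c fin sets ac \<delta>])
  from 1 2 have "\<forall>\<^sub>F k in sequentially. norm ((\<integral>y. F k y \<partial>\<nu>) - c * measure \<nu> UNIV) < \<delta>"
    by eventually_elim auto
  then show "\<exists>no. \<forall>n\<ge>no. norm ((\<integral>y. F n y \<partial>\<nu>) - c * measure \<nu> UNIV) < \<delta>"
    by (simp add: eventually_sequentially)
qed

end

section \<open>Integrals of mixtures and increments of integrals\<close>

lemma integral_bind_bounded:
  fixes g :: "'b \<Rightarrow> real"
  assumes N: "N \<in> M \<rightarrow>\<^sub>M subprob_algebra B" and M: "finite_measure M" "space M \<noteq> {}"
    and g: "g \<in> borel_measurable B" and K: "\<And>x. \<bar>g x\<bar> \<le> K"
  shows "(\<integral>x. g x \<partial>(M \<bind> N)) = (\<integral>x. (\<integral>y. g y \<partial>N x) \<partial>M)"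
proof -
  interpret M: finite_measure M by fact
  have K0: "0 \<le> K" using K[of undefined] by linarith
  have sN: "sets (N x) = sets B" "subprob_space (N x)" if "x \<in> space M" for x
    using measurable_space[OF N that] by (auto simp: space_subprob_algebra)
  have sB: "sets (M \<bind> N) = sets B" by (rule sets_bind[OF sN(1) M(2)])
  have fB: "finite_measure (M \<bind> N)"
  proof
    have "emeasure (M \<bind> N) (space (M \<bind> N)) = (\<integral>\<^sup>+x. emeasure (N x) (space (M \<bind> N)) \<partial>M)"
      using sB M(2) N by (intro emeasure_bind) (auto simp: sB[symmetric])
    also have "\<dots> \<le> (\<integral>\<^sup>+x. 1 \<partial>M)"
      using sN(2) by (intro nn_integral_mono subprob_space.subprob_emeasure_le_1)
    also have "\<dots> = emeasure M (space M)" by simp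
    finally show "emeasure (M \<bind> N) (space (M \<bind> N)) \<noteq> \<infinity>" using M.emeasure_finite[of "space M"] by (auto simp: top_unique)
  qed
  have Nb: "integrable (N x) h" "\<bar>\<integral>y. h y \<partial>N x\<bar> \<le> K" if "x \<in> space M" "h \<in> borel_measurable B" "\<And>y. \<bar>h y\<bar> \<le> K" for x and h :: "'b \<Rightarrow> real"
  proof -
    interpret subprob_space "N x" by (rule sN(2)[OF that(1)])
    show i: "integrable (N x) h"
      using that by (intro integrable_const_bound[where B=K]) (auto simp: measurable_cong_sets[OF sN(1)[OF that(1)] refl])
    have "\<bar>\<integral>y. h y \<partial>N x\<bar> \<le> (\<integral>y. \<bar>h y\<bar> \<partial>N x)" using integral_norm_bound[of "N x" h] by simp
    also have "\<dots> \<le> (\<integral>y. K \<partial>N x)" using i that(3) by (intro integral_mono) auto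
    also have "\<dots> \<le> K" using K0 subprob_measure_le_1[of "space (N x)"] by (simp add: mult_left_le_one_le)
    finally show "\<bar>\<integral>y. h y \<partial>N x\<bar> \<le> K" .
  qed
  have im: "(\<lambda>x. \<integral>y. h y \<partial>N x) \<in> borel_measurable M" if "h \<in> borel_measurable B" for h :: "'b \<Rightarrow> real"
    by (rule measurable_compose[OF N integral_measurable_subprob_algebra[OF that]])
  have ii: "integrable M (\<lambda>x. \<integral>y. h y \<partial>N x)" if "h \<in> borel_measurable B" "\<And>y. \<bar>h y\<bar> \<le> K" for h :: "'b \<Rightarrow> real"
    using im[OF that(1)] Nb(2)[OF _ that] by (intro M.integrable_const_bound[where B=K]) auto
  have ib: "integrable (M \<bind> N) h" if "h \<in> borel_measurable B" "\<And>y. \<bar>h y\<bar> \<le> K" for h :: "'b \<Rightarrow> real"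
    using that by (intro finite_measure.integrable_const_bound[OF fB, where B=K]) (auto simp: measurable_cong_sets[OF sB refl])
  have nonneg: "(\<integral>x. h x \<partial>(M \<bind> N)) = (\<integral>x. (\<integral>y. h y \<partial>N x) \<partial>M)"
    if h: "h \<in> borel_measurable B" "\<And>y. \<bar>h y\<bar> \<le> K" "\<And>y. 0 \<le> h y" for h :: "'b \<Rightarrow> real"
  proof -
    have "ennreal (\<integral>x. h x \<partial>(M \<bind> N)) = (\<integral>\<^sup>+x. h x \<partial>(M \<bind> N))"
      using h(3) ib[OF h(1,2)] by (intro nn_integral_eq_integral[symmetric]) auto
    also have "\<dots> = (\<integral>\<^sup>+x. (\<integral>\<^sup>+y. h y \<partial>N x) \<partial>M)"
      using h(1) by (intro nn_integral_bind[OF _ N]) auto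
    also have "\<dots> = (\<integral>\<^sup>+x. ennreal (\<integral>y. h y \<partial>N x) \<partial>M)"
      using h(3) Nb(1)[OF _ h(1,2)] by (intro nn_integral_cong nn_integral_eq_integral) auto
    also have "\<dots> = ennreal (\<integral>x. (\<integral>y. h y \<partial>N x) \<partial>M)"
      using h(3) ii[OF h(1,2)] by (intro nn_integral_eq_integral) (auto intro!: AE_I2 integral_nonneg_AE)
    finally show ?thesis using h(3) by (simp add: integral_nonneg_AE)
  qed
  let ?p = "\<lambda>x. max (g x) 0" and ?n = "\<lambda>x. max (- g x) 0"
  have p: "?p \<in> borel_measurable B" "?n \<in> borel_measurable B" using g by auto
  have pK: "\<bar>?p x\<bar> \<le> K" "\<bar>?n x\<bar> \<le> K" for x using K[of x] by (auto simp: max_def)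
  have gpn: "g x = ?p x - ?n x" for x by (simp add: max_def)
  have "(\<integral>x. g x \<partial>(M \<bind> N)) = (\<integral>x. ?p x \<partial>(M \<bind> N)) - (\<integral>x. ?n x \<partial>(M \<bind> N))"
    using ib[OF p(1) pK(1)] ib[OF p(2) pK(2)] by (subst gpn) (rule Bochner_Integration.integral_diff)
  also have "\<dots> = (\<integral>x. (\<integral>y. ?p y \<partial>N x) \<partial>M) - (\<integral>x. (\<integral>y. ?n y \<partial>N x) \<partial>M)"
    using nonneg[OF p(1) pK(1)] nonneg[OF p(2) pK(2)] by simp
  also have "\<dots> = (\<integral>x. (\<integral>y. ?p y \<partial>N x) - (\<integral>y. ?n y \<partial>N x) \<partial>M)"
    using ii[OF p(1) pK(1)] ii[OF p(2) pK(2)] by (rule Bochner_Integration.integral_diff[symmetric])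
  also have "\<dots> = (\<integral>x. (\<integral>y. g y \<partial>N x) \<partial>M)"
    using Nb(1)[OF _ p(1) pK(1)] Nb(1)[OF _ p(2) pK(2)]
    by (intro Bochner_Integration.integral_cong refl) (subst (3) gpn, simp)
  finally show ?thesis .
qed

text \<open>
  The singular part of the Lebesgue decomposition of \<open>\<sigma>\<close> is carried by the zero
  set of the density of \<open>\<mu>\<close> with respect to \<open>\<mu> + \<sigma>\<close>.
\<close>

lemma lebesgue_decomposition_set:
  assumes "finite_measure \<mu>" "finite_measure \<sigma>" and s: "sets \<sigma> = sets \<mu>"
  obtains N where "N \<in> null_sets \<mu>" "\<And>D. D \<in> null_sets \<mu> \<Longrightarrow> D \<inter> N = {} \<Longrightarrow> emeasure \<sigma> D = 0"
proof -
  interpret \<mu>: finite_measure \<mu> by fact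
  interpret \<sigma>: finite_measure \<sigma> by fact
  have sp: "space \<sigma> = space \<mu>" by (rule sets_eq_imp_space_eq[OF s])
  define \<rho> where "\<rho> = measure_of (space \<mu>) (sets \<mu>) (\<lambda>A. emeasure \<mu> A + emeasure \<sigma> A)"
  have em: "emeasure \<rho> A = emeasure \<mu> A + emeasure \<sigma> A" if "A \<in> sets \<mu>" for A
  proof (subst \<rho>_def, rule emeasure_measure_of_sigma)
    show "sigma_algebra (space \<mu>) (sets \<mu>)" ..
    show "countably_additive (sets \<mu>) (\<lambda>A. emeasure \<mu> A + emeasure \<sigma> A)"
    proof (rule countably_additiveI)
      fix B :: "nat \<Rightarrow> _ set" assume B: "range B \<subseteq> sets \<mu>" "disjoint_family B"
      have "(\<Sum>i. emeasure \<mu> (B i) + emeasure \<sigma> (B i)) = (\<Sum>i. emeasure \<mu> (B i)) + (\<Sum>i. emeasure \<sigma> (B i))"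
        by (rule suminf_add[symmetric]) auto
      then show "(\<Sum>i. emeasure \<mu> (B i) + emeasure \<sigma> (B i)) = emeasure \<mu> (\<Union>i. B i) + emeasure \<sigma> (\<Union>i. B i)"
        using B by (simp add: suminf_emeasure s)
    qed
  qed (use that in \<open>auto simp: positive_def\<close>)
  have sl [simp, measurable_cong]: "sets \<rho> = sets \<mu>" by (simp add: \<rho>_def)
  have spl: "space \<rho> = space \<mu>" by (rule sets_eq_imp_space_eq) simp
  have "finite_measure \<rho>"
  proof
    have "emeasure \<rho> (space \<rho>) = emeasure \<mu> (space \<mu>) + emeasure \<sigma> (space \<mu>)"
      unfolding spl by (rule em) simp
    then show "emeasure \<rho> (space \<rho>) \<noteq> \<infinity>"
      using \<mu>.emeasure_finite[of "space \<mu>"] \<sigma>.emeasure_finite[of "space \<mu>"] by simp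
  qed
  then interpret \<rho>: finite_measure \<rho> .
  have "absolutely_continuous \<rho> \<mu>"
    unfolding absolutely_continuous_def by (auto simp: null_sets_def em)
  from \<rho>.Radon_Nikodym[OF this] obtain h where h: "h \<in> borel_measurable \<rho>" "density \<rho> h = \<mu>"
    by (metis sl)
  have hm[measurable]: "h \<in> borel_measurable \<mu>" using h(1) by (simp add: measurable_cong_sets[OF sl refl])
  define N where "N = {x\<in>space \<mu>. h x = 0}"
  have N[measurable]: "N \<in> sets \<mu>" unfolding N_def by measurable
  show ?thesis
  proof
    have "emeasure \<mu> N = (\<integral>\<^sup>+x. h x * indicator N x \<partial>\<rho>)"
      using h N by (subst h(2)[symmetric], subst emeasure_density) auto
    also have "\<dots> = (\<integral>\<^sup>+x. 0 \<partial>\<rho>)" by (intro nn_integral_cong) (auto simp: N_def indicator_def)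
    finally show "N \<in> null_sets \<mu>" using N by (auto simp: null_sets_def)
    fix D assume D: "D \<in> null_sets \<mu>" "D \<inter> N = {}"
    then have Dm[measurable]: "D \<in> sets \<mu>" by auto
    have "(\<integral>\<^sup>+x. h x * indicator D x \<partial>\<rho>) = 0"
      using D h Dm by (subst emeasure_density[symmetric]) auto
    then have "AE x in \<rho>. h x * indicator D x = 0"
      using h(1) by (subst (asm) nn_integral_0_iff_AE) auto
    then have "AE x in \<rho>. x \<notin> D"
      using AE_space by eventually_elim (use D(2) in \<open>auto simp: N_def spl indicator_def split: if_splits\<close>)
    moreover have "D \<in> sets \<rho>" using Dm by auto
    ultimately have "emeasure \<rho> D = 0" using AE_iff_null_sets null_setsD1 by blast
    then show "emeasure \<sigma> D = 0" by (subst (asm) em) auto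
  qed
qed

lemma set_integral_Icc_combine:
  fixes g :: "real \<Rightarrow> real"
  assumes "a \<le> b" "b \<le> c" "set_integrable lborel {a..c} g"
  shows "(LINT u:{a..c}|lborel. g u) = (LINT u:{a..b}|lborel. g u) + (LINT u:{b..c}|lborel. g u)"
proof -
  have i: "set_integrable lborel {a..b} g" "set_integrable lborel {b..c} g"
    using assms by (auto intro: set_integrable_subset)
  have "{a..c} = {a..b} \<union> {b..c}" using assms by auto
  moreover have "(LINT u:{a..b} \<union> {b..c}|lborel. g u) = (LINT u:{a..b}|lborel. g u) + (LINT u:{b..c}|lborel. g u)"
    using AE_lborel_singleton[of b] by (intro set_integral_Un_AE i) auto
  ultimately show ?thesis by simp
qed

lemma abs_set_integral_le:
  fixes g :: "real \<Rightarrow> real"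
  assumes "set_integrable lborel D g"
  shows "ennreal \<bar>LINT u:D|lborel. g u\<bar> \<le> (\<integral>\<^sup>+u\<in>D. ennreal \<bar>g u\<bar> \<partial>lborel)"
proof -
  have "ennreal \<bar>LINT u:D|lborel. g u\<bar> \<le> (\<integral>\<^sup>+u. ennreal (norm (indicator D u *\<^sub>R g u)) \<partial>lborel)"
    unfolding set_lebesgue_integral_def using integral_norm_bound_ennreal[OF assms[unfolded set_integrable_def]] by simp
  also have "\<dots> = (\<integral>\<^sup>+u\<in>D. ennreal \<bar>g u\<bar> \<partial>lborel)"
    by (intro nn_integral_cong) (auto simp: indicator_def)
  finally show ?thesis .
qed

text \<open>
  Both integrals are compared over \<open>{0..s + T}\<close>, where they differ by an initial and a
  final piece.
\<close>

lemma shift_increment_bound: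
  fixes g :: "real \<Rightarrow> real"
  assumes s: "0 \<le> s" and T: "0 \<le> T" and i: "set_integrable lborel {0..s + T} g"
  shows "ennreal \<bar>(LINT u:{0..T}|lborel. g u) - (LINT u:{s..s + T}|lborel. g u)\<bar> \<le>
    (\<integral>\<^sup>+u\<in>{0..s}. ennreal \<bar>g u\<bar> \<partial>lborel) + (\<integral>\<^sup>+u\<in>{T..T + s}. ennreal \<bar>g u\<bar> \<partial>lborel)"
proof -
  have i2: "set_integrable lborel {0..s} g" "set_integrable lborel {T..T + s} g"
    using i s T by (auto intro: set_integrable_subset[OF i])
  have "(LINT u:{0..s+T}|lborel. g u) = (LINT u:{0..s}|lborel. g u) + (LINT u:{s..s+T}|lborel. g u)"
    "(LINT u:{0..s+T}|lborel. g u) = (LINT u:{0..T}|lborel. g u) + (LINT u:{T..T+s}|lborel. g u)"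
    using set_integral_Icc_combine[OF _ _ i, of s] set_integral_Icc_combine[OF _ _ i, of T] s T by (auto simp: add.commute)
  then have "\<bar>(LINT u:{0..T}|lborel. g u) - (LINT u:{s..s + T}|lborel. g u)\<bar> \<le>
      \<bar>LINT u:{0..s}|lborel. g u\<bar> + \<bar>LINT u:{T..T+s}|lborel. g u\<bar>" by linarith
  from ennreal_leI[OF this] have "ennreal \<bar>(LINT u:{0..T}|lborel. g u) - (LINT u:{s..s + T}|lborel. g u)\<bar> \<le>
      ennreal \<bar>LINT u:{0..s}|lborel. g u\<bar> + ennreal \<bar>LINT u:{T..T+s}|lborel. g u\<bar>"
    by (simp only: ennreal_plus abs_ge_zero)
  also have "\<dots> \<le> (\<integral>\<^sup>+u\<in>{0..s}. ennreal \<bar>g u\<bar> \<partial>lborel) + (\<integral>\<^sup>+u\<in>{T..T + s}. ennreal \<bar>g u\<bar> \<partial>lborel)"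
    by (intro add_mono abs_set_integral_le i2)
  finally show ?thesis .
qed

lemma nn_integral_Icc_shift:
  fixes g :: "real \<Rightarrow> ennreal"
  assumes "g \<in> borel_measurable borel"
  shows "(\<integral>\<^sup>+u\<in>{a..b}. g (s + u) \<partial>lborel) = (\<integral>\<^sup>+u\<in>{s + a..s + b}. g u \<partial>lborel)"
proof -
  have "(\<integral>\<^sup>+u. g u * indicator {s + a..s + b} u \<partial>lborel) = ennreal \<bar>1\<bar> * (\<integral>\<^sup>+u. g (s + 1 * u) * indicator {s + a..s + b} (s + 1 * u) \<partial>lborel)"
    using assms by (intro nn_integral_real_affine) auto
  also have "\<dots> = (\<integral>\<^sup>+u. g (s + u) * indicator {a..b} u \<partial>lborel)"
    by simp (intro nn_integral_cong, auto simp: indicator_def)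
  finally show ?thesis by simp
qed

lemma set_integral_Icc_shift:
  fixes g :: "real \<Rightarrow> real"
  shows "(LINT u:{a..b}|lborel. g (s + u)) = (LINT u:{s + a..s + b}|lborel. g u)"
proof -
  have "(LINT u:{s + a..s + b}|lborel. g u) = \<bar>1\<bar> *\<^sub>R (\<integral>u. indicator {s + a..s + b} (s + 1 * u) *\<^sub>R g (s + 1 * u) \<partial>lborel)"
    unfolding set_lebesgue_integral_def by (rule lborel_integral_real_affine) simp
  also have "\<dots> = (LINT u:{a..b}|lborel. g (s + u))"
    unfolding set_lebesgue_integral_def
    by simp (intro Bochner_Integration.integral_cong, auto simp: indicator_def)
  finally show ?thesis by simp
qed

section \<open>Occupation measures and additive functionals\<close>

context markov_family
begin

definition cesaro :: "real \<Rightarrow> 'a \<Rightarrow> 'a measure" where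
  "cesaro \<tau> x = uniform_measure lborel {0..\<tau>} \<bind> (\<lambda>s. tk (max 0 s) x)"

lemma tk_time_kernel [measurable]: "(\<lambda>s. tk (max 0 s) x) \<in> borel \<rightarrow>\<^sub>M subprob_algebra borel"
proof -
  have "(\<lambda>s. (s, x)) \<in> borel \<rightarrow>\<^sub>M borel \<Otimes>\<^sub>M borel" by measurable
  from measurable_compose[OF this tk_joint_kernel] show ?thesis by simp
qed

lemma tk_time_kernel': "(\<lambda>s. tk (max 0 s) x) \<in> uniform_measure lborel A \<rightarrow>\<^sub>M subprob_algebra borel"
  using tk_time_kernel by (simp cong: measurable_cong_sets)

lemma sets_cesaro [simp, measurable_cong]: "sets (cesaro \<tau> x) = sets borel"
  unfolding cesaro_def by (subst sets_bind[where N=borel]) auto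

lemma space_cesaro [simp]: "space (cesaro \<tau> x) = UNIV"
  using sets_eq_imp_space_eq[OF sets_cesaro] by simp

lemma nn_integral_cesaro:
  assumes "0 < \<tau>" "g \<in> borel_measurable borel"
  shows "(\<integral>\<^sup>+y. g y \<partial>cesaro \<tau> x) = (\<integral>\<^sup>+s\<in>{0..\<tau>}. (\<integral>\<^sup>+y. g y \<partial>tk s x) \<partial>lborel) / ennreal \<tau>"
proof -
  have m: "(\<lambda>s. \<integral>\<^sup>+y. g y \<partial>tk (max 0 s) x) \<in> borel_measurable borel"
    by (rule measurable_compose[OF tk_time_kernel nn_integral_measurable_subprob_algebra[OF assms(2)]])
  have "(\<integral>\<^sup>+y. g y \<partial>cesaro \<tau> x) = (\<integral>\<^sup>+s. (\<integral>\<^sup>+y. g y \<partial>tk (max 0 s) x) \<partial>uniform_measure lborel {0..\<tau>})"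
    unfolding cesaro_def by (rule nn_integral_bind[OF assms(2) tk_time_kernel'])
  also have "\<dots> = (\<integral>\<^sup>+s\<in>{0..\<tau>}. (\<integral>\<^sup>+y. g y \<partial>tk (max 0 s) x) \<partial>lborel) / emeasure lborel {0..\<tau>}"
    using m by (intro nn_integral_uniform_measure) auto
  also have "(\<integral>\<^sup>+s\<in>{0..\<tau>}. (\<integral>\<^sup>+y. g y \<partial>tk (max 0 s) x) \<partial>lborel) = (\<integral>\<^sup>+s\<in>{0..\<tau>}. (\<integral>\<^sup>+y. g y \<partial>tk s x) \<partial>lborel)"
    by (intro nn_integral_cong) (auto simp: indicator_def max_def)
  finally show ?thesis using assms(1) by simp
qed

lemma prob_uniform: "0 < (\<tau>::real) \<Longrightarrow> prob_space (uniform_measure lborel {0..\<tau>})"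
  by (intro prob_space_uniform_measure) auto

lemma prob_space_cesaro: assumes "0 < \<tau>" shows "prob_space (cesaro \<tau> x)"
proof -
  interpret prob_space "uniform_measure lborel {0..\<tau>}" by (rule prob_uniform[OF assms])
  show ?thesis unfolding cesaro_def
    by (rule prob_space_bind[OF _ tk_time_kernel']) (auto intro!: AE_I2 prob_space_tk)
qed

lemma markov_path_real:
  fixes G :: "(real \<Rightarrow> 'a) \<Rightarrow> real"
  assumes s: "0 \<le> s" and G: "G \<in> borel_measurable paths" and K: "\<And>p. \<bar>G p\<bar> \<le> K"
  shows "(\<integral>\<omega>. G (shift_path s \<omega>) \<partial>P x) = (\<integral>y. (\<integral>\<omega>. G (shift_path 0 \<omega>) \<partial>P y) \<partial>tk s x)"
proof -
  have ne: "space (tk s x) \<noteq> {}" by simp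
  have KP: "P \<in> tk s x \<rightarrow>\<^sub>M subprob_algebra \<Omega>" by (simp add: P_subprob)
  have sb: "sets (tk s x \<bind> P) = sets \<Omega>" using ne KP by (subst sets_bind[where N=\<Omega>]) auto
  have p0: "shift_path 0 \<in> (tk s x \<bind> P) \<rightarrow>\<^sub>M paths"
    using shift_path_measurable[of 0] by (simp add: measurable_cong_sets[OF sb refl])
  have ps: "shift_path s \<in> P x \<rightarrow>\<^sub>M paths" using s by simp
  have Gm: "(\<lambda>\<omega>. G (shift_path 0 \<omega>)) \<in> borel_measurable \<Omega>"
    by (rule measurable_compose[OF _ G]) simp
  have "(\<integral>\<omega>. G (shift_path s \<omega>) \<partial>P x) = (\<integral>p. G p \<partial>distr (P x) paths (shift_path s))"
    using G by (subst integral_distr[OF ps]) auto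
  also have "\<dots> = (\<integral>\<omega>. G (shift_path 0 \<omega>) \<partial>(tk s x \<bind> P))"
    unfolding shift_path_law[OF s] using G by (subst integral_distr[OF p0]) auto
  also have "\<dots> = (\<integral>y. (\<integral>\<omega>. G (shift_path 0 \<omega>) \<partial>P y) \<partial>tk s x)"
    using prob_space.finite_measure[OF prob_space_tk[OF s, of x]]
    by (intro integral_bind_bounded[OF KP _ ne Gm K])
  finally show ?thesis .
qed

text \<open>
  The additive functional as a function on path space, so that the Markov property applies to it.
\<close>

definition path_integral :: "('a \<Rightarrow> real) \<Rightarrow> real \<Rightarrow> (real \<Rightarrow> 'a) \<Rightarrow> real" where
  "path_integral f T p = (LINT u:{0..T}|lborel. f (path_at p u))"

definition path_variation :: "('a \<Rightarrow> real) \<Rightarrow> real \<Rightarrow> real \<Rightarrow> (real \<Rightarrow> 'a) \<Rightarrow> ennreal" where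
  "path_variation f a b p = (\<integral>\<^sup>+u\<in>{a..b}. ennreal \<bar>f (path_at p u)\<bar> \<partial>lborel)"

definition abs_integral :: "('a \<Rightarrow> real) \<Rightarrow> real \<Rightarrow> real \<Rightarrow> 'w \<Rightarrow> ennreal" where
  "abs_integral f a b \<omega> = (\<integral>\<^sup>+u\<in>{a..b}. ennreal \<bar>f (X u \<omega>)\<bar> \<partial>lborel)"

lemma path_integral_measurable [measurable]:
  assumes [measurable]: "f \<in> borel_measurable borel"
  shows "path_integral f T \<in> borel_measurable paths"
proof -
  have [measurable]: "(\<lambda>q. f (path_at (fst q) (snd q))) \<in> borel_measurable (paths \<Otimes>\<^sub>M lborel)"
    using measurable_compose[OF path_at_measurable assms] by (simp cong: measurable_cong_sets)
  show ?thesis unfolding path_integral_def[abs_def] set_lebesgue_integral_def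
    by (rule lborel.borel_measurable_lebesgue_integral) (simp add: case_prod_beta')
qed

lemma path_variation_measurable [measurable]:
  assumes [measurable]: "f \<in> borel_measurable borel"
  shows "path_variation f a b \<in> borel_measurable paths"
proof -
  have [measurable]: "(\<lambda>q. f (path_at (fst q) (snd q))) \<in> borel_measurable (paths \<Otimes>\<^sub>M lborel)"
    using measurable_compose[OF path_at_measurable assms] by (simp cong: measurable_cong_sets)
  show ?thesis unfolding path_variation_def[abs_def]
    by (rule lborel.borel_measurable_nn_integral) (simp add: case_prod_beta')
qed

lemma X_path_measurable:
  assumes "\<omega> \<in> space \<Omega>" shows "(\<lambda>u. X (max 0 u) \<omega>) \<in> borel_measurable borel"
proof -
  have "(\<lambda>u. (\<omega>, u)) \<in> borel \<rightarrow>\<^sub>M \<Omega> \<Otimes>\<^sub>M borel" using assms by measurable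
  from measurable_compose[OF this X_joint_measurable] show ?thesis by simp
qed

lemma path_integral_shift:
  assumes "0 \<le> s" "\<omega> \<in> space \<Omega>"
  shows "path_integral f T (shift_path s \<omega>) = (LINT u:{s..s + T}|lborel. f (X u \<omega>))"
proof -
  have "path_integral f T (shift_path s \<omega>) = (LINT u:{0..T}|lborel. f (X (s + u) \<omega>))"
    unfolding path_integral_def using assms
    by (intro set_lebesgue_integral_cong) (auto simp: path_at_shift_path max_def)
  also have "\<dots> = (LINT u:{s..s + T}|lborel. f (X u \<omega>))" using set_integral_Icc_shift[of 0 T "\<lambda>u. f (X u \<omega>)" s] by simp
  finally show ?thesis .
qed

lemma path_variation_shift:
  assumes "0 \<le> s" "0 \<le> a" "\<omega> \<in> space \<Omega>" and f: "f \<in> borel_measurable borel"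
  shows "path_variation f a b (shift_path s \<omega>) = abs_integral f (s + a) (s + b) \<omega>"
proof -
  have m: "(\<lambda>u. ennreal \<bar>f (X (max 0 u) \<omega>)\<bar>) \<in> borel_measurable borel"
    using measurable_compose[OF X_path_measurable[OF assms(3)] f] by simp
  have "path_variation f a b (shift_path s \<omega>) = (\<integral>\<^sup>+u\<in>{a..b}. ennreal \<bar>f (X (max 0 (s + u)) \<omega>)\<bar> \<partial>lborel)"
    unfolding path_variation_def using assms
    by (intro nn_integral_cong) (auto simp: path_at_shift_path max_def indicator_def)
  also have "\<dots> = (\<integral>\<^sup>+u\<in>{s + a..s + b}. ennreal \<bar>f (X (max 0 u) \<omega>)\<bar> \<partial>lborel)"
    by (rule nn_integral_Icc_shift[OF m])
  also have "\<dots> = abs_integral f (s + a) (s + b) \<omega>"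
    unfolding abs_integral_def using assms by (intro nn_integral_cong) (auto simp: max_def indicator_def)
  finally show ?thesis .
qed

lemma abs_integral_mono: "a' \<le> a \<Longrightarrow> b \<le> b' \<Longrightarrow> abs_integral f a b \<omega> \<le> abs_integral f a' b' \<omega>"
  unfolding abs_integral_def by (intro nn_integral_mono) (auto simp: indicator_def)

lemma abs_integral_measurable [measurable]:
  assumes f: "f \<in> borel_measurable borel" and a: "0 \<le> a"
  shows "abs_integral f a b \<in> borel_measurable \<Omega>"
proof -
  have "(\<lambda>\<omega>. path_variation f a b (shift_path 0 \<omega>)) \<in> borel_measurable \<Omega>"
    by (rule measurable_compose[OF _ path_variation_measurable[OF f]]) simp
  then show ?thesis by (rule measurable_cong[THEN iffD1, rotated]) (simp add: path_variation_shift a f)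
qed

text \<open>
  Off this event the additive functional may take the default value \<open>0\<close> of a divergent
  integral, and its increments are no longer integrals of \<open>f\<close> along the path. Integer
  horizons keep the event a countable intersection.
\<close>

definition locally_integrable_from :: "('a \<Rightarrow> real) \<Rightarrow> 'a \<Rightarrow> bool" where
  "locally_integrable_from f x \<longleftrightarrow> (AE \<omega> in P x. \<forall>n::nat. abs_integral f 0 (real n) \<omega> < \<infinity>)"

lemma set_integrable_path:
  assumes f: "f \<in> borel_measurable borel" and \<omega>: "\<omega> \<in> space \<Omega>"
    and fin: "\<forall>n::nat. abs_integral f 0 (real n) \<omega> < \<infinity>"
  shows "set_integrable lborel {0..T} (\<lambda>u. f (X u \<omega>))"
proof -
  have "(\<lambda>u. indicator {0..T} u *\<^sub>R f (X (max 0 u) \<omega>)) \<in> borel_measurable lborel"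
    using measurable_compose[OF X_path_measurable[OF \<omega>] f] by simp
  then have m: "(\<lambda>u. indicator {0..T} u *\<^sub>R f (X u \<omega>)) \<in> borel_measurable lborel"
    by (rule measurable_cong[THEN iffD1, rotated]) (auto simp: indicator_def max_def)
  obtain n :: nat where n: "T \<le> real n" using real_arch_simple by blast
  have "(\<integral>\<^sup>+u. ennreal (norm (indicator {0..T} u *\<^sub>R f (X u \<omega>))) \<partial>lborel) = abs_integral f 0 T \<omega>"
    unfolding abs_integral_def by (intro nn_integral_cong) (auto simp: indicator_def)
  also have "\<dots> \<le> abs_integral f 0 (real n) \<omega>" using n by (intro abs_integral_mono) auto
  also have "\<dots> < \<infinity>" using fin by blast
  finally show ?thesis unfolding set_integrable_def using m by (intro integrableI_bounded) auto
qed

lemma integral_cesaro: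
  assumes "0 < \<tau>" and g: "g \<in> borel_measurable borel" "\<And>x. \<bar>g x\<bar> \<le> (K::real)"
  shows "(\<integral>y. g y \<partial>cesaro \<tau> x) = (\<integral>s. (\<integral>y. g y \<partial>tk (max 0 s) x) \<partial>uniform_measure lborel {0..\<tau>})"
proof -
  interpret prob_space "uniform_measure lborel {0..\<tau>}" by (rule prob_uniform[OF assms(1)])
  show ?thesis unfolding cesaro_def
    by (rule integral_bind_bounded[OF tk_time_kernel' finite_measure_axioms _ g]) simp
qed

lemma nn_expectation_measurable:
  assumes "G \<in> borel_measurable \<Omega>"
  shows "(\<lambda>y. \<integral>\<^sup>+\<omega>. G \<omega> \<partial>P y) \<in> borel_measurable borel"
  by (rule measurable_compose[OF P_subprob nn_integral_measurable_subprob_algebra[OF assms]])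

lemma expectation_measurable:
  fixes G :: "'w \<Rightarrow> real"
  assumes "G \<in> borel_measurable \<Omega>"
  shows "(\<lambda>y. \<integral>\<omega>. G \<omega> \<partial>P y) \<in> borel_measurable borel"
  by (rule measurable_compose[OF P_subprob integral_measurable_subprob_algebra[OF assms]])

lemma expectation_bounded:
  fixes G :: "'w \<Rightarrow> real"
  assumes "G \<in> borel_measurable \<Omega>" "\<And>\<omega>. \<bar>G \<omega>\<bar> \<le> K"
  shows "integrable (P y) G" "\<bar>\<integral>\<omega>. G \<omega> \<partial>P y\<bar> \<le> K"
proof -
  interpret prob_space "P y" by (rule prob_space_P)
  show i: "integrable (P y) G"
    using assms by (intro integrable_const_bound[where B=K]) auto
  have "\<bar>\<integral>\<omega>. G \<omega> \<partial>P y\<bar> \<le> (\<integral>\<omega>. \<bar>G \<omega>\<bar> \<partial>P y)" using integral_norm_bound[of "P y" G] by simp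
  also have "\<dots> \<le> (\<integral>\<omega>. K \<partial>P y)" using i assms(2) by (intro integral_mono) auto
  also have "\<dots> = K" using prob_space by simp
  finally show "\<bar>\<integral>\<omega>. G \<omega> \<partial>P y\<bar> \<le> K" .
qed

end

lemma ennreal_abs_integral_diff_le:
  fixes a b :: "'b \<Rightarrow> real"
  assumes "integrable M a" "integrable M b" "AE x in M. ennreal \<bar>a x - b x\<bar> \<le> e x"
  shows "ennreal \<bar>(\<integral>x. a x \<partial>M) - (\<integral>x. b x \<partial>M)\<bar> \<le> (\<integral>\<^sup>+x. e x \<partial>M)"
proof -
  have "(\<integral>x. a x \<partial>M) - (\<integral>x. b x \<partial>M) = (\<integral>x. a x - b x \<partial>M)" using assms by simp
  then have "ennreal \<bar>(\<integral>x. a x \<partial>M) - (\<integral>x. b x \<partial>M)\<bar> \<le> (\<integral>\<^sup>+x. ennreal (norm (a x - b x)) \<partial>M)"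
    using integral_norm_bound_ennreal[of M "\<lambda>x. a x - b x"] assms by simp
  also have "\<dots> \<le> (\<integral>\<^sup>+x. e x \<partial>M)" using assms(3) by (intro nn_integral_mono_AE) auto
  finally show ?thesis .
qed

lemma LIMSEQ_null_comparison:
  fixes a b :: "nat \<Rightarrow> real"
  assumes "\<And>k. \<bar>a k\<bar> \<le> b k" "b \<longlonglongrightarrow> 0"
  shows "a \<longlonglongrightarrow> 0"
  by (rule Lim_null_comparison[OF always_eventually assms(2)]) (use assms(1) in auto)

lemma sum_const_ennreal: "0 \<le> b \<Longrightarrow> (\<Sum>i<n. ennreal b) = ennreal (real n * b)"
  by (subst sum_ennreal) auto

lemma ennreal_twice_mult:
  assumes "0 \<le> a" "0 \<le> s" "0 \<le> (I::real)"
  shows "ennreal a * (ennreal s * ennreal I + ennreal s * ennreal I) = ennreal (a * (2 * s * I))"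
proof -
  have "ennreal s * ennreal I + ennreal s * ennreal I = ennreal (s * I + s * I)"
    using assms by (simp only: ennreal_mult ennreal_plus mult_nonneg_nonneg)
  also have "s * I + s * I = 2 * s * I" by simp
  finally show ?thesis using assms by (simp only: ennreal_mult mult_nonneg_nonneg zero_le_numeral)
qed

context markov_family
begin

lemma dynkin_process_0: "dynkin_process X g q 0 \<omega> = 0"
proof -
  have "(LINT s:{0..0}|lborel. q (X s \<omega>)) = 0"
    unfolding set_lebesgue_integral_def
  proof (rule integral_eq_zero_AE)
    show "AE s in lborel. indicator {0..0} s *\<^sub>R q (X s \<omega>) = 0"
      using AE_lborel_singleton[of "0::real"] by eventually_elim (auto simp: indicator_def)
  qed
  then show ?thesis by (simp add: dynkin_process_def)
qed

lemma martingale_expectation: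
  assumes mart: "is_martingale (P x) (natural_filtration \<Omega> X) M" and t: "0 \<le> t"
  shows "(\<integral>\<omega>. M t \<omega> \<partial>P x) = (\<integral>\<omega>. M 0 \<omega> \<partial>P x)"
proof -
  interpret prob_space "P x" by (rule prob_space_P)
  interpret finite_measure_subalgebra "P x" "natural_filtration \<Omega> X 0"
    by unfold_locales (use natural_filtration_subset in \<open>auto simp: subalgebra_def\<close>)
  have i: "integrable (P x) (M t)" "integrable (P x) (M 0)" using mart t by (auto simp: is_martingale_def)
  have "(\<integral>\<omega>. M t \<omega> \<partial>P x) = (\<integral>\<omega>. real_cond_exp (P x) (natural_filtration \<Omega> X 0) (M t) \<omega> \<partial>P x)"
    using real_cond_exp_int(2)[OF i(1)] by simp
  also have "\<dots> = (\<integral>\<omega>. M 0 \<omega> \<partial>P x)"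
  proof (rule integral_cong_AE)
    show "AE \<omega> in P x. real_cond_exp (P x) (natural_filtration \<Omega> X 0) (M t) \<omega> = M 0 \<omega>"
      using mart t by (simp add: is_martingale_def)
  qed (use real_cond_exp_int(1)[OF i(1)] i in auto)
  finally show ?thesis .
qed

end

lemma (in markov_family) expected_abs_integral_from:
  assumes f: "f \<in> borel_measurable borel" and ab: "0 \<le> a"
  shows "(\<integral>\<^sup>+\<omega>. abs_integral f a b \<omega> \<partial>P y) = (\<integral>\<^sup>+u\<in>{a..b}. (\<integral>\<^sup>+z. ennreal \<bar>f z\<bar> \<partial>tk (max 0 u) y) \<partial>lborel)"
proof -
  have f'[measurable]: "(\<lambda>y. ennreal \<bar>f y\<bar>) \<in> borel_measurable borel" using f by simp
  interpret prob_space "P y" by (rule prob_space_P)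
  interpret pair_sigma_finite "P y" lborel ..
  have m: "(\<lambda>(\<omega>, u). ennreal \<bar>f (X (max 0 u) \<omega>)\<bar> * indicator {a..b} u) \<in> borel_measurable (P y \<Otimes>\<^sub>M lborel)"
  proof -
    have "(\<lambda>q. ennreal \<bar>f (X (max 0 (snd q)) (fst q))\<bar>) \<in> borel_measurable (\<Omega> \<Otimes>\<^sub>M borel)"
      using measurable_compose[OF X_joint_measurable f'] by simp
    then have [measurable]: "(\<lambda>q. ennreal \<bar>f (X (max 0 (snd q)) (fst q))\<bar>) \<in> borel_measurable (P y \<Otimes>\<^sub>M lborel)"
      by (simp cong: measurable_cong_sets)
    show ?thesis by (simp add: case_prod_beta')
  qed
  have "(\<integral>\<^sup>+\<omega>. abs_integral f a b \<omega> \<partial>P y) = (\<integral>\<^sup>+\<omega>. (\<integral>\<^sup>+u. ennreal \<bar>f (X (max 0 u) \<omega>)\<bar> * indicator {a..b} u \<partial>lborel) \<partial>P y)"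
    unfolding abs_integral_def using ab by (intro nn_integral_cong) (auto simp: indicator_def max_def)
  also have "\<dots> = (\<integral>\<^sup>+u. (\<integral>\<^sup>+\<omega>. ennreal \<bar>f (X (max 0 u) \<omega>)\<bar> * indicator {a..b} u \<partial>P y) \<partial>lborel)"
    using Fubini'[OF m] by simp
  also have "\<dots> = (\<integral>\<^sup>+u\<in>{a..b}. (\<integral>\<^sup>+z. ennreal \<bar>f z\<bar> \<partial>tk (max 0 u) y) \<partial>lborel)"
    unfolding trans_kernel_def using f X_meas_P
    by (intro nn_integral_cong) (auto simp: nn_integral_distr indicator_def)
  finally show ?thesis .
qed

context ergodic_markov
begin

lemma expected_abs_integral:
  assumes f: "f \<in> borel_measurable borel" and ab: "0 \<le> a" "a \<le> b"
  shows "(\<integral>\<^sup>+y. (\<integral>\<^sup>+\<omega>. abs_integral f a b \<omega> \<partial>P y) \<partial>\<mu>) = ennreal (b - a) * (\<integral>\<^sup>+y. ennreal \<bar>f y\<bar> \<partial>\<mu>)"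
proof -
  have f'[measurable]: "(\<lambda>y. ennreal \<bar>f y\<bar>) \<in> borel_measurable borel" using f by simp
  note 1 = expected_abs_integral_from[OF f ab(1)]
  interpret pair_sigma_finite \<mu> lborel ..
  have m: "(\<lambda>(y, u). (\<integral>\<^sup>+z. ennreal \<bar>f z\<bar> \<partial>tk (max 0 u) y) * indicator {a..b} u) \<in> borel_measurable (\<mu> \<Otimes>\<^sub>M lborel)"
  proof -
    have "(\<lambda>q. (snd q, fst q)) \<in> borel \<Otimes>\<^sub>M borel \<rightarrow>\<^sub>M (borel :: real measure) \<Otimes>\<^sub>M (borel :: 'a measure)" by measurable
    from measurable_compose[OF this measurable_compose[OF tk_joint_kernel nn_integral_measurable_subprob_algebra[OF f']]]
    have [measurable]: "(\<lambda>q. (\<integral>\<^sup>+z. ennreal \<bar>f z\<bar> \<partial>tk (max 0 (snd q)) (fst q))) \<in> borel_measurable (\<mu> \<Otimes>\<^sub>M lborel)"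
      by (simp cong: measurable_cong_sets)
    show ?thesis by (simp add: case_prod_beta')
  qed
  have "(\<integral>\<^sup>+y. (\<integral>\<^sup>+\<omega>. abs_integral f a b \<omega> \<partial>P y) \<partial>\<mu>) =
      (\<integral>\<^sup>+u. (\<integral>\<^sup>+y. (\<integral>\<^sup>+z. ennreal \<bar>f z\<bar> \<partial>tk (max 0 u) y) * indicator {a..b} u \<partial>\<mu>) \<partial>lborel)"
    unfolding 1 using Fubini'[OF m] by simp
  also have "\<dots> = (\<integral>\<^sup>+u. (\<integral>\<^sup>+y. ennreal \<bar>f y\<bar> \<partial>\<mu>) * indicator {a..b} u \<partial>lborel)"
  proof (intro nn_integral_cong)
    fix u :: real
    show "(\<integral>\<^sup>+y. (\<integral>\<^sup>+z. ennreal \<bar>f z\<bar> \<partial>tk (max 0 u) y) * indicator {a..b} u \<partial>\<mu>) = (\<integral>\<^sup>+y. ennreal \<bar>f y\<bar> \<partial>\<mu>) * indicator {a..b} u"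
      using invariant_nn[OF _ f', of "max 0 u"] by (simp add: indicator_def)
  qed
  also have "\<dots> = ennreal (b - a) * (\<integral>\<^sup>+y. ennreal \<bar>f y\<bar> \<partial>\<mu>)"
    using ab by (subst nn_integral_cmult_indicator) (auto simp: mult.commute)
  finally show ?thesis .
qed

text \<open>
  By stationarity the expected integral of \<open>\<bar>f\<bar>\<close> over \<open>{0..n}\<close>
  is \<open>n\<close> times its integral with respect to \<open>\<mu>\<close>.
\<close>

lemma AE_locally_integrable_from:
  assumes f: "f \<in> borel_measurable borel" and i: "integrable \<mu> f"
  shows "AE y in \<mu>. locally_integrable_from f y"
proof -
  have fin: "(\<integral>\<^sup>+y. ennreal \<bar>f y\<bar> \<partial>\<mu>) < \<infinity>" using i by (simp add: integrable_iff_bounded)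
  have "AE y in \<mu>. AE \<omega> in P y. abs_integral f 0 (real n) \<omega> < \<infinity>" for n :: nat
  proof -
    have m: "(\<lambda>y. \<integral>\<^sup>+\<omega>. abs_integral f 0 (real n) \<omega> \<partial>P y) \<in> borel_measurable borel"
      using f by (intro nn_expectation_measurable abs_integral_measurable) auto
    have "(\<integral>\<^sup>+y. (\<integral>\<^sup>+\<omega>. abs_integral f 0 (real n) \<omega> \<partial>P y) \<partial>\<mu>) \<noteq> \<infinity>"
      using fin expected_abs_integral[OF f, of 0 "real n"] by (auto simp: ennreal_mult_eq_top_iff)
    then have "AE y in \<mu>. (\<integral>\<^sup>+\<omega>. abs_integral f 0 (real n) \<omega> \<partial>P y) \<noteq> \<infinity>"
      using m by (intro nn_integral_noteq_infinite) auto
    then show ?thesis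
    proof eventually_elim
      case (elim y)
      then have "AE \<omega> in P y. abs_integral f 0 (real n) \<omega> \<noteq> \<infinity>"
        using f by (intro nn_integral_noteq_infinite) auto
      then show ?case by eventually_elim (auto simp: top.not_eq_extremum)
    qed
  qed
  then show ?thesis unfolding locally_integrable_from_def AE_all_countable by simp
qed

lemma locally_integrable_from_bounded:
  assumes "f \<in> borel_measurable borel" "bounded (range f)"
  shows "locally_integrable_from f x"
proof -
  obtain B where B: "\<And>y. \<bar>f y\<bar> \<le> B" using assms(2) by (auto simp: bounded_iff)
  have "abs_integral f 0 (real n) \<omega> < \<infinity>" for n \<omega>
  proof -
    have "abs_integral f 0 (real n) \<omega> \<le> (\<integral>\<^sup>+u. ennreal B * indicator {0..real n} u \<partial>lborel)"
      unfolding abs_integral_def using B by (intro nn_integral_mono) (auto simp: indicator_def intro!: ennreal_leI)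
    also have "\<dots> = ennreal B * ennreal (real n)" by (subst nn_integral_cmult_indicator) auto
    also have "\<dots> < \<infinity>" by (simp add: ennreal_mult_less_top)
    finally show ?thesis .
  qed
  then show ?thesis unfolding locally_integrable_from_def by auto
qed

end

section \<open>Forgetting the starting point\<close>

text \<open>
  A sequence of scales: \<open>v k\<close> is the normalisation and \<open>T k i\<close> are the
  times at which the additive functional is observed; the test function \<open>h\<close> sees the
  first \<open>n\<close> coordinates only.
\<close>

locale lipschitz_test = ergodic_markov \<Omega> P X \<mu>
  for \<Omega> :: "'w measure" and P :: "'a::euclidean_space \<Rightarrow> 'w measure" and X \<mu> +
  fixes f :: "'a \<Rightarrow> real" and n :: nat and h :: "(nat \<Rightarrow> real) \<Rightarrow> real" and K L :: real
    and v :: "nat \<Rightarrow> real" and T :: "nat \<Rightarrow> nat \<Rightarrow> real"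
  assumes f: "f \<in> borel_measurable borel" and f_int: "integrable \<mu> f"
    and h: "h \<in> borel_measurable borel" and hK: "\<And>y. \<bar>h y\<bar> \<le> K"
    and hL: "\<And>y z. \<bar>h y - h z\<bar> \<le> L * (\<Sum>i<n. \<bar>y i - z i\<bar>)" and L: "0 \<le> L"
    and v: "\<And>k. 0 \<le> v k" "v \<longlonglongrightarrow> 0"
    and T: "\<And>k i. i < n \<Longrightarrow> 0 \<le> T k i" "\<And>i. i < n \<Longrightarrow> filterlim (\<lambda>k. T k i) at_top sequentially"
begin

definition functional :: "nat \<Rightarrow> (real \<Rightarrow> 'a) \<Rightarrow> real" where
  "functional k p = h (\<lambda>i. if i < n then v k * path_integral f (T k i) p else 0)"

definition expected_functional :: "nat \<Rightarrow> 'a \<Rightarrow> real" where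
  "expected_functional k y = (\<integral>\<omega>. functional k (shift_path 0 \<omega>) \<partial>P y)"

text \<open>
  A bound for the contribution of the last \<open>\<tau>\<close> time units before
  \<open>T k i\<close> to the functional, truncated at \<open>2 * K\<close>, the largest possible
  change, so that it is integrable from every starting point and \<open>weak_limit\<close> applies
  to its expectation.
\<close>

definition end_error :: "real \<Rightarrow> nat \<Rightarrow> (real \<Rightarrow> 'a) \<Rightarrow> real" where
  "end_error \<tau> k p = enn2real (min (ennreal (2 * K)) (\<Sum>i<n. ennreal (L * v k) * path_variation f (max 0 (T k i - \<tau>)) (T k i) p))"

definition expected_end_error :: "real \<Rightarrow> nat \<Rightarrow> 'a \<Rightarrow> real" where
  "expected_end_error \<tau> k y = (\<integral>\<omega>. end_error \<tau> k (shift_path 0 \<omega>) \<partial>P y)"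

lemma K_nonneg: "0 \<le> K" using hK[of undefined] by linarith

lemma functional_measurable [measurable]: "functional k \<in> borel_measurable paths"
proof -
  note f[measurable]
  have "(\<lambda>p i. if i < n then v k * path_integral f (T k i) p else 0) \<in> borel_measurable paths"
    by (rule measurable_coordinatewise_then_product) (use path_integral_measurable[OF f] in auto)
  from measurable_compose[OF this h] show ?thesis by (simp add: functional_def[abs_def])
qed

lemma functional_bounded: "\<bar>functional k p\<bar> \<le> K" unfolding functional_def by (rule hK)

lemma end_error_measurable [measurable]: "end_error \<tau> k \<in> borel_measurable paths"
  unfolding end_error_def[abs_def] using path_variation_measurable[OF f] by measurable

lemma end_error_ennreal: "ennreal (end_error \<tau> k p) = min (ennreal (2 * K)) (\<Sum>i<n. ennreal (L * v k) * path_variation f (max 0 (T k i - \<tau>)) (T k i) p)"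
  unfolding end_error_def by (rule ennreal_enn2real) (simp add: min_less_iff_disj)

lemma end_error_bounded: "\<bar>end_error \<tau> k p\<bar> \<le> 2 * K" and end_error_nonneg: "0 \<le> end_error \<tau> k p"
proof -
  show 0: "0 \<le> end_error \<tau> k p" unfolding end_error_def by simp
  have "ennreal (end_error \<tau> k p) \<le> ennreal (2 * K)" unfolding end_error_ennreal by simp
  then show "\<bar>end_error \<tau> k p\<bar> \<le> 2 * K" using 0 K_nonneg by (simp add: ennreal_le_iff)
qed

lemma shift_path_functional_measurable:
  assumes "G \<in> borel_measurable paths" "0 \<le> s" shows "(\<lambda>\<omega>. G (shift_path s \<omega>)) \<in> borel_measurable \<Omega>"
  by (rule measurable_compose[OF shift_path_measurable[OF assms(2)] assms(1)])

lemma expected_functional_measurable: "expected_functional k \<in> borel_measurable borel"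
  unfolding expected_functional_def[abs_def] by (intro expectation_measurable shift_path_functional_measurable functional_measurable order_refl)

lemma expected_functional_bounded: "\<bar>expected_functional k y\<bar> \<le> K"
  unfolding expected_functional_def by (intro expectation_bounded(2) shift_path_functional_measurable functional_measurable functional_bounded order_refl)

lemma expected_end_error_measurable: "expected_end_error \<tau> k \<in> borel_measurable borel"
  unfolding expected_end_error_def[abs_def] by (intro expectation_measurable shift_path_functional_measurable end_error_measurable order_refl)

lemma expected_end_error_bounded: "\<bar>expected_end_error \<tau> k y\<bar> \<le> 2 * K"
  unfolding expected_end_error_def by (intro expectation_bounded(2) shift_path_functional_measurable end_error_measurable end_error_bounded order_refl)

lemma expected_end_error_nonneg: "0 \<le> expected_end_error \<tau> k y"
  unfolding expected_end_error_def by (simp add: end_error_nonneg)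

lemma Pt_expected_functional: "0 \<le> s \<Longrightarrow> Pt s (expected_functional k) y = (\<integral>\<omega>. functional k (shift_path s \<omega>) \<partial>P y)"
  unfolding semigroup_op_def expected_functional_def by (rule markov_path_real[OF _ functional_measurable functional_bounded, symmetric])

text \<open>
  The Lipschitz bound combined with the cancellation in \<open>shift_increment_bound\<close>.
\<close>

lemma functional_shift_diff:
  assumes \<omega>: "\<omega> \<in> space \<Omega>" and fin: "\<forall>m::nat. abs_integral f 0 (real m) \<omega> < \<infinity>" and s: "0 \<le> s"
  shows "ennreal \<bar>functional k (shift_path 0 \<omega>) - functional k (shift_path s \<omega>)\<bar> \<le>
     (\<Sum>i<n. ennreal (L * v k) * (abs_integral f 0 s \<omega> + abs_integral f (T k i) (T k i + s) \<omega>))"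
proof -
  let ?d = "\<lambda>i. \<bar>(LINT u:{0..T k i}|lborel. f (X u \<omega>)) - (LINT u:{s..s + T k i}|lborel. f (X u \<omega>))\<bar>"
  have "\<bar>functional k (shift_path 0 \<omega>) - functional k (shift_path s \<omega>)\<bar> \<le> L * (\<Sum>i<n. v k * ?d i)"
  proof -
    have "\<bar>functional k (shift_path 0 \<omega>) - functional k (shift_path s \<omega>)\<bar> \<le>
       L * (\<Sum>i<n. \<bar>v k * path_integral f (T k i) (shift_path 0 \<omega>) - v k * path_integral f (T k i) (shift_path s \<omega>)\<bar>)"
      unfolding functional_def by (rule order_trans[OF hL]) simp
    also have "\<dots> = L * (\<Sum>i<n. v k * ?d i)"
      using v(1)[of k] by (simp add: path_integral_shift \<omega> s right_diff_distrib[symmetric] abs_mult)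
    finally show ?thesis .
  qed
  then have "ennreal \<bar>functional k (shift_path 0 \<omega>) - functional k (shift_path s \<omega>)\<bar> \<le> ennreal (\<Sum>i<n. (L * v k) * ?d i)"
    by (intro ennreal_leI) (simp add: sum_distrib_left mult.assoc)
  also have "\<dots> = (\<Sum>i<n. ennreal ((L * v k) * ?d i))"
    using L v(1)[of k] by (intro sum_ennreal[symmetric]) auto
  also have "\<dots> \<le> (\<Sum>i<n. ennreal (L * v k) * (abs_integral f 0 s \<omega> + abs_integral f (T k i) (T k i + s) \<omega>))"
  proof (rule sum_mono)
    fix i assume i: "i \<in> {..<n}"
    have "ennreal (?d i) \<le> abs_integral f 0 s \<omega> + abs_integral f (T k i) (T k i + s) \<omega>"
      unfolding abs_integral_def using i T(1)[of i k]
      by (intro shift_increment_bound s set_integrable_path[OF f \<omega> fin]) auto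
    then show "ennreal ((L * v k) * ?d i) \<le> ennreal (L * v k) * (abs_integral f 0 s \<omega> + abs_integral f (T k i) (T k i + s) \<omega>)"
      using L v(1)[of k] by (subst ennreal_mult) (auto intro!: mult_left_mono)
  qed
  finally show ?thesis .
qed

text \<open>
  By stationarity both boundary terms of \<open>functional_shift_diff\<close> have expectation at
  most \<open>s\<close> times the integral of \<open>\<bar>f\<bar>\<close>, and \<open>v k\<close>
  tends to \<open>0\<close>.
\<close>

lemma expected_functional_asymptotically_invariant:
  assumes s: "0 \<le> s"
  shows "(\<lambda>k. \<integral>y. \<bar>expected_functional k y - Pt s (expected_functional k) y\<bar> \<partial>\<mu>) \<longlonglongrightarrow> 0"
proof -
  define I where "I = (\<integral>y. \<bar>f y\<bar> \<partial>\<mu>)"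
  have I: "(\<integral>\<^sup>+y. ennreal \<bar>f y\<bar> \<partial>\<mu>) = ennreal I" "0 \<le> I"
    unfolding I_def using f_int by (auto intro!: nn_integral_eq_integral)
  have am[measurable]: "abs_integral f a b \<in> borel_measurable \<Omega>" if "0 \<le> a" for a b
    using that f by (rule abs_integral_measurable[rotated])
  have bound: "(\<integral>y. \<bar>expected_functional k y - Pt s (expected_functional k) y\<bar> \<partial>\<mu>) \<le> real n * (L * v k * (2 * s * I))" for k
  proof -
    have "AE y in \<mu>. ennreal \<bar>expected_functional k y - Pt s (expected_functional k) y\<bar> \<le>
        (\<Sum>i<n. ennreal (L * v k) * ((\<integral>\<^sup>+\<omega>. abs_integral f 0 s \<omega> \<partial>P y) + (\<integral>\<^sup>+\<omega>. abs_integral f (T k i) (T k i + s) \<omega> \<partial>P y)))"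
      using AE_locally_integrable_from[OF f f_int]
    proof eventually_elim
      case (elim y)
      have "AE \<omega> in P y. ennreal \<bar>functional k (shift_path 0 \<omega>) - functional k (shift_path s \<omega>)\<bar> \<le>
         (\<Sum>i<n. ennreal (L * v k) * (abs_integral f 0 s \<omega> + abs_integral f (T k i) (T k i + s) \<omega>))"
        using elim[unfolded locally_integrable_from_def] AE_space
        by eventually_elim (intro functional_shift_diff[OF _ _ s], auto)
      then have "ennreal \<bar>expected_functional k y - Pt s (expected_functional k) y\<bar> \<le>
          (\<integral>\<^sup>+\<omega>. (\<Sum>i<n. ennreal (L * v k) * (abs_integral f 0 s \<omega> + abs_integral f (T k i) (T k i + s) \<omega>)) \<partial>P y)"
        unfolding Pt_expected_functional[OF s] expected_functional_def
        by (intro ennreal_abs_integral_diff_le expectation_bounded(1)[where K=K] shift_path_functional_measurable functional_measurable functional_bounded s order_refl)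
      also have "\<dots> = (\<Sum>i<n. ennreal (L * v k) * ((\<integral>\<^sup>+\<omega>. abs_integral f 0 s \<omega> \<partial>P y) + (\<integral>\<^sup>+\<omega>. abs_integral f (T k i) (T k i + s) \<omega> \<partial>P y)))"
      proof (subst nn_integral_sum)
        show "(\<Sum>i<n. \<integral>\<^sup>+\<omega>. ennreal (L * v k) * (abs_integral f 0 s \<omega> + abs_integral f (T k i) (T k i + s) \<omega>) \<partial>P y) =
          (\<Sum>i<n. ennreal (L * v k) * ((\<integral>\<^sup>+\<omega>. abs_integral f 0 s \<omega> \<partial>P y) + (\<integral>\<^sup>+\<omega>. abs_integral f (T k i) (T k i + s) \<omega> \<partial>P y)))"
        proof (rule sum.cong[OF refl])
          fix i assume "i \<in> {..<n}"
          then have [simp]: "0 \<le> T k i" using T(1) by auto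
          show "(\<integral>\<^sup>+\<omega>. ennreal (L * v k) * (abs_integral f 0 s \<omega> + abs_integral f (T k i) (T k i + s) \<omega>) \<partial>P y) =
            ennreal (L * v k) * ((\<integral>\<^sup>+\<omega>. abs_integral f 0 s \<omega> \<partial>P y) + (\<integral>\<^sup>+\<omega>. abs_integral f (T k i) (T k i + s) \<omega> \<partial>P y))"
            by (subst nn_integral_cmult; simp add: nn_integral_add)
        qed
      qed (use T(1) in auto)
      finally show ?case .
    qed
    then have "(\<integral>\<^sup>+y. ennreal \<bar>expected_functional k y - Pt s (expected_functional k) y\<bar> \<partial>\<mu>) \<le>
        (\<integral>\<^sup>+y. (\<Sum>i<n. ennreal (L * v k) * ((\<integral>\<^sup>+\<omega>. abs_integral f 0 s \<omega> \<partial>P y) + (\<integral>\<^sup>+\<omega>. abs_integral f (T k i) (T k i + s) \<omega> \<partial>P y))) \<partial>\<mu>)"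
      by (intro nn_integral_mono_AE)
    also have "\<dots> = (\<Sum>i<n. ennreal (L * v k) * (ennreal (s - 0) * ennreal I + ennreal (T k i + s - T k i) * ennreal I))"
    proof (subst nn_integral_sum)
      show "(\<Sum>i<n. \<integral>\<^sup>+y. ennreal (L * v k) * ((\<integral>\<^sup>+\<omega>. abs_integral f 0 s \<omega> \<partial>P y) + (\<integral>\<^sup>+\<omega>. abs_integral f (T k i) (T k i + s) \<omega> \<partial>P y)) \<partial>\<mu>) =
        (\<Sum>i<n. ennreal (L * v k) * (ennreal (s - 0) * ennreal I + ennreal (T k i + s - T k i) * ennreal I))"
      proof (rule sum.cong[OF refl])
        fix i assume "i \<in> {..<n}"
        then have [simp]: "0 \<le> T k i" using T(1) by auto
        show "(\<integral>\<^sup>+y. ennreal (L * v k) * ((\<integral>\<^sup>+\<omega>. abs_integral f 0 s \<omega> \<partial>P y) + (\<integral>\<^sup>+\<omega>. abs_integral f (T k i) (T k i + s) \<omega> \<partial>P y)) \<partial>\<mu>) =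
          ennreal (L * v k) * (ennreal (s - 0) * ennreal I + ennreal (T k i + s - T k i) * ennreal I)"
          using expected_abs_integral[OF f, of 0 s] expected_abs_integral[OF f, of "T k i" "T k i + s"] s
          by (subst nn_integral_cmult; simp add: nn_integral_add nn_expectation_measurable I)
      qed
    qed (use T(1) in \<open>auto intro!: nn_expectation_measurable\<close>)
    also have "\<dots> = ennreal (real n * (L * v k * (2 * s * I)))"
      using s L v(1)[of k] I(2) ennreal_twice_mult[of "L * v k" s I] sum_const_ennreal[of "L * v k * (2 * s * I)" n]
      by simp
    finally have "(\<integral>\<^sup>+y. ennreal \<bar>expected_functional k y - Pt s (expected_functional k) y\<bar> \<partial>\<mu>) \<le> ennreal (real n * (L * v k * (2 * s * I)))" .
    moreover have "integrable \<mu> (\<lambda>y. \<bar>expected_functional k y - Pt s (expected_functional k) y\<bar>)"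
      using integrable_\<mu>[OF expected_functional_measurable expected_functional_bounded] integrable_\<mu>[OF Pt_measurable[OF s expected_functional_measurable] Pt_bounded[OF s expected_functional_measurable expected_functional_bounded]]
      by auto
    ultimately have "ennreal (\<integral>y. \<bar>expected_functional k y - Pt s (expected_functional k) y\<bar> \<partial>\<mu>) \<le> ennreal (real n * (L * v k * (2 * s * I)))"
      by (subst nn_integral_eq_integral[symmetric]) auto
    then show ?thesis using s L v(1)[of k] I(2) by (subst (asm) ennreal_le_iff) auto
  qed
  have "(\<lambda>k. real n * (L * v k * (2 * s * I))) \<longlonglongrightarrow> real n * (L * 0 * (2 * s * I))"
    by (intro tendsto_intros v(2))
  then have lim: "(\<lambda>k. real n * (L * v k * (2 * s * I))) \<longlonglongrightarrow> 0" by simp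
  show ?thesis by (rule LIMSEQ_null_comparison[OF _ lim]) (use bound in auto)
qed

lemma expected_end_error_integral_tendsto:
  assumes \<tau>: "0 \<le> \<tau>" shows "(\<lambda>k. \<integral>y. expected_end_error \<tau> k y \<partial>\<mu>) \<longlonglongrightarrow> 0"
proof -
  define I where "I = (\<integral>y. \<bar>f y\<bar> \<partial>\<mu>)"
  have I: "(\<integral>\<^sup>+y. ennreal \<bar>f y\<bar> \<partial>\<mu>) = ennreal I" "0 \<le> I"
    unfolding I_def using f_int by (auto intro!: nn_integral_eq_integral)
  have am[measurable]: "abs_integral f a b \<in> borel_measurable \<Omega>" if "0 \<le> a" for a b
    using that f by (rule abs_integral_measurable[rotated])
  have bound: "(\<integral>y. expected_end_error \<tau> k y \<partial>\<mu>) \<le> real n * (L * v k * (\<tau> * I))" for k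
  proof -
    let ?a = "\<lambda>i. max 0 (T k i - \<tau>)"
    have "ennreal (expected_end_error \<tau> k y) \<le> (\<Sum>i<n. ennreal (L * v k) * (\<integral>\<^sup>+\<omega>. abs_integral f (?a i) (T k i) \<omega> \<partial>P y))" for y
    proof -
      have "ennreal (expected_end_error \<tau> k y) = (\<integral>\<^sup>+\<omega>. ennreal (end_error \<tau> k (shift_path 0 \<omega>)) \<partial>P y)"
        unfolding expected_end_error_def
        by (intro nn_integral_eq_integral[symmetric] expectation_bounded(1)[where K="2 * K"] shift_path_functional_measurable end_error_measurable end_error_bounded)
           (auto simp: end_error_nonneg)
      also have "\<dots> \<le> (\<integral>\<^sup>+\<omega>. (\<Sum>i<n. ennreal (L * v k) * abs_integral f (?a i) (T k i) \<omega>) \<partial>P y)"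
        unfolding end_error_ennreal
        by (intro nn_integral_mono) (auto simp: path_variation_shift f intro!: min.coboundedI2 sum_mono)
      also have "\<dots> = (\<Sum>i<n. ennreal (L * v k) * (\<integral>\<^sup>+\<omega>. abs_integral f (?a i) (T k i) \<omega> \<partial>P y))"
        by (subst nn_integral_sum) (auto simp: nn_integral_cmult)
      finally show ?thesis .
    qed
    then have "(\<integral>\<^sup>+y. ennreal (expected_end_error \<tau> k y) \<partial>\<mu>) \<le> (\<integral>\<^sup>+y. (\<Sum>i<n. ennreal (L * v k) * (\<integral>\<^sup>+\<omega>. abs_integral f (?a i) (T k i) \<omega> \<partial>P y)) \<partial>\<mu>)"
      by (intro nn_integral_mono)
    also have "\<dots> = (\<Sum>i<n. ennreal (L * v k) * (ennreal (T k i - ?a i) * ennreal I))"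
    proof (subst nn_integral_sum)
      show "(\<Sum>i<n. \<integral>\<^sup>+y. ennreal (L * v k) * (\<integral>\<^sup>+\<omega>. abs_integral f (?a i) (T k i) \<omega> \<partial>P y) \<partial>\<mu>) =
        (\<Sum>i<n. ennreal (L * v k) * (ennreal (T k i - ?a i) * ennreal I))"
      proof (rule sum.cong[OF refl])
        fix i assume "i \<in> {..<n}"
        then have "?a i \<le> T k i" using T(1)[of i k] \<tau> by auto
        then show "(\<integral>\<^sup>+y. ennreal (L * v k) * (\<integral>\<^sup>+\<omega>. abs_integral f (?a i) (T k i) \<omega> \<partial>P y) \<partial>\<mu>) =
            ennreal (L * v k) * (ennreal (T k i - ?a i) * ennreal I)"
          using expected_abs_integral[OF f, of "?a i" "T k i"]
          by (subst nn_integral_cmult) (auto simp: I intro!: nn_expectation_measurable)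
      qed
    qed (auto intro!: nn_expectation_measurable)
    also have "\<dots> \<le> (\<Sum>i<n. ennreal (L * v k * (\<tau> * I)))"
    proof (rule sum_mono)
      fix i assume "i \<in> {..<n}"
      have "ennreal (L * v k) * (ennreal (T k i - ?a i) * ennreal I) \<le> ennreal (L * v k) * (ennreal \<tau> * ennreal I)"
        by (intro mult_left_mono mult_right_mono ennreal_leI) auto
      also have "\<dots> = ennreal (L * v k * (\<tau> * I))"
        using L v(1)[of k] I(2) \<tau> by (simp only: ennreal_mult mult_nonneg_nonneg)
      finally show "ennreal (L * v k) * (ennreal (T k i - ?a i) * ennreal I) \<le> ennreal (L * v k * (\<tau> * I))" .
    qed
    also have "\<dots> = ennreal (real n * (L * v k * (\<tau> * I)))"
      using L v(1)[of k] I(2) \<tau> by (intro sum_const_ennreal) auto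
    finally have "ennreal (\<integral>y. expected_end_error \<tau> k y \<partial>\<mu>) \<le> ennreal (real n * (L * v k * (\<tau> * I)))"
      using integrable_\<mu>[OF expected_end_error_measurable expected_end_error_bounded] expected_end_error_nonneg by (subst nn_integral_eq_integral[symmetric]) auto
    then show ?thesis using \<tau> L v(1)[of k] I(2) by (subst (asm) ennreal_le_iff) auto
  qed
  have "(\<lambda>k. real n * (L * v k * (\<tau> * I))) \<longlonglongrightarrow> real n * (L * 0 * (\<tau> * I))"
    by (intro tendsto_intros v(2))
  then have lim: "(\<lambda>k. real n * (L * v k * (\<tau> * I))) \<longlonglongrightarrow> 0" by simp
  show ?thesis by (rule LIMSEQ_null_comparison[OF _ lim]) (use bound expected_end_error_nonneg in \<open>auto simp: abs_of_nonneg integral_nonneg_AE\<close>)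
qed

text \<open>
  A nonnegative sequence that tends to \<open>0\<close> in the mean under an invariant law is
  asymptotically invariant.
\<close>

lemma expected_end_error_asymptotically_invariant:
  assumes \<tau>: "0 \<le> \<tau>" and s: "0 \<le> s"
  shows "(\<lambda>k. \<integral>y. \<bar>expected_end_error \<tau> k y - Pt s (expected_end_error \<tau> k) y\<bar> \<partial>\<mu>) \<longlonglongrightarrow> 0"
proof -
  have "(\<lambda>k. 2 * (\<integral>y. expected_end_error \<tau> k y \<partial>\<mu>)) \<longlonglongrightarrow> 2 * 0" by (intro tendsto_intros expected_end_error_integral_tendsto \<tau>)
  then have lim: "(\<lambda>k. 2 * (\<integral>y. expected_end_error \<tau> k y \<partial>\<mu>)) \<longlonglongrightarrow> 0" by simp
  have bound: "(\<integral>y. \<bar>expected_end_error \<tau> k y - Pt s (expected_end_error \<tau> k) y\<bar> \<partial>\<mu>) \<le> 2 * (\<integral>y. expected_end_error \<tau> k y \<partial>\<mu>)" for k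
  proof -
    have i: "integrable \<mu> (expected_end_error \<tau> k)" "integrable \<mu> (Pt s (expected_end_error \<tau> k))"
      using integrable_\<mu>[OF expected_end_error_measurable expected_end_error_bounded] integrable_\<mu>[OF Pt_measurable[OF s expected_end_error_measurable] Pt_bounded[OF s expected_end_error_measurable expected_end_error_bounded]]
      by auto
    have p: "0 \<le> Pt s (expected_end_error \<tau> k) y" for y unfolding semigroup_op_def by (simp add: expected_end_error_nonneg)
    have "(\<integral>y. \<bar>expected_end_error \<tau> k y - Pt s (expected_end_error \<tau> k) y\<bar> \<partial>\<mu>) \<le> (\<integral>y. expected_end_error \<tau> k y + Pt s (expected_end_error \<tau> k) y \<partial>\<mu>)"
      using i p expected_end_error_nonneg by (intro integral_mono) (auto simp: abs_le_iff add_increasing add_increasing2)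
    also have "\<dots> = 2 * (\<integral>y. expected_end_error \<tau> k y \<partial>\<mu>)"
      using i invariant_integral[OF s expected_end_error_measurable expected_end_error_bounded] by simp
    finally show ?thesis .
  qed
  show ?thesis by (rule LIMSEQ_null_comparison[OF _ lim]) (use bound in auto)
qed

end

lemma (in markov_family) emeasure_P_space [simp]: "emeasure (P x) (space \<Omega>) = 1"
  using prob_space.emeasure_space_1[OF prob_space_P[of x]] by simp

context lipschitz_test
begin

text \<open>
  The counterpart of \<open>end_error\<close> for the initial piece of the path; it stays attached
  to the starting point.
\<close>

definition start_error :: "real \<Rightarrow> 'a \<Rightarrow> nat \<Rightarrow> ennreal" where
  "start_error \<tau> x k = (\<integral>\<^sup>+\<omega>. min (ennreal (2 * K)) (\<Sum>i<n. ennreal (L * v k) * abs_integral f 0 \<tau> \<omega>) \<partial>P x)"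

text \<open>
  The two boundary terms are separated because they are treated differently: the first depends on
  the path up to time \<open>\<tau>\<close>, the second is a functional of the path after time
  \<open>s\<close> and can be averaged by the Markov property. Truncation at \<open>2 * K\<close> is
  subadditive.
\<close>

lemma functional_shift_diff_split:
  assumes \<omega>: "\<omega> \<in> space \<Omega>" and fin: "\<forall>m::nat. abs_integral f 0 (real m) \<omega> < \<infinity>"
    and s: "0 \<le> s" "s \<le> \<tau>" and Tk: "\<And>i. i < n \<Longrightarrow> \<tau> \<le> T k i"
  shows "ennreal \<bar>functional k (shift_path 0 \<omega>) - functional k (shift_path s \<omega>)\<bar> \<le>
     min (ennreal (2 * K)) (\<Sum>i<n. ennreal (L * v k) * abs_integral f 0 \<tau> \<omega>) + ennreal (end_error \<tau> k (shift_path s \<omega>))"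
proof -
  have min_add: "min a (b + c) \<le> min a b + min a c" for a b c :: ennreal
    by (auto simp: min_def add_increasing add_increasing2)
  let ?A = "\<Sum>i<n. ennreal (L * v k) * abs_integral f 0 \<tau> \<omega>"
  let ?B = "\<Sum>i<n. ennreal (L * v k) * path_variation f (max 0 (T k i - \<tau>)) (T k i) (shift_path s \<omega>)"
  have "\<bar>functional k (shift_path 0 \<omega>) - functional k (shift_path s \<omega>)\<bar> \<le> 2 * K"
    using functional_bounded[of k "shift_path 0 \<omega>"] functional_bounded[of k "shift_path s \<omega>"] by linarith
  then have 1: "ennreal \<bar>functional k (shift_path 0 \<omega>) - functional k (shift_path s \<omega>)\<bar> \<le> ennreal (2 * K)" by (rule ennreal_leI)
  have "ennreal \<bar>functional k (shift_path 0 \<omega>) - functional k (shift_path s \<omega>)\<bar> \<le>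
     (\<Sum>i<n. ennreal (L * v k) * (abs_integral f 0 s \<omega> + abs_integral f (T k i) (T k i + s) \<omega>))"
    by (rule functional_shift_diff[OF \<omega> fin s(1)])
  also have "\<dots> \<le> (\<Sum>i<n. ennreal (L * v k) * (abs_integral f 0 \<tau> \<omega> + path_variation f (max 0 (T k i - \<tau>)) (T k i) (shift_path s \<omega>)))"
  proof (intro sum_mono mult_left_mono add_mono)
    fix i assume "i \<in> {..<n}"
    then have "\<tau> \<le> T k i" using Tk by auto
    then show "abs_integral f (T k i) (T k i + s) \<omega> \<le> path_variation f (max 0 (T k i - \<tau>)) (T k i) (shift_path s \<omega>)"
      using s by (subst path_variation_shift[OF s(1) _ \<omega> f]) (auto intro!: abs_integral_mono)
  qed (use s in \<open>auto intro!: abs_integral_mono\<close>)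
  also have "\<dots> = ?A + ?B" by (simp only: distrib_left sum.distrib)
  finally have "ennreal \<bar>functional k (shift_path 0 \<omega>) - functional k (shift_path s \<omega>)\<bar> \<le> min (ennreal (2 * K)) (?A + ?B)" using 1 by simp
  also have "\<dots> \<le> min (ennreal (2 * K)) ?A + min (ennreal (2 * K)) ?B" by (rule min_add)
  finally show ?thesis unfolding end_error_ennreal .
qed

lemma expected_functional_shift_diff:
  assumes loc: "locally_integrable_from f x" and s: "0 \<le> s" "s \<le> \<tau>" and Tk: "\<And>i. i < n \<Longrightarrow> \<tau> \<le> T k i"
  shows "ennreal \<bar>expected_functional k x - Pt s (expected_functional k) x\<bar> \<le> start_error \<tau> x k + (\<integral>\<^sup>+y. ennreal (expected_end_error \<tau> k y) \<partial>tk s x)"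
proof -
  have am[measurable]: "abs_integral f 0 \<tau> \<in> borel_measurable \<Omega>" by (rule abs_integral_measurable[OF f order_refl])
  have Em[measurable]: "(\<lambda>\<omega>. end_error \<tau> k (shift_path s \<omega>)) \<in> borel_measurable \<Omega>" by (rule shift_path_functional_measurable[OF end_error_measurable s(1)])
  have "AE \<omega> in P x. ennreal \<bar>functional k (shift_path 0 \<omega>) - functional k (shift_path s \<omega>)\<bar> \<le>
     min (ennreal (2 * K)) (\<Sum>i<n. ennreal (L * v k) * abs_integral f 0 \<tau> \<omega>) + ennreal (end_error \<tau> k (shift_path s \<omega>))"
    using loc[unfolded locally_integrable_from_def] AE_space
    by eventually_elim (rule functional_shift_diff_split[OF _ _ s Tk], auto)
  then have "ennreal \<bar>expected_functional k x - Pt s (expected_functional k) x\<bar> \<le>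
     (\<integral>\<^sup>+\<omega>. min (ennreal (2 * K)) (\<Sum>i<n. ennreal (L * v k) * abs_integral f 0 \<tau> \<omega>) + ennreal (end_error \<tau> k (shift_path s \<omega>)) \<partial>P x)"
    unfolding Pt_expected_functional[OF s(1)] expected_functional_def
    by (intro ennreal_abs_integral_diff_le expectation_bounded(1)[where K=K] shift_path_functional_measurable functional_measurable functional_bounded s(1) order_refl)
  also have "\<dots> = start_error \<tau> x k + (\<integral>\<^sup>+\<omega>. ennreal (end_error \<tau> k (shift_path s \<omega>)) \<partial>P x)"
    unfolding start_error_def by (rule nn_integral_add) measurable
  also have "(\<integral>\<^sup>+\<omega>. ennreal (end_error \<tau> k (shift_path s \<omega>)) \<partial>P x) = (\<integral>\<^sup>+y. (\<integral>\<^sup>+\<omega>. ennreal (end_error \<tau> k (shift_path 0 \<omega>)) \<partial>P y) \<partial>tk s x)"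
  proof (rule markov_path[OF s(1)])
    show "(\<lambda>p. ennreal (end_error \<tau> k p)) \<in> borel_measurable paths" by measurable
  qed
  also have "\<dots> = (\<integral>\<^sup>+y. ennreal (expected_end_error \<tau> k y) \<partial>tk s x)"
    unfolding expected_end_error_def
    by (intro nn_integral_cong nn_integral_eq_integral expectation_bounded(1)[where K="2 * K"] shift_path_functional_measurable end_error_measurable end_error_bounded order_refl)
       (simp add: end_error_nonneg)
  finally show ?thesis .
qed

text \<open>
  \<open>expected_functional_shift_diff\<close> is averaged over \<open>s\<close> uniform in
  \<open>{0..\<tau>}\<close>.
\<close>

lemma expected_functional_cesaro_diff:
  assumes loc: "locally_integrable_from f x" and \<tau>: "0 < \<tau>" and Tk: "\<And>i. i < n \<Longrightarrow> \<tau> \<le> T k i"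
  shows "ennreal \<bar>expected_functional k x - (\<integral>y. expected_functional k y \<partial>cesaro \<tau> x)\<bar> \<le> start_error \<tau> x k + (\<integral>\<^sup>+y. ennreal (expected_end_error \<tau> k y) \<partial>cesaro \<tau> x)"
proof -
  let ?U = "uniform_measure lborel {0..\<tau>}"
  interpret U: prob_space ?U by (rule prob_uniform[OF \<tau>])
  have Hm[measurable]: "(\<lambda>y. ennreal (expected_end_error \<tau> k y)) \<in> borel_measurable borel" using expected_end_error_measurable by measurable
  have m1: "(\<lambda>s. \<integral>\<^sup>+y. ennreal (expected_end_error \<tau> k y) \<partial>tk (max 0 s) x) \<in> borel_measurable ?U"
    by (rule measurable_compose[OF tk_time_kernel' nn_integral_measurable_subprob_algebra[OF Hm]])
  have m2: "(\<lambda>s. \<integral>y. expected_functional k y \<partial>tk (max 0 s) x) \<in> borel_measurable ?U"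
    by (rule measurable_compose[OF tk_time_kernel' integral_measurable_subprob_algebra[OF expected_functional_measurable]])
  have inU: "AE s in ?U. s \<in> {0..\<tau>}"
    by (rule AE_uniform_measureI) auto
  have i2: "integrable ?U (\<lambda>s. \<integral>y. expected_functional k y \<partial>tk (max 0 s) x)"
  proof (rule U.integrable_const_bound[where B=K])
    show "AE s in ?U. norm (\<integral>y. expected_functional k y \<partial>tk (max 0 s) x) \<le> K"
      using Pt_bounded[OF _ expected_functional_measurable expected_functional_bounded] by (auto simp: semigroup_op_def)
  qed (rule m2)
  have "ennreal \<bar>(\<integral>s. expected_functional k x \<partial>?U) - (\<integral>s. (\<integral>y. expected_functional k y \<partial>tk (max 0 s) x) \<partial>?U)\<bar> \<le>
      (\<integral>\<^sup>+s. start_error \<tau> x k + (\<integral>\<^sup>+y. ennreal (expected_end_error \<tau> k y) \<partial>tk (max 0 s) x) \<partial>?U)"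
  proof (rule ennreal_abs_integral_diff_le[OF _ i2])
    show "AE s in ?U. ennreal \<bar>expected_functional k x - (\<integral>y. expected_functional k y \<partial>tk (max 0 s) x)\<bar> \<le> start_error \<tau> x k + (\<integral>\<^sup>+y. ennreal (expected_end_error \<tau> k y) \<partial>tk (max 0 s) x)"
      using inU
    proof eventually_elim
      case (elim s)
      then show ?case using expected_functional_shift_diff[OF loc _ _ Tk, of s] by (auto simp: semigroup_op_def max_def)
    qed
  qed simp
  also have "\<dots> = start_error \<tau> x k + (\<integral>\<^sup>+y. ennreal (expected_end_error \<tau> k y) \<partial>cesaro \<tau> x)"
    unfolding cesaro_def nn_integral_bind[OF Hm tk_time_kernel']
    by (subst nn_integral_add[OF _ m1]) (simp_all only: nn_integral_const U.emeasure_space_1 mult_1_right borel_measurable_const)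
  finally show ?thesis using integral_cesaro[OF \<tau> expected_functional_measurable expected_functional_bounded] U.prob_space by simp
qed

text \<open>
  For almost every path the integral of \<open>\<bar>f\<bar>\<close> up to \<open>\<tau>\<close> is
  a finite number, which the normalisation sends to \<open>0\<close>; the truncation provides the
  dominating constant.
\<close>

lemma start_error_tendsto:
  assumes loc: "locally_integrable_from f x"
  shows "start_error \<tau> x \<longlonglongrightarrow> 0"
proof -
  interpret prob_space "P x" by (rule prob_space_P)
  have am[measurable]: "abs_integral f 0 \<tau> \<in> borel_measurable \<Omega>" by (rule abs_integral_measurable[OF f order_refl])
  have "(\<lambda>k. start_error \<tau> x k) \<longlonglongrightarrow> (\<integral>\<^sup>+\<omega>. 0 \<partial>P x)"
    unfolding start_error_def
  proof (rule nn_integral_dominated_convergence[where w="\<lambda>_. ennreal (2 * K)"])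
    show "AE \<omega> in P x. (\<lambda>k. min (ennreal (2 * K)) (\<Sum>i<n. ennreal (L * v k) * abs_integral f 0 \<tau> \<omega>)) \<longlonglongrightarrow> 0"
      using loc[unfolded locally_integrable_from_def]
    proof eventually_elim
      case (elim \<omega>)
      obtain m :: nat where "\<tau> \<le> real m" using real_arch_simple by blast
      then have "abs_integral f 0 \<tau> \<omega> \<le> abs_integral f 0 (real m) \<omega>" by (intro abs_integral_mono) auto
      also have "\<dots> < \<infinity>" using elim by blast
      finally obtain r where r: "abs_integral f 0 \<tau> \<omega> = ennreal r" "0 \<le> r" by (cases "abs_integral f 0 \<tau> \<omega>") auto
      have "(\<Sum>i<n. ennreal (L * v k) * abs_integral f 0 \<tau> \<omega>) = ennreal (real n * (L * v k * r))" for k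
        unfolding r(1) using L v(1)[of k] r(2) sum_const_ennreal[of "L * v k * r" n]
        by (simp add: ennreal_mult)
      moreover have "(\<lambda>k. ennreal (real n * (L * v k * r))) \<longlonglongrightarrow> ennreal (real n * (L * 0 * r))"
        by (intro tendsto_ennrealI tendsto_intros v(2))
      ultimately have lim: "(\<lambda>k. (\<Sum>i<n. ennreal (L * v k) * abs_integral f 0 \<tau> \<omega>)) \<longlonglongrightarrow> 0" by simp
      show ?case
        by (rule tendsto_sandwich[OF _ _ tendsto_const lim]) (auto intro: always_eventually)
    qed
  qed (auto simp: emeasure_space_1)
  then show ?thesis by simp
qed

text \<open>
  The horizon \<open>m\<close> is fixed first, so that the occupation measure gives little mass to
  the singular set; then \<open>k\<close> tends to infinity, and \<open>weak_limit\<close> is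
  applied to the expected functional and to its end error on the absolutely continuous part.
\<close>

theorem expected_functional_tendsto:
  assumes loc: "locally_integrable_from f x"
    and acc: "\<And>N. N \<in> null_sets \<mu> \<Longrightarrow> (\<lambda>m. emeasure (cesaro (real m) x) N) \<longlonglongrightarrow> 0"
    and c: "(\<lambda>k. \<integral>y. expected_functional k y \<partial>\<mu>) \<longlonglongrightarrow> c"
  shows "(\<lambda>k. expected_functional k x) \<longlonglongrightarrow> c"
proof (rule LIMSEQ_I)
  fix \<delta> :: real assume \<delta>: "0 < \<delta>"
  have c_le: "\<bar>c\<bar> \<le> K"
  proof (rule LIMSEQ_le_const2[OF tendsto_rabs[OF c]])
    have "\<bar>\<integral>y. expected_functional k y \<partial>\<mu>\<bar> \<le> K" for k
    proof -
      have "\<bar>\<integral>y. expected_functional k y \<partial>\<mu>\<bar> \<le> (\<integral>y. \<bar>expected_functional k y\<bar> \<partial>\<mu>)" using integral_norm_bound[of \<mu> "expected_functional k"] by simp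
      also have "\<dots> \<le> (\<integral>y. K \<partial>\<mu>)"
        using integrable_\<mu>[OF expected_functional_measurable expected_functional_bounded] expected_functional_bounded by (intro integral_mono) auto
      finally show ?thesis by simp
    qed
    then show "\<exists>N. \<forall>k\<ge>N. \<bar>\<integral>y. expected_functional k y \<partial>\<mu>\<bar> \<le> K" by blast
  qed
  have "\<exists>N. N \<in> null_sets \<mu> \<and> (\<forall>D. D \<in> null_sets \<mu> \<longrightarrow> D \<inter> N = {} \<longrightarrow> emeasure (cesaro (real (Suc m)) x) D = 0)" for m
    by (rule lebesgue_decomposition_set[of \<mu> "cesaro (real (Suc m)) x"])
       (auto intro: mu.finite_measure_axioms prob_space.finite_measure[OF prob_space_cesaro])
  then obtain NN where NN: "\<And>m. NN m \<in> null_sets \<mu>"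
      "\<And>m D. D \<in> null_sets \<mu> \<Longrightarrow> D \<inter> NN m = {} \<Longrightarrow> emeasure (cesaro (real (Suc m)) x) D = 0" by metis
  \<comment> \<open>One null set for all horizons, because the horizon is chosen according to its mass.\<close>
  define N where "N = (\<Union>m. NN m)"
  have N: "N \<in> null_sets \<mu>" unfolding N_def using NN(1) by auto
  then have Nb[measurable]: "N \<in> sets borel" by auto
  \<comment> \<open>Dropping \<open>N\<close> costs its mass times \<open>2 * K\<close> for the end error, \<open>K\<close> for the functional and \<open>K\<close> for \<open>c\<close>.\<close>
  define \<eta> where "\<eta> = \<delta> / (8 * K + 8)"
  have \<eta>: "0 < \<eta>" "4 * K * \<eta> < \<delta> / 2" using \<delta> K_nonneg by (auto simp: \<eta>_def field_simps)
  obtain m0 where m0: "\<And>m. m0 \<le> m \<Longrightarrow> emeasure (cesaro (real m) x) N < ennreal \<eta>"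
    using order_tendstoD(2)[OF acc[OF N], of "ennreal \<eta>"] \<eta> unfolding eventually_sequentially by auto
  define m where "m = Suc m0"
  define \<sigma> where "\<sigma> = cesaro (real m) x"
  have m_pos: "0 < real m" by (simp add: m_def)
  interpret \<sigma>: prob_space \<sigma> unfolding \<sigma>_def by (rule prob_space_cesaro[OF m_pos])
  have s\<sigma>[simp, measurable_cong]: "sets \<sigma> = sets borel" and sp\<sigma>[simp]: "space \<sigma> = UNIV" by (auto simp: \<sigma>_def)
  define q where "q = measure \<sigma> N"
  have "emeasure \<sigma> N < ennreal \<eta>" unfolding \<sigma>_def by (rule m0) (simp add: m_def)
  then have q: "q < \<eta>" "0 \<le> q" by (simp_all add: q_def \<sigma>.emeasure_eq_measure ennreal_less_iff)
  let ?\<sigma>' = "density \<sigma> (\<lambda>y. ennreal (indicator (- N) y))"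
  have s': "sets ?\<sigma>' = sets borel" by simp
  have fin': "finite_measure ?\<sigma>'"
  proof
    have "emeasure ?\<sigma>' (space ?\<sigma>') = (\<integral>\<^sup>+y. ennreal (indicator (- N) y) * indicator UNIV y \<partial>\<sigma>)"
      by (subst emeasure_density) simp_all
    also have "\<dots> \<le> (\<integral>\<^sup>+y. 1 \<partial>\<sigma>)" by (intro nn_integral_mono) (simp add: indicator_def)
    also have "\<dots> = 1" using \<sigma>.emeasure_space_1 by simp
    finally show "emeasure ?\<sigma>' (space ?\<sigma>') \<noteq> \<infinity>" by (auto simp: top_unique)
  qed
  have em': "emeasure ?\<sigma>' D = emeasure \<sigma> (D - N)" if [measurable]: "D \<in> sets borel" for D
  proof -
    have "emeasure ?\<sigma>' D = (\<integral>\<^sup>+y. ennreal (indicator (- N) y) * indicator D y \<partial>\<sigma>)"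
      by (subst emeasure_density) simp_all
    also have "\<dots> = (\<integral>\<^sup>+y. indicator (D - N) y \<partial>\<sigma>)" by (intro nn_integral_cong) (auto simp: indicator_def)
    also have "\<dots> = emeasure \<sigma> (D - N)" by (rule nn_integral_indicator) simp
    finally show ?thesis .
  qed
  have ac': "absolutely_continuous \<mu> ?\<sigma>'"
    unfolding absolutely_continuous_def
  proof
    fix D assume D: "D \<in> null_sets \<mu>"
    then have [measurable]: "D \<in> sets borel" by auto
    have "D - N \<in> null_sets \<mu>" using D N by (intro null_set_Diff) auto
    moreover have "(D - N) \<inter> NN m0 = {}" by (auto simp: N_def)
    ultimately have "emeasure \<sigma> (D - N) = 0" unfolding \<sigma>_def m_def by (rule NN(2))
    then show "D \<in> null_sets ?\<sigma>'" by (auto simp: null_sets_def em')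
  qed
  have split: "(\<integral>y. g y \<partial>?\<sigma>') = (\<integral>y. g y \<partial>\<sigma>) - (\<integral>y. indicator N y * g y \<partial>\<sigma>)"
    "\<bar>\<integral>y. indicator N y * g y \<partial>\<sigma>\<bar> \<le> C * q"
    if g: "g \<in> borel_measurable borel" "\<And>y. \<bar>g y\<bar> \<le> C" for g :: "'a \<Rightarrow> real" and C
  proof -
    have ig: "integrable \<sigma> g" using g by (intro \<sigma>.integrable_const_bound[where B=C]) auto
    have iN: "integrable \<sigma> (\<lambda>y. indicator N y * g y)"
      using integrable_real_mult_indicator[OF _ ig, of N] by (simp add: mult.commute)
    have "(\<integral>y. g y \<partial>?\<sigma>') = (\<integral>y. indicator (- N) y * g y \<partial>\<sigma>)"
      using g by (subst integral_density) auto
    also have "\<dots> = (\<integral>y. g y - indicator N y * g y \<partial>\<sigma>)"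
      by (intro Bochner_Integration.integral_cong) (auto simp: indicator_def)
    also have "\<dots> = (\<integral>y. g y \<partial>\<sigma>) - (\<integral>y. indicator N y * g y \<partial>\<sigma>)" using ig iN by (rule Bochner_Integration.integral_diff)
    finally show "(\<integral>y. g y \<partial>?\<sigma>') = (\<integral>y. g y \<partial>\<sigma>) - (\<integral>y. indicator N y * g y \<partial>\<sigma>)" .
    have "\<bar>\<integral>y. indicator N y * g y \<partial>\<sigma>\<bar> \<le> (\<integral>y. \<bar>indicator N y * g y\<bar> \<partial>\<sigma>)"
      using integral_norm_bound[of \<sigma> "\<lambda>y. indicator N y * g y"] by simp
    also have "\<dots> \<le> (\<integral>y. C * indicator N y \<partial>\<sigma>)"
    proof (rule integral_mono)
      show "integrable \<sigma> (\<lambda>y. C * indicator N y)"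
        by (intro integrable_mult_right integrable_real_indicator) (auto simp: \<sigma>.emeasure_eq_measure)
    qed (use iN g(2) in \<open>auto simp: indicator_def\<close>)
    also have "\<dots> = C * q" by (simp add: q_def)
    finally show "\<bar>\<integral>y. indicator N y * g y \<partial>\<sigma>\<bar> \<le> C * q" .
  qed
  have mass': "measure ?\<sigma>' UNIV = 1 - q"
  proof -
    have "measure ?\<sigma>' UNIV = measure \<sigma> (UNIV - N)" unfolding measure_def by (subst em') simp_all
    also have "\<dots> = 1 - q" using \<sigma>.prob_compl[of N] by (simp add: q_def)
    finally show ?thesis .
  qed
  have lF: "(\<lambda>k. \<integral>y. expected_functional k y \<partial>?\<sigma>') \<longlonglongrightarrow> c * (1 - q)"
    unfolding mass'[symmetric]
    by (rule weak_limit[OF expected_functional_measurable expected_functional_bounded expected_functional_asymptotically_invariant c fin' s' ac'])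
  have lH: "(\<lambda>k. \<integral>y. expected_end_error (real m) k y \<partial>?\<sigma>') \<longlonglongrightarrow> 0 * measure ?\<sigma>' UNIV"
    using m_pos
    by (intro weak_limit[OF expected_end_error_measurable expected_end_error_bounded expected_end_error_asymptotically_invariant expected_end_error_integral_tendsto fin' s' ac']) auto
  define e where "e k = enn2real (start_error (real m) x k)" for k
  have e_fin: "start_error (real m) x k = ennreal (e k)" for k
  proof -
    have "start_error (real m) x k \<le> (\<integral>\<^sup>+\<omega>. ennreal (2 * K) \<partial>P x)"
      unfolding start_error_def by (intro nn_integral_mono) auto
    also have "\<dots> < \<infinity>" using prob_space.emeasure_space_1[OF prob_space_P[of x]] by simp
    finally show ?thesis unfolding e_def by simp
  qed
  have e0: "0 \<le> e k" for k by (simp add: e_def)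
  have le: "e \<longlonglongrightarrow> 0"
  proof -
    have "(\<lambda>k. ennreal (e k)) \<longlonglongrightarrow> ennreal 0" using start_error_tendsto[OF loc, of "real m"] by (simp add: e_fin[abs_def])
    then show ?thesis using e0 by (subst (asm) tendsto_ennreal_iff) auto
  qed
  define r where "r k = e k + (\<integral>y. expected_end_error (real m) k y \<partial>?\<sigma>') + \<bar>(\<integral>y. expected_functional k y \<partial>?\<sigma>') - c * (1 - q)\<bar>" for k
  have "r \<longlonglongrightarrow> 0 + 0 * measure ?\<sigma>' UNIV + \<bar>c * (1 - q) - c * (1 - q)\<bar>"
    unfolding r_def by (intro tendsto_add le lH tendsto_rabs tendsto_diff lF tendsto_const)
  then have "r \<longlonglongrightarrow> 0" by simp
  then have ev_r: "\<forall>\<^sub>F k in sequentially. r k < \<delta> / 2" using \<delta> by (intro order_tendstoD) auto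
  have "\<forall>\<^sub>F k in sequentially. \<forall>i\<in>{..<n}. real m \<le> T k i"
    using T(2) by (intro eventually_ball_finite) (auto simp: filterlim_at_top)
  with ev_r have "\<forall>\<^sub>F k in sequentially. norm (expected_functional k x - c) < \<delta>"
  proof eventually_elim
    case (elim k)
    have iH: "integrable \<sigma> (expected_end_error (real m) k)"
      using expected_end_error_measurable expected_end_error_bounded by (intro \<sigma>.integrable_const_bound[where B="2 * K"]) auto
    have H0: "0 \<le> (\<integral>y. expected_end_error (real m) k y \<partial>\<sigma>)" by (simp add: expected_end_error_nonneg)
    have "ennreal \<bar>expected_functional k x - (\<integral>y. expected_functional k y \<partial>\<sigma>)\<bar> \<le> start_error (real m) x k + (\<integral>\<^sup>+y. ennreal (expected_end_error (real m) k y) \<partial>\<sigma>)"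
      unfolding \<sigma>_def using elim(2) by (intro expected_functional_cesaro_diff[OF loc m_pos]) auto
    also have "\<dots> = ennreal (e k + (\<integral>y. expected_end_error (real m) k y \<partial>\<sigma>))"
      unfolding e_fin using iH e0 H0 expected_end_error_nonneg by (subst nn_integral_eq_integral) auto
    finally have 1: "\<bar>expected_functional k x - (\<integral>y. expected_functional k y \<partial>\<sigma>)\<bar> \<le> e k + (\<integral>y. expected_end_error (real m) k y \<partial>\<sigma>)"
      using e0 H0 by (subst (asm) ennreal_le_iff) auto
    have 2: "(\<integral>y. expected_end_error (real m) k y \<partial>\<sigma>) \<le> (\<integral>y. expected_end_error (real m) k y \<partial>?\<sigma>') + 2 * K * q"
      using split[OF expected_end_error_measurable expected_end_error_bounded, of "real m" k] by linarith
    have 3: "\<bar>(\<integral>y. expected_functional k y \<partial>\<sigma>) - (\<integral>y. expected_functional k y \<partial>?\<sigma>')\<bar> \<le> K * q"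
      using split[OF expected_functional_measurable expected_functional_bounded, of k] by linarith
    have 4: "\<bar>c * (1 - q) - c\<bar> \<le> K * q"
    proof -
      have "\<bar>c * (1 - q) - c\<bar> = \<bar>c\<bar> * q" using q(2) by (simp add: algebra_simps abs_mult)
      then show ?thesis using c_le q(2) by (simp add: mult_right_mono)
    qed
    have "\<bar>expected_functional k x - c\<bar> \<le> r k + 4 * K * q"
      using 1 2 3 4 unfolding r_def by linarith
    also have "4 * K * q \<le> 4 * K * \<eta>" using q(1) K_nonneg by (intro mult_left_mono) auto
    finally show ?case using elim(1) \<eta>(2) by simp
  qed
  then show "\<exists>no. \<forall>k\<ge>no. norm (expected_functional k x - c) < \<delta>" by (simp add: eventually_sequentially)
qed

end

section \<open>Null sets under a drift condition\<close>

context ergodic_markov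
begin

lemma tk_time_measurable:
  assumes "D \<in> sets borel"
  shows "(\<lambda>s. emeasure (tk (max 0 s) x) D) \<in> borel_measurable borel"
  by (rule measurable_emeasure_kernel[OF tk_time_kernel assms])

lemma tk_joint_measurable:
  assumes "D \<in> sets borel"
  shows "(\<lambda>q. emeasure (tk (max 0 (fst q)) (snd q)) D) \<in> borel_measurable (lborel \<Otimes>\<^sub>M borel)"
  using measurable_emeasure_kernel[OF tk_joint_kernel assms] by (simp cong: measurable_cong_sets)

lemma occupation_max: "occupation P X x D = (\<integral>\<^sup>+t\<in>{0..}. emeasure (tk (max 0 t) x) D \<partial>lborel)"
  unfolding occupation_def by (intro nn_integral_cong) (auto simp: indicator_def max_def)

lemma time_integral_measurable:
  assumes "D \<in> sets borel" "A \<in> sets borel"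
  shows "(\<lambda>x. \<integral>\<^sup>+s\<in>A. emeasure (tk (max 0 s) x) D \<partial>lborel) \<in> borel_measurable borel"
proof -
  have "(\<lambda>q. (snd q, fst q)) \<in> borel \<Otimes>\<^sub>M lborel \<rightarrow>\<^sub>M lborel \<Otimes>\<^sub>M borel" by measurable
  from measurable_compose[OF this tk_joint_measurable[OF assms(1)]]
  have [measurable]: "(\<lambda>q. emeasure (tk (max 0 (snd q)) (fst q)) D) \<in> borel_measurable (borel \<Otimes>\<^sub>M lborel)" by simp
  show ?thesis using assms(2)
    by (intro lborel.borel_measurable_nn_integral) (simp add: case_prod_beta')
qed

lemma occupation_measurable: "D \<in> sets borel \<Longrightarrow> (\<lambda>x. occupation P X x D) \<in> borel_measurable borel"
  unfolding occupation_max by (rule time_integral_measurable) auto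

lemma occupation_null:
  assumes N: "N \<in> null_sets \<mu>"
  shows "(\<integral>\<^sup>+x. occupation P X x N \<partial>\<mu>) = 0"
proof -
  have Nb[measurable]: "N \<in> sets borel" using N by auto
  interpret pair_sigma_finite \<mu> lborel ..
  have m: "(\<lambda>(x, t). emeasure (tk (max 0 t) x) N * indicator {0..} t) \<in> borel_measurable (\<mu> \<Otimes>\<^sub>M lborel)"
  proof -
    have "(\<lambda>q. (snd q, fst q)) \<in> borel \<Otimes>\<^sub>M lborel \<rightarrow>\<^sub>M lborel \<Otimes>\<^sub>M borel" by measurable
    from measurable_compose[OF this tk_joint_measurable[OF Nb]]
    have [measurable]: "(\<lambda>q. emeasure (tk (max 0 (snd q)) (fst q)) N) \<in> borel_measurable (\<mu> \<Otimes>\<^sub>M lborel)"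
      by (simp cong: measurable_cong_sets)
    show ?thesis by (simp add: case_prod_beta')
  qed
  have "(\<integral>\<^sup>+x. occupation P X x N \<partial>\<mu>) = (\<integral>\<^sup>+t. (\<integral>\<^sup>+x. emeasure (tk (max 0 t) x) N * indicator {0..} t \<partial>\<mu>) \<partial>lborel)"
    unfolding occupation_max using Fubini'[OF m] by simp
  also have "\<dots> = (\<integral>\<^sup>+(t::real). 0 \<partial>lborel)"
  proof (intro nn_integral_cong)
    fix t :: real
    have "(\<integral>\<^sup>+x. emeasure (tk (max 0 t) x) N \<partial>\<mu>) = (\<integral>\<^sup>+x. (\<integral>\<^sup>+z. indicator N z \<partial>tk (max 0 t) x) \<partial>\<mu>)"
      by (intro nn_integral_cong) simp
    also have "\<dots> = (\<integral>\<^sup>+x. indicator N x \<partial>\<mu>)" by (rule invariant_nn) auto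
    also have "\<dots> = 0" using null_setsD1[OF N] by simp
    finally show "(\<integral>\<^sup>+x. emeasure (tk (max 0 t) x) N * indicator {0..} t \<partial>\<mu>) = 0"
      by (cases "0 \<le> t") (auto simp: max_def)
  qed
  finally show ?thesis by simp
qed

text \<open>
  Iterate: add to the set the points from which it is visited for a positive time. By stationarity
  they form a null set at each stage.
\<close>

lemma null_set_absorbing_complement:
  assumes N0: "N0 \<in> null_sets \<mu>"
  obtains N where "N \<in> null_sets \<mu>" "N0 \<subseteq> N" "\<And>x. x \<notin> N \<Longrightarrow> occupation P X x N = 0"
proof -
  define NN where "NN = rec_nat N0 (\<lambda>_ A. A \<union> {x. occupation P X x A \<noteq> 0})"
  have NN0: "NN 0 = N0" and NNS: "NN (Suc k) = NN k \<union> {x. occupation P X x (NN k) \<noteq> 0}" for k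
    by (simp_all add: NN_def)
  have null: "NN k \<in> null_sets \<mu>" for k
  proof (induction k)
    case (Suc k)
    have b[measurable]: "NN k \<in> sets borel" using Suc by auto
    have m[measurable]: "(\<lambda>x. occupation P X x (NN k)) \<in> borel_measurable borel" by (rule occupation_measurable[OF b])
    have "AE x in \<mu>. occupation P X x (NN k) = 0"
      using occupation_null[OF Suc] by (subst (asm) nn_integral_0_iff_AE) auto
    moreover have "{x. occupation P X x (NN k) \<noteq> 0} \<in> sets \<mu>" by simp
    ultimately have "{x. occupation P X x (NN k) \<noteq> 0} \<in> null_sets \<mu>"
      by (subst AE_iff_null_sets) auto
    then show ?case unfolding NNS using Suc by auto
  qed (simp add: NN0 N0)
  show ?thesis
  proof
    show "(\<Union>k. NN k) \<in> null_sets \<mu>" using null by auto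
    show "N0 \<subseteq> (\<Union>k. NN k)" using NN0 by auto
    fix x assume x: "x \<notin> (\<Union>k. NN k)"
    have z: "occupation P X x (NN k) = 0" for k using x NNS[of k] by auto
    have b[measurable]: "NN k \<in> sets borel" for k using null[of k] by auto
    have "occupation P X x (\<Union>k. NN k) \<le> (\<integral>\<^sup>+t. (\<Sum>k. emeasure (tk (max 0 t) x) (NN k) * indicator {0..} t) \<partial>lborel)"
      unfolding occupation_max
      by (intro nn_integral_mono) (auto simp: indicator_def intro!: emeasure_subadditive_countably)
    also have "\<dots> = (\<Sum>k. occupation P X x (NN k))"
      unfolding occupation_max using tk_time_measurable[OF b]
      by (intro nn_integral_suminf) auto
    also have "\<dots> = 0" using z by simp
    finally show "occupation P X x (\<Union>k. NN k) = 0" by simp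
  qed
qed

lemma emeasure_cesaro:
  assumes "0 < \<tau>" "D \<in> sets borel"
  shows "emeasure (cesaro \<tau> x) D = (\<integral>\<^sup>+s\<in>{0..\<tau>}. emeasure (tk (max 0 s) x) D \<partial>lborel) / ennreal \<tau>"
proof -
  have "emeasure (cesaro \<tau> x) D = (\<integral>\<^sup>+y. indicator D y \<partial>cesaro \<tau> x)" using assms(2) by simp
  also have "\<dots> = (\<integral>\<^sup>+s\<in>{0..\<tau>}. (\<integral>\<^sup>+y. indicator D y \<partial>tk s x) \<partial>lborel) / ennreal \<tau>"
    using assms by (intro nn_integral_cesaro) auto
  also have "(\<integral>\<^sup>+s\<in>{0..\<tau>}. (\<integral>\<^sup>+y. indicator D y \<partial>tk s x) \<partial>lborel) = (\<integral>\<^sup>+s\<in>{0..\<tau>}. emeasure (tk (max 0 s) x) D \<partial>lborel)"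
    using assms(2) by (intro nn_integral_cong) (auto simp: max_def split: split_indicator)
  finally show ?thesis .
qed

text \<open>
  The upper limiting fraction of expected time spent in \<open>N\<close>; the successor avoids the
  horizon \<open>0\<close>.
\<close>

definition sojourn :: "'a set \<Rightarrow> 'a \<Rightarrow> ennreal" where
  "sojourn N x = limsup (\<lambda>m. emeasure (cesaro (real (Suc m)) x) N)"

lemma cesaro_measurable:
  assumes "0 < \<tau>" "N \<in> sets borel" shows "(\<lambda>x. emeasure (cesaro \<tau> x) N) \<in> borel_measurable borel"
  unfolding emeasure_cesaro[OF assms] using time_integral_measurable[OF assms(2), of "{0..\<tau>}"] by measurable

lemma sojourn_measurable: "N \<in> sets borel \<Longrightarrow> sojourn N \<in> borel_measurable borel"
  unfolding sojourn_def[abs_def] by (intro borel_measurable_limsup cesaro_measurable) auto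

lemma cesaro_le_1: "0 < \<tau> \<Longrightarrow> emeasure (cesaro \<tau> x) N \<le> 1"
  using prob_space_cesaro by (intro subprob_space.subprob_emeasure_le_1 prob_space_imp_subprob_space) 

lemma tk_le_1: "0 \<le> t \<Longrightarrow> emeasure (tk t x) N \<le> 1"
  using prob_space_tk by (intro subprob_space.subprob_emeasure_le_1 prob_space_imp_subprob_space) 

lemma sojourn_le_1: "sojourn N x \<le> 1"
  unfolding sojourn_def by (rule Limsup_bounded) (auto intro!: always_eventually cesaro_le_1)

text \<open>
  The time before \<open>t\<close> does not count in the limit, and the upper limit of integrals is
  at most the integral of the upper limit by the reverse Fatou lemma.
\<close>

lemma sojourn_subinvariant:
  assumes t: "0 \<le> t" and N: "N \<in> sets borel"
  shows "sojourn N x \<le> (\<integral>\<^sup>+y. sojourn N y \<partial>tk t x)"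
proof -
  note [measurable] = N
  interpret pt: prob_space "tk t x" by (rule prob_space_tk[OF t])
  let ?c = "\<lambda>m y. emeasure (cesaro (real (Suc m)) y) N"
  have cm[measurable]: "?c m \<in> borel_measurable borel" for m by (rule cesaro_measurable) auto
  have main: "?c m x \<le> ennreal (t / real (Suc m)) + (\<integral>\<^sup>+y. ?c m y \<partial>tk t x)" for m
  proof -
    let ?T = "real (Suc m)"
    have mt: "(\<lambda>s. emeasure (tk (max 0 s) x) N) \<in> borel_measurable borel" by (rule tk_time_measurable) simp
    interpret pair_sigma_finite "tk t x" lborel ..
    have mj: "(\<lambda>(y, s). emeasure (tk (max 0 s) y) N * indicator {0..?T} s) \<in> borel_measurable (tk t x \<Otimes>\<^sub>M lborel)"
    proof -
      have "(\<lambda>q. (snd q, fst q)) \<in> borel \<Otimes>\<^sub>M lborel \<rightarrow>\<^sub>M lborel \<Otimes>\<^sub>M borel" by measurable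
      from measurable_compose[OF this tk_joint_measurable[OF N]]
      have [measurable]: "(\<lambda>q. emeasure (tk (max 0 (snd q)) (fst q)) N) \<in> borel_measurable (tk t x \<Otimes>\<^sub>M lborel)"
        by (simp cong: measurable_cong_sets)
      show ?thesis by (simp add: case_prod_beta')
    qed
    have "(\<integral>\<^sup>+y. ?c m y \<partial>tk t x) = (\<integral>\<^sup>+y. (\<integral>\<^sup>+s\<in>{0..?T}. emeasure (tk (max 0 s) y) N \<partial>lborel) \<partial>tk t x) / ennreal ?T"
      unfolding emeasure_cesaro[OF of_nat_0_less_iff[THEN iffD2, OF zero_less_Suc] N]
      using time_integral_measurable[OF N, of "{0..?T}"] by (intro nn_integral_divide) auto
    also have "(\<integral>\<^sup>+y. (\<integral>\<^sup>+s\<in>{0..?T}. emeasure (tk (max 0 s) y) N \<partial>lborel) \<partial>tk t x) =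
        (\<integral>\<^sup>+s\<in>{0..?T}. (\<integral>\<^sup>+y. emeasure (tk (max 0 s) y) N \<partial>tk t x) \<partial>lborel)"
      using Fubini'[OF mj] measurable_emeasure_kernel[OF tk_kernel N]
      by (simp add: nn_integral_multc)
    also have "\<dots> = (\<integral>\<^sup>+s\<in>{0..?T}. emeasure (tk (max 0 (t + s)) x) N \<partial>lborel)"
    proof (intro nn_integral_cong)
      fix s :: real
      have "(\<integral>\<^sup>+y. emeasure (tk s y) N \<partial>tk t x) = emeasure (tk (t + s) x) N" if "0 \<le> s"
        using tk_chapman[OF t that, of "indicator N" x] by simp
      then show "(\<integral>\<^sup>+y. emeasure (tk (max 0 s) y) N \<partial>tk t x) * indicator {0..?T} s = emeasure (tk (max 0 (t + s)) x) N * indicator {0..?T} s"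
        using t by (simp add: indicator_def max_def)
    qed
    also have "\<dots> = (\<integral>\<^sup>+s\<in>{t + 0..t + ?T}. emeasure (tk (max 0 s) x) N \<partial>lborel)"
      by (rule nn_integral_Icc_shift[OF mt])
    finally have e: "(\<integral>\<^sup>+y. ?c m y \<partial>tk t x) = (\<integral>\<^sup>+s\<in>{t..t + ?T}. emeasure (tk (max 0 s) x) N \<partial>lborel) / ennreal ?T" by simp
    have "(\<integral>\<^sup>+s\<in>{0..?T}. emeasure (tk (max 0 s) x) N \<partial>lborel) \<le>
        (\<integral>\<^sup>+s. indicator {0..t} s + emeasure (tk (max 0 s) x) N * indicator {t..t + ?T} s \<partial>lborel)"
      using tk_le_1 t by (intro nn_integral_mono) (auto simp: indicator_def)
    also have "\<dots> = ennreal t + (\<integral>\<^sup>+s\<in>{t..t + ?T}. emeasure (tk (max 0 s) x) N \<partial>lborel)"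
      using mt t by (subst nn_integral_add) auto
    finally have "?c m x \<le> (ennreal t + (\<integral>\<^sup>+s\<in>{t..t + ?T}. emeasure (tk (max 0 s) x) N \<partial>lborel)) / ennreal ?T"
      unfolding emeasure_cesaro[OF of_nat_0_less_iff[THEN iffD2, OF zero_less_Suc] N] by (intro divide_right_mono_ennreal)
    also have "\<dots> = ennreal (t / ?T) + (\<integral>\<^sup>+y. ?c m y \<partial>tk t x)"
      unfolding e add_divide_distrib_ennreal by (subst divide_ennreal) (use t in auto)
    finally show ?thesis .
  qed
  have "limsup (\<lambda>m. ?c m x) \<le> ennreal e + limsup (\<lambda>m. \<integral>\<^sup>+y. ?c m y \<partial>tk t x)" if e: "0 < e" for e
  proof -
    have "(\<lambda>m. t / real (Suc m)) \<longlonglongrightarrow> 0"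
      by (rule LIMSEQ_Suc[OF lim_const_over_n])
    then have "\<forall>\<^sub>F m in sequentially. t / real (Suc m) < e" using e by (rule order_tendstoD)
    then have "\<forall>\<^sub>F m in sequentially. ?c m x \<le> ennreal e + (\<integral>\<^sup>+y. ?c m y \<partial>tk t x)"
    proof eventually_elim
      case (elim m)
      then show ?case using main[of m] by (intro order_trans[OF main] add_right_mono ennreal_leI) auto
    qed
    then have "limsup (\<lambda>m. ?c m x) \<le> limsup (\<lambda>m. ennreal e + (\<integral>\<^sup>+y. ?c m y \<partial>tk t x))" by (rule Limsup_mono)
    then show ?thesis by (simp add: Limsup_const_add)
  qed
  note eps = this
  have "limsup (\<lambda>m. ?c m x) \<le> limsup (\<lambda>m. \<integral>\<^sup>+y. ?c m y \<partial>tk t x)"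
    by (rule ennreal_le_epsilon, subst add.commute, rule eps)
  also have "\<dots> \<le> (\<integral>\<^sup>+y. limsup (\<lambda>m. ?c m y) \<partial>tk t x)"
  proof (rule nn_integral_limsup[where w="\<lambda>_. 1"])
    show "?c m \<in> borel_measurable (tk t x)" for m
      using cm[of m] by (simp only: measurable_cong_sets[OF sets_tk refl])
    show "AE y in tk t x. ?c m y \<le> 1" for m by (intro AE_I2 cesaro_le_1) simp
    show "(\<integral>\<^sup>+y. 1 \<partial>tk t x) < \<infinity>" using pt.emeasure_space_1 by simp
  qed simp
  finally show ?thesis unfolding sojourn_def .
qed

lemma sojourn_off_absorbing:
  assumes N: "N \<in> sets borel" and x: "occupation P X x N = 0"
  shows "sojourn N x = 0"
proof -
  have "emeasure (cesaro (real (Suc m)) x) N = 0" for m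
  proof -
    have "(\<integral>\<^sup>+s\<in>{0..real (Suc m)}. emeasure (tk (max 0 s) x) N \<partial>lborel) \<le> occupation P X x N"
      unfolding occupation_max by (intro nn_integral_mono) (auto split: split_indicator)
    then have "(\<integral>\<^sup>+s\<in>{0..real (Suc m)}. emeasure (tk (max 0 s) x) N \<partial>lborel) = 0" using x by simp
    then show ?thesis by (subst emeasure_cesaro[OF _ N]) simp_all
  qed
  then show ?thesis unfolding sojourn_def by (simp add: Limsup_const)
qed

text \<open>
  The irreducibility measure does not charge \<open>N\<close>, for otherwise \<open>N\<close> would
  be visited from every point, while by stationarity it is not visited from almost every point.
\<close>

lemma irreducible_charges_conull:
  assumes irr: "irreducible_process P X \<psi>" and N: "N \<in> null_sets \<mu>"
  shows "occupation P X x (- N) > 0"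
proof -
  have Nb[measurable]: "N \<in> sets borel" using N by auto
  have s\<psi>: "sets \<psi> = sets borel" and pos: "emeasure \<psi> UNIV \<noteq> 0"
    and hit: "\<And>x D. D \<in> sets borel \<Longrightarrow> emeasure \<psi> D > 0 \<Longrightarrow> occupation P X x D > 0"
    using irr by (auto simp: irreducible_process_def)
  have "emeasure \<psi> N = 0"
  proof (rule ccontr)
    assume "emeasure \<psi> N \<noteq> 0"
    then have h: "occupation P X y N > 0" for y using hit[of N y] by (simp add: zero_less_iff_neq_zero)
    have "AE y in \<mu>. occupation P X y N = 0"
      using occupation_null[OF N] occupation_measurable[OF Nb] by (subst (asm) nn_integral_0_iff_AE) auto
    then have "AE y in \<mu>. False" by eventually_elim (use h in \<open>metis less_irrefl\<close>)
    then show False by simp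
  qed
  moreover have "emeasure \<psi> UNIV \<le> emeasure \<psi> N + emeasure \<psi> (- N)"
    using emeasure_subadditive[of N \<psi> "- N"] s\<psi> by (simp add: Compl_partition)
  ultimately have "emeasure \<psi> (- N) > 0" using pos by (auto simp: zero_less_iff_neq_zero)
  then show ?thesis by (intro hit) auto
qed

text \<open>
  A gap below \<open>1\<close> on \<open>D\<close> is felt at every point, in proportion to the
  chance of being in \<open>D\<close> later.
\<close>

lemma sojourn_step:
  assumes N: "N \<in> sets borel" and D: "D \<in> sets borel" and De: "\<And>z. sojourn N z + c * indicator D z \<le> 1" and s: "0 \<le> s"
  shows "sojourn N y + c * emeasure (tk s y) D \<le> 1"
proof -
  interpret pt: prob_space "tk s y" by (rule prob_space_tk[OF s])
  have sm[measurable]: "sojourn N \<in> borel_measurable borel" by (rule sojourn_measurable[OF N])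
  note [measurable] = D
  have "sojourn N y + c * emeasure (tk s y) D \<le> (\<integral>\<^sup>+z. sojourn N z \<partial>tk s y) + (\<integral>\<^sup>+z. c * indicator D z \<partial>tk s y)"
    using sojourn_subinvariant[OF s N, of y] by (intro add_mono) (auto simp: nn_integral_cmult_indicator)
  also have "\<dots> = (\<integral>\<^sup>+z. sojourn N z + c * indicator D z \<partial>tk s y)"
    by (rule nn_integral_add[symmetric]) auto
  also have "\<dots> \<le> (\<integral>\<^sup>+z. 1 \<partial>tk s y)" by (intro nn_integral_mono De)
  also have "\<dots> = 1" using pt.emeasure_space_1 by simp
  finally show ?thesis .
qed

text \<open>
  The sets where \<open>sojourn N\<close> is at most \<open>1 - 1 / (j + 1)\<close> exhaust the
  space, so one of them is charged by the minorising measure of the petite set; the gap there is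
  felt uniformly on \<open>C\<close>.
\<close>

lemma sojourn_bound_petite:
  assumes N: "N \<in> sets borel" and lt: "\<And>y. sojourn N y < 1"
    and C: "petite P X C"
  obtains c where "0 < c" "\<And>y. y \<in> C \<Longrightarrow> sojourn N y + ennreal c \<le> 1"
proof -
  from C obtain p m where p: "prob_space p" "sets p = sets (borel :: real measure)" "emeasure p {0..} = 1"
    and m: "sets m = sets borel" "emeasure m UNIV \<noteq> 0"
    and pm: "\<And>x D. x \<in> C \<Longrightarrow> D \<in> sets borel \<Longrightarrow> (\<integral>\<^sup>+t\<in>{0..}. emeasure (tk t x) D \<partial>p) \<ge> emeasure m D"
    unfolding petite_def by blast
  note [measurable_cong] = p(2) m(1)
  have sm[measurable]: "sojourn N \<in> borel_measurable borel" by (rule sojourn_measurable[OF N])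
  define D where "D j = {y. sojourn N y + ennreal (1 / real (Suc j)) \<le> 1}" for j
  have Dm[measurable]: "D j \<in> sets borel" for j unfolding D_def by measurable
  have U: "(\<Union>j. D j) = UNIV"
  proof safe
    fix y
    obtain r where r: "sojourn N y = ennreal r" "0 \<le> r" using sojourn_le_1[of N y] by (cases "sojourn N y") (auto simp: top_unique)
    have "r < 1" using lt[of y] r by simp
    then obtain j where j: "1 / real (Suc j) < 1 - r" using nat_approx_posE[of "1 - r"] by auto
    have "sojourn N y + ennreal (1 / real (Suc j)) = ennreal (r + 1 / real (Suc j))" using r by (simp add: ennreal_plus)
    also have "\<dots> \<le> 1" using j by simp
    finally show "y \<in> (\<Union>j. D j)" unfolding D_def by auto
  qed auto
  have "\<exists>j. emeasure m (D j) \<noteq> 0"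
  proof (rule ccontr)
    assume "\<not> ?thesis"
    then have "(\<Union>j. D j) \<in> null_sets m" using m(1) by (intro null_sets_UN) (auto simp: null_sets_def)
    then show False using m(2) by (simp add: U null_sets_def)
  qed
  then obtain j where j: "emeasure m (D j) \<noteq> 0" by blast
  define e where "e = 1 / real (Suc j)"
  have e: "0 < e" by (simp add: e_def)
  have De: "sojourn N z + ennreal e * indicator (D j) z \<le> 1" for z
    using sojourn_le_1[of N z] by (auto simp: D_def e_def split: split_indicator)
  note step = sojourn_step[OF N Dm De]
  have main: "sojourn N y + ennreal e * emeasure m (D j) \<le> 1" if y: "y \<in> C" for y
  proof -
    interpret p: prob_space p by fact
    have spp: "space p = UNIV" using sets_eq_imp_space_eq[OF p(2)] by simp
    have tm[measurable]: "(\<lambda>s. emeasure (tk (max 0 s) y) (D j)) \<in> borel_measurable borel" by (rule tk_time_measurable) simp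
    have pmax: "(\<integral>\<^sup>+t\<in>{0..}. emeasure (tk t y) (D j) \<partial>p) = (\<integral>\<^sup>+t\<in>{0..}. emeasure (tk (max 0 t) y) (D j) \<partial>p)"
      by (intro nn_integral_cong) (auto simp: max_def split: split_indicator)
    have "sojourn N y + ennreal e * emeasure m (D j) \<le> sojourn N y * emeasure p {0..} + ennreal e * (\<integral>\<^sup>+t\<in>{0..}. emeasure (tk (max 0 t) y) (D j) \<partial>p)"
      using pm[OF y Dm, of j] p(3) by (intro add_mono mult_left_mono) (auto simp: pmax)
    also have "\<dots> = (\<integral>\<^sup>+t. sojourn N y * indicator {0..} t + ennreal e * (emeasure (tk (max 0 t) y) (D j) * indicator {0..} t) \<partial>p)"
      by (subst nn_integral_add) (auto simp: nn_integral_cmult nn_integral_cmult_indicator p(2))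
    also have "\<dots> \<le> (\<integral>\<^sup>+t. 1 \<partial>p)"
      using step by (intro nn_integral_mono) (auto split: split_indicator)
    also have "\<dots> = 1" using p.emeasure_space_1 spp by simp
    finally show ?thesis .
  qed
  show ?thesis
  proof (cases "emeasure m (D j)")
    case (real r)
    then have r: "0 < r" using j by (cases "r = 0") auto
    show ?thesis
    proof (rule that[of "e * r"])
      show "0 < e * r" using e r by simp
      fix y assume "y \<in> C"
      from main[OF this] show "sojourn N y + ennreal (e * r) \<le> 1" using real e r by (simp add: ennreal_mult)
    qed
  next
    case top
    show ?thesis
    proof (rule that[of 1])
      fix y assume "y \<in> C"
      from main[OF this] top e show "sojourn N y + ennreal 1 \<le> 1" by (simp add: ennreal_mult_top top_unique)
    qed simp
  qed
qed

text \<open>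
  The drift makes the process spend at least the fraction \<open>a\<close> of a long time in
  \<open>C\<close>, and the gap \<open>c\<close> on \<open>C\<close> is felt during this fraction of
  the time.
\<close>

lemma sojourn_drift_bound:
  assumes N: "N \<in> sets borel" and C: "C \<in> sets borel" "0 < c" "\<And>y. y \<in> C \<Longrightarrow> sojourn N y + ennreal c \<le> 1"
    and a: "0 < a" and drift: "\<And>t. 0 \<le> t \<Longrightarrow> ennreal (a * t) \<le> ennreal w + (\<integral>\<^sup>+s\<in>{0..t}. emeasure (tk (max 0 s) x) C \<partial>lborel)"
    and w: "0 \<le> w"
  shows "sojourn N x + ennreal (c * a) \<le> 1"
proof -
  note [measurable] = C(1)
  have tm[measurable]: "(\<lambda>s. emeasure (tk (max 0 s) x) C) \<in> borel_measurable borel" by (rule tk_time_measurable) simp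
  have Ce: "sojourn N z + ennreal c * indicator C z \<le> 1" for z
    using sojourn_le_1[of N z] C(3) by (auto split: split_indicator)
  note step = sojourn_step[OF N C(1) Ce]
  obtain r where r: "sojourn N x = ennreal r" "0 \<le> r" using sojourn_le_1[of N x] by (cases "sojourn N x") (auto simp: top_unique)
  have stepx: "ennreal r + ennreal c * emeasure (tk s x) C \<le> 1" if "0 \<le> s" for s
    using step[OF that, of x] r by simp
  have main: "t * r + c * (a * t) \<le> t + c * w" if t: "0 \<le> t" for t
  proof -
    let ?I = "\<integral>\<^sup>+s\<in>{0..t}. emeasure (tk (max 0 s) x) C \<partial>lborel"
    have "ennreal t * ennreal r + ennreal c * ?I =
        (\<integral>\<^sup>+s. ennreal r * indicator {0..t} s + ennreal c * (emeasure (tk (max 0 s) x) C * indicator {0..t} s) \<partial>lborel)"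
      using t by (subst nn_integral_add) (auto simp: nn_integral_cmult nn_integral_cmult_indicator mult.commute)
    also have "\<dots> \<le> (\<integral>\<^sup>+s. indicator {0..t} s \<partial>lborel)"
      using stepx by (intro nn_integral_mono) (auto split: split_indicator)
    also have "\<dots> = ennreal t" using t by simp
    finally have 1: "ennreal t * ennreal r + ennreal c * ?I \<le> ennreal t" .
    have "ennreal (t * r + c * (a * t)) = ennreal t * ennreal r + ennreal c * ennreal (a * t)"
      using t r C(2) a by (simp add: ennreal_mult)
    also have "\<dots> \<le> ennreal t * ennreal r + ennreal c * (ennreal w + ?I)"
      by (intro add_left_mono mult_left_mono drift t) auto
    also have "\<dots> = ennreal c * ennreal w + (ennreal t * ennreal r + ennreal c * ?I)"
      by (simp only: distrib_left add_ac)
    also have "\<dots> \<le> ennreal c * ennreal w + ennreal t" by (intro add_left_mono 1)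
    also have "\<dots> = ennreal (t + c * w)" using t C(2) w by (simp add: ennreal_mult add.commute)
    finally show ?thesis using t C(2) w by (subst (asm) ennreal_le_iff) auto
  qed
  have "r + c * a \<le> 1"
  proof (rule ccontr)
    assume "\<not> r + c * a \<le> 1"
    then have d: "0 < r + c * a - 1" by simp
    \<comment> \<open>A time at which the linear growth of the drift has overtaken the initial value \<open>w\<close>.\<close>
    define t where "t = c * w / (r + c * a - 1) + 1"
    have t0: "0 \<le> t" using d C(2) w by (simp add: t_def)
    have "t * (r + c * a - 1) = c * w + (r + c * a - 1)" using d by (simp add: t_def distrib_right)
    with main[OF t0] d show False by (simp add: algebra_simps)
  qed
  then have "ennreal (r + c * a) \<le> 1" by simp
  then show ?thesis using r C(2) a by simp
qed

text \<open>
  Off the absorbing complement \<open>sojourn N\<close> vanishes, and on \<open>N\<close> it is at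
  most some \<open>\<rho> < 1\<close>. By subinvariance a value \<open>r\<close> at \<open>x\<close>
  therefore requires the process to be in \<open>N\<close> at every time with probability at least
  \<open>r / \<rho>\<close>, whence the fraction \<open>r\<close> of time in \<open>N\<close> is at
  least \<open>r / \<rho>\<close>. This forces \<open>r = 0\<close>.
\<close>

theorem cesaro_null_of_drift:
  assumes irr: "irreducible_process P X \<psi>" and C: "petite P X C" "C \<in> sets borel"
    and a: "0 < a" and w: "\<And>x. 0 \<le> w x"
    and drift: "\<And>x t. 0 \<le> t \<Longrightarrow> ennreal (a * t) \<le> ennreal (w x) + (\<integral>\<^sup>+s\<in>{0..t}. emeasure (tk (max 0 s) x) C \<partial>lborel)"
    and N0: "N0 \<in> null_sets \<mu>"
  shows "(\<lambda>m. emeasure (cesaro (real m) x) N0) \<longlonglongrightarrow> 0"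
proof -
  obtain N where N: "N \<in> null_sets \<mu>" "N0 \<subseteq> N" "\<And>x. x \<notin> N \<Longrightarrow> occupation P X x N = 0"
    using null_set_absorbing_complement[OF N0] by metis
  have Nb[measurable]: "N \<in> sets borel" and N0b: "N0 \<in> sets borel" using N N0 by auto
  have off: "sojourn N y = 0" if "y \<notin> N" for y by (rule sojourn_off_absorbing[OF Nb N(3)[OF that]])
  have ind: "sojourn N y \<le> indicator N y" for y
    using off[of y] sojourn_le_1[of N y] by (auto split: split_indicator)
  have lt: "sojourn N y < 1" for y
  proof (rule ccontr)
    assume "\<not> sojourn N y < 1"
    then have one: "1 \<le> sojourn N y" by simp
    have "emeasure (tk s y) (- N) = 0" if s: "0 \<le> s" for s
    proof -
      interpret pt: prob_space "tk s y" by (rule prob_space_tk[OF s])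
      have "1 \<le> (\<integral>\<^sup>+z. sojourn N z \<partial>tk s y)" using one sojourn_subinvariant[OF s Nb, of y] by order
      also have "\<dots> \<le> (\<integral>\<^sup>+z. indicator N z \<partial>tk s y)" by (intro nn_integral_mono ind)
      finally have "1 \<le> emeasure (tk s y) N" by simp
      then have "pt.prob N = 1" using pt.prob_le_1[of N] by (simp add: pt.emeasure_eq_measure)
      then have "pt.prob (- N) = 0" using pt.prob_compl[of N] by (simp add: Compl_eq_Diff_UNIV)
      then show ?thesis by (simp add: pt.emeasure_eq_measure)
    qed
    then have "occupation P X y (- N) = (\<integral>\<^sup>+t. 0 \<partial>(lborel :: real measure))"
      unfolding occupation_def by (intro nn_integral_cong) (auto split: split_indicator)
    then show False using irreducible_charges_conull[OF irr N(1), of y] by simp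
  qed
  obtain c where c: "0 < c" "\<And>y. y \<in> C \<Longrightarrow> sojourn N y + ennreal c \<le> 1"
    using sojourn_bound_petite[OF Nb lt C(1)] by blast
  have unif: "sojourn N y + ennreal (c * a) \<le> 1" for y
    by (rule sojourn_drift_bound[OF Nb C(2) c a drift w])
  have zero: "sojourn N x = 0"
  proof (rule ccontr)
    assume nz: "sojourn N x \<noteq> 0"
    define \<rho> where "\<rho> = 1 - c * a"
    have fin: "\<exists>q. sojourn N z = ennreal q \<and> 0 \<le> q \<and> q \<le> \<rho>" for z
    proof -
      obtain q where q: "sojourn N z = ennreal q" "0 \<le> q" using sojourn_le_1[of N z] by (cases "sojourn N z") (auto simp: top_unique)
      have "ennreal (q + c * a) \<le> 1" using unif[of z] q c(1) a by (simp add: ennreal_plus)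
      then show ?thesis using q by (auto simp: \<rho>_def)
    qed
    obtain r where r: "sojourn N x = ennreal r" "0 \<le> r" "r \<le> \<rho>" using fin by blast
    have r0: "0 < r" using r nz by (cases "r = 0") auto
    have unif': "sojourn N y \<le> ennreal \<rho> * indicator N y" for y
      using off[of y] fin[of y] by (auto intro: ennreal_leI split: split_indicator)
    have \<rho>: "0 < \<rho>" "\<rho> < 1" using r(3) r0 c(1) a by (auto simp: \<rho>_def)
    have le_c: "ennreal (r / \<rho>) \<le> emeasure (cesaro (real (Suc m)) x) N" for m
    proof -
      define T where "T = real (Suc m)"
      have T: "0 < T" by (simp add: T_def)
      have tm[measurable]: "(\<lambda>s. emeasure (tk (max 0 s) x) N) \<in> borel_measurable borel" by (rule tk_time_measurable) simp
      have st: "ennreal r \<le> ennreal \<rho> * emeasure (tk s x) N" if s: "0 \<le> s" for s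
      proof -
        have "ennreal r \<le> (\<integral>\<^sup>+z. sojourn N z \<partial>tk s x)" using sojourn_subinvariant[OF s Nb, of x] r by simp
        also have "\<dots> \<le> (\<integral>\<^sup>+z. ennreal \<rho> * indicator N z \<partial>tk s x)" by (intro nn_integral_mono unif')
        also have "\<dots> = ennreal \<rho> * emeasure (tk s x) N" by (simp add: nn_integral_cmult_indicator)
        finally show ?thesis .
      qed
      have "ennreal (r * T) = (\<integral>\<^sup>+s. ennreal r * indicator {0..T} s \<partial>lborel)"
        using T r by (simp add: nn_integral_cmult_indicator ennreal_mult)
      also have "\<dots> \<le> (\<integral>\<^sup>+s. ennreal \<rho> * (emeasure (tk (max 0 s) x) N * indicator {0..T} s) \<partial>lborel)"
        using st by (intro nn_integral_mono) (auto split: split_indicator)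
      also have "\<dots> = ennreal \<rho> * (\<integral>\<^sup>+s\<in>{0..T}. emeasure (tk (max 0 s) x) N \<partial>lborel)"
        by (rule nn_integral_cmult) measurable
      finally have "ennreal (r * T) / ennreal T \<le> ennreal \<rho> * (\<integral>\<^sup>+s\<in>{0..T}. emeasure (tk (max 0 s) x) N \<partial>lborel) / ennreal T"
        by (rule divide_right_mono_ennreal)
      also have "\<dots> = ennreal \<rho> * emeasure (cesaro T x) N"
        unfolding emeasure_cesaro[OF T Nb] by (simp add: ennreal_times_divide)
      also have "ennreal (r * T) / ennreal T = ennreal r"
        using r(2) T by (subst divide_ennreal) auto
      finally have 1: "ennreal r \<le> ennreal \<rho> * emeasure (cesaro T x) N" .
      interpret ce: prob_space "cesaro T x" by (rule prob_space_cesaro[OF T])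
      have "r \<le> \<rho> * ce.prob N" using 1 r(2) \<rho> by (simp add: ce.emeasure_eq_measure ennreal_mult[symmetric])
      then show ?thesis unfolding T_def[symmetric] using \<rho> by (simp add: ce.emeasure_eq_measure pos_divide_le_eq mult.commute)
    qed
    have "ennreal (r / \<rho>) \<le> sojourn N x"
      unfolding sojourn_def by (rule le_Limsup, simp, rule always_eventually, rule allI, rule le_c)
    then have "r / \<rho> \<le> r" using r \<rho> by (simp add: ennreal_le_iff)
    then have "r \<le> r * \<rho>" using \<rho> by (simp add: pos_divide_le_eq)
    then show False using r0 \<rho> by simp
  qed
  have lim: "(\<lambda>m. emeasure (cesaro (real (Suc m)) x) N) \<longlonglongrightarrow> 0"
    using zero unfolding sojourn_def by (rule tendsto_0_if_Limsup_eq_0_ennreal)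
  have "(\<lambda>m. emeasure (cesaro (real (Suc m)) x) N0) \<longlonglongrightarrow> 0"
    by (rule tendsto_sandwich[OF _ _ tendsto_const lim]) (use N(2) in \<open>auto intro!: emeasure_mono always_eventually\<close>)
  then show ?thesis by (rule LIMSEQ_imp_Suc)
qed

text \<open>
  Taking expectations in the localised martingale and dropping \<open>V\<close> at the stopped time
  bounds \<open>b\<close> times the expected stopping time by \<open>V x\<close> plus
  \<open>\<kappa>\<close> times the expected time in \<open>C\<close>; then the localisation is
  removed by dominated convergence.
\<close>

lemma drift_of_extended_generator:
  assumes gen: "extended_generator \<Omega> P X V LV" and V: "\<And>x. 0 \<le> V x"
    and L: "\<And>x. LV x \<le> - b + \<kappa> * indicator C x" and C: "C \<in> sets borel" and b: "0 < b" and \<kappa>: "0 < \<kappa>" and t: "0 \<le> t"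
  shows "ennreal (b / \<kappa> * t) \<le> ennreal (V x / \<kappa>) + (\<integral>\<^sup>+s\<in>{0..t}. emeasure (tk (max 0 s) x) C \<partial>lborel)"
proof -
  interpret Px: prob_space "P x" by (rule prob_space_P)
  let ?F = "natural_filtration \<Omega> X"
  let ?M = "dynkin_process X V LV"
  note C[measurable]
  have int: "AE \<omega> in P x. \<forall>t\<ge>0. set_integrable lborel {0..t} (\<lambda>s. LV (X s \<omega>))"
    and lm: "is_local_martingale (P x) ?F ?M"
    using gen unfolding extended_generator_def by blast+
  from lm obtain \<tau> :: "nat \<Rightarrow> 'w \<Rightarrow> real" where
    st: "\<And>n. stopping_time ?F (\<tau> n)" and \<tau>0: "\<And>n \<omega>. \<omega> \<in> space \<Omega> \<Longrightarrow> 0 \<le> \<tau> n \<omega>"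
    and lim': "AE \<omega> in P x. incseq (\<lambda>n. \<tau> n \<omega>) \<and> filterlim (\<lambda>n. \<tau> n \<omega>) at_top sequentially"
    and mart: "\<And>n. is_martingale (P x) ?F (\<lambda>t \<omega>. ?M (min t (\<tau> n \<omega>)) \<omega>)"
    unfolding is_local_martingale_def by auto
  from lim' have lim: "AE \<omega> in P x. filterlim (\<lambda>n. \<tau> n \<omega>) at_top sequentially" by eventually_elim auto
  have \<tau>m[measurable]: "\<tau> n \<in> borel_measurable \<Omega>" for n
    by (rule measurable_stopping_time[OF st]) (auto simp: natural_filtration_subset)
  let ?O = "abs_integral (indicator C) 0 t"
  have Om[measurable]: "?O \<in> borel_measurable \<Omega>" by (rule abs_integral_measurable) auto
  have O_le: "?O \<omega> \<le> ennreal t" for \<omega>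
  proof -
    have "?O \<omega> \<le> (\<integral>\<^sup>+u. indicator {0..t} u \<partial>lborel)"
      unfolding abs_integral_def by (intro nn_integral_mono) (auto split: split_indicator)
    then show ?thesis using t by simp
  qed
  define O' where "O' \<omega> = enn2real (?O \<omega>)" for \<omega>
  have O': "?O \<omega> = ennreal (O' \<omega>)" "0 \<le> O' \<omega>" "O' \<omega> \<le> t" for \<omega>
  proof -
    have "?O \<omega> < top" using O_le[of \<omega>] by (rule le_less_trans) simp
    then show 1: "?O \<omega> = ennreal (O' \<omega>)" unfolding O'_def by simp
    show 2: "0 \<le> O' \<omega>" by (simp add: O'_def)
    show "O' \<omega> \<le> t" using O_le[of \<omega>] t unfolding 1 by simp
  qed
  have O'm[measurable]: "O' \<in> borel_measurable \<Omega>" unfolding O'_def by measurable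
  have iO': "integrable (P x) O'" using O' by (intro Px.integrable_const_bound[where B=t]) auto
  have i\<tau>: "integrable (P x) (\<lambda>\<omega>. min t (\<tau> n \<omega>))" for n
    using \<tau>0 t by (intro Px.integrable_const_bound[where B=t] AE_I2) (auto simp: min_def)
  have bound: "b * (\<integral>\<omega>. min t (\<tau> n \<omega>) \<partial>P x) \<le> V x + \<kappa> * (\<integral>\<omega>. O' \<omega> \<partial>P x)" for n
  proof -
    let ?N = "\<lambda>t \<omega>. ?M (min t (\<tau> n \<omega>)) \<omega>"
    have iN: "integrable (P x) (?N t)" using mart[of n] t by (auto simp: is_martingale_def)
    have "(\<integral>\<omega>. ?N t \<omega> \<partial>P x) = (\<integral>\<omega>. ?N 0 \<omega> \<partial>P x)"
      by (rule martingale_expectation[OF mart t])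
    also have "\<dots> = (\<integral>\<omega>. 0 \<partial>P x)"
      using \<tau>0 by (intro Bochner_Integration.integral_cong) (simp_all add: dynkin_process_0 min_absorb1)
    finally have E0: "(\<integral>\<omega>. ?N t \<omega> \<partial>P x) = 0" by simp
    have iL: "integrable (P x) (\<lambda>\<omega>. - V x + b * min t (\<tau> n \<omega>) - \<kappa> * O' \<omega>)"
      using i\<tau>[of n] iO' by auto
    have "(\<integral>\<omega>. - V x + b * min t (\<tau> n \<omega>) - \<kappa> * O' \<omega> \<partial>P x) \<le> (\<integral>\<omega>. ?N t \<omega> \<partial>P x)"
    proof (rule integral_mono_AE[OF iL iN])
      show "AE \<omega> in P x. - V x + b * min t (\<tau> n \<omega>) - \<kappa> * O' \<omega> \<le> ?N t \<omega>"
        using int X_start[of x] AE_space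
      proof eventually_elim
        case (elim \<omega>)
        define T where "T = min t (\<tau> n \<omega>)"
        have \<omega>: "\<omega> \<in> space \<Omega>" using elim(3) by simp
        have T: "0 \<le> T" "T \<le> t" using t \<tau>0[OF \<omega>] by (auto simp: T_def)
        have ind_m: "(\<lambda>u. indicator {0..T} u * indicator C (X u \<omega>) :: real) \<in> borel_measurable lborel"
        proof -
          have [measurable]: "(\<lambda>u. X (max 0 u) \<omega>) \<in> borel_measurable borel" by (rule X_path_measurable[OF \<omega>])
          have "(\<lambda>u. indicator {0..T} u * indicator C (X (max 0 u) \<omega>) :: real) \<in> borel_measurable lborel"
            by measurable
          then show ?thesis by (rule measurable_cong[THEN iffD1, rotated]) (auto split: split_indicator simp: max_def)
        qed
        have i2: "integrable lborel (indicator {0..T} :: real \<Rightarrow> real)" by (rule integrable_real_indicator) (use T in auto)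
        have i1: "integrable lborel (\<lambda>u. indicator {0..T} u * indicator C (X u \<omega>) :: real)"
          by (rule Bochner_Integration.integrable_bound[OF i2 ind_m]) (auto split: split_indicator)
        have "(LINT s:{0..T}|lborel. LV (X s \<omega>)) \<le> (\<integral>u. - b * indicator {0..T} u + \<kappa> * (indicator {0..T} u * indicator C (X u \<omega>)) \<partial>lborel)"
          unfolding set_lebesgue_integral_def
        proof (rule integral_mono)
          show "integrable lborel (\<lambda>s. indicator {0..T} s *\<^sub>R LV (X s \<omega>))"
            using elim(1) T(1) unfolding set_integrable_def by blast
          show "integrable lborel (\<lambda>u. - b * indicator {0..T} u + \<kappa> * (indicator {0..T} u * indicator C (X u \<omega>)))"
            using i1 i2 by auto
          show "indicator {0..T} s *\<^sub>R LV (X s \<omega>) \<le> - b * indicator {0..T} s + \<kappa> * (indicator {0..T} s * indicator C (X s \<omega>))" for s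
            using L[of "X s \<omega>"] by (auto split: split_indicator)
        qed
        also have "\<dots> = - b * T + \<kappa> * (\<integral>u. indicator {0..T} u * indicator C (X u \<omega>) \<partial>lborel)"
          using i1 i2 T(1) by simp
        also have "\<dots> \<le> - b * T + \<kappa> * O' \<omega>"
        proof -
          have "ennreal (\<integral>u. indicator {0..T} u * indicator C (X u \<omega>) \<partial>lborel) = (\<integral>\<^sup>+u. ennreal (indicator {0..T} u * indicator C (X u \<omega>)) \<partial>lborel)"
            by (rule nn_integral_eq_integral[OF i1, symmetric]) auto
          also have "\<dots> \<le> ?O \<omega>"
            unfolding abs_integral_def using T by (intro nn_integral_mono) (auto split: split_indicator)
          finally have "(\<integral>u. indicator {0..T} u * indicator C (X u \<omega>) \<partial>lborel) \<le> O' \<omega>" using O'(1,2)[of \<omega>] by simp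
          then show ?thesis using \<kappa> by simp
        qed
        finally have "(LINT s:{0..T}|lborel. LV (X s \<omega>)) \<le> - b * T + \<kappa> * O' \<omega>" .
        then show ?case using V[of "X T \<omega>"] elim(2) unfolding T_def[symmetric] by (simp add: dynkin_process_def)
      qed
    qed
    also have "(\<integral>\<omega>. - V x + b * min t (\<tau> n \<omega>) - \<kappa> * O' \<omega> \<partial>P x) = - V x + b * (\<integral>\<omega>. min t (\<tau> n \<omega>) \<partial>P x) - \<kappa> * (\<integral>\<omega>. O' \<omega> \<partial>P x)"
      using i\<tau>[of n] iO' Px.prob_space by simp
    finally show ?thesis using E0 by simp
  qed
  have "(\<lambda>n. \<integral>\<omega>. min t (\<tau> n \<omega>) \<partial>P x) \<longlonglongrightarrow> (\<integral>\<omega>. t \<partial>P x)"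
  proof (rule integral_dominated_convergence[where w="\<lambda>_. t"])
    show "AE \<omega> in P x. (\<lambda>n. min t (\<tau> n \<omega>)) \<longlonglongrightarrow> t"
      using lim
    proof eventually_elim
      case (elim \<omega>)
      then have "\<forall>\<^sub>F n in sequentially. t \<le> \<tau> n \<omega>" by (simp add: filterlim_at_top)
      then have "\<forall>\<^sub>F n in sequentially. min t (\<tau> n \<omega>) = t" by eventually_elim simp
      then show ?case by (rule tendsto_eventually)
    qed
    show "AE \<omega> in P x. norm (min t (\<tau> n \<omega>)) \<le> t" for n
      using \<tau>0 t by (intro AE_I2) (auto simp: min_def)
  qed auto
  then have "(\<lambda>n. b * (\<integral>\<omega>. min t (\<tau> n \<omega>) \<partial>P x)) \<longlonglongrightarrow> b * (\<integral>\<omega>. t \<partial>P x)" by (intro tendsto_mult tendsto_const)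
  then have "(\<lambda>n. b * (\<integral>\<omega>. min t (\<tau> n \<omega>) \<partial>P x)) \<longlonglongrightarrow> b * t" using Px.prob_space by simp
  then have le: "b * t \<le> V x + \<kappa> * (\<integral>\<omega>. O' \<omega> \<partial>P x)" using bound by (intro LIMSEQ_le_const2) auto
  have EO: "ennreal (\<integral>\<omega>. O' \<omega> \<partial>P x) = (\<integral>\<^sup>+s\<in>{0..t}. emeasure (tk (max 0 s) x) C \<partial>lborel)"
  proof -
    have "ennreal (\<integral>\<omega>. O' \<omega> \<partial>P x) = (\<integral>\<^sup>+\<omega>. ?O \<omega> \<partial>P x)"
      unfolding O'(1) by (rule nn_integral_eq_integral[OF iO', symmetric]) (simp add: O')
    also have "\<dots> = (\<integral>\<^sup>+u\<in>{0..t}. (\<integral>\<^sup>+z. ennreal \<bar>indicator C z\<bar> \<partial>tk (max 0 u) x) \<partial>lborel)"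
      by (rule expected_abs_integral_from) auto
    also have "\<dots> = (\<integral>\<^sup>+s\<in>{0..t}. emeasure (tk (max 0 s) x) C \<partial>lborel)"
      by (intro nn_integral_cong) (simp add: ennreal_indicator)
    finally show ?thesis .
  qed
  have "b / \<kappa> * t \<le> V x / \<kappa> + (\<integral>\<omega>. O' \<omega> \<partial>P x)"
    using le \<kappa> by (simp add: field_simps)
  then have "ennreal (b / \<kappa> * t) \<le> ennreal (V x / \<kappa> + (\<integral>\<omega>. O' \<omega> \<partial>P x))" by (rule ennreal_leI)
  also have "\<dots> = ennreal (V x / \<kappa>) + ennreal (\<integral>\<omega>. O' \<omega> \<partial>P x)"
    using V[of x] \<kappa> O'(2) by (intro ennreal_plus) (auto intro!: integral_nonneg_AE)
  finally show ?thesis unfolding EO .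
qed

end

section \<open>Smooth bump functions\<close>

lemma partial_deriv_eq: "(g has_derivative g') (at x) \<Longrightarrow> partial_deriv i g x = g' (axis i 1)"
  by (simp add: partial_deriv_def frechet_derivative_at[symmetric])

text \<open>
  The inductive definition of \<open>C_k\<close> refers to Frechet derivatives chosen by
  description; this rule allows any derivative that has been computed.
\<close>

lemma C_k_SucI:
  assumes "\<And>x. (g has_derivative G x) (at x)" "\<And>i. C_k k (\<lambda>x. G x (axis i 1))"
  shows "C_k (Suc k) g"
proof -
  have "partial_deriv i g = (\<lambda>x. G x (axis i 1))" for i
    using partial_deriv_eq[OF assms(1)] by auto
  moreover have "g differentiable_on UNIV"
    using assms(1) by (auto simp: differentiable_on_def differentiable_def)
  ultimately show ?thesis using assms(2) by simp
qed

lemma C_k_has_derivative: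
  assumes "C_k (Suc k) g"
  shows "(g has_derivative frechet_derivative g (at x)) (at x)"
  using assms by (auto simp: differentiable_on_def frechet_derivative_works[symmetric])

lemma C_k_partial_deriv: "C_k (Suc k) g \<Longrightarrow> C_k k (\<lambda>x. frechet_derivative g (at x) (axis i 1))"
proof -
  assume "C_k (Suc k) g"
  moreover have "(\<lambda>x. frechet_derivative g (at x) (axis i 1)) = partial_deriv i g" by (simp add: partial_deriv_def fun_eq_iff)
  ultimately show ?thesis by simp
qed

lemma C_k_Suc_imp: "C_k (Suc k) g \<Longrightarrow> C_k k g"
proof (induction k arbitrary: g)
  case 0
  then show ?case by (auto intro: differentiable_imp_continuous_on)
next
  case (Suc k)
  then show ?case by (metis C_k.simps(2))
qed

lemma C_k_const: "C_k k (\<lambda>x. c)"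
proof (induction k arbitrary: c)
  case (Suc k)
  show ?case by (rule C_k_SucI[where G="\<lambda>_ _. 0"]) (auto simp: Suc)
qed simp

lemma C_k_add: "C_k k f \<Longrightarrow> C_k k g \<Longrightarrow> C_k k (\<lambda>x. f x + g x)"
proof (induction k arbitrary: f g)
  case (Suc k)
  show ?case
    by (rule C_k_SucI[OF has_derivative_add[OF C_k_has_derivative[OF Suc.prems(1)] C_k_has_derivative[OF Suc.prems(2)]]])
       (intro Suc.IH C_k_partial_deriv Suc.prems)
qed (simp add: continuous_on_add)

lemma C_k_mult: "C_k k f \<Longrightarrow> C_k k g \<Longrightarrow> C_k k (\<lambda>x. f x * g x)"
proof (induction k arbitrary: f g)
  case (Suc k)
  show ?case
    by (rule C_k_SucI[OF has_derivative_mult[OF C_k_has_derivative[OF Suc.prems(1)] C_k_has_derivative[OF Suc.prems(2)]]])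
       (intro C_k_add Suc.IH C_k_partial_deriv Suc.prems C_k_Suc_imp)
qed (simp add: continuous_on_mult)

lemma C_k_component: "C_k k (\<lambda>x::real^'d. x $ i)"
proof (cases k)
  case 0
  then show ?thesis by (simp add: continuous_intros)
next
  case (Suc k')
  show ?thesis unfolding Suc
  proof (rule C_k_SucI)
    show "((\<lambda>x. x $ i) has_derivative (\<lambda>h. h $ i)) (at x)" for x :: "real^'d"
      by (rule bounded_linear_imp_has_derivative[OF bounded_linear_vec_nth])
  qed (rule C_k_const)
qed

lemma C_k_sum: "finite I \<Longrightarrow> (\<And>i. i \<in> I \<Longrightarrow> C_k k (f i)) \<Longrightarrow> C_k k (\<lambda>x. \<Sum>i\<in>I. f i x)"
  by (induction I rule: finite_induct) (auto intro!: C_k_const C_k_add)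

text \<open>
  The derivatives of \<open>flat_exp 0\<close>, the standard function that is flat at
  \<open>0\<close>, are combinations of these functions, because the derivative of each of them is
  (\<open>flat_deriv\<close>).
\<close>

definition flat_exp :: "nat \<Rightarrow> real \<Rightarrow> real" where
  "flat_exp n s = (if 0 < s then exp (- inverse s) * inverse s ^ n else 0)"

lemma flat_nonneg: "0 \<le> flat_exp n s" by (simp add: flat_exp_def)

lemma flat_nonpos [simp]: "s \<le> 0 \<Longrightarrow> flat_exp n s = 0" by (simp add: flat_exp_def)

text \<open>
  The term \<open>u ^ n / fact n\<close> of the exponential series is at most \<open>exp u\<close>;
  here \<open>u = 1 / s\<close>.
\<close>

lemma flat_le_fact: "flat_exp n s \<le> fact n"
proof (cases "0 < s")
  case True
  define x where "x = inverse s"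
  have x: "0 < x" using True by (simp add: x_def)
  have "(\<Sum>k\<in>{n}. x ^ k /\<^sub>R fact k) \<le> (\<Sum>k. x ^ k /\<^sub>R fact k)"
    using x summable_exp_generic[of x] by (intro sum_le_suminf) auto
  then have "x ^ n / fact n \<le> exp x" by (simp add: exp_def divide_inverse mult.commute)
  then have "x ^ n \<le> fact n * exp x" by (simp add: field_simps)
  then have "exp (- x) * x ^ n \<le> exp (- x) * (fact n * exp x)" by (intro mult_left_mono) auto
  also have "\<dots> = fact n" by (simp add: exp_minus field_simps)
  finally show ?thesis using True by (simp add: flat_exp_def x_def)
qed simp

lemma flat_shift: "flat_exp n s = s * flat_exp (Suc n) s"
  by (simp add: flat_exp_def)

lemma flat_le_linear: "\<bar>flat_exp n s\<bar> \<le> fact (Suc n) * \<bar>s\<bar>"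
proof -
  have "\<bar>flat_exp n s\<bar> = \<bar>s\<bar> * flat_exp (Suc n) s"
    using flat_nonneg[of "Suc n" s] by (subst flat_shift) (simp add: abs_mult)
  also have "\<dots> \<le> \<bar>s\<bar> * fact (Suc n)" by (intro mult_left_mono flat_le_fact) auto
  finally show ?thesis by (simp add: mult.commute)
qed

text \<open>
  At \<open>0\<close> the difference quotients are bounded by a multiple of
  \<open>\<bar>s\<bar>\<close>, by \<open>flat_shift\<close> and \<open>flat_le_linear\<close>.
\<close>

lemma flat_deriv: "(flat_exp n has_real_derivative (flat_exp (n + 2) s - real n * flat_exp (n + 1) s)) (at s)"
proof -
  consider "s > 0" | "s < 0" | "s = 0" by linarith
  then show ?thesis
  proof cases
    case 1
    have "((\<lambda>s. exp (- inverse s) * inverse s ^ n) has_real_derivative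
        ((exp (- inverse s) * inverse s ^ 2) * inverse s ^ n + exp (- inverse s) * (real n * (inverse s ^ (n - 1) * (- (inverse s ^ 2)))))) (at s)"
      using 1 by (auto intro!: derivative_eq_intros simp: power2_eq_square)
    moreover have "(exp (- inverse s) * inverse s ^ 2) * inverse s ^ n + exp (- inverse s) * (real n * (inverse s ^ (n - 1) * (- (inverse s ^ 2)))) =
        flat_exp (n + 2) s - real n * flat_exp (n + 1) s"
      using 1 by (cases n) (auto simp: flat_exp_def power_add power2_eq_square algebra_simps)
    ultimately have "((\<lambda>s. exp (- inverse s) * inverse s ^ n) has_real_derivative (flat_exp (n + 2) s - real n * flat_exp (n + 1) s)) (at s)"
      by simp
    then show ?thesis
      by (rule has_field_derivative_transform_within_open[of _ _ _ "{0<..}"]) (use 1 in \<open>auto simp: flat_exp_def\<close>)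
  next
    case 2
    have "((\<lambda>_. 0) has_real_derivative (flat_exp (n + 2) s - real n * flat_exp (n + 1) s)) (at s)" using 2 by simp
    then show ?thesis
      by (rule has_field_derivative_transform_within_open[of _ _ _ "{..<0}"]) (use 2 in auto)
  next
    case 3
    have "(\<lambda>h. (flat_exp n (0 + h) - flat_exp n 0) / h) \<midarrow>0\<rightarrow> 0"
    proof (rule Lim_null_comparison)
      show "\<forall>\<^sub>F h in at 0. norm ((flat_exp n (0 + h) - flat_exp n 0) / h) \<le> fact (Suc (Suc n)) * \<bar>h\<bar>"
      proof (rule always_eventually, rule allI)
        fix h :: real
        show "norm ((flat_exp n (0 + h) - flat_exp n 0) / h) \<le> fact (Suc (Suc n)) * \<bar>h\<bar>"
        proof (cases "h = 0")
          case False
          then have "(flat_exp n (0 + h) - flat_exp n 0) / h = flat_exp (Suc n) h" using flat_shift[of n h] by simp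
          then show ?thesis using flat_le_linear[of "Suc n" h] by simp
        qed simp
      qed
      have "((\<lambda>h. fact (Suc (Suc n)) * \<bar>h\<bar>) \<longlongrightarrow> fact (Suc (Suc n)) * \<bar>0::real\<bar>) (at 0)"
        by (intro tendsto_intros)
      then show "((\<lambda>h. fact (Suc (Suc n)) * \<bar>h::real\<bar>) \<longlongrightarrow> 0) (at 0)" by simp
    qed
    then show ?thesis using 3 by (simp add: DERIV_def)
  qed
qed

lemma continuous_flat: "continuous_on S (flat_exp n)"
  by (meson flat_deriv DERIV_isCont continuous_at_imp_continuous_on)

lemma flat_measurable [measurable]: "flat_exp n \<in> borel_measurable borel"
  by (intro borel_measurable_continuous_onI continuous_flat)

text \<open>
  The induction on \<open>k\<close> runs over all \<open>n\<close> at once, since differentiation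
  raises \<open>n\<close>.
\<close>

lemma C_k_flat: "(\<And>j. C_k j q) \<Longrightarrow> C_k k (\<lambda>y. flat_exp n (q y))"
proof (induction k arbitrary: n)
  case 0
  then have "continuous_on UNIV q" using C_k.simps(1) by blast
  then show ?case by (simp add: continuous_on_compose2[OF continuous_flat[of UNIV]])
next
  case (Suc k)
  note q = Suc.prems
  show ?case
  proof (rule C_k_SucI)
    show "((\<lambda>y. flat_exp n (q y)) has_derivative (\<lambda>h. (flat_exp (n + 2) (q x) + (- real n) * flat_exp (n + 1) (q x)) * frechet_derivative q (at x) h)) (at x)" for x
    proof -
      have "(flat_exp n has_derivative (\<lambda>h. (flat_exp (n + 2) (q x) - real n * flat_exp (n + 1) (q x)) * h)) (at (q x))"
        using flat_deriv[of n "q x"] by (simp add: has_field_derivative_def)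
      from diff_chain_at[OF C_k_has_derivative[OF q] this]
      show ?thesis by (simp add: o_def)
    qed
    show "C_k k (\<lambda>x. (flat_exp (n + 2) (q x) + (- real n) * flat_exp (n + 1) (q x)) * frechet_derivative q (at x) (axis i 1))" for i
      by (intro C_k_mult C_k_add C_k_const Suc.IH C_k_partial_deriv q)
  qed
qed

section \<open>The frozen operator and the parametrix\<close>

text \<open>
  Half the squared distance from \<open>y\<close> to \<open>z\<close> at scale \<open>r\<close>, in
  the metric given by \<open>B\<close>.
\<close>

definition width :: "real^'d^'d \<Rightarrow> real^'d \<Rightarrow> real \<Rightarrow> real^'d \<Rightarrow> real" where
  "width B z r y = ((y - z) \<bullet> (B *v (y - z))) / (2 * r\<^sup>2)"

text \<open>
  A primitive of the profile \<open>flat_exp 2\<close> used for the parametrix. Its sign is such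
  that the second order operator with coefficient matrix inverse to \<open>B\<close> maps it to minus the
  derivative of the parametrix in \<open>r\<close>, up to a power of \<open>r\<close>; compare
  \<open>trace_bump\<close> with \<open>scaled_profile_deriv\<close>.
\<close>

definition bump :: "real^'d^'d \<Rightarrow> real^'d \<Rightarrow> real \<Rightarrow> real^'d \<Rightarrow> real" where
  "bump B z r y = - flat_exp 0 (1 - width B z r y)"

lemma width_has_derivative:
  assumes "transpose B = B" and r: "0 < r"
  shows "(width B z r has_derivative (\<lambda>h. (h \<bullet> (B *v (y - z))) / r\<^sup>2)) (at y)"
proof -
  have sym: "(y - z) \<bullet> (B *v h) = h \<bullet> (B *v (y - z))" for h
    using assms(1) by (metis dot_lmul_matrix inner_commute vector_transpose_matrix)
  have "((\<lambda>y. (y - z) \<bullet> (B *v (y - z))) has_derivative (\<lambda>h. (y - z) \<bullet> (B *v h) + h \<bullet> (B *v (y - z)))) (at y)"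
    by (auto intro!: derivative_eq_intros bounded_linear.has_derivative[OF matrix_vector_mul_bounded_linear])
  then have "((\<lambda>y. (y - z) \<bullet> (B *v (y - z))) has_derivative (\<lambda>h. 2 * (h \<bullet> (B *v (y - z))))) (at y)"
    by (simp add: sym)
  then have "((\<lambda>y. ((y - z) \<bullet> (B *v (y - z))) / (2 * r\<^sup>2)) has_derivative (\<lambda>h. (2 * (h \<bullet> (B *v (y - z)))) / (2 * r\<^sup>2))) (at y)"
    by (rule bounded_linear.has_derivative[OF bounded_linear_divide])
  then show ?thesis by (simp add: width_def[abs_def])
qed

lemma C_k_width: "C_k k (width B z r)"
proof -
  have e: "width B z r = (\<lambda>y. (\<Sum>i\<in>UNIV. (y $ i + (- z $ i)) * (\<Sum>j\<in>UNIV. B $ i $ j * (y $ j + (- z $ j)))) * inverse (2 * r\<^sup>2))"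
    unfolding width_def[abs_def] divide_inverse inner_vec_def matrix_vector_mult_def by simp
  show ?thesis unfolding e
    by (intro C_k_sum C_k_mult C_k_add C_k_component C_k_const finite_class.finite_UNIV)
qed

lemma smooth_bump: "smooth (bump B z r)"
proof -
  have "C_k k (bump B z r)" for k
  proof -
    have e: "bump B z r = (\<lambda>y. (- 1) * flat_exp 0 (1 + (- 1) * width B z r y))" by (auto simp: bump_def)
    show ?thesis unfolding e
      by (intro C_k_mult C_k_const C_k_flat C_k_add C_k_width)
  qed
  then show ?thesis by (simp add: smooth_def)
qed

lemma flat_width_has_derivative:
  assumes "transpose B = B" and r: "0 < r"
  shows "((\<lambda>y. flat_exp n (1 - width B z r y)) has_derivative
    (\<lambda>h. - (flat_exp (n + 2) (1 - width B z r y) - real n * flat_exp (n + 1) (1 - width B z r y)) * ((h \<bullet> (B *v (y - z))) / r\<^sup>2))) (at y)"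
proof -
  let ?s = "1 - width B z r y"
  have 1: "((\<lambda>y. 1 - width B z r y) has_derivative (\<lambda>h. - ((h \<bullet> (B *v (y - z))) / r\<^sup>2))) (at y)"
    using has_derivative_diff[OF has_derivative_const width_has_derivative[OF assms]] by simp
  have "(flat_exp n has_derivative (\<lambda>h. (flat_exp (n + 2) ?s - real n * flat_exp (n + 1) ?s) * h)) (at ?s)"
    using flat_deriv[of n ?s] by (simp add: has_field_derivative_def)
  from diff_chain_at[OF 1 this] show ?thesis
    unfolding o_def by (rule has_derivative_eq_rhs) (simp only: mult_minus_left mult_minus_right)
qed

lemma partial_bump:
  assumes "transpose B = B" and r: "0 < r"
  shows "partial_deriv i (bump B z r) y = flat_exp 2 (1 - width B z r y) * (B *v (y - z)) $ i / r\<^sup>2"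
proof -
  have "(bump B z r has_derivative (\<lambda>h. flat_exp 2 (1 - width B z r y) * ((h \<bullet> (B *v (y - z))) / r\<^sup>2))) (at y)"
    unfolding bump_def[abs_def]
    by (rule has_derivative_eq_rhs[OF has_derivative_minus[OF flat_width_has_derivative[OF assms]]])
       (simp add: fun_eq_iff del: add_2_eq_Suc')
  from partial_deriv_eq[OF this] show ?thesis by (simp add: inner_axis')
qed

lemma partial2_bump:
  assumes "transpose B = B" and r: "0 < r"
  shows "partial_deriv j (partial_deriv i (bump B z r)) y =
    (flat_exp 2 (1 - width B z r y) * B $ i $ j
      - (flat_exp 4 (1 - width B z r y) - 2 * flat_exp 3 (1 - width B z r y)) * ((B *v (y - z)) $ i * (B *v (y - z)) $ j / r\<^sup>2)) / r\<^sup>2"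
proof -
  let ?s = "1 - width B z r y"
  have e: "partial_deriv i (bump B z r) = (\<lambda>y. flat_exp 2 (1 - width B z r y) * (B *v (y - z)) $ i / r\<^sup>2)"
    using partial_bump[OF assms] by auto
  have l: "((\<lambda>y. (B *v (y - z)) $ i) has_derivative (\<lambda>h. (B *v h) $ i)) (at y)"
    by (auto intro!: derivative_eq_intros bounded_linear.has_derivative[OF matrix_vector_mul_bounded_linear] bounded_linear.has_derivative[OF bounded_linear_vec_nth])
  have "(partial_deriv i (bump B z r) has_derivative (\<lambda>h. (flat_exp 2 ?s * (B *v h) $ i
      + - (flat_exp (2 + 2) ?s - real 2 * flat_exp (2 + 1) ?s) * ((h \<bullet> (B *v (y - z))) / r\<^sup>2) * (B *v (y - z)) $ i) / r\<^sup>2)) (at y)"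
    unfolding e
    by (intro bounded_linear.has_derivative[OF bounded_linear_divide] has_derivative_mult flat_width_has_derivative assms l)
  note pd = partial_deriv_eq[OF this, of j]
  have i1: "axis j 1 \<bullet> (B *v (y - z)) = (B *v (y - z)) $ j" by (simp add: inner_axis')
  have i2: "(B *v axis j 1) $ i = B $ i $ j" by (simp add: matrix_vector_mult_basis column_def)
  have alg: "(p * c + - (q - 2 * t) * (vj / R) * vi) / R = (p * c - (q - 2 * t) * (vi * vj / R)) / R"
    for p c q t vi vj R :: real
    by (cases "R = 0") (simp_all add: field_simps)
  have num: "2 + 2 = (4 :: nat)" "2 + 1 = (3 :: nat)" "real 2 = 2" by simp_all
  show ?thesis unfolding pd i1 i2 num alg ..
qed

text \<open>
  Since \<open>B\<close> is inverse to \<open>A\<close>, the Hessian of the squared distance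
  contributes the trace of the identity, and the square of its gradient contributes the squared
  distance itself.
\<close>

lemma trace_bump:
  fixes A B :: "real^'d^'d"
  assumes sym: "transpose B = B" and r: "0 < r" and inv: "A ** B = mat 1" and symA: "transpose A = A"
  shows "(\<Sum>i\<in>UNIV. \<Sum>j\<in>UNIV. A $ i $ j * partial_deriv i (partial_deriv j (bump B z r)) y) =
    (real CARD('d) * flat_exp 2 (1 - width B z r y)
      - 2 * width B z r y * (flat_exp 4 (1 - width B z r y) - 2 * flat_exp 3 (1 - width B z r y))) / r\<^sup>2"
proof -
  let ?s = "1 - width B z r y" and ?v = "B *v (y - z)"
  let ?p = "flat_exp 2 ?s" and ?q = "flat_exp 4 ?s - 2 * flat_exp 3 ?s"
  have tr: "(\<Sum>i\<in>UNIV. \<Sum>j\<in>UNIV. A $ i $ j * B $ j $ i) = real CARD('d)"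
  proof -
    have "(\<Sum>i\<in>UNIV. \<Sum>j\<in>UNIV. A $ i $ j * B $ j $ i) = (\<Sum>i\<in>UNIV. (A ** B) $ i $ i)"
      by (simp add: matrix_matrix_mult_def)
    also have "\<dots> = real CARD('d)" unfolding inv by (simp add: mat_def)
    finally show ?thesis .
  qed
  have qu: "(\<Sum>i\<in>UNIV. \<Sum>j\<in>UNIV. A $ i $ j * (?v $ j * ?v $ i)) = 2 * r\<^sup>2 * width B z r y"
  proof -
    have "(\<Sum>i\<in>UNIV. \<Sum>j\<in>UNIV. A $ i $ j * (u $ j * u $ i)) = u \<bullet> (A *v u)" for u
      by (simp add: inner_vec_def matrix_vector_mult_def sum_distrib_left mult.assoc mult.commute mult.left_commute)
    from this[of ?v] have "(\<Sum>i\<in>UNIV. \<Sum>j\<in>UNIV. A $ i $ j * (?v $ j * ?v $ i)) = ?v \<bullet> (A *v ?v)" .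
    also have "A *v ?v = y - z" by (simp add: matrix_vector_mul_assoc inv)
    also have "?v \<bullet> (y - z) = 2 * r\<^sup>2 * width B z r y" using r by (simp add: width_def inner_commute)
    finally show ?thesis .
  qed
  have "(\<Sum>i\<in>UNIV. \<Sum>j\<in>UNIV. A $ i $ j * partial_deriv i (partial_deriv j (bump B z r)) y) =
     (\<Sum>i\<in>UNIV. \<Sum>j\<in>UNIV. (?p / r\<^sup>2) * (A $ i $ j * B $ j $ i) - (?q / r\<^sup>2 / r\<^sup>2) * (A $ i $ j * (?v $ j * ?v $ i)))"
  proof (intro sum.cong refl)
    fix i j
    have alg: "a * ((p * c - q * (x / R)) / R) = (p / R) * (a * c) - (q / R / R) * (a * x)" for a p c q x R :: real
      by (cases "R = 0") (simp_all add: field_simps)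
    show "A $ i $ j * partial_deriv i (partial_deriv j (bump B z r)) y =
        (?p / r\<^sup>2) * (A $ i $ j * B $ j $ i) - (?q / r\<^sup>2 / r\<^sup>2) * (A $ i $ j * (?v $ j * ?v $ i))"
      unfolding partial2_bump[OF sym r] by (rule alg)
  qed
  also have "\<dots> = (?p / r\<^sup>2) * real CARD('d) - (?q / r\<^sup>2 / r\<^sup>2) * (2 * r\<^sup>2 * width B z r y)"
    by (simp only: sum_subtractf sum_distrib_left[symmetric] tr qu)
  also have "\<dots> = (real CARD('d) * ?p - 2 * width B z r y * ?q) / r\<^sup>2"
  proof -
    have "(p / R) * D - (q / R / R) * (2 * R * w) = (D * p - 2 * w * q) / R" if "R \<noteq> 0" for p R D q w :: real
      using that by (simp add: field_simps)
    note alg = this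
    show ?thesis by (rule alg) (use r in simp)
  qed
  finally show ?thesis .
qed

lemma inverse_power_deriv:
  "0 < r \<Longrightarrow> ((\<lambda>r. inverse r ^ d) has_real_derivative - (real d * inverse r ^ Suc d)) (at r)"
proof -
  assume "0 < r"
  then have "((\<lambda>r. inverse r ^ d) has_real_derivative real d * inverse r ^ (d - Suc 0) * - (inverse r ^ Suc (Suc 0))) (at r)"
    by (intro DERIV_chain2[OF DERIV_pow DERIV_inverse]) simp
  moreover have "real d * inverse r ^ (d - Suc 0) * - (inverse r ^ Suc (Suc 0)) = - (real d * inverse r ^ Suc d)"
    by (cases d) auto
  ultimately show ?thesis by (simp only:)
qed

lemma scaled_profile_deriv:
  assumes r: "0 < r"
  shows "((\<lambda>r. flat_exp 2 (1 - Q / (2 * r\<^sup>2)) * inverse r ^ d) has_real_derivative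
     - ((real d * flat_exp 2 (1 - Q / (2 * r\<^sup>2)) - 2 * (Q / (2 * r\<^sup>2)) * (flat_exp 4 (1 - Q / (2 * r\<^sup>2)) - 2 * flat_exp 3 (1 - Q / (2 * r\<^sup>2)))) * inverse r ^ Suc d)) (at r)"
proof -
  define p a where "p = flat_exp 2 (1 - Q / (2 * r\<^sup>2))" and "a = flat_exp 4 (1 - Q / (2 * r\<^sup>2)) - 2 * flat_exp 3 (1 - Q / (2 * r\<^sup>2))"
  have s: "((\<lambda>r. 1 - Q / (2 * r\<^sup>2)) has_real_derivative Q / r\<^sup>2 * inverse r) (at r)"
    using r by (auto intro!: derivative_eq_intros simp: field_simps power2_eq_square)
  have f: "((\<lambda>r. flat_exp 2 (1 - Q / (2 * r\<^sup>2))) has_real_derivative a * (Q / r\<^sup>2 * inverse r)) (at r)"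
    using DERIV_chain2[OF flat_deriv[of 2] s] by (simp add: a_def)
  have "((\<lambda>r. flat_exp 2 (1 - Q / (2 * r\<^sup>2)) * inverse r ^ d) has_real_derivative
     a * (Q / r\<^sup>2 * inverse r) * inverse r ^ d + - (real d * inverse r ^ Suc d) * p) (at r)"
    using DERIV_mult[OF f inverse_power_deriv[OF r]] by (simp add: p_def)
  moreover have "a * (Q / r\<^sup>2 * inverse r) * inverse r ^ d + - (real d * inverse r ^ Suc d) * p =
     - ((real d * p - 2 * (Q / (2 * r\<^sup>2)) * a) * inverse r ^ Suc d)"
    by (simp add: algebra_simps)
  ultimately show ?thesis unfolding p_def a_def by simp
qed

lemma continuous_bounded_on_cball:
  fixes g :: "'a::euclidean_space \<Rightarrow> real"
  assumes "continuous_on UNIV g"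
  shows "\<exists>K\<ge>0. \<forall>x\<in>cball 0 R. \<bar>g x\<bar> \<le> K"
proof -
  have "bounded (g ` cball 0 R)"
    using assms by (intro compact_imp_bounded compact_continuous_image) (auto intro: continuous_on_subset)
  then obtain K where K: "\<forall>x\<in>cball 0 R. \<bar>g x\<bar> \<le> K" unfolding bounded_iff by auto
  have "\<forall>x\<in>cball 0 R. \<bar>g x\<bar> \<le> max 0 K"
  proof
    fix x :: 'a assume "x \<in> cball 0 R"
    then have "\<bar>g x\<bar> \<le> K" using K by blast
    then show "\<bar>g x\<bar> \<le> max 0 K" by simp
  qed
  then show ?thesis by (intro exI[of _ "max 0 K"]) auto
qed

text \<open>
  The mean value theorem, with the gradient bounded on the compact convex ball.
\<close>

lemma C_1_lipschitz_on_cball: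
  fixes g :: "real^'d \<Rightarrow> real"
  assumes g: "C_k (Suc 0) g"
  obtains M where "0 \<le> M" "\<And>x y. norm x \<le> R \<Longrightarrow> norm y \<le> R \<Longrightarrow> \<bar>g x - g y\<bar> \<le> M * norm (x - y)"
proof -
  let ?G = "\<lambda>x. frechet_derivative g (at x)"
  have der: "(g has_derivative ?G x) (at x)" for x by (rule C_k_has_derivative[OF g])
  have "\<exists>K\<ge>0. \<forall>x\<in>cball 0 R. \<bar>?G x (axis i 1)\<bar> \<le> K" for i
    using C_k_partial_deriv[OF g, of i] by (intro continuous_bounded_on_cball) simp
  then obtain K where K: "\<And>i. 0 \<le> K i" "\<And>i x. x \<in> cball 0 R \<Longrightarrow> \<bar>?G x (axis i 1)\<bar> \<le> K i" by metis
  have "norm (?G x h) \<le> (\<Sum>i\<in>UNIV. K i) * norm h" if x: "x \<in> cball 0 R" for x h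
  proof -
    have lin: "linear (?G x)" using der by (rule has_derivative_linear)
    have "?G x h = ?G x (\<Sum>i\<in>UNIV. h $ i *\<^sub>R axis i 1)"
      using basis_expansion[of h] by (simp add: scalar_mult_eq_scaleR)
    also have "\<dots> = (\<Sum>i\<in>UNIV. h $ i * ?G x (axis i 1))"
      by (simp add: linear_sum[OF lin] linear_scale[OF lin])
    also have "\<bar>\<dots>\<bar> \<le> (\<Sum>i\<in>UNIV. \<bar>h $ i * ?G x (axis i 1)\<bar>)" by (rule sum_abs)
    also have "\<dots> \<le> (\<Sum>i\<in>UNIV. norm h * K i)"
      using K x component_le_norm_cart[of h] by (intro sum_mono) (auto simp: abs_mult intro!: mult_mono)
    also have "\<dots> = (\<Sum>i\<in>UNIV. K i) * norm h" unfolding sum_distrib_right by (intro sum.cong refl mult.commute)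
    finally show ?thesis by simp
  qed
  then have on: "onorm (?G x) \<le> (\<Sum>i\<in>UNIV. K i)" if "x \<in> cball 0 R" for x
    using that by (intro onorm_le) auto
  show ?thesis
  proof (rule that)
    show "0 \<le> (\<Sum>i\<in>UNIV. K i)" using K by (intro sum_nonneg) auto
    fix x y :: "real^'d" assume "norm x \<le> R" "norm y \<le> R"
    then show "\<bar>g x - g y\<bar> \<le> (\<Sum>i\<in>UNIV. K i) * norm (x - y)"
      using differentiable_bound[of "cball 0 R" g ?G, OF convex_cball has_derivative_at_withinI[OF der] on, of x y] by simp
  qed
qed

locale elliptic_operator =
  fixes A :: "real^'d \<Rightarrow> real^'d^'d" and b :: "real^'d \<Rightarrow> real^'d" and l \<Lambda> :: real
  assumes A_smooth: "\<And>i j. smooth (\<lambda>x. A x $ i $ j)"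
    and A_symmetric: "\<And>x. transpose (A x) = A x"
    and b_smooth: "\<And>i. smooth (\<lambda>x. b x $ i)"
    and l: "0 < l" and elliptic: "\<And>x \<xi>. l * (\<xi> \<bullet> \<xi>) \<le> \<xi> \<bullet> (A x *v \<xi>)"
    and \<Lambda>: "0 < \<Lambda>" and A_bounded: "\<And>x \<xi>. norm (A x *v \<xi>) \<le> \<Lambda> * norm \<xi>"
begin

definition A_inv :: "real^'d \<Rightarrow> real^'d^'d" where "A_inv z = matrix_inv (A z)"

lemma A_inv: "A z ** A_inv z = mat 1" "A_inv z ** A z = mat 1"
proof -
  have "\<xi> = 0" if "A z *v \<xi> = 0" for \<xi>
  proof -
    have "l * (\<xi> \<bullet> \<xi>) \<le> 0" using elliptic[of \<xi> z] that by simp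
    then show ?thesis using l by (simp add: mult_le_0_iff inner_gt_zero_iff) (metis inner_ge_zero inner_eq_zero_iff order_antisym)
  qed
  then have "invertible (A z)" unfolding invertible_left_inverse matrix_left_invertible_ker by blast
  then have "\<exists>B. A z ** B = mat 1 \<and> B ** A z = mat 1" by (simp add: invertible_def)
  then have "A z ** A_inv z = mat 1 \<and> A_inv z ** A z = mat 1"
    unfolding A_inv_def matrix_inv_def by (rule someI_ex)
  then show "A z ** A_inv z = mat 1" "A_inv z ** A z = mat 1" by auto
qed

lemma A_inv_symmetric: "transpose (A_inv z) = A_inv z"
proof -
  have "transpose (A_inv z) ** A z = transpose (A z ** A_inv z)"
    by (simp add: matrix_transpose_mul A_symmetric)
  then have t: "transpose (A_inv z) ** A z = mat 1" by (simp add: A_inv transpose_mat)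
  have "transpose (A_inv z) = transpose (A_inv z) ** (A z ** A_inv z)" by (simp add: A_inv)
  also have "\<dots> = A_inv z" by (simp add: matrix_mul_assoc t)
  finally show ?thesis .
qed

lemma A_A_inv [simp]: "A z *v (A_inv z *v \<xi>) = \<xi>" by (simp add: matrix_vector_mul_assoc A_inv)

lemma A_inv_A [simp]: "A_inv z *v (A z *v \<xi>) = \<xi>" by (simp add: matrix_vector_mul_assoc A_inv)

lemma A_inv_norm: "norm (A_inv z *v \<xi>) \<le> norm \<xi> / l"
proof -
  let ?\<zeta> = "A_inv z *v \<xi>"
  have "l * (norm ?\<zeta>)\<^sup>2 \<le> ?\<zeta> \<bullet> \<xi>" using elliptic[of ?\<zeta> z] by (simp add: power2_norm_eq_inner)
  also have "\<dots> \<le> norm ?\<zeta> * norm \<xi>" by (rule norm_cauchy_schwarz)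
  finally have "norm ?\<zeta> * (l * norm ?\<zeta>) \<le> norm ?\<zeta> * norm \<xi>" by (simp add: power2_eq_square algebra_simps)
  then have "l * norm ?\<zeta> \<le> norm \<xi>" by (cases "norm ?\<zeta> = 0") (auto simp: mult_le_cancel_left)
  then show ?thesis using l by (simp add: field_simps)
qed

lemma A_inv_quadratic_upper: "\<xi> \<bullet> (A_inv z *v \<xi>) \<le> (norm \<xi>)\<^sup>2 / l"
proof -
  have "\<xi> \<bullet> (A_inv z *v \<xi>) \<le> norm \<xi> * norm (A_inv z *v \<xi>)" by (rule norm_cauchy_schwarz)
  also have "\<dots> \<le> norm \<xi> * (norm \<xi> / l)" by (intro mult_left_mono A_inv_norm) auto
  finally show ?thesis by (simp add: power2_eq_square)
qed

lemma A_inv_quadratic_lower: "l * (norm \<xi>)\<^sup>2 / \<Lambda>\<^sup>2 \<le> \<xi> \<bullet> (A_inv z *v \<xi>)"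
proof -
  let ?\<zeta> = "A_inv z *v \<xi>"
  have "norm \<xi> \<le> \<Lambda> * norm ?\<zeta>" using A_bounded[of z ?\<zeta>] by simp
  then have "(norm \<xi>)\<^sup>2 \<le> (\<Lambda> * norm ?\<zeta>)\<^sup>2" by (intro power_mono) auto
  then have "l * ((norm \<xi>)\<^sup>2 / \<Lambda>\<^sup>2) \<le> l * (norm ?\<zeta>)\<^sup>2"
    using l \<Lambda> by (intro mult_left_mono) (auto simp: field_simps power_mult_distrib)
  also have "\<dots> \<le> ?\<zeta> \<bullet> \<xi>" using elliptic[of ?\<zeta> z] by (simp add: power2_norm_eq_inner)
  finally show ?thesis by (simp add: inner_commute)
qed

lemma A_inv_entry: "\<bar>A_inv z $ i $ j\<bar> \<le> 1 / l"
proof -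
  have "A_inv z $ i $ j = (A_inv z *v axis j 1) $ i" by (simp add: matrix_vector_mult_basis column_def)
  also have "\<bar>\<dots>\<bar> \<le> norm (A_inv z *v axis j 1)" by (rule component_le_norm_cart)
  also have "\<dots> \<le> norm (axis j 1 :: real^'d) / l" by (rule A_inv_norm)
  finally show ?thesis by simp
qed

lemma A_entry_continuous: "continuous_on S (\<lambda>x. A x $ i $ j)"
proof -
  have "C_k 0 (\<lambda>x. A x $ i $ j)" using A_smooth[of i j] unfolding smooth_def by blast
  then show ?thesis by (auto intro: continuous_on_subset)
qed

lemma A_vec_continuous: "continuous_on S (\<lambda>x. A x *v u)"
  unfolding matrix_vector_mult_def by (intro continuous_intros A_entry_continuous)

lemma A_inv_vec_continuous: "continuous_on UNIV (\<lambda>z. A_inv z *v v)"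
proof (rule continuous_at_imp_continuous_on, rule ballI)
  fix z
  let ?u = "A_inv z *v v"
  have est: "norm (A_inv z' *v v - ?u) \<le> norm (A z *v ?u - A z' *v ?u) / l" for z'
  proof -
    have "A_inv z' *v v - ?u = A_inv z' *v (A z *v ?u) - A_inv z' *v (A z' *v ?u)"
      by (simp only: A_A_inv A_inv_A)
    also have "\<dots> = A_inv z' *v (A z *v ?u - A z' *v ?u)" by (simp add: matrix_vector_mult_diff_distrib)
    finally show ?thesis using A_inv_norm by simp
  qed
  have "isCont (\<lambda>z'. A z' *v ?u) z" using A_vec_continuous[of UNIV ?u] continuous_on_eq_continuous_at by blast
  then have "((\<lambda>z'. norm (A z *v ?u - A z' *v ?u) / l) \<longlongrightarrow> norm (A z *v ?u - A z *v ?u) / l) (at z)"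
    unfolding isCont_def using l by (intro tendsto_intros) auto
  then have "((\<lambda>z'. norm (A z *v ?u - A z' *v ?u) / l) \<longlongrightarrow> 0) (at z)" by simp
  then have "((\<lambda>z'. A_inv z' *v v - ?u) \<longlongrightarrow> 0) (at z)"
    by (rule Lim_null_comparison[rotated]) (use est in auto)
  then show "isCont (\<lambda>z. A_inv z *v v) z" unfolding isCont_def by (rule LIM_zero_cancel)
qed

lemma A_inv_entry_measurable [measurable]: "(\<lambda>z. A_inv z $ i $ j) \<in> borel_measurable borel"
proof -
  have "(\<lambda>z. A_inv z $ i $ j) = (\<lambda>z. (A_inv z *v axis j 1) $ i)" by (simp add: matrix_vector_mult_basis column_def)
  moreover have "continuous_on UNIV (\<lambda>z. (A_inv z *v axis j 1) $ i)" by (intro continuous_intros A_inv_vec_continuous)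
  ultimately show ?thesis by (simp add: borel_measurable_continuous_onI)
qed

text \<open>
  The lower bound on the quadratic form of \<open>A_inv\<close> turns \<open>width < 1\<close> into
  \<open>norm (y - z) < radius * r\<close>.
\<close>

definition radius :: real where "radius = \<Lambda> * sqrt (2 / l)"

lemma radius_pos: "0 < radius" using l \<Lambda> by (simp add: radius_def)

lemma width_support:
  assumes r: "0 < r" and w: "width (A_inv z) z r y < 1"
  shows "y \<in> ball z (radius * r)"
proof -
  have "(y - z) \<bullet> (A_inv z *v (y - z)) < 2 * r\<^sup>2" using w r by (simp add: width_def field_simps)
  then have "l * (norm (y - z))\<^sup>2 / \<Lambda>\<^sup>2 < 2 * r\<^sup>2" using A_inv_quadratic_lower[of "y - z" z] by linarith
  then have "(norm (y - z))\<^sup>2 < (2 / l) * \<Lambda>\<^sup>2 * r\<^sup>2" using l \<Lambda> by (simp add: field_simps)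
  also have "\<dots> = (radius * r)\<^sup>2" using l by (simp add: radius_def power_mult_distrib mult.commute)
  finally have "norm (y - z) < radius * r" by (rule power_less_imp_less_base) (use r radius_pos in auto)
  then show ?thesis by (simp add: dist_norm norm_minus_commute)
qed

lemma width_nonneg: "0 \<le> width (A_inv z) z r y"
proof -
  have "0 \<le> l * (norm (y - z))\<^sup>2 / \<Lambda>\<^sup>2" using l by simp
  also have "\<dots> \<le> (y - z) \<bullet> (A_inv z *v (y - z))" by (rule A_inv_quadratic_lower)
  finally show ?thesis by (simp add: width_def)
qed

abbreviation "frozen_width z r y \<equiv> width (A_inv z) z r y"
abbreviation "frozen_bump z r \<equiv> bump (A_inv z) z r"

lemma flat_outside: "0 < r \<Longrightarrow> y \<notin> ball z (radius * r) \<Longrightarrow> flat_exp n (1 - frozen_width z r y) = 0"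
  using width_support[of r z y] by force

lemma bump_support: "0 < r \<Longrightarrow> {y. frozen_bump z r y \<noteq> 0} \<subseteq> ball z (radius * r)"
  unfolding bump_def using flat_outside[of r _ z 0] by force

lemma bump_le_1: "\<bar>frozen_bump z r y\<bar> \<le> 1"
  using flat_le_fact[of 0 "1 - frozen_width z r y"] flat_nonneg[of 0 "1 - frozen_width z r y"] by (simp add: bump_def)

lemma bump_compact_support: "0 < r \<Longrightarrow> compact (closure {y. frozen_bump z r y \<noteq> 0})"
  using bounded_subset[OF bounded_ball bump_support] by simp

lemma partial_bump_le:
  assumes r: "0 < r"
  shows "\<bar>partial_deriv i (frozen_bump z r) y\<bar> \<le> (2 * radius / l / r) * indicator (ball z (radius * r)) y"
proof (cases "y \<in> ball z (radius * r)")
  case True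
  have "\<bar>(A_inv z *v (y - z)) $ i\<bar> \<le> norm (A_inv z *v (y - z))" by (rule component_le_norm_cart)
  also have "\<dots> \<le> norm (y - z) / l" by (rule A_inv_norm)
  also have "\<dots> \<le> radius * r / l" using True l by (intro divide_right_mono) (auto simp: dist_norm norm_minus_commute)
  finally have v: "\<bar>(A_inv z *v (y - z)) $ i\<bar> \<le> radius * r / l" .
  have "\<bar>partial_deriv i (frozen_bump z r) y\<bar> = flat_exp 2 (1 - frozen_width z r y) * \<bar>(A_inv z *v (y - z)) $ i\<bar> / r\<^sup>2"
    unfolding partial_bump[OF A_inv_symmetric r] using flat_nonneg by (simp add: abs_mult)
  also have "\<dots> \<le> 2 * (radius * r / l) / r\<^sup>2"
    using flat_le_fact[of 2 "1 - frozen_width z r y"] flat_nonneg v by (intro divide_right_mono mult_mono) auto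
  also have "\<dots> = 2 * radius / l / r" using r by (simp add: power2_eq_square)
  finally show ?thesis using True by simp
qed (simp add: partial_bump[OF A_inv_symmetric r] flat_outside[OF r])

definition hessian_bound :: real where "hessian_bound = 2 / l + 36 * (radius / l)\<^sup>2"

lemma partial2_bump_le:
  assumes r: "0 < r"
  shows "\<bar>partial_deriv j (partial_deriv i (frozen_bump z r)) y\<bar> \<le> (hessian_bound / r\<^sup>2) * indicator (ball z (radius * r)) y"
proof (cases "y \<in> ball z (radius * r)")
  case True
  let ?s = "1 - frozen_width z r y" and ?v = "A_inv z *v (y - z)"
  have v: "\<bar>?v $ i\<bar> \<le> radius * r / l" for i
  proof -
    have "\<bar>?v $ i\<bar> \<le> norm ?v" by (rule component_le_norm_cart)
    also have "\<dots> \<le> norm (y - z) / l" by (rule A_inv_norm)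
    also have "\<dots> \<le> radius * r / l" using True l by (intro divide_right_mono) (auto simp: dist_norm norm_minus_commute)
    finally show ?thesis .
  qed
  have f4: "\<bar>flat_exp 4 ?s - 2 * flat_exp 3 ?s\<bar> \<le> 36"
    using flat_le_fact[of 4 ?s] flat_le_fact[of 3 ?s] flat_nonneg[of 4 ?s] flat_nonneg[of 3 ?s]
    by (simp add: fact_numeral abs_le_iff)
  have "\<bar>?v $ i * ?v $ j / r\<^sup>2\<bar> \<le> (radius * r / l) * (radius * r / l) / r\<^sup>2"
    using v l radius_pos r by (simp only: abs_divide abs_mult abs_power2) (intro divide_right_mono mult_mono, auto)
  also have "\<dots> = (radius / l)\<^sup>2" using r by (simp add: power2_eq_square)
  finally have vv: "\<bar>?v $ i * ?v $ j / r\<^sup>2\<bar> \<le> (radius / l)\<^sup>2" .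
  have 1: "\<bar>flat_exp 2 ?s * A_inv z $ i $ j\<bar> \<le> 2 * (1 / l)"
    using flat_le_fact[of 2 ?s] flat_nonneg[of 2 ?s] A_inv_entry[of z i j] by (simp only: abs_mult) (intro mult_mono, auto)
  have 2: "\<bar>(flat_exp 4 ?s - 2 * flat_exp 3 ?s) * (?v $ i * ?v $ j / r\<^sup>2)\<bar> \<le> 36 * (radius / l)\<^sup>2"
    using f4 vv by (simp only: abs_mult[of "flat_exp 4 ?s - 2 * flat_exp 3 ?s"]) (intro mult_mono, auto)
  have "\<bar>partial_deriv j (partial_deriv i (frozen_bump z r)) y\<bar> \<le> hessian_bound / r\<^sup>2"
    unfolding partial2_bump[OF A_inv_symmetric r] abs_divide hessian_bound_def using 1 2 by (simp only: abs_power2) (intro divide_right_mono, linarith, simp)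
  then show ?thesis using True by simp
qed (simp add: partial2_bump[OF A_inv_symmetric r] flat_outside[OF r])

definition frozen_trace :: "real^'d \<Rightarrow> real \<Rightarrow> real^'d \<Rightarrow> real" where
  "frozen_trace z r y = (real CARD('d) * flat_exp 2 (1 - frozen_width z r y)
      - 2 * frozen_width z r y * (flat_exp 4 (1 - frozen_width z r y) - 2 * flat_exp 3 (1 - frozen_width z r y))) / r\<^sup>2"

lemma frozen_trace_le: 
  assumes r: "0 < r"
  shows "\<bar>frozen_trace z r y\<bar> \<le> (2 * real CARD('d) + 72) / r\<^sup>2"
proof (cases "frozen_width z r y < 1")
  case True
  let ?s = "1 - frozen_width z r y"
  have f4: "\<bar>flat_exp 4 ?s - 2 * flat_exp 3 ?s\<bar> \<le> 36"
    using flat_le_fact[of 4 ?s] flat_le_fact[of 3 ?s] flat_nonneg[of 4 ?s] flat_nonneg[of 3 ?s]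
    by (simp add: fact_numeral abs_le_iff)
  have 1: "\<bar>real CARD('d) * flat_exp 2 ?s\<bar> \<le> 2 * real CARD('d)"
    using flat_le_fact[of 2 ?s] flat_nonneg[of 2 ?s] by (simp add: abs_mult)
  have "\<bar>(2 * frozen_width z r y) * (flat_exp 4 ?s - 2 * flat_exp 3 ?s)\<bar> \<le> 2 * 36"
    using True width_nonneg[of z r y] f4 by (simp only: abs_mult[of "2 * frozen_width z r y"]) (intro mult_mono, auto)
  with 1 have "\<bar>real CARD('d) * flat_exp 2 ?s - (2 * frozen_width z r y) * (flat_exp 4 ?s - 2 * flat_exp 3 ?s)\<bar> \<le> 2 * real CARD('d) + 72" by linarith
  then show ?thesis unfolding frozen_trace_def abs_divide by (simp only: abs_power2) (intro divide_right_mono, simp_all)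
qed (simp add: frozen_trace_def)

lemma width_sum: "width B z r y = (\<Sum>i\<in>UNIV. (y $ i - z $ i) * (\<Sum>j\<in>UNIV. B $ i $ j * (y $ j - z $ j))) / (2 * r\<^sup>2)"
  by (simp add: width_def inner_vec_def matrix_vector_mult_def)

lemma frozen_width_joint_measurable [measurable]:
  assumes [measurable]: "f \<in> borel_measurable M" "g \<in> borel_measurable M" "h \<in> borel_measurable M"
  shows "(\<lambda>x. frozen_width (f x) (g x) (h x)) \<in> borel_measurable M"
proof -
  have c: "(\<lambda>y::real^'d. y $ i) \<in> borel_measurable borel" for i
    by (intro borel_measurable_continuous_onI continuous_intros)
  have [measurable]: "(\<lambda>x. f x $ i) \<in> borel_measurable M" "(\<lambda>x. h x $ i) \<in> borel_measurable M" for i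
    using measurable_compose[OF assms(1) c] measurable_compose[OF assms(3) c] by auto
  have [measurable]: "(\<lambda>x. A_inv (f x) $ i $ j) \<in> borel_measurable M" for i j
    by (rule measurable_compose[OF assms(1) A_inv_entry_measurable])
  show ?thesis unfolding width_sum by measurable
qed

lemma frozen_trace_measurable [measurable]: "frozen_trace z r \<in> borel_measurable borel"
  unfolding frozen_trace_def[abs_def] by measurable

lemma diff_op_continuous:
  assumes "smooth g" shows "continuous_on UNIV (diff_op A b g)"
proof -
  have g: "C_k k g" for k using assms by (simp add: smooth_def)
  have p1: "continuous_on UNIV (partial_deriv i g)" for i using g[of "Suc 0"] by simp
  have p2: "continuous_on UNIV (partial_deriv i (partial_deriv j g))" for i j using g[of "Suc (Suc 0)"] by simp
  have bc: "continuous_on UNIV (\<lambda>x. b x $ i)" for i using b_smooth[of i] unfolding smooth_def by (metis C_k.simps(1))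
  show ?thesis unfolding diff_op_def[abs_def]
    by (intro continuous_intros A_entry_continuous p1 p2 bc)
qed

text \<open>
  On the support of the bump the coefficients of \<open>A\<close> differ from their values at
  \<open>z\<close> by a multiple of \<open>r\<close>, which gains one power of \<open>r\<close> on
  the second derivatives; the drift acts on first derivatives only. The constant is uniform for
  \<open>z\<close> in a ball, where the coefficients are Lipschitz and bounded.
\<close>

lemma frozen_error:
  obtains C where "0 \<le> C" "\<And>z r y. norm z \<le> R \<Longrightarrow> 0 < r \<Longrightarrow> r \<le> 1 \<Longrightarrow>
     \<bar>2 * diff_op A b (frozen_bump z r) y - frozen_trace z r y\<bar> \<le> (C / r) * indicator (ball z (radius * r)) y"
proof -
  let ?R = "R + radius"
  have "\<exists>M\<ge>0. \<forall>x y. norm x \<le> ?R \<longrightarrow> norm y \<le> ?R \<longrightarrow> \<bar>A x $ i $ j - A y $ i $ j\<bar> \<le> M * norm (x - y)" for i j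
  proof -
    have "C_k (Suc 0) (\<lambda>x. A x $ i $ j)" using A_smooth[of i j] unfolding smooth_def by blast
    then show ?thesis by (rule C_1_lipschitz_on_cball[where R="?R"]) blast
  qed
  then obtain M where M: "\<And>i j. 0 \<le> M i j" "\<And>i j x y. norm x \<le> ?R \<Longrightarrow> norm y \<le> ?R \<Longrightarrow> \<bar>A x $ i $ j - A y $ i $ j\<bar> \<le> M i j * norm (x - y)"
    by metis
  have "\<exists>K\<ge>0. \<forall>x\<in>cball 0 ?R. \<bar>b x $ i\<bar> \<le> K" for i
  proof -
    have "C_k 0 (\<lambda>x. b x $ i)" using b_smooth[of i] unfolding smooth_def by blast
    then show ?thesis by (intro continuous_bounded_on_cball) simp
  qed
  then obtain K where K0: "\<And>i. 0 \<le> K i" "\<And>i x. x \<in> cball 0 ?R \<Longrightarrow> \<bar>b x $ i\<bar> \<le> K i" by metis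
  have K: "0 \<le> K i" "norm x \<le> ?R \<Longrightarrow> \<bar>b x $ i\<bar> \<le> K i" for i x using K0(1) K0(2)[of x i] by auto
  define C where "C = (\<Sum>i\<in>UNIV. \<Sum>j\<in>UNIV. M i j * radius * hessian_bound) + 2 * (\<Sum>i\<in>UNIV. K i * (2 * radius / l))"
  have hessian_bound: "0 \<le> hessian_bound" using l by (simp add: hessian_bound_def)
  show ?thesis
  proof (rule that[of C])
    show "0 \<le> C" using M K l radius_pos hessian_bound unfolding C_def by (intro add_nonneg_nonneg sum_nonneg mult_nonneg_nonneg) auto
    fix z y :: "real^'d" and r :: real assume z: "norm z \<le> R" and r: "0 < r" "r \<le> 1"
    let ?I = "indicator (ball z (radius * r)) y :: real"
    let ?p1 = "\<lambda>i. partial_deriv i (frozen_bump z r) y" and ?p2 = "\<lambda>i j. partial_deriv i (partial_deriv j (frozen_bump z r)) y"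
    have tr: "frozen_trace z r y = (\<Sum>i\<in>UNIV. \<Sum>j\<in>UNIV. A z $ i $ j * ?p2 i j)"
      unfolding frozen_trace_def by (rule trace_bump[OF A_inv_symmetric r(1) A_inv(1) A_symmetric, symmetric])
    have e: "2 * diff_op A b (frozen_bump z r) y - frozen_trace z r y =
       (\<Sum>i\<in>UNIV. \<Sum>j\<in>UNIV. (A y $ i $ j - A z $ i $ j) * ?p2 i j) + 2 * (\<Sum>i\<in>UNIV. b y $ i * ?p1 i)"
      unfolding tr diff_op_def by (simp add: left_diff_distrib sum_subtractf)
    have t1: "\<bar>(A y $ i $ j - A z $ i $ j) * ?p2 i j\<bar> \<le> (M i j * radius * hessian_bound) * (?I / r)" for i j
    proof (cases "y \<in> ball z (radius * r)")
      case True
      then have d: "norm (y - z) \<le> radius * r" by (simp add: dist_norm norm_minus_commute)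
      have "norm y \<le> norm z + norm (y - z)" using norm_triangle_ineq[of z "y - z"] by simp
      also have "\<dots> \<le> R + radius * r" using z d by simp
      also have "\<dots> \<le> ?R" using r radius_pos by (simp add: mult_left_le)
      finally have y: "norm y \<le> ?R" .
      have z': "norm z \<le> ?R" using z radius_pos by simp
      have "\<bar>A y $ i $ j - A z $ i $ j\<bar> \<le> M i j * norm (y - z)" by (rule M(2)[OF y z'])
      also have "\<dots> \<le> M i j * (radius * r)" using d M(1) by (intro mult_left_mono) auto
      finally have a: "\<bar>A y $ i $ j - A z $ i $ j\<bar> \<le> M i j * (radius * r)" .
      have "\<bar>(A y $ i $ j - A z $ i $ j) * ?p2 i j\<bar> \<le> (M i j * (radius * r)) * (hessian_bound / r\<^sup>2)"
        using a partial2_bump_le[OF r(1), of i j z y] True M(1)[of i j] radius_pos r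
        by (simp only: abs_mult) (intro mult_mono, auto)
      also have "\<dots> = (M i j * radius * hessian_bound) * (?I / r)" using True r by (simp add: power2_eq_square)
      finally show ?thesis .
    next
      case False
      then have "?p2 i j = 0" using partial2_bump_le[OF r(1), of i j z y] by simp
      then show ?thesis using False by simp
    qed
    have t2: "\<bar>b y $ i * ?p1 i\<bar> \<le> (K i * (2 * radius / l)) * (?I / r)" for i
    proof (cases "y \<in> ball z (radius * r)")
      case True
      then have d: "norm (y - z) \<le> radius * r" by (simp add: dist_norm norm_minus_commute)
      have "norm y \<le> norm z + norm (y - z)" using norm_triangle_ineq[of z "y - z"] by simp
      also have "\<dots> \<le> R + radius * r" using z d by simp
      also have "\<dots> \<le> ?R" using r radius_pos by (simp add: mult_left_le)
      finally have y: "norm y \<le> ?R" .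
      have "\<bar>b y $ i * ?p1 i\<bar> \<le> K i * (2 * radius / l / r)"
        using K(2)[OF y, of i] partial_bump_le[OF r(1), of i z y] True K(1)[of i]
        by (simp only: abs_mult) (intro mult_mono, auto)
      then show ?thesis using True by simp
    next
      case False
      then have "?p1 i = 0" using partial_bump_le[OF r(1), of i z y] by simp
      then show ?thesis using False by simp
    qed
    have "\<bar>2 * diff_op A b (frozen_bump z r) y - frozen_trace z r y\<bar> \<le>
      (\<Sum>i\<in>UNIV. \<Sum>j\<in>UNIV. \<bar>(A y $ i $ j - A z $ i $ j) * ?p2 i j\<bar>) + 2 * (\<Sum>i\<in>UNIV. \<bar>b y $ i * ?p1 i\<bar>)"
    proof -
      have "\<bar>\<Sum>i\<in>UNIV. \<Sum>j\<in>UNIV. (A y $ i $ j - A z $ i $ j) * ?p2 i j\<bar> \<le> (\<Sum>i\<in>UNIV. \<Sum>j\<in>UNIV. \<bar>(A y $ i $ j - A z $ i $ j) * ?p2 i j\<bar>)"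
        by (rule order_trans[OF sum_abs sum_mono[OF sum_abs]])
      moreover have "\<bar>\<Sum>i\<in>UNIV. b y $ i * ?p1 i\<bar> \<le> (\<Sum>i\<in>UNIV. \<bar>b y $ i * ?p1 i\<bar>)" by (rule sum_abs)
      ultimately show ?thesis unfolding e by linarith
    qed
    also have "\<dots> \<le> (\<Sum>i\<in>UNIV. \<Sum>j\<in>UNIV. (M i j * radius * hessian_bound) * (?I / r)) + 2 * (\<Sum>i\<in>UNIV. (K i * (2 * radius / l)) * (?I / r))"
      by (intro add_mono sum_mono mult_left_mono t1 t2) auto
    also have "\<dots> = C * (?I / r)"
      unfolding C_def by (simp only: sum_distrib_right[symmetric] distrib_right mult.assoc[of 2])
    finally show "\<bar>2 * diff_op A b (frozen_bump z r) y - frozen_trace z r y\<bar> \<le> (C / r) * ?I" by simp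
  qed
qed

end

section \<open>Approximate solutions do not charge Lebesgue null sets\<close>

lemma nn_integral_emeasure_ball:
  fixes n :: "(real^'d) measure"
  assumes "finite_measure n" and [measurable_cong]: "sets n = sets borel"
  shows "(\<integral>\<^sup>+z. emeasure n (ball z \<rho>) \<partial>lborel) = emeasure n UNIV * emeasure lborel (ball (0::real^'d) \<rho>)"
proof -
  interpret n: finite_measure n by fact
  interpret pair_sigma_finite n "lborel :: (real^'d) measure" ..
  have m: "(\<lambda>(y, z). indicator {q. dist (snd q) (fst q) < \<rho>} (y, z) :: ennreal) \<in> borel_measurable (n \<Otimes>\<^sub>M (lborel :: (real^'d) measure))"
    by measurable
  have "(\<integral>\<^sup>+z. emeasure n (ball z \<rho>) \<partial>lborel) = (\<integral>\<^sup>+z. (\<integral>\<^sup>+y. indicator {q. dist (snd q) (fst q) < \<rho>} (y, z) \<partial>n) \<partial>lborel)"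
  proof (rule nn_integral_cong)
    fix z :: "real^'d"
    have "emeasure n (ball z \<rho>) = (\<integral>\<^sup>+y. indicator (ball z \<rho>) y \<partial>n)" by (simp add: assms)
    also have "\<dots> = (\<integral>\<^sup>+y. indicator {q. dist (snd q) (fst q) < \<rho>} (y, z) \<partial>n)"
      by (intro nn_integral_cong) (auto split: split_indicator)
    finally show "emeasure n (ball z \<rho>) = (\<integral>\<^sup>+y. indicator {q. dist (snd q) (fst q) < \<rho>} (y, z) \<partial>n)" .
  qed
  also have "\<dots> = (\<integral>\<^sup>+y. (\<integral>\<^sup>+z. indicator {q. dist (snd q) (fst q) < \<rho>} (y, z) \<partial>lborel) \<partial>n)"
    using Fubini'[OF m] by simp
  also have "\<dots> = (\<integral>\<^sup>+y. emeasure lborel (ball (0::real^'d) \<rho>) \<partial>n)"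
  proof (rule nn_integral_cong)
    fix y :: "real^'d"
    have "(\<integral>\<^sup>+z. indicator {q. dist (snd q) (fst q) < \<rho>} (y, z) \<partial>lborel) = (\<integral>\<^sup>+z. indicator (ball y \<rho>) z \<partial>lborel)"
      by (intro nn_integral_cong) (auto split: split_indicator simp: dist_commute)
    also have "\<dots> = emeasure lborel (ball y \<rho>)" by simp
    also have "\<dots> = emeasure lborel (ball (0::real^'d) \<rho>)"
      by (cases "0 \<le> \<rho>") (auto simp: emeasure_ball ball_empty)
    finally show "(\<integral>\<^sup>+z. indicator {q. dist (snd q) (fst q) < \<rho>} (y, z) \<partial>lborel) = emeasure lborel (ball (0::real^'d) \<rho>)" .
  qed
  also have "\<dots> = emeasure n UNIV * emeasure lborel (ball (0::real^'d) \<rho>)"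
    using sets_eq_imp_space_eq[OF assms(2)] by (simp add: mult.commute)
  finally show ?thesis .
qed

text \<open>
  The adjoint of the operator maps \<open>\<sigma>\<close> to a distribution of order zero that is
  dominated by the measure \<open>n\<close>. Allowing any \<open>S\<close> containing the support
  keeps track of where \<open>n\<close> puts its mass.
\<close>

locale approximate_elliptic_solution = elliptic_operator A b l \<Lambda>
  for A :: "real^'d \<Rightarrow> real^'d^'d" and b l \<Lambda> +
  fixes \<sigma> n :: "(real^'d) measure"
  assumes fin_\<sigma>: "finite_measure \<sigma>" and sets_\<sigma> [measurable_cong, simp]: "sets \<sigma> = sets borel"
    and fin_n: "finite_measure n" and sets_n [measurable_cong, simp]: "sets n = sets borel"
    and weak: "\<And>\<phi> S. smooth \<phi> \<Longrightarrow> compact (closure {y. \<phi> y \<noteq> 0}) \<Longrightarrow> S \<in> sets borel \<Longrightarrow>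
       {y. \<phi> y \<noteq> 0} \<subseteq> S \<Longrightarrow> (\<And>y. \<bar>\<phi> y\<bar> \<le> 1) \<Longrightarrow> (\<integral>y. diff_op A b \<phi> y \<partial>\<sigma>) \<le> measure n S"
begin

sublocale s: finite_measure \<sigma> by (rule fin_\<sigma>)
sublocale n: finite_measure n by (rule fin_n)

lemma space_\<sigma> [simp]: "space \<sigma> = UNIV" using sets_eq_imp_space_eq[OF sets_\<sigma>] by simp
lemma space_n [simp]: "space n = UNIV" using sets_eq_imp_space_eq[OF sets_n] by simp

text \<open>
  As \<open>r\<close> tends to \<open>0\<close> this concentrates at \<open>y = z\<close> with mass
  of constant order.
\<close>

definition parametrix :: "real^'d \<Rightarrow> real \<Rightarrow> real^'d \<Rightarrow> real" where
  "parametrix z r y = flat_exp 2 (1 - frozen_width z r y) * inverse r ^ CARD('d)"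

lemma parametrix_nonneg: "0 < r \<Longrightarrow> 0 \<le> parametrix z r y"
  unfolding parametrix_def by (intro mult_nonneg_nonneg flat_nonneg) auto

lemma parametrix_le: "0 < r \<Longrightarrow> parametrix z r y \<le> 2 * inverse r ^ CARD('d)"
  unfolding parametrix_def using flat_le_fact[of 2] by (intro mult_right_mono) auto

lemma parametrix_measurable [measurable]:
  assumes [measurable]: "f \<in> borel_measurable M" "g \<in> borel_measurable M" "h \<in> borel_measurable M"
  shows "(\<lambda>x. parametrix (f x) (g x) (h x)) \<in> borel_measurable M"
  unfolding parametrix_def by measurable

lemma integrable_parametrix: "0 < r \<Longrightarrow> integrable \<sigma> (parametrix z r)"
  using parametrix_nonneg parametrix_le by (intro s.integrable_const_bound[where B="2 * inverse r ^ CARD('d)"]) auto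

definition mass :: "real^'d \<Rightarrow> real \<Rightarrow> ennreal" where
  "mass z r = emeasure \<sigma> (ball z (radius * r)) + emeasure n (ball z (radius * r))"

lemma trace_integral_le:
  assumes r: "0 < r" and C: "0 \<le> C" "\<And>y. \<bar>2 * diff_op A b (frozen_bump z r) y - frozen_trace z r y\<bar> \<le> (C / r) * indicator (ball z (radius * r)) y"
  shows "(\<integral>y. frozen_trace z r y \<partial>\<sigma>) \<le> 2 * measure n (ball z (radius * r)) + (C / r) * measure \<sigma> (ball z (radius * r))"
proof -
  let ?S = "ball z (radius * r)"
  have half_bound: "\<bar>a\<bar> \<le> (u + v) / 2" if "\<bar>2 * a - t\<bar> \<le> v" "\<bar>t\<bar> \<le> u" for a t u v :: real
  proof -
    have "2 * a \<le> u + v" "- (2 * a) \<le> u + v" using that by linarith+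
    then show ?thesis by (simp add: abs_le_iff field_simps)
  qed
  have iT: "integrable \<sigma> (frozen_trace z r)"
    using frozen_trace_le[OF r] by (intro s.integrable_const_bound[where B="(2 * real CARD('d) + 72) / r\<^sup>2"]) auto
  have Dm: "diff_op A b (frozen_bump z r) \<in> borel_measurable borel"
    by (intro borel_measurable_continuous_onI diff_op_continuous smooth_bump)
  have iD: "integrable \<sigma> (diff_op A b (frozen_bump z r))"
  proof (rule s.integrable_const_bound[where B="((2 * real CARD('d) + 72) / r\<^sup>2 + C / r) / 2"])
    show "AE y in \<sigma>. norm (diff_op A b (frozen_bump z r) y) \<le> ((2 * real CARD('d) + 72) / r\<^sup>2 + C / r) / 2"
    proof (rule AE_I2)
      fix y
      have "\<bar>2 * diff_op A b (frozen_bump z r) y - frozen_trace z r y\<bar> \<le> C / r"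
        using C(2)[of y] C(1) r by (auto split: split_indicator_asm intro: order_trans)
      then show "norm (diff_op A b (frozen_bump z r) y) \<le> ((2 * real CARD('d) + 72) / r\<^sup>2 + C / r) / 2"
        using frozen_trace_le[OF r, of z y] unfolding real_norm_def by (rule half_bound)
    qed
  qed (use Dm in simp)
  have iS: "integrable \<sigma> (\<lambda>y. (C / r) * indicator ?S y)"
    by (intro integrable_mult_right integrable_real_indicator) (auto simp: s.emeasure_eq_measure)
  have "(\<integral>y. frozen_trace z r y \<partial>\<sigma>) \<le> (\<integral>y. 2 * diff_op A b (frozen_bump z r) y + (C / r) * indicator ?S y \<partial>\<sigma>)"
  proof (rule integral_mono[OF iT])
    show "frozen_trace z r y \<le> 2 * diff_op A b (frozen_bump z r) y + (C / r) * indicator ?S y" for y using C(2)[of y] by linarith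
  qed (use iD iS in auto)
  also have "\<dots> = 2 * (\<integral>y. diff_op A b (frozen_bump z r) y \<partial>\<sigma>) + (C / r) * measure \<sigma> ?S"
    using iD iS by simp
  also have "(\<integral>y. diff_op A b (frozen_bump z r) y \<partial>\<sigma>) \<le> measure n ?S"
    using r by (intro weak smooth_bump bump_compact_support bump_support bump_le_1) auto
  finally show ?thesis by simp
qed

text \<open>
  The integral of the parametrix over \<open>\<sigma>\<close> is followed from scale
  \<open>1\<close> down to scale \<open>\<delta>\<close>. Its derivative in the scale is, up to sign, the
  integral of the frozen operator applied to the bump, times \<open>r\<close> to the power
  \<open>1 - CARD('d)\<close>; \<open>trace_integral_le\<close> bounds this by the mass of a ball of
  radius of order \<open>r\<close>, divided by \<open>r ^ CARD('d)\<close>.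
\<close>

lemma parametrix_increase:
  assumes C: "0 \<le> C" "\<And>r y. 0 < r \<Longrightarrow> r \<le> 1 \<Longrightarrow> \<bar>2 * diff_op A b (frozen_bump z r) y - frozen_trace z r y\<bar> \<le> (C / r) * indicator (ball z (radius * r)) y"
    and \<delta>: "0 < \<delta>" "\<delta> \<le> 1"
  shows "(\<integral>\<^sup>+y. ennreal (parametrix z \<delta> y) \<partial>\<sigma>) \<le>
     2 * emeasure \<sigma> UNIV + (\<integral>\<^sup>+r\<in>{0<..1}. ennreal ((2 + C) * inverse r ^ CARD('d)) * mass z r \<partial>lborel)"
proof -
  let ?d = "CARD('d)"
  \<comment> \<open>Minus the derivative of the parametrix in the scale.\<close>
  define k where "k y r = frozen_trace z r y * r * inverse r ^ ?d" for y r
  have k_alt: "k y r = (real ?d * flat_exp 2 (1 - frozen_width z r y) - 2 * frozen_width z r y * (flat_exp 4 (1 - frozen_width z r y) - 2 * flat_exp 3 (1 - frozen_width z r y))) * inverse r ^ Suc ?d"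
    if "0 < r" for y r
    unfolding k_def frozen_trace_def using that by (simp add: power2_eq_square divide_inverse)
  have wdQ: "frozen_width z r y = ((y - z) \<bullet> (A_inv z *v (y - z))) / (2 * r\<^sup>2)" for r y by (simp add: width_def)
  have der: "((\<lambda>r. parametrix z r y) has_real_derivative - k y r) (at r)" if "0 < r" for y r
    using scaled_profile_deriv[OF that, of "(y - z) \<bullet> (A_inv z *v (y - z))" ?d]
    unfolding parametrix_def wdQ[symmetric] k_alt[OF that, symmetric] by simp
  have ft: "(\<integral>r. indicator {\<delta>..1} r *\<^sub>R (- k y r) \<partial>lborel) = parametrix z 1 y - parametrix z \<delta> y" for y
  proof (rule integral_FTC_atLeastAtMost[OF \<delta>(2)])
    fix r assume "\<delta> \<le> r" "r \<le> 1"
    then have "0 < r" using \<delta> by simp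
    from der[OF this] show "((\<lambda>r. parametrix z r y) has_vector_derivative - k y r) (at r within {\<delta>..1})"
      by (simp add: has_real_derivative_iff_has_vector_derivative has_vector_derivative_at_within)
  next
    have cw: "continuous_on {\<delta>..1} (\<lambda>r. frozen_width z r y)" unfolding wdQ using \<delta> by (intro continuous_intros) auto
    have cf: "continuous_on {\<delta>..1} (\<lambda>r. flat_exp m (1 - frozen_width z r y))" for m
      by (rule continuous_on_compose2[OF continuous_flat[of UNIV m]]) (auto intro!: continuous_intros cw)
    show "continuous_on {\<delta>..1} (\<lambda>r. - k y r)"
      unfolding k_def frozen_trace_def using \<delta> by (intro continuous_intros cw cf) auto
  qed
  interpret pair_sigma_finite \<sigma> "lborel :: real measure" ..
  let ?c = "\<lambda>y r. indicator {\<delta>..1} r *\<^sub>R k y r"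
  define Kb where "Kb = (2 * real ?d + 72) / \<delta>\<^sup>2 * inverse \<delta> ^ ?d"
  have kb: "\<bar>?c y r\<bar> \<le> Kb" for y r
  proof (cases "r \<in> {\<delta>..1}")
    case True
    then have r: "0 < r" "\<delta> \<le> r" "r \<le> 1" using \<delta> by auto
    have "\<bar>k y r\<bar> \<le> ((2 * real ?d + 72) / r\<^sup>2 * 1) * inverse r ^ ?d"
      unfolding k_def using frozen_trace_le[OF r(1), of z y] r by (simp only: abs_mult) (intro mult_mono, auto)
    also have "\<dots> \<le> ((2 * real ?d + 72) / \<delta>\<^sup>2 * 1) * inverse \<delta> ^ ?d"
      using r \<delta> by (intro mult_mono divide_left_mono power_mono) auto
    finally show ?thesis using True by (simp add: Kb_def)
  qed (use \<delta> in \<open>simp add: Kb_def\<close>)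
  have km: "(\<lambda>(y, r). ?c y r) \<in> borel_measurable (\<sigma> \<Otimes>\<^sub>M (lborel :: real measure))"
    unfolding k_def frozen_trace_def case_prod_beta' by measurable
  have ik: "integrable (\<sigma> \<Otimes>\<^sub>M (lborel :: real measure)) (\<lambda>(y, r). ?c y r)"
  proof (rule integrableI_bounded_set[where A="UNIV \<times> {\<delta>..1}" and B=Kb])
    show "emeasure (\<sigma> \<Otimes>\<^sub>M (lborel :: real measure)) (UNIV \<times> {\<delta>..1}) < \<infinity>"
      using \<delta> by (subst lborel.emeasure_pair_measure_Times) (auto simp: ennreal_mult_less_top s.emeasure_eq_measure)
    show "AE x in \<sigma> \<Otimes>\<^sub>M (lborel :: real measure). x \<in> UNIV \<times> {\<delta>..1} \<longrightarrow> norm (case x of (y, r) \<Rightarrow> ?c y r) \<le> Kb"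
      using kb by (auto simp del: real_scaleR_def intro!: AE_I2)
    show "AE x in \<sigma> \<Otimes>\<^sub>M (lborel :: real measure). x \<notin> UNIV \<times> {\<delta>..1} \<longrightarrow> (case x of (y, r) \<Rightarrow> ?c y r) = 0"
      by (auto intro!: AE_I2 split: split_indicator_asm)
  qed (use km in auto)
  define G where "G r = indicator {\<delta>..1} r * ((2 + C) * inverse r ^ ?d * (measure \<sigma> (ball z (radius * r)) + measure n (ball z (radius * r))))" for r
  have inner: "(\<integral>y. ?c y r \<partial>\<sigma>) \<le> G r" for r
  proof (cases "r \<in> {\<delta>..1}")
    case True
    then have r: "0 < r" "r \<le> 1" using \<delta> by auto
    let ?S = "ball z (radius * r)"
    have "(\<integral>y. ?c y r \<partial>\<sigma>) = (\<integral>y. frozen_trace z r y \<partial>\<sigma>) * (r * inverse r ^ ?d)" using True by (simp add: k_def mult.assoc)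
    also have "\<dots> \<le> (2 * measure n ?S + (C / r) * measure \<sigma> ?S) * (r * inverse r ^ ?d)"
      using r by (intro mult_right_mono trace_integral_le[OF r(1) C(1) C(2)[OF r]]) auto
    also have "\<dots> = (2 * r * measure n ?S + C * measure \<sigma> ?S) * inverse r ^ ?d" using r by (simp add: field_simps)
    also have "\<dots> \<le> ((2 + C) * measure n ?S + (2 + C) * measure \<sigma> ?S) * inverse r ^ ?d"
      using r C(1) by (intro mult_right_mono add_mono mult_right_mono) auto
    also have "\<dots> = G r" using True by (simp add: G_def algebra_simps)
    finally show ?thesis .
  qed (simp add: G_def)
  have G0: "0 \<le> G r" for r using C(1) by (cases "r \<in> {\<delta>..1}") (use \<delta> in \<open>auto simp: G_def\<close>)
  have diff: "(\<integral>y. parametrix z \<delta> y \<partial>\<sigma>) - (\<integral>y. parametrix z 1 y \<partial>\<sigma>) = (\<integral>r. (\<integral>y. ?c y r \<partial>\<sigma>) \<partial>lborel)"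
  proof -
    have "(\<integral>y. parametrix z \<delta> y \<partial>\<sigma>) - (\<integral>y. parametrix z 1 y \<partial>\<sigma>) = (\<integral>y. parametrix z \<delta> y - parametrix z 1 y \<partial>\<sigma>)"
      using integrable_parametrix \<delta> by (intro Bochner_Integration.integral_diff[symmetric]) auto
    also have "\<dots> = (\<integral>y. (\<integral>r. ?c y r \<partial>lborel) \<partial>\<sigma>)"
    proof (rule Bochner_Integration.integral_cong[OF refl])
      fix y
      have "- (\<integral>r. ?c y r \<partial>lborel) = parametrix z 1 y - parametrix z \<delta> y" using ft[of y] by simp
      then show "parametrix z \<delta> y - parametrix z 1 y = (\<integral>r. ?c y r \<partial>lborel)" by linarith
    qed
    also have "\<dots> = (\<integral>r. (\<integral>y. ?c y r \<partial>\<sigma>) \<partial>lborel)" by (rule Fubini_integral[OF ik, symmetric])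
    finally show ?thesis .
  qed
  have "ennreal (\<integral>r. (\<integral>y. ?c y r \<partial>\<sigma>) \<partial>lborel) \<le> (\<integral>\<^sup>+r. ennreal (G r) \<partial>lborel)"
  proof -
    have ic: "integrable lborel (\<lambda>r. \<integral>y. ?c y r \<partial>\<sigma>)" by (rule integrable_snd[OF ik])
    have "(\<integral>r. (\<integral>y. ?c y r \<partial>\<sigma>) \<partial>lborel) \<le> (\<integral>r. max 0 (\<integral>y. ?c y r \<partial>\<sigma>) \<partial>lborel)"
      using ic by (intro integral_mono) auto
    then have "ennreal (\<integral>r. (\<integral>y. ?c y r \<partial>\<sigma>) \<partial>lborel) \<le> ennreal (\<integral>r. max 0 (\<integral>y. ?c y r \<partial>\<sigma>) \<partial>lborel)" by (rule ennreal_leI)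
    also have "\<dots> = (\<integral>\<^sup>+r. ennreal (max 0 (\<integral>y. ?c y r \<partial>\<sigma>)) \<partial>lborel)"
      using ic by (intro nn_integral_eq_integral[symmetric]) auto
    also have "\<dots> \<le> (\<integral>\<^sup>+r. ennreal (G r) \<partial>lborel)"
      using inner G0 by (intro nn_integral_mono ennreal_leI) auto
    finally show ?thesis .
  qed
  also have "\<dots> \<le> (\<integral>\<^sup>+r\<in>{0<..1}. ennreal ((2 + C) * inverse r ^ ?d) * mass z r \<partial>lborel)"
  proof (rule nn_integral_mono)
    fix r :: real
    show "ennreal (G r) \<le> ennreal ((2 + C) * inverse r ^ ?d) * mass z r * indicator {0<..1} r"
    proof (cases "r \<in> {\<delta>..1}")
      case True
      then have r: "0 < r" "r \<in> {0<..1}" using \<delta> by auto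
      have "ennreal (G r) = ennreal ((2 + C) * inverse r ^ ?d) * (ennreal (measure \<sigma> (ball z (radius * r))) + ennreal (measure n (ball z (radius * r))))"
        using True r C(1) by (simp add: G_def ennreal_mult ennreal_plus[symmetric] del: ennreal_plus)
      also have "\<dots> = ennreal ((2 + C) * inverse r ^ ?d) * mass z r"
        by (simp add: mass_def s.emeasure_eq_measure n.emeasure_eq_measure)
      finally show ?thesis using r by simp
    qed (simp add: G_def)
  qed
  finally have D: "ennreal ((\<integral>y. parametrix z \<delta> y \<partial>\<sigma>) - (\<integral>y. parametrix z 1 y \<partial>\<sigma>)) \<le> (\<integral>\<^sup>+r\<in>{0<..1}. ennreal ((2 + C) * inverse r ^ ?d) * mass z r \<partial>lborel)"
    unfolding diff .
  have one: "ennreal (\<integral>y. parametrix z 1 y \<partial>\<sigma>) \<le> 2 * emeasure \<sigma> UNIV"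
  proof -
    have "ennreal (\<integral>y. parametrix z 1 y \<partial>\<sigma>) = (\<integral>\<^sup>+y. ennreal (parametrix z 1 y) \<partial>\<sigma>)"
      using integrable_parametrix[of 1] parametrix_nonneg[of 1] by (intro nn_integral_eq_integral[symmetric]) auto
    also have "\<dots> \<le> (\<integral>\<^sup>+y. ennreal 2 \<partial>\<sigma>)" using parametrix_le[of 1 z] by (intro nn_integral_mono ennreal_leI) simp
    finally show ?thesis by simp
  qed
  have "(\<integral>\<^sup>+y. ennreal (parametrix z \<delta> y) \<partial>\<sigma>) = ennreal (\<integral>y. parametrix z \<delta> y \<partial>\<sigma>)"
    using integrable_parametrix[OF \<delta>(1)] parametrix_nonneg[OF \<delta>(1)] by (intro nn_integral_eq_integral) auto
  also have "\<dots> \<le> ennreal (\<integral>y. parametrix z 1 y \<partial>\<sigma>) + ennreal ((\<integral>y. parametrix z \<delta> y \<partial>\<sigma>) - (\<integral>y. parametrix z 1 y \<partial>\<sigma>))"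
  proof (cases "(\<integral>y. parametrix z 1 y \<partial>\<sigma>) \<le> (\<integral>y. parametrix z \<delta> y \<partial>\<sigma>)")
    case True
    have "0 \<le> (\<integral>y. parametrix z 1 y \<partial>\<sigma>)" using parametrix_nonneg[of 1] by (intro integral_nonneg_AE) auto
    then show ?thesis using True by (subst ennreal_plus[symmetric]) auto
  next
    case False
    then have "ennreal (\<integral>y. parametrix z \<delta> y \<partial>\<sigma>) \<le> ennreal (\<integral>y. parametrix z 1 y \<partial>\<sigma>)" by (intro ennreal_leI) simp
    then show ?thesis by (rule order_trans) simp
  qed
  also have "\<dots> \<le> 2 * emeasure \<sigma> UNIV + (\<integral>\<^sup>+r\<in>{0<..1}. ennreal ((2 + C) * inverse r ^ ?d) * mass z r \<partial>lborel)"
    by (intro add_mono one D)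
  finally show ?thesis .
qed

lemma mass_measurable: "(\<lambda>q. mass (fst q) (snd q)) \<in> borel_measurable (lborel \<Otimes>\<^sub>M lborel)"
proof -
  have eb: "(\<lambda>q. emeasure N (ball (fst q) (radius * snd q))) \<in> borel_measurable (lborel \<Otimes>\<^sub>M lborel)"
    if N: "finite_measure N" and [measurable_cong]: "sets N = sets borel" for N :: "(real^'d) measure"
  proof -
    interpret N: finite_measure N by fact
    have "(\<lambda>q. \<integral>\<^sup>+y. indicator {p. dist (fst (fst p)) (snd p) < radius * snd (fst p)} (q, y) \<partial>N) \<in> borel_measurable ((lborel :: (real^'d) measure) \<Otimes>\<^sub>M (lborel :: real measure))"
      by (rule N.borel_measurable_nn_integral) measurable
    moreover have "(\<integral>\<^sup>+y. indicator {p. dist (fst (fst p)) (snd p) < radius * snd (fst p)} (q, y) \<partial>N) = emeasure N (ball (fst q) (radius * snd q))" for q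
    proof -
      have "(\<integral>\<^sup>+y. indicator {p. dist (fst (fst p)) (snd p) < radius * snd (fst p)} (q, y) \<partial>N) = (\<integral>\<^sup>+y. indicator (ball (fst q) (radius * snd q)) y \<partial>N)"
        by (intro nn_integral_cong) (auto split: split_indicator)
      also have "\<dots> = emeasure N (ball (fst q) (radius * snd q))" using that(2) by simp
      finally show ?thesis .
    qed
    ultimately show ?thesis by simp
  qed
  show ?thesis unfolding mass_def
    by (intro borel_measurable_add eb fin_\<sigma> fin_n sets_\<sigma> sets_n)
qed

text \<open>
  The bound of \<open>parametrix_increase\<close>, which is uniform in the final scale.
\<close>

definition potential :: "real \<Rightarrow> real^'d \<Rightarrow> ennreal" where
  "potential C z = 2 * emeasure \<sigma> UNIV + (\<integral>\<^sup>+r\<in>{0<..1}. ennreal ((2 + C) * inverse r ^ CARD('d)) * mass z r \<partial>lborel)"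

lemma potential_joint: "(\<lambda>q. ennreal ((2 + C) * inverse (snd q) ^ CARD('d)) * mass (fst q) (snd q) * indicator {0<..1} (snd q)) \<in> borel_measurable ((lborel :: (real^'d) measure) \<Otimes>\<^sub>M (lborel :: real measure))"
  using mass_measurable by measurable

lemma potential_measurable [measurable]: "potential C \<in> borel_measurable borel"
proof -
  have "(\<lambda>z. \<integral>\<^sup>+r\<in>{0<..1}. ennreal ((2 + C) * inverse r ^ CARD('d)) * mass z r \<partial>lborel) \<in> borel_measurable (lborel :: (real^'d) measure)"
    by (rule lborel.borel_measurable_nn_integral) (use potential_joint in \<open>simp add: case_prod_beta'\<close>)
  then show ?thesis unfolding potential_def[abs_def] by measurable
qed

text \<open>
  Integrating over \<open>z\<close> first, the volume of the ball cancels the power of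
  \<open>r\<close>.
\<close>

lemma potential_locally_integrable:
  assumes C: "0 \<le> C"
  shows "(\<integral>\<^sup>+z\<in>ball 0 R. potential C z \<partial>lborel) < \<infinity>"
proof -
  let ?d = "CARD('d)"
  let ?f = "\<lambda>z r. ennreal ((2 + C) * inverse r ^ ?d) * mass z r * indicator {0<..1} r"
  define V where "V = unit_ball_vol (real ?d)"
  have V: "0 \<le> V" by (simp add: V_def)
  define m where "m = measure \<sigma> UNIV + measure n UNIV"
  have m: "0 \<le> m" by (simp add: m_def)
  have mm: "(\<lambda>(z, r). ?f z r) \<in> borel_measurable ((lborel :: (real^'d) measure) \<Otimes>\<^sub>M (lborel :: real measure))"
    using potential_joint by (simp add: case_prod_beta')
  have slice: "(\<integral>\<^sup>+z. ?f z r \<partial>lborel) \<le> ennreal ((2 + C) * m * V * radius ^ ?d) * indicator {0<..1} r" for r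
  proof (cases "r \<in> {0<..1}")
    case True
    then have r: "0 < r" by simp
    have mz: "(\<lambda>z. mass z r) \<in> borel_measurable lborel"
      using measurable_compose[of "\<lambda>z. (z, r)" lborel "lborel \<Otimes>\<^sub>M lborel", OF _ mass_measurable] by simp
    have me: "(\<lambda>z. emeasure N (ball z (radius * r))) \<in> borel_measurable lborel"
      if N: "finite_measure N" and [measurable_cong]: "sets N = sets borel" for N :: "(real^'d) measure"
    proof -
      interpret N: finite_measure N by fact
      have "(\<lambda>z. \<integral>\<^sup>+y. indicator {p. dist (fst p) (snd p) < radius * r} (z, y) \<partial>N) \<in> borel_measurable (lborel :: (real^'d) measure)"
        by (rule N.borel_measurable_nn_integral) measurable
      moreover have "(\<integral>\<^sup>+y. indicator {p. dist (fst p) (snd p) < radius * r} (z, y) \<partial>N) = (\<integral>\<^sup>+y. indicator (ball z (radius * r)) y \<partial>N)" for z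
        by (intro nn_integral_cong) (auto split: split_indicator)
      moreover have "(\<integral>\<^sup>+y. indicator (ball z (radius * r)) y \<partial>N) = emeasure N (ball z (radius * r))" for z using that(2) by simp
      ultimately show ?thesis by simp
    qed
    have eb: "emeasure lborel (ball (0::real^'d) (radius * r)) = ennreal (V * (radius * r) ^ ?d)"
      using r radius_pos by (simp add: emeasure_ball V_def)
    have "(\<integral>\<^sup>+z. ?f z r \<partial>lborel) = ennreal ((2 + C) * inverse r ^ ?d) * (\<integral>\<^sup>+z. mass z r \<partial>lborel)"
      using True mz by (simp add: nn_integral_cmult)
    also have "(\<integral>\<^sup>+z. mass z r \<partial>lborel) = (emeasure \<sigma> UNIV + emeasure n UNIV) * emeasure lborel (ball (0::real^'d) (radius * r))"
      unfolding mass_def using me[OF fin_\<sigma> sets_\<sigma>] me[OF fin_n sets_n]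
      by (subst nn_integral_add) (simp_all add: nn_integral_emeasure_ball[OF fin_\<sigma> sets_\<sigma>] nn_integral_emeasure_ball[OF fin_n sets_n] distrib_right)
    also have "\<dots> = ennreal (m * (V * (radius * r) ^ ?d))"
      unfolding eb m_def using V r radius_pos by (simp add: s.emeasure_eq_measure n.emeasure_eq_measure ennreal_mult)
    also have "ennreal ((2 + C) * inverse r ^ ?d) * \<dots> = ennreal ((2 + C) * inverse r ^ ?d * (m * (V * (radius * r) ^ ?d)))"
      using C r m V radius_pos by (subst ennreal_mult) auto
    also have "(2 + C) * inverse r ^ ?d * (m * (V * (radius * r) ^ ?d)) = (2 + C) * m * V * radius ^ ?d"
    proof -
      have "inverse r ^ ?d * r ^ ?d = 1" using r by (simp add: power_mult_distrib[symmetric])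
      then show ?thesis by (simp add: power_mult_distrib mult.assoc mult.left_commute)
    qed
    finally show ?thesis using True by simp
  qed simp
  have "(\<integral>\<^sup>+z. (\<integral>\<^sup>+r. ?f z r \<partial>lborel) \<partial>lborel) = (\<integral>\<^sup>+r. (\<integral>\<^sup>+z. ?f z r \<partial>lborel) \<partial>lborel)"
    using lborel_pair.Fubini'[OF mm] by (simp only: prod.case)
  also have "\<dots> \<le> (\<integral>\<^sup>+r. ennreal ((2 + C) * m * V * radius ^ ?d) * indicator {0<..1} r \<partial>(lborel :: real measure))"
    by (rule nn_integral_mono) (rule slice)
  also have "\<dots> = ennreal ((2 + C) * m * V * radius ^ ?d)" by (simp add: nn_integral_cmult_indicator)
  also have "\<dots> < \<infinity>" by simp
  finally have fin: "(\<integral>\<^sup>+z. (\<integral>\<^sup>+r. ?f z r \<partial>lborel) \<partial>lborel) < \<infinity>" .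
  have fm: "(\<lambda>z. \<integral>\<^sup>+r. ?f z r \<partial>lborel) \<in> borel_measurable (lborel :: (real^'d) measure)"
    by (rule lborel.borel_measurable_nn_integral[OF mm])
  have im: "(\<lambda>z. 2 * emeasure \<sigma> UNIV * indicator (ball 0 R) z) \<in> borel_measurable (lborel :: (real^'d) measure)"
    by (intro borel_measurable_times_ennreal borel_measurable_const borel_measurable_indicator) auto
  have "(\<integral>\<^sup>+z\<in>ball 0 R. potential C z \<partial>lborel) \<le> (\<integral>\<^sup>+z. 2 * emeasure \<sigma> UNIV * indicator (ball 0 R) z + (\<integral>\<^sup>+r. ?f z r \<partial>lborel) \<partial>lborel)"
    unfolding potential_def by (intro nn_integral_mono) (auto split: split_indicator)
  also have "\<dots> = 2 * emeasure \<sigma> UNIV * emeasure lborel (ball (0::real^'d) R) + (\<integral>\<^sup>+z. (\<integral>\<^sup>+r. ?f z r \<partial>lborel) \<partial>lborel)"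
    using fm im by (subst nn_integral_add) (auto simp: nn_integral_cmult_indicator)
  also have "\<dots> < \<infinity>"
    using fin emeasure_lborel_ball_finite[of "0 :: real^'d" R] by (simp add: ennreal_mult_less_top s.emeasure_eq_measure)
  finally show ?thesis .
qed

definition parametrix_mass :: real where
  "parametrix_mass = exp (- 2) * unit_ball_vol (real CARD('d)) * sqrt l ^ CARD('d)"

lemma parametrix_mass_pos: "0 < parametrix_mass" unfolding parametrix_mass_def using l by simp

text \<open>
  On the ball of radius \<open>sqrt l * \<delta>\<close> the width is at most \<open>1 / 2\<close>,
  and there \<open>flat_exp 2\<close> is at least \<open>exp (- 2)\<close>.
\<close>

lemma parametrix_mass_le:
  assumes \<delta>: "0 < \<delta>" and ball: "ball y (sqrt l * \<delta>) \<subseteq> O'" and O': "O' \<in> sets borel"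
  shows "ennreal parametrix_mass \<le> (\<integral>\<^sup>+z\<in>O'. ennreal (parametrix z \<delta> y) \<partial>lborel)"
proof -
  let ?d = "CARD('d)"
  have pt: "exp (- 2) * inverse \<delta> ^ ?d \<le> parametrix z \<delta> y" if "z \<in> ball y (sqrt l * \<delta>)" for z
  proof -
    have "(norm (y - z))\<^sup>2 \<le> (sqrt l * \<delta>)\<^sup>2" using that by (intro power_mono) (auto simp: dist_norm)
    then have "(norm (y - z))\<^sup>2 / l \<le> \<delta>\<^sup>2" using l by (simp add: power_mult_distrib field_simps)
    with A_inv_quadratic_upper[of "y - z" z] have "(y - z) \<bullet> (A_inv z *v (y - z)) \<le> \<delta>\<^sup>2" by linarith
    then have w: "frozen_width z \<delta> y \<le> 1 / 2" using \<delta> by (simp add: width_def field_simps)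
    define s where "s = 1 - frozen_width z \<delta> y"
    have s: "1 / 2 \<le> s" "s \<le> 1" using w width_nonneg[of z \<delta> y] by (auto simp: s_def)
    have i: "inverse s \<le> 2" "1 \<le> inverse s" using s by (simp_all add: field_simps)
    have "exp (- 2) * 1 \<le> exp (- inverse s) * inverse s ^ 2"
      using i by (intro mult_mono) (auto intro: one_le_power)
    then have "exp (- 2) \<le> flat_exp 2 s" using s by (simp add: flat_exp_def)
    then show ?thesis unfolding parametrix_def s_def using \<delta> by (intro mult_right_mono) auto
  qed
  have "ennreal parametrix_mass = ennreal (exp (- 2) * inverse \<delta> ^ ?d) * emeasure lborel (ball y (sqrt l * \<delta>))"
  proof -
    have "emeasure lborel (ball y (sqrt l * \<delta>)) = ennreal (unit_ball_vol (real ?d) * (sqrt l * \<delta>) ^ ?d)"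
      using \<delta> l by (simp add: emeasure_ball)
    then have "ennreal (exp (- 2) * inverse \<delta> ^ ?d) * emeasure lborel (ball y (sqrt l * \<delta>)) =
        ennreal (exp (- 2) * inverse \<delta> ^ ?d * (unit_ball_vol (real ?d) * (sqrt l * \<delta>) ^ ?d))"
      using \<delta> l by (simp add: ennreal_mult)
    also have "exp (- 2) * inverse \<delta> ^ ?d * (unit_ball_vol (real ?d) * (sqrt l * \<delta>) ^ ?d) = parametrix_mass"
    proof -
      have "inverse \<delta> ^ ?d * \<delta> ^ ?d = 1" using \<delta> by (simp add: power_mult_distrib[symmetric])
      then show ?thesis unfolding parametrix_mass_def by (simp add: power_mult_distrib mult.assoc mult.left_commute)
    qed
    finally show ?thesis by simp
  qed
  also have "\<dots> = (\<integral>\<^sup>+z. ennreal (exp (- 2) * inverse \<delta> ^ ?d) * indicator (ball y (sqrt l * \<delta>)) z \<partial>lborel)"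
    by (simp add: nn_integral_cmult_indicator)
  also have "\<dots> \<le> (\<integral>\<^sup>+z\<in>O'. ennreal (parametrix z \<delta> y) \<partial>lborel)"
    using pt ball by (intro nn_integral_mono) (auto split: split_indicator intro: ennreal_leI)
  finally show ?thesis .
qed

text \<open>
  Averaging the parametrix over centres \<open>z\<close> in an open set sees each of its points in
  the limit; Fatou's lemma then passes the uniform bound by the potential to the limit.
\<close>

lemma open_set_bound:
  assumes C: "0 \<le> C" "\<And>z r y. norm z \<le> R \<Longrightarrow> 0 < r \<Longrightarrow> r \<le> 1 \<Longrightarrow> \<bar>2 * diff_op A b (frozen_bump z r) y - frozen_trace z r y\<bar> \<le> (C / r) * indicator (ball z (radius * r)) y"
    and O': "open O'" "O' \<subseteq> ball 0 R"
  shows "ennreal parametrix_mass * emeasure \<sigma> O' \<le> (\<integral>\<^sup>+z\<in>O'. potential C z \<partial>lborel)"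
proof -
  have Ob[measurable]: "O' \<in> sets borel" using O' by auto
  define g where "g m y = (\<integral>\<^sup>+z\<in>O'. ennreal (parametrix z (1 / real (Suc m)) y) \<partial>lborel)" for m y
  interpret pair_sigma_finite \<sigma> "lborel :: (real^'d) measure" ..
  have jm: "(\<lambda>(y, z). ennreal (parametrix z (1 / real (Suc m)) y) * indicator O' z) \<in> borel_measurable (\<sigma> \<Otimes>\<^sub>M (lborel :: (real^'d) measure))" for m
    unfolding case_prod_beta' by measurable
  have gm: "g m \<in> borel_measurable \<sigma>" for m
    unfolding g_def[abs_def] by (rule lborel.borel_measurable_nn_integral[OF jm])
  have ub: "(\<integral>\<^sup>+y. g m y \<partial>\<sigma>) \<le> (\<integral>\<^sup>+z\<in>O'. potential C z \<partial>lborel)" for m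
  proof -
    have "(\<integral>\<^sup>+y. g m y \<partial>\<sigma>) = (\<integral>\<^sup>+z. (\<integral>\<^sup>+y. ennreal (parametrix z (1 / real (Suc m)) y) * indicator O' z \<partial>\<sigma>) \<partial>lborel)"
      unfolding g_def using Fubini'[OF jm] by simp
    also have "\<dots> = (\<integral>\<^sup>+z\<in>O'. (\<integral>\<^sup>+y. ennreal (parametrix z (1 / real (Suc m)) y) \<partial>\<sigma>) \<partial>lborel)"
      by (intro nn_integral_cong nn_integral_multc) measurable
    also have "\<dots> \<le> (\<integral>\<^sup>+z\<in>O'. potential C z \<partial>lborel)"
    proof (intro nn_integral_mono)
      fix z :: "real^'d"
      show "(\<integral>\<^sup>+y. ennreal (parametrix z (1 / real (Suc m)) y) \<partial>\<sigma>) * indicator O' z \<le> potential C z * indicator O' z"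
      proof (cases "z \<in> O'")
        case True
        then have "norm z \<le> R" using O'(2) by auto
        then have "(\<integral>\<^sup>+y. ennreal (parametrix z (1 / real (Suc m)) y) \<partial>\<sigma>) \<le> potential C z"
          unfolding potential_def by (intro parametrix_increase C) auto
        then show ?thesis using True by simp
      qed simp
    qed
    finally show ?thesis .
  qed
  have "ennreal parametrix_mass * emeasure \<sigma> O' = (\<integral>\<^sup>+y. ennreal parametrix_mass * indicator O' y \<partial>\<sigma>)"
    by (simp add: nn_integral_cmult_indicator)
  also have "\<dots> \<le> (\<integral>\<^sup>+y. liminf (\<lambda>m. g m y) \<partial>\<sigma>)"
  proof (intro nn_integral_mono)
    fix y :: "real^'d"
    show "ennreal parametrix_mass * indicator O' y \<le> liminf (\<lambda>m. g m y)"
    proof (cases "y \<in> O'")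
      case True
      then obtain e where e: "0 < e" "ball y e \<subseteq> O'" using O'(1) open_contains_ball by blast
      have "(\<lambda>m. sqrt l * (1 / real (Suc m))) \<longlonglongrightarrow> sqrt l * 0"
        by (intro tendsto_mult tendsto_const LIMSEQ_Suc[OF lim_const_over_n])
      then have "\<forall>\<^sub>F m in sequentially. sqrt l * (1 / real (Suc m)) < e" using e(1) by (intro order_tendstoD) auto
      then have "\<forall>\<^sub>F m in sequentially. ennreal parametrix_mass \<le> g m y"
      proof eventually_elim
        case (elim m)
        have "ball y (sqrt l * (1 / real (Suc m))) \<subseteq> O'" using elim e(2) by (intro order_trans[OF subset_ball e(2)]) auto
        then show ?case unfolding g_def by (intro parametrix_mass_le) auto
      qed
      then have "ennreal parametrix_mass \<le> liminf (\<lambda>m. g m y)" by (intro Liminf_bounded)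
      then show ?thesis using True by simp
    qed simp
  qed
  also have "\<dots> \<le> liminf (\<lambda>m. \<integral>\<^sup>+y. g m y \<partial>\<sigma>)" by (rule nn_integral_liminf[OF gm])
  also have "\<dots> \<le> limsup (\<lambda>m. \<integral>\<^sup>+y. g m y \<partial>\<sigma>)" by (rule Liminf_le_Limsup) simp
  also have "\<dots> \<le> (\<integral>\<^sup>+z\<in>O'. potential C z \<partial>lborel)" by (intro Limsup_bounded always_eventually allI ub)
  finally show ?thesis .
qed

text \<open>
  By outer regularity a null set lies in open sets whose intersection is null. The potential is
  locally integrable, so its integrals over these sets tend to \<open>0\<close>, and they dominate
  the measure.
\<close>

theorem lborel_null_imp_null:
  assumes N: "N \<in> null_sets lborel"
  shows "emeasure \<sigma> N = 0"
proof -
  have Nb[measurable]: "N \<in> sets borel" using N by auto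
  have bounded_case: "emeasure \<sigma> (N \<inter> ball 0 R) = 0" for R
  proof -
    obtain C where C: "0 \<le> C" "\<And>z r y. norm z \<le> R \<Longrightarrow> 0 < r \<Longrightarrow> r \<le> 1 \<Longrightarrow> \<bar>2 * diff_op A b (frozen_bump z r) y - frozen_trace z r y\<bar> \<le> (C / r) * indicator (ball z (radius * r)) y"
      using frozen_error[of R] by blast
    have "\<exists>U. open U \<and> N \<subseteq> U \<and> emeasure lborel (U - N) < ennreal (1 / real (Suc j))" for j
      using outer_regular_lborel[OF Nb, of "1 / real (Suc j)"] by (metis divide_pos_pos of_nat_0_less_iff zero_less_Suc zero_less_one)
    then obtain U where U: "\<And>j. open (U j)" "\<And>j. N \<subseteq> U j" "\<And>j. emeasure lborel (U j - N) < ennreal (1 / real (Suc j))"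
      by metis
    define W where "W k = (\<Inter>j\<le>k. U j) \<inter> ball 0 R" for k
    have Wo: "open (W k)" for k unfolding W_def using U(1) by (intro open_Int open_INT) auto
    have Wb[measurable]: "W k \<in> sets borel" for k using Wo[of k] by auto
    have Wdec: "decseq W" unfolding decseq_def W_def by auto
    define \<nu> where "\<nu> = density lborel (\<lambda>z. potential C z * indicator (ball 0 R) z)"
    have s\<nu>[simp]: "sets \<nu> = sets borel" by (simp add: \<nu>_def)
    have pm: "(\<lambda>z. potential C z * indicator (ball 0 R) z) \<in> borel_measurable borel"
      by (intro borel_measurable_times_ennreal potential_measurable borel_measurable_indicator) auto
    have em: "emeasure \<nu> D = (\<integral>\<^sup>+z. potential C z * indicator (ball 0 R) z * indicator D z \<partial>lborel)" if [measurable]: "D \<in> sets borel" for D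
      unfolding \<nu>_def using pm that by (subst emeasure_density) (simp_all add: measurable_lborel1)
    have fin: "emeasure \<nu> (W k) \<noteq> \<infinity>" for k
    proof -
      have "emeasure \<nu> (W k) \<le> (\<integral>\<^sup>+z\<in>ball 0 R. potential C z \<partial>lborel)"
        by (subst em) (auto intro!: nn_integral_mono split: split_indicator)
      then show ?thesis using potential_locally_integrable[OF C(1), of R] by auto
    qed
    have "emeasure lborel (\<Inter>k. W k) = 0"
    proof -
      have le: "emeasure lborel (\<Inter>k. W k) \<le> ennreal (1 / real (Suc j))" for j
      proof -
        have "emeasure lborel (\<Inter>k. W k) \<le> emeasure lborel (N \<union> (U j - N))"
          using U(1) by (intro emeasure_mono) (auto simp: W_def)
        also have "\<dots> \<le> emeasure lborel N + emeasure lborel (U j - N)"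
          using U(1) by (intro emeasure_subadditive) auto
        also have "\<dots> \<le> ennreal (1 / real (Suc j))" using null_setsD1[OF N] U(3)[of j] by simp
        finally show ?thesis .
      qed
      have "(\<lambda>j. ennreal (1 / real (Suc j))) \<longlonglongrightarrow> ennreal 0"
        by (intro tendsto_ennrealI LIMSEQ_Suc[OF lim_const_over_n])
      then have "emeasure lborel (\<Inter>k. W k) \<le> ennreal 0" using le by (intro LIMSEQ_le_const) auto
      then show ?thesis by simp
    qed
    then have "AE z in lborel. z \<notin> (\<Inter>k. W k)" by (intro AE_not_in) (auto simp: null_sets_def)
    then have "(\<integral>\<^sup>+z. potential C z * indicator (ball 0 R) z * indicator (\<Inter>k. W k) z \<partial>lborel) = (\<integral>\<^sup>+z. 0 \<partial>(lborel :: (real^'d) measure))"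
      by (intro nn_integral_cong_AE) (auto split: split_indicator elim: eventually_mono)
    then have "emeasure \<nu> (\<Inter>k. W k) = 0" by (subst em) auto
    then have lim: "(\<lambda>k. emeasure \<nu> (W k)) \<longlonglongrightarrow> 0"
      using Lim_emeasure_decseq[of W \<nu>, OF _ Wdec fin] Wb by (simp add: image_subset_iff)
    have "ennreal parametrix_mass * emeasure \<sigma> (N \<inter> ball 0 R) \<le> emeasure \<nu> (W k)" for k
    proof -
      have "ennreal parametrix_mass * emeasure \<sigma> (N \<inter> ball 0 R) \<le> ennreal parametrix_mass * emeasure \<sigma> (W k)"
      proof (intro mult_left_mono emeasure_mono)
        show "N \<inter> ball 0 R \<subseteq> W k" using U(2) by (auto simp: W_def)
        show "W k \<in> sets \<sigma>" using Wb[of k] by simp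
      qed simp
      also have "\<dots> \<le> (\<integral>\<^sup>+z\<in>W k. potential C z \<partial>lborel)"
        by (rule open_set_bound[OF C Wo]) (auto simp: W_def)
      also have "\<dots> = emeasure \<nu> (W k)"
        by (subst em[OF Wb]) (auto intro!: nn_integral_cong split: split_indicator simp: W_def)
      finally show ?thesis .
    qed
    then have "ennreal parametrix_mass * emeasure \<sigma> (N \<inter> ball 0 R) \<le> 0" by (intro LIMSEQ_le_const[OF lim]) auto
    then show ?thesis using parametrix_mass_pos by simp
  qed
  have "N = (\<Union>k::nat. N \<inter> ball 0 (real k))"
    using reals_Archimedean2 by auto
  then have "emeasure \<sigma> N = emeasure \<sigma> (\<Union>k::nat. N \<inter> ball 0 (real k))" by simp
  also have "\<dots> = 0" using bounded_case by (intro emeasure_UN_eq_0) auto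
  finally show ?thesis .
qed

end

section \<open>Lipschitz test functions suffice\<close>

definition restr :: "nat \<Rightarrow> (nat \<Rightarrow> real) \<Rightarrow> nat \<Rightarrow> real" where
  "restr n y = (\<lambda>i. if i < n then y i else 0)"

text \<open>
  The largest function below \<open>h\<close> on the first \<open>n\<close> coordinates that is
  \<open>k\<close>-Lipschitz for the sum of the coordinate distances.
\<close>

definition lipschitz_envelope :: "nat \<Rightarrow> ((nat \<Rightarrow> real) \<Rightarrow> real) \<Rightarrow> nat \<Rightarrow> (nat \<Rightarrow> real) \<Rightarrow> real" where
  "lipschitz_envelope n h k y = (INF z. h (restr n z) + real k * (\<Sum>i<n. \<bar>y i - z i\<bar>))"

context
  fixes n :: nat and h :: "(nat \<Rightarrow> real) \<Rightarrow> real" and K :: real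
  assumes h: "continuous_on UNIV h" and K: "\<And>y. \<bar>h y\<bar> \<le> K"
begin

lemma penalty_nonneg: "0 \<le> real k * (\<Sum>i<n. \<bar>y i - z i :: real\<bar>)"
  by (intro mult_nonneg_nonneg sum_nonneg) auto

lemma envelope_bdd: "bdd_below (range (\<lambda>z. h (restr n z) + real k * (\<Sum>i<n. \<bar>y i - z i\<bar>)))"
proof (rule bdd_belowI2)
  fix z show "- K \<le> h (restr n z) + real k * (\<Sum>i<n. \<bar>y i - z i\<bar>)"
    using K[of "restr n z"] penalty_nonneg[of k y z] by linarith
qed

lemma envelope_le: "lipschitz_envelope n h k y \<le> h (restr n z) + real k * (\<Sum>i<n. \<bar>y i - z i\<bar>)"
  unfolding lipschitz_envelope_def by (rule cINF_lower[OF envelope_bdd]) simp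

lemma envelope_le_self: "lipschitz_envelope n h k y \<le> h (restr n y)"
  using envelope_le[of k y y] by simp

lemma envelope_ge: "(\<And>z. c \<le> h (restr n z) + real k * (\<Sum>i<n. \<bar>y i - z i\<bar>)) \<Longrightarrow> c \<le> lipschitz_envelope n h k y"
  unfolding lipschitz_envelope_def by (rule cINF_greatest) auto

lemma envelope_abs_le: "\<bar>lipschitz_envelope n h k y\<bar> \<le> K"
proof -
  have "- K \<le> lipschitz_envelope n h k y"
  proof (rule envelope_ge)
    fix z show "- K \<le> h (restr n z) + real k * (\<Sum>i<n. \<bar>y i - z i\<bar>)"
      using K[of "restr n z"] penalty_nonneg[of k y z] by linarith
  qed
  moreover have "lipschitz_envelope n h k y \<le> K"
    using envelope_le_self[of k y] K[of "restr n y"] by linarith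
  ultimately show ?thesis by linarith
qed

lemma envelope_lipschitz: "\<bar>lipschitz_envelope n h k y - lipschitz_envelope n h k y'\<bar> \<le> real k * (\<Sum>i<n. \<bar>y i - y' i\<bar>)"
proof -
  have one: "lipschitz_envelope n h k y - real k * (\<Sum>i<n. \<bar>y i - y' i\<bar>) \<le> lipschitz_envelope n h k y'" for y y'
  proof (rule envelope_ge)
    fix z
    have "(\<Sum>i<n. \<bar>y i - z i\<bar>) \<le> (\<Sum>i<n. \<bar>y i - y' i\<bar>) + (\<Sum>i<n. \<bar>y' i - z i\<bar>)"
      unfolding sum.distrib[symmetric] by (intro sum_mono) linarith
    then have "real k * (\<Sum>i<n. \<bar>y i - z i\<bar>) \<le> real k * ((\<Sum>i<n. \<bar>y i - y' i\<bar>) + (\<Sum>i<n. \<bar>y' i - z i\<bar>))"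
      by (intro mult_left_mono) auto
    then show "lipschitz_envelope n h k y - real k * (\<Sum>i<n. \<bar>y i - y' i\<bar>) \<le> h (restr n z) + real k * (\<Sum>i<n. \<bar>y' i - z i\<bar>)"
      using envelope_le[of k y z] by (simp add: distrib_left)
  qed
  have sym: "(\<Sum>i<n. \<bar>y' i - y i\<bar>) = (\<Sum>i<n. \<bar>y i - y' i\<bar>)" by (simp add: abs_minus_commute)
  show ?thesis using one[of y y'] one[of y' y] unfolding sym by linarith
qed

text \<open>
  A point that nearly realises the infimum has distance at most \<open>(2 * K + 1) / k\<close> from
  \<open>y\<close>, because the penalty exceeds the oscillation of \<open>h\<close> by at most
  \<open>1\<close>; so continuity of \<open>h\<close> applies.
\<close>

lemma envelope_tendsto: "(\<lambda>k. lipschitz_envelope n h k y) \<longlonglongrightarrow> h (restr n y)"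
proof -
  have "\<exists>z. h (restr n z) + real k * (\<Sum>i<n. \<bar>y i - z i\<bar>) < lipschitz_envelope n h k y + 1 / real (Suc k)" for k
    using cINF_less_iff[OF _ envelope_bdd, of k y "lipschitz_envelope n h k y + 1 / real (Suc k)"]
    by (simp add: lipschitz_envelope_def)
  then obtain z where z: "\<And>k. h (restr n (z k)) + real k * (\<Sum>i<n. \<bar>y i - z k i\<bar>) < lipschitz_envelope n h k y + 1 / real (Suc k)"
    by metis
  have dist: "real k * (\<Sum>i<n. \<bar>y i - z k i\<bar>) \<le> 2 * K + 1" for k
  proof -
    have "1 / real (Suc k) \<le> 1" by simp
    then show ?thesis using z[of k] envelope_le_self[of k y] K[of "restr n y"] K[of "restr n (z k)"] by linarith
  qed
  have coord: "(\<lambda>k. z k i) \<longlonglongrightarrow> y i" if i: "i < n" for i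
  proof -
    have "(\<lambda>k. z (Suc k) i - y i) \<longlonglongrightarrow> 0"
    proof (rule Lim_null_comparison)
      show "\<forall>\<^sub>F k in sequentially. norm (z (Suc k) i - y i) \<le> (2 * K + 1) / real (Suc k)"
      proof (rule always_eventually, rule allI)
        fix k
        have "\<bar>y i - z (Suc k) i\<bar> \<le> (\<Sum>i<n. \<bar>y i - z (Suc k) i\<bar>)" using i by (intro member_le_sum) auto
        then have "real (Suc k) * \<bar>y i - z (Suc k) i\<bar> \<le> real (Suc k) * (\<Sum>i<n. \<bar>y i - z (Suc k) i\<bar>)" by (intro mult_left_mono) auto
        also have "\<dots> \<le> 2 * K + 1" by (rule dist)
        finally have "\<bar>y i - z (Suc k) i\<bar> * real (Suc k) \<le> 2 * K + 1" by (simp only: mult.commute)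
        then have "\<bar>y i - z (Suc k) i\<bar> \<le> (2 * K + 1) / real (Suc k)" by (subst pos_le_divide_eq) auto
        then show "norm (z (Suc k) i - y i) \<le> (2 * K + 1) / real (Suc k)" by (simp add: abs_minus_commute)
      qed
      show "(\<lambda>k. (2 * K + 1) / real (Suc k)) \<longlonglongrightarrow> 0" by (rule LIMSEQ_Suc[OF lim_const_over_n])
    qed
    then have "(\<lambda>k. z (Suc k) i) \<longlonglongrightarrow> y i" by (simp add: LIM_zero_iff)
    then show ?thesis by (rule LIMSEQ_imp_Suc)
  qed
  have "(\<lambda>k. restr n (z k)) \<longlonglongrightarrow> restr n y"
  proof -
    have "\<forall>i. (\<lambda>k. restr n (z k) i) \<longlonglongrightarrow> restr n y i"
      using coord by (auto simp: restr_def)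
    then have "limitin (product_topology (\<lambda>_. euclidean) UNIV) (\<lambda>k. restr n (z k)) (restr n y) sequentially"
      unfolding limitin_componentwise by (simp add: limitin_canonical_iff)
    then show ?thesis unfolding euclidean_product_topology limitin_canonical_iff .
  qed
  then have hz: "(\<lambda>k. h (restr n (z k))) \<longlonglongrightarrow> h (restr n y)"
    by (rule continuous_on_tendsto_compose[OF h]) auto
  have "(\<lambda>k. h (restr n (z k)) - 1 / real (Suc k)) \<longlonglongrightarrow> h (restr n y) - 0"
    by (intro tendsto_diff hz LIMSEQ_Suc[OF lim_const_over_n])
  then have lo: "(\<lambda>k. h (restr n (z k)) - 1 / real (Suc k)) \<longlonglongrightarrow> h (restr n y)" by simp
  show ?thesis
  proof (rule tendsto_sandwich[OF _ _ lo tendsto_const])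
    show "\<forall>\<^sub>F k in sequentially. h (restr n (z k)) - 1 / real (Suc k) \<le> lipschitz_envelope n h k y"
    proof (rule always_eventually, rule allI)
      fix k
      have "0 \<le> real k * (\<Sum>i<n. \<bar>y i - z k i\<bar>)" by (intro mult_nonneg_nonneg sum_nonneg) auto
      then show "h (restr n (z k)) - 1 / real (Suc k) \<le> lipschitz_envelope n h k y" using z[of k] by linarith
    qed
    show "\<forall>\<^sub>F k in sequentially. lipschitz_envelope n h k y \<le> h (restr n y)"
      by (rule always_eventually) (simp add: envelope_le_self)
  qed
qed

end

lemma lipschitz_continuous:
  fixes g :: "(nat \<Rightarrow> real) \<Rightarrow> real"
  assumes "\<And>y z. \<bar>g y - g z\<bar> \<le> L * (\<Sum>i<n. \<bar>y i - z i\<bar>)"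
  shows "continuous_on UNIV g"
  unfolding continuous_on_def
proof
  fix y :: "nat \<Rightarrow> real"
  have "((\<lambda>z. z i) \<longlongrightarrow> y i) (at y within UNIV)" for i
  proof -
    have "continuous_on UNIV (\<lambda>z :: nat \<Rightarrow> real. z i)" by (rule continuous_on_product_coordinates)
    then show ?thesis unfolding continuous_on_def by blast
  qed
  then have "((\<lambda>z. L * (\<Sum>i<n. \<bar>z i - y i\<bar>)) \<longlongrightarrow> L * (\<Sum>i<n. \<bar>y i - y i\<bar>)) (at y within UNIV)"
    by (intro tendsto_intros)
  then have lim: "((\<lambda>z. L * (\<Sum>i<n. \<bar>z i - y i\<bar>)) \<longlongrightarrow> 0) (at y within UNIV)" by simp
  have "((\<lambda>z. g z - g y) \<longlongrightarrow> 0) (at y within UNIV)"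
    by (rule Lim_null_comparison[OF _ lim]) (simp add: assms)
  then show "(g \<longlongrightarrow> g y) (at y within UNIV)" by (simp add: LIM_zero_iff)
qed

text \<open>
  The Lipschitz envelopes increase to the function from below, which gives a lower bound for the
  lower limit of its integrals; the negative of the function gives the upper bound.
\<close>

lemma lipschitz_portmanteau:
  fixes N :: "nat \<Rightarrow> (nat \<Rightarrow> real) measure" and h :: "(nat \<Rightarrow> real) \<Rightarrow> real"
  assumes N: "\<And>j. prob_space (N j)" "\<And>j. sets (N j) = sets borel"
    and N': "prob_space N'" "sets N' = sets borel"
    and supp: "\<And>j. AE y in N j. restr n y = y" "AE y in N'. restr n y = y"
    and lip: "\<And>(g :: (nat \<Rightarrow> real) \<Rightarrow> real) K L. (\<And>y. \<bar>g y\<bar> \<le> K) \<Longrightarrow> 0 \<le> L \<Longrightarrow> (\<And>y z. \<bar>g y - g z\<bar> \<le> L * (\<Sum>i<n. \<bar>y i - z i\<bar>)) \<Longrightarrow>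
      (\<lambda>j. \<integral>y. g y \<partial>N j) \<longlonglongrightarrow> (\<integral>y. g y \<partial>N')"
    and h: "continuous_on UNIV h" "bounded (range h)"
  shows "(\<lambda>j. \<integral>y. h y \<partial>N j) \<longlonglongrightarrow> (\<integral>y. h y \<partial>N')"
proof -
  obtain K where K: "\<And>y. \<bar>h y\<bar> \<le> K" using h(2) by (auto simp: bounded_iff)
  have lower: "\<forall>\<^sub>F j in sequentially. (\<integral>y. g y \<partial>N') - e < (\<integral>y. g y \<partial>N j)"
    if g: "continuous_on UNIV g" "\<And>y. \<bar>g y\<bar> \<le> K" and e: "0 < e" for g e
  proof -
    let ?E = "lipschitz_envelope n g"
    have gm[measurable]: "g \<in> borel_measurable borel" using g(1) by (rule borel_measurable_continuous_onI)
    have Em[measurable]: "?E k \<in> borel_measurable borel" for k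
      by (rule borel_measurable_continuous_onI[OF lipschitz_continuous[OF envelope_lipschitz[OF g]]])
    interpret N': prob_space N' by fact
    have int: "integrable M q" if "prob_space M" "sets M = sets borel" "q \<in> borel_measurable borel" "\<And>y. \<bar>q y\<bar> \<le> K"
      for M and q :: "(nat \<Rightarrow> real) \<Rightarrow> real"
    proof -
      interpret prob_space M by fact
      show ?thesis using that by (intro integrable_const_bound[where B=K]) (auto simp: measurable_cong_sets[OF that(2) refl])
    qed
    have "(\<lambda>k. \<integral>y. ?E k y \<partial>N') \<longlonglongrightarrow> (\<integral>y. g y \<partial>N')"
    proof (rule integral_dominated_convergence)
      show "AE y in N'. (\<lambda>k. ?E k y) \<longlonglongrightarrow> g y"
        using supp(2) by eventually_elim (metis envelope_tendsto[OF g])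
      show "AE y in N'. norm (?E k y) \<le> K" for k using envelope_abs_le[OF g] by simp
    qed (auto simp: measurable_cong_sets[OF N'(2) refl])
    then have "\<forall>\<^sub>F k in sequentially. (\<integral>y. g y \<partial>N') - e < (\<integral>y. ?E k y \<partial>N')"
      using e by (intro order_tendstoD) auto
    then obtain k where k: "(\<integral>y. g y \<partial>N') - e < (\<integral>y. ?E k y \<partial>N')"
      by (auto simp: eventually_sequentially)
    have "(\<lambda>j. \<integral>y. ?E k y \<partial>N j) \<longlonglongrightarrow> (\<integral>y. ?E k y \<partial>N')"
      by (rule lip[OF envelope_abs_le[OF g] _ envelope_lipschitz[OF g]]) simp
    then have "\<forall>\<^sub>F j in sequentially. (\<integral>y. g y \<partial>N') - e < (\<integral>y. ?E k y \<partial>N j)"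
      using k by (rule order_tendstoD)
    then show ?thesis
    proof eventually_elim
      case (elim j)
      have "(\<integral>y. ?E k y \<partial>N j) \<le> (\<integral>y. g y \<partial>N j)"
      proof (rule integral_mono_AE)
        show "AE y in N j. ?E k y \<le> g y"
          using supp(1)[of j] by eventually_elim (metis envelope_le_self[OF g])
      qed (auto intro!: int N gm Em g(2) envelope_abs_le[OF g])
      then show ?case using elim by linarith
    qed
  qed
  show ?thesis
  proof (rule tendstoI)
    fix e :: real assume e: "0 < e"
    have "\<forall>\<^sub>F j in sequentially. (\<integral>y. - h y \<partial>N') - e < (\<integral>y. - h y \<partial>N j)"
      using h(1) K e by (intro lower) (auto intro: continuous_intros)
    with lower[OF h(1) K e] show "\<forall>\<^sub>F j in sequentially. dist (\<integral>y. h y \<partial>N j) (\<integral>y. h y \<partial>N') < e"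
      by eventually_elim (simp add: dist_real_def abs_less_iff)
  qed
qed

section \<open>Occupation measures of elliptic diffusions\<close>

context markov_family
begin

lemma integral_uniform_Icc:
  fixes q :: "real \<Rightarrow> real"
  assumes T: "0 < T" and q: "q \<in> borel_measurable borel"
  shows "T * (\<integral>s. q s \<partial>uniform_measure lborel {0..T}) = (LINT s:{0..T}|lborel. q s)"
proof -
  have e: "indicator {0..T} s / emeasure lborel {0..T} = ennreal (indicator {0..T} s / T)" for s
    using T divide_ennreal[of 1 T] by (auto split: split_indicator)
  have "(\<integral>s. q s \<partial>uniform_measure lborel {0..T}) = (\<integral>s. (indicator {0..T} s / T) *\<^sub>R q s \<partial>lborel)"
    unfolding uniform_measure_def e using T q by (intro integral_density) auto
  also have "\<dots> = (\<integral>s. (1 / T) * (indicator {0..T} s *\<^sub>R q s) \<partial>lborel)" by (simp add: field_simps)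
  also have "\<dots> = (1 / T) * (LINT s:{0..T}|lborel. q s)"
    unfolding set_lebesgue_integral_def by (rule integral_mult_right_zero)
  finally show ?thesis using T by simp
qed

text \<open>
  The martingale of the martingale problem has mean \<open>0\<close>, and its time integral has
  expectation \<open>T\<close> times an integral over the mean occupation measure.
\<close>

lemma dynkin_cesaro:
  assumes mart: "is_martingale (P x) (natural_filtration \<Omega> X) (dynkin_process X g q)"
    and g[measurable]: "g \<in> borel_measurable borel" and gK: "\<And>y. \<bar>g y\<bar> \<le> K"
    and q[measurable]: "q \<in> borel_measurable borel" and qK: "\<And>y. \<bar>q y\<bar> \<le> K'"
    and T: "0 < T"
  shows "T * (\<integral>y. q y \<partial>cesaro T x) = (\<integral>y. g y \<partial>tk T x) - g x"
proof -
  interpret Px: prob_space "P x" by (rule prob_space_P)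
  let ?U = "uniform_measure lborel {0..T}"
  interpret U: prob_space ?U by (rule prob_uniform[OF T])
  interpret pair_prob_space ?U "P x" ..
  let ?M = "dynkin_process X g q"
  have iM: "integrable (P x) (?M T)" using mart T by (auto simp: is_martingale_def)
  have "(\<integral>\<omega>. ?M T \<omega> \<partial>P x) = (\<integral>\<omega>. ?M 0 \<omega> \<partial>P x)"
    using T by (intro martingale_expectation[OF mart]) simp
  then have E0: "(\<integral>\<omega>. ?M T \<omega> \<partial>P x) = 0" by (simp add: dynkin_process_0)
  define J where "J \<omega> = (\<integral>s. q (X (max 0 s) \<omega>) \<partial>?U)" for \<omega>
  have jm: "(\<lambda>r. q (X (max 0 (fst r)) (snd r))) \<in> borel_measurable (?U \<Otimes>\<^sub>M P x)"
  proof -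
    have "(\<lambda>r. (snd r, fst r)) \<in> (?U \<Otimes>\<^sub>M P x) \<rightarrow>\<^sub>M \<Omega> \<Otimes>\<^sub>M borel" by measurable
    from measurable_compose[OF measurable_compose[OF this X_joint_measurable] q] show ?thesis by simp
  qed
  have ji: "integrable (?U \<Otimes>\<^sub>M P x) (\<lambda>(s, \<omega>). q (X (max 0 s) \<omega>))"
    using jm qK by (intro P.integrable_const_bound[where B=K']) (auto simp: case_prod_beta')
  have MT: "AE \<omega> in P x. ?M T \<omega> = g (X T \<omega>) - g x - T * J \<omega>"
    using X_start[of x] AE_space
  proof eventually_elim
    case (elim \<omega>)
    then have \<omega>: "\<omega> \<in> space \<Omega>" by simp
    have "T * J \<omega> = (LINT s:{0..T}|lborel. q (X (max 0 s) \<omega>))"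
      unfolding J_def using measurable_compose[OF X_path_measurable[OF \<omega>] q] by (intro integral_uniform_Icc[OF T]) simp
    also have "\<dots> = (LINT s:{0..T}|lborel. q (X s \<omega>))"
      by (intro set_lebesgue_integral_cong) (auto simp: max_def)
    finally show ?case using elim by (simp add: dynkin_process_def)
  qed
  have iJ: "integrable (P x) J" unfolding J_def[abs_def] using integrable_snd[OF ji] by simp
  have ig: "integrable (P x) (\<lambda>\<omega>. g (X T \<omega>))" using T gK X_meas_P[of T x] by (intro Px.integrable_const_bound[where B=K]) auto
  have "(\<integral>\<omega>. ?M T \<omega> \<partial>P x) = (\<integral>\<omega>. g (X T \<omega>) - g x - T * J \<omega> \<partial>P x)"
    using iM ig iJ by (intro integral_cong_AE MT) auto
  also have "\<dots> = (\<integral>\<omega>. g (X T \<omega>) \<partial>P x) - g x - T * (\<integral>\<omega>. J \<omega> \<partial>P x)"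
    using ig iJ Px.prob_space by simp
  also have "(\<integral>\<omega>. g (X T \<omega>) \<partial>P x) = (\<integral>y. g y \<partial>tk T x)"
    unfolding trans_kernel_def using T X_meas_P[of T x] by (intro integral_distr[symmetric]) auto
  also have "(\<integral>\<omega>. J \<omega> \<partial>P x) = (\<integral>s. (\<integral>\<omega>. q (X (max 0 s) \<omega>) \<partial>P x) \<partial>?U)"
    unfolding J_def using Fubini_integral[OF ji] by simp
  also have "\<dots> = (\<integral>s. (\<integral>y. q y \<partial>tk (max 0 s) x) \<partial>?U)"
    unfolding trans_kernel_def using X_meas_P by (intro Bochner_Integration.integral_cong refl integral_distr[symmetric]) auto
  also have "\<dots> = (\<integral>y. q y \<partial>cesaro T x)"
    using integral_cesaro[OF T q qK] by simp
  finally show ?thesis using E0 by linarith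
qed

end

text \<open>
  The complement of the closed support is open, so derivatives may be computed there for the zero
  function.
\<close>

lemma diff_op_vanishes_off_support:
  fixes g :: "real^'d \<Rightarrow> real"
  assumes "y \<notin> closure {y. g y \<noteq> 0}"
  shows "diff_op A b g y = 0"
proof -
  let ?S = "- closure {y. g y \<noteq> 0}"
  have z: "(h has_derivative (\<lambda>_. 0)) (at u)"
    if "\<And>u. u \<in> ?S \<Longrightarrow> h u = 0" "u \<in> ?S" for h :: "real^'d \<Rightarrow> real" and u
  proof -
    have "((\<lambda>_. 0) has_derivative (\<lambda>_. 0)) (at u)" by simp
    then show ?thesis
      by (rule has_derivative_transform_within_open[of _ _ _ _ ?S]) (use that in auto)
  qed
  have p: "partial_deriv i h u = 0" if "\<And>u. u \<in> ?S \<Longrightarrow> h u = 0" "u \<in> ?S" for h :: "real^'d \<Rightarrow> real" and u i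
    by (rule partial_deriv_eq[OF z[of h u, OF that]])
  have g0: "g u = 0" if "u \<in> ?S" for u using that closure_subset[of "{y. g y \<noteq> 0}"] by auto
  have p1: "partial_deriv i g u = 0" if "u \<in> ?S" for i u by (rule p[OF g0 that])
  have p2: "partial_deriv i (partial_deriv j g) u = 0" if "u \<in> ?S" for i j u by (rule p[OF p1 that])
  show ?thesis using p1 p2 assms by (simp add: diff_op_def)
qed

lemma (in elliptic_operator) diff_op_bounded:
  assumes "smooth g" "compact (closure {y. g y \<noteq> 0})"
  shows "\<exists>K. \<forall>y. \<bar>diff_op A b g y\<bar> \<le> K"
proof -
  obtain R where R: "closure {y. g y \<noteq> 0} \<subseteq> cball 0 R"
    using compact_imp_bounded[OF assms(2)] unfolding bounded_any_center[of _ 0] by (auto simp: subset_iff)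
  obtain K where K: "0 \<le> K" "\<And>y. y \<in> cball 0 R \<Longrightarrow> \<bar>diff_op A b g y\<bar> \<le> K"
    using continuous_bounded_on_cball[OF diff_op_continuous[OF assms(1)], of R] by blast
  have "\<bar>diff_op A b g y\<bar> \<le> K" for y
    using K R diff_op_vanishes_off_support[of y g A b] by (cases "y \<in> closure {y. g y \<noteq> 0}") auto
  then show ?thesis by blast
qed

lemma smooth_measurable: "smooth g \<Longrightarrow> g \<in> borel_measurable borel"
  unfolding smooth_def by (metis C_k.simps(1) borel_measurable_continuous_onI)

text \<open>
  By \<open>dynkin_cesaro\<close> the mean occupation measure is an approximate solution; its error
  measure \<open>n\<close> is the law at time \<open>T\<close> plus the unit mass at the starting
  point, divided by \<open>T\<close>.
\<close>

lemma elliptic_cesaro_null: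
  fixes P :: "real^'d \<Rightarrow> 'w measure"
  assumes mf: "markov_family \<Omega> P X" and el: "elliptic_operator A b l \<Lambda>"
    and gen: "\<And>g x. smooth g \<Longrightarrow> compact (closure {y. g y \<noteq> 0}) \<Longrightarrow>
       is_martingale (P x) (natural_filtration \<Omega> X) (dynkin_process X g (diff_op A b g))"
    and T: "0 < T" and N: "N \<in> null_sets lborel"
  shows "emeasure (markov_family.cesaro P X T x) N = 0"
proof -
  interpret markov_family \<Omega> P X by fact
  interpret elliptic_operator A b l \<Lambda> by fact
  interpret tkT: prob_space "tk T x" using T by (intro prob_space_tk) simp
  interpret ce: prob_space "cesaro T x" by (rule prob_space_cesaro[OF T])
  define n where "n = measure_of UNIV (sets borel) (\<lambda>S. ennreal (1 / T) * (emeasure (tk T x) S + indicator S x))"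
  have sn: "sets n = sets borel" unfolding n_def using sets.sigma_sets_eq[of "borel :: (real^'d) measure"] by simp
  have spn: "space n = UNIV" unfolding n_def by (simp add: space_measure_of_conv)
  have en: "emeasure n S = ennreal (1 / T) * (emeasure (tk T x) S + indicator S x)" if S: "S \<in> sets borel" for S
  proof (rule emeasure_measure_of[OF n_def])
    show "countably_additive (sets n) (\<lambda>S. ennreal (1 / T) * (emeasure (tk T x) S + indicator S x))"
      unfolding countably_additive_def
    proof (intro allI impI)
      fix D :: "nat \<Rightarrow> (real^'d) set" assume D: "range D \<subseteq> sets n" "disjoint_family D" "(\<Union>i. D i) \<in> sets n"
      have "(\<Sum>i. emeasure (tk T x) (D i)) = emeasure (tk T x) (\<Union>i. D i)"
        using D by (intro suminf_emeasure) (auto simp: sn)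
      moreover have "(\<Sum>i. indicator (D i) x :: ennreal) = indicator (\<Union>i. D i) x"
        by (rule suminf_indicator[OF D(2)])
      ultimately show "(\<Sum>i. ennreal (1 / T) * (emeasure (tk T x) (D i) + indicator (D i) x)) = ennreal (1 / T) * (emeasure (tk T x) (\<Union>i. D i) + indicator (\<Union>i. D i) x)"
        by (simp add: suminf_add[symmetric])
    qed
    show "positive (sets n) (\<lambda>S. ennreal (1 / T) * (emeasure (tk T x) S + indicator S x))" by (simp add: positive_def)
  qed (use S sn in auto)
  have fn: "finite_measure n"
    by (rule finite_measureI) (simp add: spn en ennreal_mult_eq_top_iff tkT.emeasure_eq_measure)
  have mn: "measure n S = (measure (tk T x) S + indicator S x) / T" if S: "S \<in> sets borel" for S
  proof -
    have "emeasure n S = ennreal ((measure (tk T x) S + indicator S x) / T)"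
      unfolding en[OF S] tkT.emeasure_eq_measure using T
      by (auto simp: ennreal_mult[symmetric] ennreal_indicator[symmetric] ennreal_plus[symmetric] simp del: ennreal_plus split: split_indicator)
    then show ?thesis unfolding measure_def[of n] using T by (simp add: enn2real_ennreal)
  qed
  interpret approximate_elliptic_solution A b l \<Lambda> "cesaro T x" n
  proof (intro approximate_elliptic_solution.intro approximate_elliptic_solution_axioms.intro)
    show "elliptic_operator A b l \<Lambda>" by fact
    show "finite_measure (cesaro T x)" "finite_measure n" by (rule ce.finite_measure_axioms) (rule fn)
    show "sets (cesaro T x) = sets borel" "sets n = sets borel" by (simp_all add: sn)
    fix \<phi> :: "real^'d \<Rightarrow> real" and S
    assume \<phi>: "smooth \<phi>" "compact (closure {y. \<phi> y \<noteq> 0})" and S[measurable]: "S \<in> sets borel" "{y. \<phi> y \<noteq> 0} \<subseteq> S" and b1: "\<And>y. \<bar>\<phi> y\<bar> \<le> 1"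
    obtain K where K: "\<And>y. \<bar>diff_op A b \<phi> y\<bar> \<le> K" using diff_op_bounded[OF \<phi>] by blast
    have \<phi>m[measurable]: "\<phi> \<in> borel_measurable borel" by (rule smooth_measurable[OF \<phi>(1)])
    have dm: "diff_op A b \<phi> \<in> borel_measurable borel"
      by (rule borel_measurable_continuous_onI[OF diff_op_continuous[OF \<phi>(1)]])
    have ind: "\<bar>\<phi> y\<bar> \<le> indicator S y" for y using b1[of y] S(2) by (auto split: split_indicator)
    have ii: "integrable (tk T x) \<phi>" using b1 by (intro tkT.integrable_const_bound[where B=1]) auto
    have "(\<integral>y. \<phi> y \<partial>tk T x) \<le> (\<integral>y. indicator S y \<partial>tk T x)"
    proof (rule integral_mono[OF ii])
      show "integrable (tk T x) (indicator S :: _ \<Rightarrow> real)" by (intro integrable_real_indicator) (auto simp: tkT.emeasure_eq_measure)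
      show "\<phi> y \<le> indicator S y" for y using ind[of y] by linarith
    qed
    also have "\<dots> = measure (tk T x) S" by simp
    finally have "T * (\<integral>y. diff_op A b \<phi> y \<partial>cesaro T x) \<le> measure (tk T x) S + indicator S x"
      unfolding dynkin_cesaro[OF gen[OF \<phi>] \<phi>m b1 dm K T] using ind[of x] by linarith
    then show "(\<integral>y. diff_op A b \<phi> y \<partial>cesaro T x) \<le> measure n S"
      unfolding mn[OF S(1)] using T by (simp add: pos_le_divide_eq mult.commute)
  qed
  show ?thesis by (rule lborel_null_imp_null[OF N])
qed

section \<open>Transfer of the limit theorem\<close>

lemma restr_fixed_measurable: "{y. restr n y = y} \<in> sets borel"
proof -
  have "continuous_on UNIV (restr n)" unfolding restr_def[abs_def]
  proof (rule continuous_on_coordinatewise_then_product)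
    show "continuous_on UNIV (\<lambda>y. if i < n then y i else 0 :: real)" for i by (cases "i < n") auto
  qed
  then show ?thesis by (intro borel_closed closed_Collect_eq) (auto intro: continuous_on_id)
qed

context ergodic_markov
begin

lemma vector_law_measurable:
  fixes n :: nat
  assumes f: "f \<in> borel_measurable borel"
  shows "(\<lambda>\<omega> i. if i < n then u * additive_functional X f (T i) \<omega> else 0) \<in> borel_measurable \<Omega>"
proof (rule measurable_coordinatewise_then_product)
  fix i
  have "(\<lambda>\<omega>. path_integral f (T i) (shift_path 0 \<omega>)) \<in> borel_measurable \<Omega>"
    by (rule measurable_compose[OF _ path_integral_measurable[OF f]]) simp
  then have "additive_functional X f (T i) \<in> borel_measurable \<Omega>"
    by (rule measurable_cong[THEN iffD1, rotated]) (simp add: path_integral_shift additive_functional_def)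
  then show "(\<lambda>\<omega>. if i < n then u * additive_functional X f (T i) \<omega> else 0) \<in> borel_measurable \<Omega>"
    by (cases "i < n") auto
qed

lemma mixture_kernel:
  assumes "prob_space \<rho>" "sets \<rho> = sets borel"
  shows "sets (\<rho> \<bind> P) = sets \<Omega>" "prob_space (\<rho> \<bind> P)" "P \<in> \<rho> \<rightarrow>\<^sub>M subprob_algebra \<Omega>" "space \<rho> \<noteq> {}"
proof -
  interpret \<rho>: prob_space \<rho> by fact
  show ne: "space \<rho> \<noteq> {}" by (rule \<rho>.not_empty)
  show KP: "P \<in> \<rho> \<rightarrow>\<^sub>M subprob_algebra \<Omega>" using P_subprob by (simp add: measurable_cong_sets[OF assms(2) refl])
  show "sets (\<rho> \<bind> P) = sets \<Omega>" using ne KP by (subst sets_bind[where N=\<Omega>]) auto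
  show "prob_space (\<rho> \<bind> P)" by (rule \<rho>.prob_space_bind[OF _ KP]) (auto intro!: AE_I2 prob_space_P)
qed

text \<open>
  Under any initial law the test integrals are the integrals of \<open>expected_functional\<close>.
  Under \<open>\<mu>\<close> their convergence is the hypothesis; by
  \<open>expected_functional_tendsto\<close> it gives pointwise convergence for almost every
  starting point, and dominated convergence does the rest. The same Brownian motion serves for both
  laws.
\<close>

theorem FCLT_transfer:
  fixes f :: "'a \<Rightarrow> real" and v :: "real \<Rightarrow> real" and \<nu> :: "'a measure"
  assumes f: "f \<in> borel_measurable borel" "integrable \<mu> f"
    and v: "\<And>\<epsilon>. 0 < \<epsilon> \<Longrightarrow> 0 < v \<epsilon>" "(v \<longlongrightarrow> 0) (at_right 0)"
    and clt: "FCLT P X f v \<mu>"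
    and \<nu>: "prob_space \<nu>" "sets \<nu> = sets borel"
    and loc: "AE x in \<nu>. locally_integrable_from f x"
    and acc: "\<And>x N. N \<in> null_sets \<mu> \<Longrightarrow> (\<lambda>m. emeasure (cesaro (real m) x) N) \<longlonglongrightarrow> 0"
  shows "FCLT P X f v \<nu>"
proof -
  obtain Q :: "(real \<Rightarrow> real) measure" and B where Q: "standard_brownian_motion Q B"
    and conv: "\<And>n t. \<forall>i<n. 0 < t i \<Longrightarrow> \<forall>i j. i \<le> j \<and> j < n \<longrightarrow> t i \<le> t j \<Longrightarrow>
      converges_in_law (\<lambda>\<epsilon>. vector_law (\<mu> \<bind> P) n (\<lambda>i \<omega>. v \<epsilon> * additive_functional X f (t i / \<epsilon>) \<omega>))
        (vector_law Q n (\<lambda>i. B (t i))) (at_right 0)"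
    using clt unfolding FCLT_def by blast
  interpret Q: prob_space Q using Q by (simp add: standard_brownian_motion_def)
  interpret \<nu>: prob_space \<nu> by fact
  have lim: "converges_in_law (\<lambda>\<epsilon>. vector_law (\<nu> \<bind> P) n (\<lambda>i \<omega>. v \<epsilon> * additive_functional X f (t i / \<epsilon>) \<omega>))
        (vector_law Q n (\<lambda>i. B (t i))) (at_right 0)"
    if t: "\<forall>i<n. 0 < t i" "\<forall>i j. i \<le> j \<and> j < n \<longrightarrow> t i \<le> t j" for n and t :: "nat \<Rightarrow> real"
    unfolding converges_in_law_def
  proof (intro allI impI, unfold tendsto_at_iff_sequentially, intro allI impI)
    fix h :: "(nat \<Rightarrow> real) \<Rightarrow> real" and \<epsilon> :: "nat \<Rightarrow> real"
    assume h: "continuous_on UNIV h \<and> bounded (range h)"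
      and \<epsilon>: "\<forall>k. \<epsilon> k \<in> {0<..} - {0}" "\<epsilon> \<longlonglongrightarrow> 0"
    have \<epsilon>pos: "0 < \<epsilon> k" for k using \<epsilon>(1) by auto
    let ?Y = "\<lambda>k \<omega> i. if i < n then v (\<epsilon> k) * additive_functional X f (t i / \<epsilon> k) \<omega> else 0"
    let ?N = "\<lambda>\<rho> k. vector_law (\<rho> \<bind> P) n (\<lambda>i \<omega>. v (\<epsilon> k) * additive_functional X f (t i / \<epsilon> k) \<omega>)"
    let ?N' = "vector_law Q n (\<lambda>i. B (t i))"
    have Ym: "?Y k \<in> borel_measurable \<Omega>" for k by (rule vector_law_measurable[OF f(1)])
    have YB: "?Y k \<in> borel_measurable (\<rho> \<bind> P)" if "prob_space \<rho>" "sets \<rho> = sets borel" for k \<rho>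
      using Ym[of k] by (simp add: measurable_cong_sets[OF mixture_kernel(1)[OF that] refl])
    have Bm: "(\<lambda>\<omega> i. if i < n then B (t i) \<omega> else 0) \<in> borel_measurable Q"
    proof (rule measurable_coordinatewise_then_product)
      show "(\<lambda>\<omega>. if i < n then B (t i) \<omega> else 0) \<in> borel_measurable Q" for i
        using Q t(1) by (cases "i < n") (auto simp: standard_brownian_motion_def less_imp_le)
    qed
    have "(\<lambda>k. \<integral>y. h y \<partial>?N \<nu> k) \<longlonglongrightarrow> (\<integral>y. h y \<partial>?N')"
    proof (rule lipschitz_portmanteau[where n=n])
      show "prob_space (?N \<nu> k)" for k unfolding vector_law_def
        by (rule prob_space.prob_space_distr[OF mixture_kernel(2)[OF \<nu>] YB[OF \<nu>]])
      show "prob_space ?N'" unfolding vector_law_def by (rule Q.prob_space_distr[OF Bm])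
      show "sets (?N \<nu> k) = sets borel" "sets ?N' = sets borel" for k by (simp_all add: vector_law_def)
      have S: "{y \<in> space borel. restr n y = y} \<in> sets borel" using restr_fixed_measurable[of n] by simp
      show "AE y in ?N \<nu> k. restr n y = y" for k
        unfolding vector_law_def AE_distr_iff[OF YB[OF \<nu>] S] by (rule AE_I2) (auto simp: restr_def)
      show "AE y in ?N'. restr n y = y"
        unfolding vector_law_def AE_distr_iff[OF Bm S] by (rule AE_I2) (auto simp: restr_def)
      show "continuous_on UNIV h" "bounded (range h)" using h by auto
      fix g :: "(nat \<Rightarrow> real) \<Rightarrow> real" and K L :: real
      assume gK: "\<And>y. \<bar>g y\<bar> \<le> K" and L: "0 \<le> L" and gL: "\<And>y z. \<bar>g y - g z\<bar> \<le> L * (\<Sum>i<n. \<bar>y i - z i\<bar>)"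
      have gc: "continuous_on UNIV g" by (rule lipschitz_continuous[OF gL])
      then have gm: "g \<in> borel_measurable borel" by (rule borel_measurable_continuous_onI)
      define c where "c = (\<integral>y. g y \<partial>?N')"
      interpret lipschitz_test \<Omega> P X \<mu> f n g K L "\<lambda>k. v (\<epsilon> k)" "\<lambda>k i. t i / \<epsilon> k"
      proof unfold_locales
        show "f \<in> borel_measurable borel" "integrable \<mu> f" "g \<in> borel_measurable borel" "0 \<le> L" by fact+
        show "0 \<le> v (\<epsilon> k)" for k using v(1)[OF \<epsilon>pos] by (rule less_imp_le)
        show "(\<lambda>k. v (\<epsilon> k)) \<longlonglongrightarrow> 0" using v(2) \<epsilon> unfolding tendsto_at_iff_sequentially by (auto simp: o_def)
        show "0 \<le> t i / \<epsilon> k" if "i < n" for k i using t(1) that \<epsilon>pos[of k] by (simp add: less_imp_le)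
        show "filterlim (\<lambda>k. t i / \<epsilon> k) at_top sequentially" if "i < n" for i
        proof -
          have "filterlim (\<lambda>k. inverse (\<epsilon> k)) at_top sequentially"
            using \<epsilon>(2) \<epsilon>pos by (intro filterlim_inverse_at_top) auto
          then have "filterlim (\<lambda>k. t i * inverse (\<epsilon> k)) at_top sequentially"
            using t(1) that by (intro filterlim_tendsto_pos_mult_at_top[OF tendsto_const]) auto
          then show ?thesis by (simp only: divide_inverse)
        qed
      qed (use gK gL in auto)
      have expect: "(\<integral>y. g y \<partial>?N \<rho> k) = (\<integral>y. expected_functional k y \<partial>\<rho>)" if \<rho>: "prob_space \<rho>" "sets \<rho> = sets borel" for \<rho> k
      proof -
        have "(\<integral>y. g y \<partial>?N \<rho> k) = (\<integral>\<omega>. g (?Y k \<omega>) \<partial>(\<rho> \<bind> P))"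
          unfolding vector_law_def using YB[OF \<rho>] gm by (rule integral_distr)
        also have "\<dots> = (\<integral>y. (\<integral>\<omega>. g (?Y k \<omega>) \<partial>P y) \<partial>\<rho>)"
          using mixture_kernel(3,4)[OF \<rho>] prob_space.finite_measure[OF \<rho>(1)]
          by (intro integral_bind_bounded[where B=\<Omega> and K=K] measurable_compose[OF Ym gm] gK) auto
        also have "\<dots> = (\<integral>y. expected_functional k y \<partial>\<rho>)"
        proof -
          have "g (?Y k \<omega>) = functional k (shift_path 0 \<omega>)" if "\<omega> \<in> space \<Omega>" for \<omega>
            unfolding functional_def additive_functional_def using path_integral_shift[OF order_refl that] by (simp cong: if_cong)
          then show ?thesis unfolding expected_functional_def by (intro Bochner_Integration.integral_cong refl) simp
        qed
        finally show ?thesis .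
      qed
      have "((\<lambda>\<epsilon>. \<integral>y. g y \<partial>vector_law (\<mu> \<bind> P) n (\<lambda>i \<omega>. v \<epsilon> * additive_functional X f (t i / \<epsilon>) \<omega>)) \<longlongrightarrow> c) (at_right 0)"
        using conv[OF t] gc gK unfolding converges_in_law_def c_def by (auto simp: bounded_iff)
      then have "(\<lambda>k. \<integral>y. g y \<partial>?N \<mu> k) \<longlonglongrightarrow> c"
        using \<epsilon> unfolding tendsto_at_iff_sequentially by (auto simp: o_def)
      then have \<mu>lim: "(\<lambda>k. \<integral>y. expected_functional k y \<partial>\<mu>) \<longlonglongrightarrow> c" by (simp add: expect prob_space_\<mu>)
      have "(\<lambda>k. \<integral>y. expected_functional k y \<partial>\<nu>) \<longlonglongrightarrow> (\<integral>y. c \<partial>\<nu>)"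
      proof (rule integral_dominated_convergence[where w="\<lambda>_. K"])
        show "expected_functional k \<in> borel_measurable \<nu>" for k using expected_functional_measurable[of k] by (simp add: measurable_cong_sets[OF \<nu>(2) refl])
        show "AE y in \<nu>. (\<lambda>k. expected_functional k y) \<longlonglongrightarrow> c"
          using loc
        proof eventually_elim
          case (elim y)
          show ?case
          proof (rule expected_functional_tendsto)
            show "locally_integrable_from f y" by (rule elim)
            show "(\<lambda>k. \<integral>y. expected_functional k y \<partial>\<mu>) \<longlonglongrightarrow> c" by (rule \<mu>lim)
            show "(\<lambda>m. emeasure (cesaro (real m) y) N) \<longlonglongrightarrow> 0" if "N \<in> null_sets \<mu>" for N by (rule acc[OF that])
          qed
        qed
        show "AE y in \<nu>. norm (expected_functional k y) \<le> K" for k using expected_functional_bounded by simp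
      qed auto
      then show "(\<lambda>k. \<integral>y. g y \<partial>?N \<nu> k) \<longlonglongrightarrow> (\<integral>y. g y \<partial>?N')"
        by (simp add: expect \<nu> \<nu>.prob_space c_def)
    qed
    then show "((\<lambda>\<epsilon>. \<integral>y. h y \<partial>vector_law (\<nu> \<bind> P) n (\<lambda>i \<omega>. v \<epsilon> * additive_functional X f (t i / \<epsilon>) \<omega>)) \<circ> \<epsilon>) \<longlonglongrightarrow> (\<integral>y. h y \<partial>?N')"
      by (simp add: o_def)
  qed
  then show ?thesis unfolding FCLT_def using Q by blast
qed

end

lemma ergodic_diffusion_markov:
  assumes "ergodic_diffusion A b \<Omega> P X \<mu>"
  shows "ergodic_markov \<Omega> P X \<mu>"
proof -
  interpret ergodic_diffusion A b \<Omega> P X \<mu> by fact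
  show ?thesis
    by unfold_locales (rule P_kernel X_measurable X_continuous X_start X_strong_markov \<mu>_invariant \<mu>_unique; assumption?)+
qed

text \<open>
  Since \<open>\<phi>\<close> is increasing and \<open>V\<close> is at least \<open>1\<close>,
  \<open>LV\<close> is at most \<open>- \<phi> 1\<close> off \<open>C\<close>.
\<close>

lemma lyapunov_cesaro_null:
  fixes P :: "real^'d \<Rightarrow> 'w measure"
  assumes ed: "ergodic_diffusion A b \<Omega> P X \<mu>" and lyap: "assumption_A \<Omega> P X \<mu> \<nu>"
    and N: "N \<in> null_sets \<mu>"
  shows "(\<lambda>m. emeasure (markov_family.cesaro P X (real m) x) N) \<longlonglongrightarrow> 0"
proof -
  interpret ergodic_diffusion A b \<Omega> P X \<mu> by fact
  interpret em: ergodic_markov \<Omega> P X \<mu> by (rule ergodic_diffusion_markov[OF ed])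
  obtain \<psi> where \<psi>: "irreducible_process P X \<psi>" using X_recurrent by blast
  from lyap obtain \<phi> V LV \<kappa> C where mono: "mono_on {1..} \<phi>" and pos: "\<forall>u\<ge>1. 0 < \<phi> u"
    and gen: "extended_generator \<Omega> P X V LV" and V: "\<forall>x. (1::real) \<le> V x"
    and C: "compact C" "petite P X C" and LV: "\<forall>x. LV x \<le> - \<phi> (V x) + \<kappa> * indicator C x"
    unfolding assumption_A_def by blast
  \<comment> \<open>The constant need not be positive in the assumption, but has to be for the division by it.\<close>
  define \<kappa>' where "\<kappa>' = \<bar>\<kappa>\<bar> + 1"
  have \<kappa>': "0 < \<kappa>'" "\<kappa> \<le> \<kappa>'" by (auto simp: \<kappa>'_def)
  have \<phi>1: "0 < \<phi> 1" using pos by simp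
  have Cb: "C \<in> sets borel" using compact_imp_closed[OF C(1)] by auto
  have LV': "LV x \<le> - \<phi> 1 + \<kappa>' * indicator C x" for x
  proof -
    have "\<phi> 1 \<le> \<phi> (V x)" using V by (intro mono_onD[OF mono]) auto
    moreover have "\<kappa> * indicator C x \<le> \<kappa>' * indicator C x" using \<kappa>'(2) by (intro mult_right_mono) auto
    ultimately show ?thesis using LV[rule_format, of x] by linarith
  qed
  have V0: "0 \<le> V x" for x using V[rule_format, of x] by linarith
  show ?thesis
  proof (rule em.cesaro_null_of_drift[OF \<psi> C(2) Cb _ _ _ N])
    show "0 < \<phi> 1 / \<kappa>'" using \<phi>1 \<kappa>' by simp
    show "0 \<le> V x / \<kappa>'" for x using V0[of x] \<kappa>' by simp
    show "ennreal (\<phi> 1 / \<kappa>' * t) \<le> ennreal (V x / \<kappa>') + (\<integral>\<^sup>+s\<in>{0..t}. emeasure (trans_kernel P X (max 0 s) x) C \<partial>lborel)" if "0 \<le> t" for x t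
      by (rule em.drift_of_extended_generator[OF gen V0 LV' Cb \<phi>1 \<kappa>'(1) that])
  qed
qed

lemma elliptic_operator_of_bounded:
  fixes A :: "real^'d \<Rightarrow> real^'d^'d"
  assumes "\<And>i j. smooth (\<lambda>x. A x $ i $ j)" "\<And>x. transpose (A x) = A x" "\<And>i. smooth (\<lambda>x. b x $ i)"
    and "uniformly_elliptic A" "bounded (range A)"
  obtains l \<Lambda> where "elliptic_operator A b l \<Lambda>"
proof -
  obtain l where l: "0 < l" "\<And>x \<xi>. l * (\<xi> \<bullet> \<xi>) \<le> \<xi> \<bullet> (A x *v \<xi>)"
    using assms(4) by (auto simp: uniformly_elliptic_def)
  obtain K where K: "\<And>x. norm (A x) \<le> K" using assms(5) by (auto simp: bounded_iff)
  define \<Lambda> where "\<Lambda> = max 1 (real CARD('d) * real CARD('d) * K)"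
  have "norm (A x *v \<xi>) \<le> \<Lambda> * norm \<xi>" for x \<xi>
  proof -
    have "\<bar>A x $ i $ j\<bar> \<le> K" for i j
      using component_le_norm_cart[of "A x $ i" j] Finite_Cartesian_Product.norm_nth_le[of "A x" i] K[of x] by linarith
    then have "onorm ((*v) (A x)) \<le> real CARD('d) * real CARD('d) * K" by (rule onorm_le_matrix_component)
    then have "onorm ((*v) (A x)) \<le> \<Lambda>" by (simp add: \<Lambda>_def)
    then have "onorm ((*v) (A x)) * norm \<xi> \<le> \<Lambda> * norm \<xi>" by (rule mult_right_mono) simp
    then show ?thesis using onorm[OF matrix_vector_mul_bounded_linear, of "A x" \<xi>] by linarith
  qed
  then have "elliptic_operator A b l \<Lambda>" using assms(1-3) l by unfold_locales (auto simp: \<Lambda>_def)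
  then show thesis by (rule that)
qed

text \<open>
  The density of \<open>\<mu>\<close> is positive, so \<open>\<mu>\<close>-null sets are Lebesgue
  null.
\<close>

lemma elliptic_diffusion_cesaro_null:
  fixes P :: "real^'d \<Rightarrow> 'w measure"
  assumes ed: "ergodic_diffusion A b \<Omega> P X \<mu>" and B: "assumption_B A b P X \<mu> \<nu>"
    and N: "N \<in> null_sets \<mu>"
  shows "(\<lambda>m. emeasure (markov_family.cesaro P X (real m) x) N) \<longlonglongrightarrow> 0"
proof -
  interpret ergodic_diffusion A b \<Omega> P X \<mu> by fact
  interpret em: ergodic_markov \<Omega> P X \<mu> by (rule ergodic_diffusion_markov[OF ed])
  from B obtain W where W: "C_k 2 W" "\<mu> = density lborel (\<lambda>x. ennreal (exp (- W x)))"
    and el: "uniformly_elliptic A" "bounded (range A)" unfolding assumption_B_def by blast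
  obtain l \<Lambda> where op: "elliptic_operator A b l \<Lambda>"
    using elliptic_operator_of_bounded[OF A_smooth A_symmetric b_smooth el] .
  have "continuous_on UNIV W" using W(1) by (auto simp: numeral_2_eq_2 intro: differentiable_imp_continuous_on)
  then have [measurable]: "W \<in> borel_measurable borel" by (rule borel_measurable_continuous_onI)
  have "N \<in> null_sets (density lborel (\<lambda>x. ennreal (exp (- W x))))" using N W(2) by simp
  then have "N \<in> sets borel" "AE x in lborel. x \<notin> N"
    by (subst (asm) null_sets_density_iff; auto)+
  then have leb: "N \<in> null_sets lborel" by (subst AE_iff_null_sets) auto
  have "emeasure (em.cesaro (real (Suc m)) x) N = 0" for m
    by (rule elliptic_cesaro_null[OF em.markov_family_axioms op X_generator _ leb]) auto
  then have "(\<lambda>m. emeasure (em.cesaro (real (Suc m)) x) N) \<longlonglongrightarrow> 0" by simp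
  then show ?thesis by (rule LIMSEQ_imp_Suc)
qed

theorem theorem8p6:
  fixes A :: "real^'d \<Rightarrow> real^'d^'d" and b :: "real^'d \<Rightarrow> real^'d"
    and \<Omega> :: "'w measure" and P :: "real^'d \<Rightarrow> 'w measure" and X :: "real \<Rightarrow> 'w \<Rightarrow> real^'d"
    and \<mu> :: "(real^'d) measure" and f :: "real^'d \<Rightarrow> real" and v :: "real \<Rightarrow> real"
  assumes "ergodic_diffusion A b \<Omega> P X \<mu>"
    and "f \<in> borel_measurable borel" and "integrable \<mu> (\<lambda>x. (f x)\<^sup>2)"
    and "\<not> (AE x in \<mu>. f x = 0)" and "(LINT x|\<mu>. f x) = 0"
    and "\<And>\<epsilon>. 0 < \<epsilon> \<Longrightarrow> 0 < v \<epsilon>"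
    and "(v \<longlongrightarrow> 0) (at_right 0)"
    and "filterlim (\<lambda>\<epsilon>. v \<epsilon> / \<epsilon>) at_top (at_right 0)"
    and "FCLT P X f v \<mu>"
  shows "(\<forall>\<nu>. prob_space \<nu> \<and> sets \<nu> = sets borel \<and>
              (assumption_A \<Omega> P X \<mu> \<nu> \<or> assumption_B A b P X \<mu> \<nu>) \<and>
              absolutely_continuous \<mu> \<nu> \<longrightarrow> FCLT P X f v \<nu>) \<and>
         (AE x in \<mu>.
              (assumption_A \<Omega> P X \<mu> (return borel x) \<or> assumption_B A b P X \<mu> (return borel x)) \<longrightarrow>
              FCLT P X f v (return borel x)) \<and>
         (\<forall>\<nu>. prob_space \<nu> \<and> sets \<nu> = sets borel \<and>
              (assumption_A \<Omega> P X \<mu> \<nu> \<or> assumption_B A b P X \<mu> \<nu>) \<and>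
              bounded (range f) \<longrightarrow> FCLT P X f v \<nu>)"
proof -
  interpret em: ergodic_markov \<Omega> P X \<mu> by (rule ergodic_diffusion_markov[OF assms(1)])
  have f_int: "integrable \<mu> f"
    by (rule em.mu.square_integrable_imp_integrable) (use assms(2,3) in simp_all)
  have transfer: "FCLT P X f v \<nu>"
    if "prob_space \<nu>" "sets \<nu> = sets borel" "assumption_A \<Omega> P X \<mu> \<nu> \<or> assumption_B A b P X \<mu> \<nu>"
      "AE x in \<nu>. em.locally_integrable_from f x" for \<nu>
  proof (rule em.FCLT_transfer[OF assms(2) f_int assms(6,7,9) that(1,2,4)])
    show "(\<lambda>m. emeasure (em.cesaro (real m) x) N) \<longlonglongrightarrow> 0" if "N \<in> null_sets \<mu>" for x N
      using \<open>assumption_A \<Omega> P X \<mu> \<nu> \<or> assumption_B A b P X \<mu> \<nu>\<close>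
        lyapunov_cesaro_null[OF assms(1) _ that] elliptic_diffusion_cesaro_null[OF assms(1) _ that] by blast
  qed
  note loc = em.AE_locally_integrable_from[OF assms(2) f_int]
  show ?thesis
  proof (intro conjI allI impI)
    fix \<nu> assume \<nu>: "prob_space \<nu> \<and> sets \<nu> = sets borel \<and>
      (assumption_A \<Omega> P X \<mu> \<nu> \<or> assumption_B A b P X \<mu> \<nu>) \<and> absolutely_continuous \<mu> \<nu>"
    then have "AE x in \<nu>. em.locally_integrable_from f x"
      using absolutely_continuous_AE[OF _ _ loc] by simp
    with \<nu> show "FCLT P X f v \<nu>" by (intro transfer) auto
  next
    show "AE x in \<mu>. (assumption_A \<Omega> P X \<mu> (return borel x) \<or> assumption_B A b P X \<mu> (return borel x)) \<longrightarrow>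
        FCLT P X f v (return borel x)"
      using loc
    proof eventually_elim
      case (elim x)
      show ?case
      proof
        assume "assumption_A \<Omega> P X \<mu> (return borel x) \<or> assumption_B A b P X \<mu> (return borel x)"
        moreover have "AE y in return borel x. em.locally_integrable_from f y"
        proof -
          have "AE y in return borel x. y = x" by (subst AE_return) auto
          then show ?thesis by eventually_elim (use elim in simp)
        qed
        ultimately show "FCLT P X f v (return borel x)"
          by (intro transfer) (auto intro: prob_space_return)
      qed
    qed
  next
    fix \<nu> assume \<nu>: "prob_space \<nu> \<and> sets \<nu> = sets borel \<and>
      (assumption_A \<Omega> P X \<mu> \<nu> \<or> assumption_B A b P X \<mu> \<nu>) \<and> bounded (range f)"
    then have "AE x in \<nu>. em.locally_integrable_from f x"
      using em.locally_integrable_from_bounded[OF assms(2)] by simp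
    with \<nu> show "FCLT P X f v \<nu>" by (intro transfer) auto
  qed
qed

end
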